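(* Let $Q$ be a finite quiver, let $M\in\mathrm{rep}_{\mathbb{C}}(Q)$ be straight and $\mathbf{e}\in\mathbb{Z}^{Q_0}$, and let $T_M$ act on $X=\mathrm{Gr}_{\mathbf{e}}(M)$. Take a generic attractive cocharacter $\chi\in\mathfrak{X}_*(T_M)$ and a compatible basis $B$. Then there exists a KT-basis of $H^\bullet_{T_M}(X)$.
   Context: A quiver $Q$ has vertex set $Q_0$ and arrow set $Q_1$; an arrow $a$ has source $s_a$ and target $t_a$. $\mathrm{rep}_{\mathbb{C}}(Q)$ is the category of finite-dimensional complex representations. $\mathrm{Gr}_{\mathbf e}(M)$ is the closed subvariety of $\prod_{i\in Q_0}\mathrm{Gr}_{e_i}(M^{(i)})$ of all subrepresentations $U\subseteq M$ with $\dim U^{(i)}=e_i$. For an indexed basis $B=\{b^{(i)}_k:i\in Q_0,1\le k\le\dim M^{(i)}\}$ with $b^{(i)}_k\in M^{(i)}$, the coefficient quiver $Q(M,B)$ has vertex set $B$ and an arrow $b^{(i)}_k\to b^{(j)}_\ell$ for each $(a:i\to j)\in Q_1$ such that the coefficient of $b^{(j)}_\ell$ in $M_ab^{(i)}_k$ is non-zero. $M$ is straight if for some $B$ (a straightening basis) all connected components of $Q(M,B)$ are equioriented strings $\bullet\to\cdots\to\bullet$. Basis vectors are normalized so that $M_ab\in B\cup\{0\}$. Torus: $d$ is the number of components of $Q(M,B)$, $c$ the number of arrows of $\mathrm{supp}\,M$ (vertices $i$ with $M^{(i)}\ne0$, arrows $a$ with $M_a\neq0$). $T_M=(\mathbb{C}^*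 )^{d+c}\ni((\gamma_i)_{i\in[d]},(\nu_j)_{j\in[c]})$ scales the starting vertex of the $i$-th string by $\gamma_i$, and along each arrow of $Q(M,B)$ the scaling factor is multiplied by $\nu_j$, $j$ the label of the underlying arrow of $Q$; this induces an action on $\mathrm{Gr}_{\mathbf e}(M)$. $\mathfrak{X}_*(T_M)$ is the group of cocharacters; $\chi$ is generic if $X^{T_M}=X^{\chi(\mathbb{C}^* )}$. The pair $(\chi,B)$ is attractive and compatible if $B$ is a straightening basis with $Q(M,B)$ aligned and the grading $\mathrm{wt}:B\to\mathbb{Z}$ given by $\chi(\lambda).b=\lambda^{\mathrm{wt}(b)}b$ is attractive. Aligned: over each $(a:i\to j)\in Q_1$, (1) if $M_ab^{(i)}_\ell=0$ and $M_ab^{(i)}_k\ne0$ then $\ell>k$; (2) if $M_ab^{(i)}_\ell=b^{(j)}_{\ell'}$, $M_ab^{(i)}_k=b^{(j)}_{k'}$ and $\ell>k$ then $\ell'>k'$. Attractive: (1) $\mathrm{wt}(b^{(i)}_k)>\mathrm{wt}(b^{(i)}_\ell)$ whenever $k>\ell$; (2) for each $a\in Q_1$ there is $\mathrm{wt}(a)\in\mathbb{Z}$ with $\mathrm{wt}(b')=\mathrm{wt}(b)+\mathrm{wt}(a)$ for each arrow $b\to b'$ of $Q(M,B)$ over $a$. Moment graph $\mathcal{G}=\mathcal{G}(X,T,\chi)$ of a GKM-variety $(X,T)$ (projective variety with torus action having finitely many fixed points and one-dimensional orbits, and vanishing odd rational cohomology; $(\mathrm{Gr}_{\mathbf e}(M),T_M)$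 is one): vertices are the $T$-fixed points; edges are the closures $\overline E=E\cup\{x,y\}$ of one-dimensional $T$-orbits $E$, oriented from $x$ to $y$ if $\lim_{\lambda\to0}\chi(\lambda).p=x$ for $p\in E$ (the source of this edge is denoted $S_E=x$); each edge is labeled by a character $\alpha_E$ of $T$ describing the $T$-action on $E$ (unique up to a sign, fixed by choice). $H_T^\bullet$ is equivariant cohomology with rational coefficients, and $R=H_T^\bullet(\mathrm{pt})$ is identified with $\mathbb{Q}[T]=\mathbb{Q}[\tau_1,\dots,\tau_q]$, the symmetric algebra of $\mathfrak{X}^*(T)\otimes_{\mathbb Z}\mathbb{Q}$, where $\tau_1,\dots,\tau_q$ is a $\mathbb{Z}$-basis of the character lattice $\mathfrak{X}^*(T)$. By localization, $H_T^\bullet(X)$ is identified with the set of $(f_x)\in\bigoplus_{x\in X^T}R$ such that $f_{x}-f_{y}\in\alpha_ER$ for every edge $\overline E=E\cup\{x,y\}$. Write $x\succeq_\chi y$ if there is a directed path (possibly of length zero) from $x$ to $y$ in $\mathcal G$. If $\mathcal{G}$ is acyclic, a Knutson-Tao class (KT-class) for $x\in X^T$ is an equivariant class $p^x=(p^x_y)_{y\in X^T}\in H^\bullet_T(X)$ such that: (1) $p^x_x=\prod_{E\in\mathcal{G}_1:\,S_E=x}\alpha_E$; (2) each $p^x_y$ is a homogeneous polynomial in $\mathbb{Q}[T]$ with $\deg p^x_y=\deg p^x_x$; (3) $p^x_y=0$ for each $y\in X^T$ with $y\not\succeq_\chi x$. A KT-basis is a basis of $H^\bullet_T(X)$ (as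 an $R$-module) consisting of KT-classes; the notion presupposes that $\mathcal G$ is acyclic. *)

theory Defs
  imports
    "HOL-Analysis.Analysis"
    "HOL-Library.Poly_Mapping"
    "Graph_Theory.Digraph_Component"
begin

section \<open>Quiver representations and quiver Grassmannians\<close>

text \<open>A finite quiver is a \<^const>\<open>fin_digraph\<close>. The spaces of a finite-dimensional
  complex representation are subspaces of a common space \<open>complex ^ 'n\<close>, with \<open>'n\<close> arbitrary;
  the values of the maps outside these subspaces are irrelevant.\<close>

record ('v, 'a, 'n) rep =
  vsp :: "'v \<Rightarrow> (complex ^ 'n) set"
  vmap :: "'a \<Rightarrow> complex ^ 'n \<Rightarrow> complex ^ 'n"

definition quiver_rep :: "('v, 'a) pre_digraph \<Rightarrow> ('v, 'a, 'n::finite) rep \<Rightarrow> bool" where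
  "quiver_rep Q M \<longleftrightarrow>
     (\<forall>i\<in>verts Q. vec.subspace (vsp M i)) \<and>
     (\<forall>a\<in>arcs Q.
        vmap M a ` vsp M (tail Q a) \<subseteq> vsp M (head Q a) \<and>
        (\<forall>x\<in>vsp M (tail Q a). \<forall>y\<in>vsp M (tail Q a). vmap M a (x + y) = vmap M a x + vmap M a y) \<and>
        (\<forall>c. \<forall>x\<in>vsp M (tail Q a). vmap M a (c *s x) = c *s vmap M a x))"

definition Gr :: "int \<Rightarrow> (complex ^ 'n) set \<Rightarrow> (complex ^ 'n::finite) set set" where
  "Gr k V = {U. vec.subspace U \<and> U \<subseteq> V \<and> int (vec.dim U) = k}"

definition frames :: "nat \<Rightarrow> (complex ^ 'n) set \<Rightarrow> (nat \<Rightarrow> complex ^ 'n::finite) set" where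
  "frames k V = {w \<in> {..<k} \<rightarrow>\<^sub>E V. inj_on w {..<k} \<and> vec.independent (w ` {..<k})}"

text \<open>The (analytic) topology of the Grassmannian: the quotient topology with respect to the
  map sending a \<open>k\<close>-frame to its span.\<close>

definition Gr_openin :: "int \<Rightarrow> (complex ^ 'n) set \<Rightarrow> (complex ^ 'n::finite) set set \<Rightarrow> bool" where
  "Gr_openin k V S \<longleftrightarrow> S \<subseteq> Gr k V \<and>
     openin (subtopology (product_topology (\<lambda>_. euclidean) {..<nat k}) (frames (nat k) V))
       {w \<in> frames (nat k) V. vec.span (w ` {..<nat k}) \<in> S}"

definition Gr_top :: "int \<Rightarrow> (complex ^ 'n) set \<Rightarrow> (complex ^ 'n::finite) set topology" where
  "Gr_top k V = topology (Gr_openin k V)"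

definition quiver_Gr ::
  "('v, 'a) pre_digraph \<Rightarrow> ('v, 'a, 'n) rep \<Rightarrow> ('v \<Rightarrow> int) \<Rightarrow> ('v \<Rightarrow> (complex ^ 'n::finite) set) set"
  where
  "quiver_Gr Q M e =
     {U \<in> (\<Pi>\<^sub>E i\<in>verts Q. Gr (e i) (vsp M i)).
        \<forall>a\<in>arcs Q. vmap M a ` U (tail Q a) \<subseteq> U (head Q a)}"

definition quiver_Gr_top ::
  "('v, 'a) pre_digraph \<Rightarrow> ('v, 'a, 'n) rep \<Rightarrow> ('v \<Rightarrow> int) \<Rightarrow> ('v \<Rightarrow> (complex ^ 'n::finite) set) topology"
  where
  "quiver_Gr_top Q M e =
     subtopology (product_topology (\<lambda>i. Gr_top (e i) (vsp M i)) (verts Q)) (quiver_Gr Q M e)"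

lemma istopology_Gr_openin: "istopology (Gr_openin k V)"
proof -
  let ?F = "subtopology (product_topology (\<lambda>_. euclidean) {..<nat k}) (frames (nat k) V)"
  let ?P = "\<lambda>S. {w \<in> frames (nat k) V. vec.span (w ` {..<nat k}) \<in> S}"
  have "Gr_openin k V (S \<inter> T)" if "Gr_openin k V S" "Gr_openin k V T" for S T
  proof -
    have "?P (S \<inter> T) = ?P S \<inter> ?P T" by auto
    moreover have "openin ?F (?P S \<inter> ?P T)"
      using that unfolding Gr_openin_def by (intro openin_Int) auto
    moreover have "S \<inter> T \<subseteq> Gr k V" using that unfolding Gr_openin_def by auto
    ultimately show ?thesis unfolding Gr_openin_def by simp
  qed
  moreover have "Gr_openin k V (\<Union>\<K>)" if "\<forall>K\<in>\<K>. Gr_openin k V K" for \<K>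
  proof -
    have "?P (\<Union>\<K>) = (\<Union>K\<in>\<K>. ?P K)" by auto
    moreover have "openin ?F (\<Union>K\<in>\<K>. ?P K)"
      using that unfolding Gr_openin_def by (intro openin_Union) auto
    moreover have "\<Union>\<K> \<subseteq> Gr k V" using that unfolding Gr_openin_def by auto
    ultimately show ?thesis unfolding Gr_openin_def by simp
  qed
  ultimately show ?thesis unfolding istopology_def by simp
qed

lemma openin_Gr_top: "openin (Gr_top k V) = Gr_openin k V"
  unfolding Gr_top_def by (rule topology_inverse'[OF istopology_Gr_openin])

lemma topspace_Gr_top:
  assumes "vec.subspace V"
  shows "topspace (Gr_top k V) = Gr k V"
proof -
  let ?F = "subtopology (product_topology (\<lambda>_. euclidean) {..<nat k}) (frames (nat k) V)"
  have "{w \<in> frames (nat k) V. vec.span (w ` {..<nat k}) \<in> Gr k V} = (if k < 0 then {} else frames (nat k) V)"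
  proof (cases "k < 0")
    case False
    have "vec.span (w ` {..<nat k}) \<in> Gr k V" if "w \<in> frames (nat k) V" for w
    proof -
      have "w ` {..<nat k} \<subseteq> V" using that unfolding frames_def by auto
      then have "vec.span (w ` {..<nat k}) \<subseteq> V" using assms by (rule vec.span_minimal)
      moreover have "vec.dim (vec.span (w ` {..<nat k})) = nat k"
        using that unfolding frames_def
        by (simp add: vec.dim_eq_card_independent card_image)
      ultimately show ?thesis using False by (simp add: Gr_def)
    qed
    then show ?thesis using False by auto
  qed (auto simp: Gr_def)
  moreover have F: "topspace ?F = frames (nat k) V" by (auto simp: frames_def)
  ultimately have "Gr_openin k V (Gr k V)"
    using openin_topspace[of ?F] unfolding Gr_openin_def F by simp
  then have "Gr k V \<subseteq> topspace (Gr_top k V)"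
    by (intro openin_subset) (simp add: openin_Gr_top)
  moreover have "topspace (Gr_top k V) \<subseteq> Gr k V"
    using openin_topspace[of "Gr_top k V"] unfolding openin_Gr_top Gr_openin_def by simp
  ultimately show ?thesis by simp
qed

lemma topspace_quiver_Gr_top:
  assumes "quiver_rep Q M"
  shows "topspace (quiver_Gr_top Q M e) = quiver_Gr Q M e"
proof -
  have "(\<Pi>\<^sub>E i\<in>verts Q. topspace (Gr_top (e i) (vsp M i))) = (\<Pi>\<^sub>E i\<in>verts Q. Gr (e i) (vsp M i))"
    using assms by (intro PiE_cong topspace_Gr_top) (auto simp: quiver_rep_def)
  then show ?thesis unfolding quiver_Gr_top_def quiver_Gr_def by auto
qed

section \<open>Coefficient quivers and straight representations\<close>

abbreviation bix :: "('v, 'a, 'n::finite) rep \<Rightarrow> 'v \<Rightarrow> nat set" where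
  "bix M i \<equiv> {1..vec.dim (vsp M i)}"

definition indexed_basis ::
  "('v, 'a) pre_digraph \<Rightarrow> ('v, 'a, 'n) rep \<Rightarrow> ('v \<Rightarrow> nat \<Rightarrow> complex ^ 'n::finite) \<Rightarrow> bool" where
  "indexed_basis Q M b \<longleftrightarrow>
     (\<forall>i\<in>verts Q. inj_on (b i) (bix M i) \<and> vec.independent (b i ` bix M i) \<and>
        vec.span (b i ` bix M i) = vsp M i)"

definition coeff ::
  "('v, 'a, 'n) rep \<Rightarrow> ('v \<Rightarrow> nat \<Rightarrow> complex ^ 'n::finite) \<Rightarrow> 'v \<Rightarrow> nat \<Rightarrow> complex ^ 'n \<Rightarrow> complex"
  where "coeff M b i k v = vec.representation (b i ` bix M i) v (b i k)"

text \<open>The vertex \<open>(i, k)\<close> stands for \<open>b i k\<close>; the arrow \<open>(a, k, l)\<close> is the one over \<open>a\<close>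
  from the \<open>k\<close>-th basis vector at the tail to the \<open>l\<close>-th basis vector at the head of \<open>a\<close>.\<close>

definition coeff_quiver ::
  "('v, 'a) pre_digraph \<Rightarrow> ('v, 'a, 'n) rep \<Rightarrow> ('v \<Rightarrow> nat \<Rightarrow> complex ^ 'n::finite)
    \<Rightarrow> ('v \<times> nat, 'a \<times> nat \<times> nat) pre_digraph" where
  "coeff_quiver Q M b =
     \<lparr> verts = (SIGMA i : verts Q. bix M i),
       arcs = {(a, k, l). a \<in> arcs Q \<and> k \<in> bix M (tail Q a) \<and> l \<in> bix M (head Q a) \<and>
                 coeff M b (head Q a) l (vmap M a (b (tail Q a) k)) \<noteq> 0},
       tail = (\<lambda>(a, k, l). (tail Q a, k)),
       head = (\<lambda>(a, k, l). (head Q a, l)) \<rparr>"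

text \<open>Connected components are those of the underlying undirected graph.\<close>

definition weak_component :: "('w, 'b) pre_digraph \<Rightarrow> 'w \<Rightarrow> 'w set" where
  "weak_component G x = {y. x \<rightarrow>\<^sup>*\<^bsub>with_proj (mk_symmetric G)\<^esub> y}"

definition weak_components :: "('w, 'b) pre_digraph \<Rightarrow> 'w set set" where
  "weak_components G = weak_component G ` verts G"

definition equioriented_string :: "('w, 'b) pre_digraph \<Rightarrow> bool" where
  "equioriented_string G \<longleftrightarrow>
     (\<exists>xs as. distinct xs \<and> set xs = verts G \<and> distinct as \<and> set as = arcs G \<and>
        length xs = Suc (length as) \<and>
        (\<forall>k<length as. tail G (as ! k) = xs ! k \<and> head G (as ! k) = xs ! Suc k))"

definition straightening_basis ::
  "('v, 'a) pre_digraph \<Rightarrow> ('v, 'a, 'n) rep \<Rightarrow> ('v \<Rightarrow> nat \<Rightarrow> complex ^ 'n::finite) \<Rightarrow> bool" where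
  "straightening_basis Q M b \<longleftrightarrow> indexed_basis Q M b \<and>
     (\<forall>C\<in>weak_components (coeff_quiver Q M b). equioriented_string (coeff_quiver Q M b \<restriction> C))"

definition straight :: "('v, 'a) pre_digraph \<Rightarrow> ('v, 'a, 'n::finite) rep \<Rightarrow> bool" where
  "straight Q M \<longleftrightarrow> (\<exists>b. straightening_basis Q M b)"

definition normalized ::
  "('v, 'a) pre_digraph \<Rightarrow> ('v, 'a, 'n) rep \<Rightarrow> ('v \<Rightarrow> nat \<Rightarrow> complex ^ 'n::finite) \<Rightarrow> bool" where
  "normalized Q M b \<longleftrightarrow>
     (\<forall>a\<in>arcs Q. \<forall>k\<in>bix M (tail Q a).
        vmap M a (b (tail Q a) k) \<in> insert 0 (b (head Q a) ` bix M (head Q a)))"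

definition aligned ::
  "('v, 'a) pre_digraph \<Rightarrow> ('v, 'a, 'n) rep \<Rightarrow> ('v \<Rightarrow> nat \<Rightarrow> complex ^ 'n::finite) \<Rightarrow> bool" where
  "aligned Q M b \<longleftrightarrow>
     (\<forall>a\<in>arcs Q. \<forall>k\<in>bix M (tail Q a). \<forall>l\<in>bix M (tail Q a).
        (vmap M a (b (tail Q a) l) = 0 \<and> vmap M a (b (tail Q a) k) \<noteq> 0 \<longrightarrow> l > k) \<and>
        (\<forall>k'\<in>bix M (head Q a). \<forall>l'\<in>bix M (head Q a).
           vmap M a (b (tail Q a) l) = b (head Q a) l' \<and>
           vmap M a (b (tail Q a) k) = b (head Q a) k' \<and> l > k \<longrightarrow> l' > k'))"

section \<open>Tori and moment graphs\<close>

text \<open>The torus with coordinates indexed by the finite set \<open>I\<close>. Its characters and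
  cocharacters are identified with their exponent vectors.\<close>

definition torus :: "'i set \<Rightarrow> ('i \<Rightarrow> complex) set" where
  "torus I = I \<rightarrow>\<^sub>E (- {0})"

definition characters :: "'i set \<Rightarrow> ('i \<Rightarrow> int) set" where
  "characters I = I \<rightarrow>\<^sub>E UNIV"

definition char_eval :: "'i set \<Rightarrow> ('i \<Rightarrow> int) \<Rightarrow> ('i \<Rightarrow> complex) \<Rightarrow> complex" where
  "char_eval I m t = (\<Prod>j\<in>I. t j powi m j)"

definition cocharacters :: "'i set \<Rightarrow> ('i \<Rightarrow> int) set" where
  "cocharacters I = I \<rightarrow>\<^sub>E UNIV"

definition cochar_eval :: "'i set \<Rightarrow> ('i \<Rightarrow> int) \<Rightarrow> complex \<Rightarrow> ('i \<Rightarrow> complex)" where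
  "cochar_eval I chi z = (\<lambda>j\<in>I. z powi chi j)"

definition fixed_points ::
  "'i set \<Rightarrow> (('i \<Rightarrow> complex) \<Rightarrow> 'x \<Rightarrow> 'x) \<Rightarrow> 'x topology \<Rightarrow> 'x set" where
  "fixed_points I act X = {x \<in> topspace X. \<forall>t\<in>torus I. act t x = x}"

definition generic_cochar ::
  "'i set \<Rightarrow> (('i \<Rightarrow> complex) \<Rightarrow> 'x \<Rightarrow> 'x) \<Rightarrow> 'x topology \<Rightarrow> ('i \<Rightarrow> int) \<Rightarrow> bool" where
  "generic_cochar I act X chi \<longleftrightarrow>
     fixed_points I act X = {x \<in> topspace X. \<forall>z. z \<noteq> 0 \<longrightarrow> act (cochar_eval I chi z) x = x}"

definition torus_orbit :: "'i set \<Rightarrow> (('i \<Rightarrow> complex) \<Rightarrow> 'x \<Rightarrow> 'x) \<Rightarrow> 'x \<Rightarrow> 'x set" where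
  "torus_orbit I act p = (\<lambda>t. act t p) ` torus I"

text \<open>The orbit of \<open>p\<close> is \<open>T / T\<^sub>p\<close>, a torus whose character lattice consists of the
  characters of \<open>T\<close> that are trivial on the stabilizer \<open>T\<^sub>p\<close>. Its dimension is the rank of
  this lattice.\<close>

definition orbit_characters ::
  "'i set \<Rightarrow> (('i \<Rightarrow> complex) \<Rightarrow> 'x \<Rightarrow> 'x) \<Rightarrow> 'x \<Rightarrow> ('i \<Rightarrow> int) set" where
  "orbit_characters I act p =
     {m \<in> characters I. \<forall>t\<in>torus I. act t p = p \<longrightarrow> char_eval I m t = 1}"

definition int_independent :: "'i set \<Rightarrow> ('i \<Rightarrow> int) set \<Rightarrow> bool" where
  "int_independent I S \<longleftrightarrow> finite S \<and>
     (\<forall>c :: ('i \<Rightarrow> int) \<Rightarrow> int. (\<forall>j\<in>I. (\<Sum>m\<in>S. c m * m j) = 0) \<longrightarrow> (\<forall>m\<in>S. c m = 0))"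

definition orbit_dim :: "'i set \<Rightarrow> (('i \<Rightarrow> complex) \<Rightarrow> 'x \<Rightarrow> 'x) \<Rightarrow> 'x \<Rightarrow> nat" where
  "orbit_dim I act p = Max (card ` {S. S \<subseteq> orbit_characters I act p \<and> int_independent I S})"

definition one_dim_orbits ::
  "'i set \<Rightarrow> (('i \<Rightarrow> complex) \<Rightarrow> 'x \<Rightarrow> 'x) \<Rightarrow> 'x topology \<Rightarrow> 'x set set" where
  "one_dim_orbits I act X = torus_orbit I act ` {p \<in> topspace X. orbit_dim I act p = 1}"

text \<open>An edge is a triple \<open>(E, x, y)\<close> consisting of a one-dimensional orbit and the fixed points
  in its closure, \<open>x\<close> being the limit for \<open>\<lambda> \<rightarrow> 0\<close>; the closure of \<open>E\<close> determines \<open>E\<close>.\<close>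

definition moment_graph ::
  "'i set \<Rightarrow> (('i \<Rightarrow> complex) \<Rightarrow> 'x \<Rightarrow> 'x) \<Rightarrow> 'x topology \<Rightarrow> ('i \<Rightarrow> int)
    \<Rightarrow> ('x, 'x set \<times> 'x \<times> 'x) pre_digraph" where
  "moment_graph I act X chi =
     \<lparr> verts = fixed_points I act X,
       arcs = {(E, x, y). E \<in> one_dim_orbits I act X \<and>
                 x \<in> fixed_points I act X \<and> y \<in> fixed_points I act X \<and>
                 X closure_of E = E \<union> {x, y} \<and>
                 (\<forall>p\<in>E. limitin X (\<lambda>z. act (cochar_eval I chi z) p) x (at 0))},
       tail = (\<lambda>(E, x, y). x),
       head = (\<lambda>(E, x, y). y) \<rparr>"

text \<open>The character \<open>\<alpha>\<close> describes the action on \<open>E\<close> if \<open>E\<close> can be identified with \<open>\<complex>\<^sup>*\<close> such that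
  \<open>t\<close> acts as multiplication by \<open>\<alpha>(t)\<close>. For a one-dimensional orbit this determines \<open>\<alpha>\<close> up to sign,
  since the kernel of \<open>\<alpha>\<close> is then the stabilizer of any point of \<open>E\<close>.\<close>

definition describes_action ::
  "'i set \<Rightarrow> (('i \<Rightarrow> complex) \<Rightarrow> 'x \<Rightarrow> 'x) \<Rightarrow> 'x set \<Rightarrow> ('i \<Rightarrow> int) \<Rightarrow> bool" where
  "describes_action I act E \<alpha> \<longleftrightarrow> \<alpha> \<in> characters I \<and>
     (\<exists>\<phi>. bij_betw \<phi> (- {0}) E \<and>
        (\<forall>t\<in>torus I. \<forall>z. z \<noteq> 0 \<longrightarrow> act t (\<phi> z) = \<phi> (char_eval I \<alpha> t * z)))"

definition edge_labelling ::
  "'i set \<Rightarrow> (('i \<Rightarrow> complex) \<Rightarrow> 'x \<Rightarrow> 'x) \<Rightarrow> 'x topology \<Rightarrow> ('x set \<Rightarrow> ('i \<Rightarrow> int)) \<Rightarrow> bool" where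
  "edge_labelling I act X \<alpha> \<longleftrightarrow> (\<forall>E\<in>one_dim_orbits I act X. describes_action I act E (\<alpha> E))"

section \<open>Equivariant cohomology and Knutson-Tao classes\<close>

type_synonym 'i qpoly = "('i \<Rightarrow>\<^sub>0 nat) \<Rightarrow>\<^sub>0 rat"

text \<open>\<open>R\<close> is the polynomial ring over the rationals whose variables \<open>\<tau>\<^sub>j\<close>, \<open>j \<in> I\<close>, are the coordinate
  characters of the torus.\<close>

definition poly_ring :: "'i set \<Rightarrow> 'i qpoly set" where
  "poly_ring I = {p. \<forall>m\<in>Poly_Mapping.keys p. Poly_Mapping.keys m \<subseteq> I}"

definition char_poly :: "'i set \<Rightarrow> ('i \<Rightarrow> int) \<Rightarrow> 'i qpoly" where
  "char_poly I m = (\<Sum>j\<in>I. Poly_Mapping.single (Poly_Mapping.single j 1) (of_int (m j)))"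

definition monom_degree :: "('i \<Rightarrow>\<^sub>0 nat) \<Rightarrow> nat" where
  "monom_degree m = (\<Sum>j\<in>Poly_Mapping.keys m. Poly_Mapping.lookup m j)"

definition poly_degree :: "'i qpoly \<Rightarrow> nat" where
  "poly_degree p = Max (insert 0 (monom_degree ` Poly_Mapping.keys p))"

text \<open>The zero polynomial is homogeneous of every degree.\<close>

definition homogeneous :: "nat \<Rightarrow> 'i qpoly \<Rightarrow> bool" where
  "homogeneous n p \<longleftrightarrow> (\<forall>m\<in>Poly_Mapping.keys p. monom_degree m = n)"

text \<open>Equivariant cohomology with rational coefficients, in terms of the localizations at the
  vertices of the moment graph \<open>G\<close>.\<close>

definition equiv_cohomology ::
  "'i set \<Rightarrow> ('x, 'x set \<times> 'x \<times> 'x) pre_digraph \<Rightarrow> ('x set \<Rightarrow> ('i \<Rightarrow> int)) \<Rightarrow> ('x \<Rightarrow> 'i qpoly) set"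
  where
  "equiv_cohomology I G \<alpha> =
     {f \<in> verts G \<rightarrow>\<^sub>E poly_ring I.
        \<forall>(E, x, y)\<in>arcs G. \<exists>r\<in>poly_ring I. f x - f y = char_poly I (\<alpha> E) * r}"

definition KT_class ::
  "'i set \<Rightarrow> ('x, 'x set \<times> 'x \<times> 'x) pre_digraph \<Rightarrow> ('x set \<Rightarrow> ('i \<Rightarrow> int)) \<Rightarrow> 'x
    \<Rightarrow> ('x \<Rightarrow> 'i qpoly) \<Rightarrow> bool" where
  "KT_class I G \<alpha> x p \<longleftrightarrow> p \<in> equiv_cohomology I G \<alpha> \<and>
     p x = (\<Prod>(E, _)\<in>out_arcs G x. char_poly I (\<alpha> E)) \<and>
     (\<forall>y\<in>verts G. homogeneous (poly_degree (p x)) (p y)) \<and>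
     (\<forall>y\<in>verts G. \<not> y \<rightarrow>\<^sup>*\<^bsub>G\<^esub> x \<longrightarrow> p y = 0)"

text \<open>Bases of a submodule \<open>N\<close> of the module of functions on \<open>S\<close> with values in a subring \<open>R\<close>.\<close>

definition module_basis ::
  "'r::comm_ring_1 set \<Rightarrow> 'x set \<Rightarrow> ('x \<Rightarrow> 'r) set \<Rightarrow> ('x \<Rightarrow> 'r) set \<Rightarrow> bool" where
  "module_basis R S N P \<longleftrightarrow> finite P \<and> P \<subseteq> N \<and>
     (\<forall>f\<in>N. \<exists>c\<in>P \<rightarrow> R. \<forall>x\<in>S. f x = (\<Sum>p\<in>P. c p * p x)) \<and>
     (\<forall>c\<in>P \<rightarrow> R. (\<forall>x\<in>S. (\<Sum>p\<in>P. c p * p x) = 0) \<longrightarrow> (\<forall>p\<in>P. c p = 0))"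

definition KT_basis ::
  "'i set \<Rightarrow> ('x, 'x set \<times> 'x \<times> 'x) pre_digraph \<Rightarrow> ('x set \<Rightarrow> ('i \<Rightarrow> int))
    \<Rightarrow> ('x \<Rightarrow> 'i qpoly) set \<Rightarrow> bool" where
  "KT_basis I G \<alpha> P \<longleftrightarrow> acyclic (arcs_ends G) \<and>
     module_basis (poly_ring I) (verts G) (equiv_cohomology I G \<alpha>) P \<and>
     (\<forall>p\<in>P. \<exists>x\<in>verts G. KT_class I G \<alpha> x p)"

section \<open>The torus of a straight representation\<close>

text \<open>The coordinates of \<open>T\<^sub>M\<close> are indexed by the strings of the coefficient quiver
  (the \<open>\<gamma>\<^sub>i\<close>) and the arrows of the support of \<open>M\<close> (the \<open>\<nu>\<^sub>j\<close>).\<close>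

type_synonym ('v, 'a) tindex = "('v \<times> nat) set + 'a"

definition supp_arcs :: "('v, 'a) pre_digraph \<Rightarrow> ('v, 'a, 'n::finite) rep \<Rightarrow> 'a set" where
  "supp_arcs Q M = {a \<in> arcs Q. \<exists>v\<in>vsp M (tail Q a). vmap M a v \<noteq> 0}"

definition TM_index ::
  "('v, 'a) pre_digraph \<Rightarrow> ('v, 'a, 'n) rep \<Rightarrow> ('v \<Rightarrow> nat \<Rightarrow> complex ^ 'n::finite)
    \<Rightarrow> ('v, 'a) tindex set" where
  "TM_index Q M b = weak_components (coeff_quiver Q M b) <+> supp_arcs Q M"

text \<open>The scaling factor of a basis vector \<open>x\<close>: the arrows of the coefficient quiver whose head
  is connected to \<open>x\<close> by a directed path are those between the starting vertex of the string of \<open>x\<close>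
  and \<open>x\<close>.\<close>

definition TM_scale ::
  "('v, 'a) pre_digraph \<Rightarrow> ('v, 'a, 'n) rep \<Rightarrow> ('v \<Rightarrow> nat \<Rightarrow> complex ^ 'n::finite)
    \<Rightarrow> (('v, 'a) tindex \<Rightarrow> complex) \<Rightarrow> 'v \<times> nat \<Rightarrow> complex" where
  "TM_scale Q M b t x =
     t (Inl (weak_component (coeff_quiver Q M b) x)) *
     (\<Prod>(a, k, l)\<in>{f \<in> arcs (coeff_quiver Q M b).
         head (coeff_quiver Q M b) f \<rightarrow>\<^sup>*\<^bsub>coeff_quiver Q M b\<^esub> x}. t (Inr a))"

definition TM_act_vec ::
  "('v, 'a) pre_digraph \<Rightarrow> ('v, 'a, 'n) rep \<Rightarrow> ('v \<Rightarrow> nat \<Rightarrow> complex ^ 'n::finite)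
    \<Rightarrow> (('v, 'a) tindex \<Rightarrow> complex) \<Rightarrow> 'v \<Rightarrow> complex ^ 'n \<Rightarrow> complex ^ 'n" where
  "TM_act_vec Q M b t i v = (\<Sum>k\<in>bix M i. (TM_scale Q M b t (i, k) * coeff M b i k v) *s b i k)"

definition TM_act ::
  "('v, 'a) pre_digraph \<Rightarrow> ('v, 'a, 'n) rep \<Rightarrow> ('v \<Rightarrow> nat \<Rightarrow> complex ^ 'n::finite)
    \<Rightarrow> (('v, 'a) tindex \<Rightarrow> complex) \<Rightarrow> ('v \<Rightarrow> (complex ^ 'n) set) \<Rightarrow> ('v \<Rightarrow> (complex ^ 'n) set)" where
  "TM_act Q M b t U = (\<lambda>i\<in>verts Q. TM_act_vec Q M b t i ` U i)"

definition attractive_grading ::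
  "('v, 'a) pre_digraph \<Rightarrow> ('v, 'a, 'n) rep \<Rightarrow> ('v \<Rightarrow> nat \<Rightarrow> complex ^ 'n::finite)
    \<Rightarrow> ('v \<times> nat \<Rightarrow> int) \<Rightarrow> bool" where
  "attractive_grading Q M b wt \<longleftrightarrow>
     (\<forall>i\<in>verts Q. \<forall>k\<in>bix M i. \<forall>l\<in>bix M i. k > l \<longrightarrow> wt (i, k) > wt (i, l)) \<and>
     (\<forall>a\<in>arcs Q. \<exists>w. \<forall>k l. (a, k, l) \<in> arcs (coeff_quiver Q M b) \<longrightarrow>
        wt (head Q a, l) = wt (tail Q a, k) + w)"

definition attractive_compatible ::
  "('v, 'a) pre_digraph \<Rightarrow> ('v, 'a, 'n) rep \<Rightarrow> (('v, 'a) tindex \<Rightarrow> int)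
    \<Rightarrow> ('v \<Rightarrow> nat \<Rightarrow> complex ^ 'n::finite) \<Rightarrow> bool" where
  "attractive_compatible Q M chi b \<longleftrightarrow>
     straightening_basis Q M b \<and> normalized Q M b \<and> aligned Q M b \<and>
     (\<exists>wt. (\<forall>i\<in>verts Q. \<forall>k\<in>bix M i. \<forall>z. z \<noteq> 0 \<longrightarrow>
              TM_act_vec Q M b (cochar_eval (TM_index Q M b) chi z) i (b i k) = (z powi wt (i, k)) *s b i k) \<and>
           attractive_grading Q M b wt)"

abbreviation TM_moment_graph ::
  "('v, 'a) pre_digraph \<Rightarrow> ('v, 'a, 'n) rep \<Rightarrow> ('v \<Rightarrow> nat \<Rightarrow> complex ^ 'n::finite) \<Rightarrow> ('v \<Rightarrow> int)
    \<Rightarrow> (('v, 'a) tindex \<Rightarrow> int)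
    \<Rightarrow> ('v \<Rightarrow> (complex ^ 'n) set,
        ('v \<Rightarrow> (complex ^ 'n) set) set \<times> ('v \<Rightarrow> (complex ^ 'n) set) \<times> ('v \<Rightarrow> (complex ^ 'n) set)) pre_digraph"
  where
  "TM_moment_graph Q M b e chi \<equiv>
     moment_graph (TM_index Q M b) (TM_act Q M b) (quiver_Gr_top Q M e) chi"

end

theory Submission
  imports Defs
begin

text \<open>Along an acyclic moment graph, Knutson-Tao classes can be built vertex by vertex as soon as
  every class on a set \<open>D\<close> that is closed under arcs and contains the targets of the arcs leaving
  \<open>x\<close> extends to \<open>x\<close>. The labels of the arcs leaving \<open>x\<close> are pairwise independent linear forms, and
  by unique factorisation the extension exists if it exists for the labels in each plane spanned by
  two of them.

  A fixed point of the quiver Grassmannian is given by a starting position on each string, from which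
  on the string belongs to the subrepresentation. An arc drops the first elements of one such final
  part, on \<open>s\<close>, and prepends an aligned segment to the one on another string \<open>s'\<close>; the coefficients of
  its label at \<open>s'\<close> and \<open>s\<close> are \<open>1\<close> and \<open>-1\<close>, and those at the other strings vanish. Hence a
  plane with more than two labels comes from three strings, where the problem is that of a hexagon
  of type \<open>A\<^sub>2\<close>, or from a single pair of strings, where the labels form a pencil and the class is
  extended by Newton interpolation.

  The closure of a one-dimensional orbit is the image of a projective line under a family of spans
  of vectors \<open>a *s p + c *s q\<close>. Reduced echelon forms of the subrepresentations show that every other
  subrepresentation is fixed or has an orbit of dimension at least two. The stabiliser of a point
  of the orbit is the kernel of the label, so that any labelling of the edge is a multiple of it.\<close>

section \<open>Linear forms in a polynomial ring\<close>

text \<open>The congruences modulo the labels leaving \<open>x\<close> cannot be solved by looking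
  at two of them at a time: compatibility for two labels says nothing about a third one in the same
  plane. This is why three strings and a single pair of strings need arguments of their own, and why
  states not adjacent to \<open>x\<close> enter: they supply the missing congruences. Several arcs
  join the same pair of strings only if the receiving string returns to the same vertex of the
  quiver, along a cycle. Alignment then makes it periodic between these visits, so that the labels
  are \<open>c - b d\<close> for consecutive integers \<open>b\<close>, where \<open>d\<close> is
  the character gained in one period. Pairwise independence of the labels leaving \<open>x\<close>
  has a second use: a class that vanishes at all targets of these arcs is divisible at
  \<open>x\<close> by the product of the labels, which makes the classes a triangular basis.
  Divisibility by a linear form is tested by eliminating one variable; primality then comes down to
  the absence of zero divisors.\<close>

definition pvar :: "'i \<Rightarrow> 'i qpoly" where
  "pvar j = Poly_Mapping.single (Poly_Mapping.single j 1) 1"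

abbreviation pconst :: "rat \<Rightarrow> 'i qpoly" where
  "pconst c \<equiv> Poly_Mapping.single 0 c"

definition pmono :: "('i \<Rightarrow> 'j qpoly) \<Rightarrow> ('i \<Rightarrow>\<^sub>0 nat) \<Rightarrow> 'j qpoly" where
  "pmono \<theta> m = (\<Prod>j\<in>Poly_Mapping.keys m. \<theta> j ^ Poly_Mapping.lookup m j)"

text \<open>The algebra homomorphism that sends the variable \<open>j\<close> to
  \<open>\<theta> j\<close>. It serves to kill a linear form, to rename variables and to discard
  variables.\<close>

definition psubst :: "('i \<Rightarrow> 'j qpoly) \<Rightarrow> 'i qpoly \<Rightarrow> 'j qpoly" where
  "psubst \<theta> p = (\<Sum>m\<in>Poly_Mapping.keys p. pconst (Poly_Mapping.lookup p m) * pmono \<theta> m)"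

lemma pmono_superset:
  assumes "finite A" "Poly_Mapping.keys m \<subseteq> A"
  shows "pmono \<theta> m = (\<Prod>j\<in>A. \<theta> j ^ Poly_Mapping.lookup m j)"
  unfolding pmono_def using assms by (intro prod.mono_neutral_left) (auto simp: in_keys_iff)

lemma pmono_add: "pmono \<theta> (m + n) = pmono \<theta> m * pmono \<theta> n"
proof -
  define A where "A = Poly_Mapping.keys m \<union> Poly_Mapping.keys n"
  have "finite A" "Poly_Mapping.keys m \<subseteq> A" "Poly_Mapping.keys n \<subseteq> A"
    "Poly_Mapping.keys (m + n) \<subseteq> A"
    using Poly_Mapping.keys_add[of m n] by (auto simp: A_def)
  then show ?thesis
    by (simp add: pmono_superset[of A] lookup_add power_add prod.distrib)
qed

lemma pmono_0 [simp]: "pmono \<theta> 0 = 1"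
  by (simp add: pmono_def)

lemma psubst_superset:
  assumes "finite A" "Poly_Mapping.keys p \<subseteq> A"
  shows "psubst \<theta> p = (\<Sum>m\<in>A. pconst (Poly_Mapping.lookup p m) * pmono \<theta> m)"
  unfolding psubst_def using assms
  by (intro sum.mono_neutral_left) (auto simp: in_keys_iff)

lemma psubst_add: "psubst \<theta> (p + q) = psubst \<theta> p + psubst \<theta> q"
proof -
  define A where "A = Poly_Mapping.keys p \<union> Poly_Mapping.keys q"
  have "finite A" "Poly_Mapping.keys p \<subseteq> A" "Poly_Mapping.keys q \<subseteq> A"
    "Poly_Mapping.keys (p + q) \<subseteq> A"
    using Poly_Mapping.keys_add[of p q] by (auto simp: A_def)
  then show ?thesis
    by (simp add: psubst_superset[of A] lookup_add single_add distrib_right sum.distrib)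
qed

lemma psubst_single: "psubst \<theta> (Poly_Mapping.single m c) = pconst c * pmono \<theta> m"
  by (subst psubst_superset[of "{m}"]) auto

lemma psubst_0 [simp]: "psubst \<theta> 0 = 0"
  by (simp add: psubst_def)

lemma psubst_pconst [simp]: "psubst \<theta> (pconst c) = pconst c"
  by (simp add: psubst_single)

lemma psubst_1 [simp]: "psubst \<theta> 1 = 1"
  using psubst_pconst[of \<theta> 1] by simp

lemma psubst_pvar [simp]: "psubst \<theta> (pvar j) = \<theta> j"
  by (simp add: pvar_def psubst_single pmono_def)

lemma psubst_sum: "psubst \<theta> (sum f A) = (\<Sum>x\<in>A. psubst \<theta> (f x))"
  by (induction A rule: infinite_finite_induct) (auto simp: psubst_add)

lemma poly_mapping_decomp:
  "(p :: 'a \<Rightarrow>\<^sub>0 'b::comm_monoid_add) = (\<Sum>m\<in>Poly_Mapping.keys p. Poly_Mapping.single m (Poly_Mapping.lookup p m))"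
  by (rule poly_mapping_eqI) (simp add: lookup_sum lookup_single when_def in_keys_iff)

lemma poly_mapping_induct_single [case_names single add]:
  assumes "\<And>m c. P (Poly_Mapping.single m c)" "\<And>p q. P p \<Longrightarrow> P q \<Longrightarrow> P (p + q)"
  shows "P (p :: 'a \<Rightarrow>\<^sub>0 'b::comm_monoid_add)"
proof -
  have "P (\<Sum>m\<in>A. Poly_Mapping.single m (Poly_Mapping.lookup p m))" if "finite A" for A
    using that by (induction A rule: finite_induct) (use assms(1)[of _ 0] assms in auto)
  then show ?thesis using poly_mapping_decomp[of p] by (metis finite_keys)
qed

lemma psubst_mult:
  fixes \<theta> :: "'i \<Rightarrow> 'j qpoly"
  shows "psubst \<theta> (p * q) = psubst \<theta> p * psubst \<theta> q"
proof (induction p rule: poly_mapping_induct_single)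
  case (single m c)
  show ?case
  proof (induction q rule: poly_mapping_induct_single)
    case (single n d)
    have "pconst (c * d) = (pconst c * pconst d :: 'j qpoly)"
      by (simp add: mult_single)
    have "psubst \<theta> (Poly_Mapping.single m c * Poly_Mapping.single n d) =
        pconst (c * d) * (pmono \<theta> m * pmono \<theta> n)"
      by (simp only: mult_single psubst_single pmono_add)
    also have "\<dots> = psubst \<theta> (Poly_Mapping.single m c) * psubst \<theta> (Poly_Mapping.single n d)"
      unfolding psubst_single \<open>pconst (c * d) = _\<close> by (simp only: mult_ac)
    finally show ?case .
  qed (simp add: psubst_add distrib_left)
qed (simp add: psubst_add distrib_right)

lemma psubst_uminus: "psubst \<theta> (- p) = - psubst \<theta> p"
  using psubst_add[of \<theta> p "- p"] by (simp add: add_eq_0_iff)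

lemma psubst_diff: "psubst \<theta> (p - q) = psubst \<theta> p - psubst \<theta> q"
  using psubst_add[of \<theta> p "- q"] by (simp add: psubst_uminus)

lemma psubst_power: "psubst \<theta> (p ^ n) = psubst \<theta> p ^ n"
  by (induction n) (auto simp: psubst_mult)

lemma psubst_prod: "psubst \<theta> (prod f A) = (\<Prod>x\<in>A. psubst \<theta> (f x))"
  by (induction A rule: infinite_finite_induct) (auto simp: psubst_mult)

lemma psubst_pmono: "psubst \<theta> (pmono \<eta> m) = pmono (\<lambda>j. psubst \<theta> (\<eta> j)) m"
  by (simp add: pmono_def psubst_prod psubst_power)

lemma psubst_compose: "psubst \<theta> (psubst \<eta> p) = psubst (\<lambda>j. psubst \<theta> (\<eta> j)) p"
  by (simp add: psubst_def[of \<eta>] psubst_def[of "\<lambda>j. psubst \<theta> (\<eta> j)"] psubst_sum psubst_mult psubst_pmono)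

lemma single_eq_pmono: "Poly_Mapping.single m c = pconst c * pmono pvar m"
proof -
  have *: "pvar j ^ k = Poly_Mapping.single (Poly_Mapping.single j k) 1" for j and k :: nat
    by (induction k) (auto simp: pvar_def mult_single single_add[symmetric])
  have **: "(\<Prod>j\<in>A. Poly_Mapping.single (Poly_Mapping.single j (Poly_Mapping.lookup m j)) (1::rat)) =
     Poly_Mapping.single (\<Sum>j\<in>A. Poly_Mapping.single j (Poly_Mapping.lookup m j)) 1"
    if "finite A" for A
    using that by (induction A rule: finite_induct) (auto simp: mult_single)
  show ?thesis
    by (simp add: pmono_def * ** mult_single poly_mapping_decomp[of m, symmetric])
qed

definition pvars :: "'i qpoly \<Rightarrow> 'i set" where
  "pvars p = (\<Union>m\<in>Poly_Mapping.keys p. Poly_Mapping.keys m)"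

lemma finite_pvars [simp]: "finite (pvars p)"
  by (simp add: pvars_def)

lemma psubst_pvar_id:
  assumes "\<And>j. j \<in> pvars p \<Longrightarrow> \<theta> j = pvar j"
  shows "psubst \<theta> p = p"
proof -
  have "pmono \<theta> m = pmono pvar m" if "m \<in> Poly_Mapping.keys p" for m
  proof -
    have "j \<in> pvars p" if "j \<in> Poly_Mapping.keys m" for j
      using that \<open>m \<in> _\<close> by (auto simp: pvars_def)
    then show ?thesis unfolding pmono_def using assms by (intro prod.cong) auto
  qed
  then have "psubst \<theta> p = (\<Sum>m\<in>Poly_Mapping.keys p. pconst (Poly_Mapping.lookup p m) * pmono pvar m)"
    unfolding psubst_def by (intro sum.cong) auto
  also have "\<dots> = p"
    by (simp add: single_eq_pmono[symmetric] poly_mapping_decomp[symmetric])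
  finally show ?thesis .
qed

text \<open>Only finitely many variables occur, and renaming them to natural numbers is undone by
  another substitution. With ordered variables the monomials are ordered and leading terms
  multiply.\<close>

lemma qpoly_no_zero_divisors:
  fixes p q :: "'i qpoly"
  assumes "p * q = 0"
  shows "p = 0 \<or> q = 0"
proof -
  obtain g :: "'i \<Rightarrow> nat" where g: "inj_on g (pvars p \<union> pvars q)"
    using finite_imp_inj_to_nat_seg[of "pvars p \<union> pvars q"] by auto
  let ?h = "the_inv_into (pvars p \<union> pvars q) g"
  have inv: "psubst (\<lambda>k. pvar (?h k)) (psubst (\<lambda>j. pvar (g j)) r) = r"
    if "pvars r \<subseteq> pvars p \<union> pvars q" for r :: "'i qpoly"
    unfolding psubst_compose using that g
    by (intro psubst_pvar_id) (auto simp: the_inv_into_f_f)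
  have "psubst (\<lambda>j. pvar (g j)) p * psubst (\<lambda>j. pvar (g j)) q = 0"
    using assms by (simp flip: psubst_mult)
  then have "psubst (\<lambda>j. pvar (g j)) p = 0 \<or> psubst (\<lambda>j. pvar (g j)) q = 0"
    by simp
  then show ?thesis using inv[of p] inv[of q] by auto
qed

text \<open>Modulo \<open>a\<close> each variable equals its image, hence so does every
  polynomial.\<close>

lemma dvd_diff_psubst:
  fixes p a :: "'i qpoly"
  assumes "\<And>j. a dvd pvar j - \<theta> j"
  shows "a dvd p - psubst \<theta> p"
proof -
  have mult: "a dvd x * y - x' * y'" if "a dvd x - x'" "a dvd y - y'" for x y x' y' :: "'i qpoly"
  proof -
    have "x * y - x' * y' = x * (y - y') + y' * (x - x')" by (simp add: algebra_simps)
    then show ?thesis using that by auto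
  qed
  have pow: "a dvd pvar j ^ k - \<theta> j ^ k" for j k
    by (induction k) (auto intro!: mult assms)
  have "a dvd (\<Prod>j\<in>A. pvar j ^ Poly_Mapping.lookup m j) - (\<Prod>j\<in>A. \<theta> j ^ Poly_Mapping.lookup m j)"
    if "finite A" for A and m :: "'i \<Rightarrow>\<^sub>0 nat"
    using that by (induction A rule: finite_induct) (auto intro!: mult pow)
  then have mono: "a dvd pmono pvar m - pmono \<theta> m" for m
    by (simp add: pmono_def)
  show ?thesis
  proof (induction p rule: poly_mapping_induct_single)
    case (single m c)
    show ?case
      using mult[of "pconst c" "pconst c", OF _ mono[of m]]
      unfolding psubst_single by (simp add: single_eq_pmono[of m c])
  next
    case (add p q)
    have "p + q - psubst \<theta> (p + q) = (p - psubst \<theta> p) + (q - psubst \<theta> q)"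
      by (simp add: psubst_add)
    then show ?case using add by (metis dvd_add)
  qed
qed

section \<open>Linear forms as primes, and ideals of two linear forms\<close>

definition lin :: "'i set \<Rightarrow> ('i \<Rightarrow> rat) \<Rightarrow> 'i qpoly" where
  "lin I c = (\<Sum>j\<in>I. pconst (c j) * pvar j)"

lemma lin_add: "lin I (\<lambda>j. c j + d j) = lin I c + lin I d"
  by (simp add: lin_def single_add sum.distrib distrib_right)

lemma lin_scale: "lin I (\<lambda>j. x * c j) = pconst x * lin I c"
  by (simp add: lin_def sum_distrib_left mult_single flip: mult.assoc)

lemma lin_diff: "lin I (\<lambda>j. c j - d j) = lin I c - lin I d"
  by (simp add: lin_def single_diff sum_subtractf left_diff_distrib)

lemma char_poly_eq_lin: "char_poly I m = lin I (\<lambda>j. of_int (m j))"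
  by (simp add: char_poly_def lin_def pvar_def mult_single del: single_of_int)

lemma lin_cong: "(\<And>j. j \<in> I \<Longrightarrow> c j = d j) \<Longrightarrow> lin I c = lin I d"
  by (simp add: lin_def)

lemma lookup_lin:
  assumes "finite I" "j \<in> I"
  shows "Poly_Mapping.lookup (lin I c) (Poly_Mapping.single j 1) = c j"
proof -
  have *: "Poly_Mapping.single k (1::nat) = Poly_Mapping.single j 1 \<longleftrightarrow> k = j" for k :: 'a
    using keys_single[of k "1::nat"] keys_single[of j "1::nat"] by (metis one_neq_zero singleton_inject)
  have "Poly_Mapping.lookup (lin I c) (Poly_Mapping.single j 1) = (\<Sum>k\<in>I. if k = j then c k else 0)"
    unfolding lin_def lookup_sum
    by (intro sum.cong refl) (use * in \<open>auto simp: lookup_single when_def pvar_def mult_single\<close>)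
  then show ?thesis using assms by simp
qed

lemma lin_eq_0_iff:
  assumes "finite I"
  shows "lin I c = 0 \<longleftrightarrow> (\<forall>j\<in>I. c j = 0)"
proof
  assume "lin I c = 0"
  then show "\<forall>j\<in>I. c j = 0" using lookup_lin[OF assms, of _ c] by auto
qed (simp add: lin_def)

text \<open>The substitution that solves the equation \<open>lin I c = 0\<close> for the variable
  \<open>j\<close>; it is used for \<open>c j \<noteq> 0\<close>.\<close>

definition elim_var :: "'i set \<Rightarrow> ('i \<Rightarrow> rat) \<Rightarrow> 'i \<Rightarrow> 'i \<Rightarrow> 'i qpoly" where
  "elim_var I c j = pvar(j := pvar j - pconst (1 / c j) * lin I c)"

lemma psubst_elim_lin:
  assumes "finite I" "j \<in> I" "c j \<noteq> 0"
  shows "psubst (elim_var I c j) (lin I d) = lin I (\<lambda>i. d i - d j / c j * c i)"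
proof -
  have "psubst (elim_var I c j) (lin I d) = (\<Sum>i\<in>I. pconst (d i) * elim_var I c j i)"
    by (simp add: lin_def psubst_sum psubst_mult)
  also have "\<dots> = (\<Sum>i\<in>I. pconst (d i) * pvar i - (if i = j then pconst (d j / c j) * lin I c else 0))"
  proof (intro sum.cong refl)
    fix i
    have "pconst (d j) * pconst (1 / c j) = (pconst (d j / c j) :: 'a qpoly)"
      by (simp add: mult_single)
    then show "pconst (d i) * elim_var I c j i =
        pconst (d i) * pvar i - (if i = j then pconst (d j / c j) * lin I c else 0)"
      by (auto simp: elim_var_def algebra_simps)
  qed
  also have "\<dots> = lin I d - pconst (d j / c j) * lin I c"
    using assms by (simp add: sum_subtractf lin_def)
  finally show ?thesis unfolding lin_diff lin_scale .
qed

lemma psubst_elim_lin_self: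
  assumes "finite I" "j \<in> I" "c j \<noteq> 0"
  shows "psubst (elim_var I c j) (lin I c) = 0"
  using assms by (simp add: psubst_elim_lin lin_eq_0_iff)

text \<open>The substitution kills \<open>lin I c\<close> and changes every polynomial only by a
  multiple of it, so its kernel is the ideal generated by this form. Primality of the form is then
  the absence of zero divisors in the image.\<close>

lemma lin_dvd_iff:
  assumes "finite I" "j \<in> I" "c j \<noteq> 0"
  shows "lin I c dvd p \<longleftrightarrow> psubst (elim_var I c j) p = 0"
proof
  assume "lin I c dvd p"
  moreover have "psubst (elim_var I c j) (lin I c) = 0"
    using assms by (rule psubst_elim_lin_self)
  ultimately show "psubst (elim_var I c j) p = 0"
    by (auto simp: psubst_mult)
next
  assume *: "psubst (elim_var I c j) p = 0"
  have "lin I c dvd p - psubst (elim_var I c j) p"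
    by (rule dvd_diff_psubst) (auto simp: elim_var_def)
  then show "lin I c dvd p" using * by simp
qed

lemma prime_lin:
  assumes "finite I" "j \<in> I" "c j \<noteq> 0" "lin I c dvd p * q"
  shows "lin I c dvd p \<or> lin I c dvd q"
  using assms qpoly_no_zero_divisors by (simp add: lin_dvd_iff[of I j] psubst_mult)

lemma lin_dvd_lin:
  assumes "finite I" "j \<in> I" "c j \<noteq> 0" "lin I c dvd lin I d"
  shows "\<exists>x. \<forall>i\<in>I. d i = x * c i"
proof (intro exI ballI)
  fix i assume "i \<in> I"
  have "lin I (\<lambda>i. d i - d j / c j * c i) = 0"
    using assms by (simp add: lin_dvd_iff[of I j] psubst_elim_lin)
  then show "d i = d j / c j * c i"
    using \<open>i \<in> I\<close> assms(1) by (simp only: lin_eq_0_iff right_minus_eq)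
qed

definition in_ideal2 :: "'r::comm_ring_1 \<Rightarrow> 'r \<Rightarrow> 'r \<Rightarrow> bool" where
  "in_ideal2 a b p \<longleftrightarrow> (\<exists>u v. p = a * u + b * v)"

text \<open>The substitution computes modulo \<open>lin I c\<close>. There, membership in the ideal
  of two forms becomes divisibility by the image of the second, again a linear form.\<close>

lemma in_ideal2_lin_iff:
  assumes "finite I" "j \<in> I" "c j \<noteq> 0"
  shows "in_ideal2 (lin I c) (lin I d) p \<longleftrightarrow>
    psubst (elim_var I c j) (lin I d) dvd psubst (elim_var I c j) p"
proof
  let ?\<theta> = "elim_var I c j"
  have dv: "lin I c dvd q - psubst ?\<theta> q" for q
    by (rule dvd_diff_psubst) (auto simp: elim_var_def)
  {
    assume "in_ideal2 (lin I c) (lin I d) p"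
    moreover have "psubst ?\<theta> (lin I c) = 0"
      using assms by (rule psubst_elim_lin_self)
    ultimately show "psubst ?\<theta> (lin I d) dvd psubst ?\<theta> p"
      by (auto simp: in_ideal2_def psubst_add psubst_mult)
  next
    assume "psubst ?\<theta> (lin I d) dvd psubst ?\<theta> p"
    then obtain w where w: "psubst ?\<theta> p = psubst ?\<theta> (lin I d) * w" by auto
    obtain u v where u: "p - psubst ?\<theta> p = lin I c * u" and v: "lin I d - psubst ?\<theta> (lin I d) = lin I c * v"
      using dv unfolding dvd_def by blast
    have "p = lin I c * u + psubst ?\<theta> (lin I d) * w"
      using u w by (metis diff_add_cancel)
    also have "psubst ?\<theta> (lin I d) = lin I d - lin I c * v"
      by (simp flip: v)
    also have "lin I c * u + (lin I d - lin I c * v) * w = lin I c * (u - v * w) + lin I d * w"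
      by (simp add: algebra_simps)
    finally show "in_ideal2 (lin I c) (lin I d) p" unfolding in_ideal2_def by (intro exI)
  }
qed

definition lindep :: "'i set \<Rightarrow> ('i \<Rightarrow> rat) \<Rightarrow> ('i \<Rightarrow> rat) \<Rightarrow> bool" where
  "lindep I c d \<longleftrightarrow> (\<exists>x. \<forall>i\<in>I. d i = x * c i)"

lemma not_lindepE:
  assumes "\<not> lindep I c d"
  obtains i where "i \<in> I" "d i - x * c i \<noteq> 0"
proof (rule ccontr)
  assume "\<not> thesis"
  then have "\<forall>i\<in>I. d i = x * c i" using that by force
  then show False using assms unfolding lindep_def by blast
qed

text \<open>Independence makes the image of the second form non-zero, hence prime.\<close>

lemma prime_ideal2:
  assumes "finite I" "\<exists>j\<in>I. c j \<noteq> 0" "\<not> lindep I c d"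
    and "in_ideal2 (lin I c) (lin I d) (p * q)"
  shows "in_ideal2 (lin I c) (lin I d) p \<or> in_ideal2 (lin I c) (lin I d) q"
proof -
  obtain j where j: "j \<in> I" "c j \<noteq> 0" using assms by auto
  obtain i where i: "i \<in> I" "d i - d j / c j * c i \<noteq> 0"
    using not_lindepE[OF assms(3), of "d j / c j"] by metis
  show ?thesis
    using assms(1,4) j prime_lin[OF assms(1) i(1), of "\<lambda>i. d i - d j / c j * c i"] i(2)
    by (simp add: in_ideal2_lin_iff psubst_mult psubst_elim_lin)
qed

text \<open>After one variable is eliminated, the image of \<open>e\<close> is a scalar multiple of
  the image of \<open>d\<close>; undoing the elimination adds a multiple of
  \<open>c\<close>.\<close>

lemma in_ideal2_linD:
  assumes "finite I" "\<exists>j\<in>I. c j \<noteq> 0" "\<not> lindep I c d"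
    and "in_ideal2 (lin I c) (lin I d) (lin I e)"
  shows "\<exists>x y. \<forall>i\<in>I. e i = x * c i + y * d i"
proof -
  obtain j where j: "j \<in> I" "c j \<noteq> 0" using assms by auto
  obtain i where i: "i \<in> I" "d i - d j / c j * c i \<noteq> 0"
    using not_lindepE[OF assms(3), of "d j / c j"] by metis
  have "lin I (\<lambda>i. d i - d j / c j * c i) dvd lin I (\<lambda>i. e i - e j / c j * c i)"
    using assms(1,4) j by (simp add: in_ideal2_lin_iff psubst_elim_lin)
  from lin_dvd_lin[OF assms(1) i(1) _ this] i(2)
  obtain x where x: "\<And>i. i \<in> I \<Longrightarrow> e i - e j / c j * c i = x * (d i - d j / c j * c i)" by auto
  show ?thesis
  proof (intro exI ballI)
    fix i assume "i \<in> I"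
    from x[OF this] show "e i = (e j / c j - x * (d j / c j)) * c i + x * d i"
      by (simp add: algebra_simps)
  qed
qed

section \<open>Extension of classes\<close>

definition nz_on :: "'i set \<Rightarrow> ('i \<Rightarrow> rat) \<Rightarrow> bool" where
  "nz_on I c \<longleftrightarrow> (\<exists>j\<in>I. c j \<noteq> 0)"

definition in_plane :: "'i set \<Rightarrow> ('i \<Rightarrow> rat) \<Rightarrow> ('i \<Rightarrow> rat) \<Rightarrow> ('i \<Rightarrow> rat) \<Rightarrow> bool" where
  "in_plane I c d e \<longleftrightarrow> (\<exists>x y. \<forall>i\<in>I. e i = x * c i + y * d i)"

lemma prime_lin_nz:
  assumes "finite I" "nz_on I c" "lin I c dvd p * q"
  shows "lin I c dvd p \<or> lin I c dvd q"
  using assms prime_lin unfolding nz_on_def by metis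

lemma lin_dvd_linD:
  assumes "finite I" "nz_on I c" "lin I c dvd lin I d"
  shows "lindep I c d"
  using assms lin_dvd_lin unfolding nz_on_def lindep_def by metis

lemma lin_not_dvd_1:
  assumes "finite I" "nz_on I c"
  shows "\<not> lin I c dvd 1"
  using assms unfolding nz_on_def by (auto simp: lin_dvd_iff)

lemma lin_dvd_prodD:
  assumes "finite I" "nz_on I c" "lin I c dvd (\<Prod>j\<in>J. f j)"
  shows "\<exists>j\<in>J. lin I c dvd f j"
  using assms(3)
proof (induction J rule: infinite_finite_induct)
  case (insert j J)
  then show ?case using prime_lin_nz[OF assms(1,2)] by auto
qed (use lin_not_dvd_1[OF assms(1,2)] in auto)

text \<open>Independent forms are primes none of which divides another, so they can be split off
  from \<open>p\<close> one at a time.\<close>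

lemma prod_lin_dvd:
  assumes "finite I" "finite J"
    and "\<And>j. j \<in> J \<Longrightarrow> nz_on I (c j)"
    and "\<And>j k. j \<in> J \<Longrightarrow> k \<in> J \<Longrightarrow> j \<noteq> k \<Longrightarrow> \<not> lindep I (c j) (c k)"
    and "\<And>j. j \<in> J \<Longrightarrow> lin I (c j) dvd p"
  shows "(\<Prod>j\<in>J. lin I (c j)) dvd p"
  using assms(2-)
proof (induction J rule: finite_induct)
  case (insert k J)
  then obtain q where q: "p = (\<Prod>j\<in>J. lin I (c j)) * q"
    by (metis dvd_def insertI2)
  have "\<not> lin I (c k) dvd (\<Prod>j\<in>J. lin I (c j))"
  proof
    assume "lin I (c k) dvd (\<Prod>j\<in>J. lin I (c j))"
    then obtain j where j: "j \<in> J" "lin I (c k) dvd lin I (c j)"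
      using lin_dvd_prodD[OF assms(1)] insert.prems(1) by blast
    then have "lindep I (c k) (c j)"
      using lin_dvd_linD[OF assms(1)] insert.prems(1) by blast
    then show False using insert.prems(2) insert.hyps j by blast
  qed
  then have "lin I (c k) dvd q"
    using prime_lin_nz[OF assms(1)] insert.prems(1)[of k] insert.prems(3)[of k] q by auto
  then show ?case
    using q insert.hyps by (simp add: mult_dvd_mono mult.commute)
qed simp

lemma in_plane_trans:
  assumes "in_plane I c d e" "in_plane I c e f"
  shows "in_plane I c d f"
proof -
  obtain x y where e: "\<And>i. i \<in> I \<Longrightarrow> e i = x * c i + y * d i"
    using assms(1) unfolding in_plane_def by blast
  obtain z w where f: "\<And>i. i \<in> I \<Longrightarrow> f i = z * c i + w * e i"
    using assms(2) unfolding in_plane_def by blast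
  have "\<forall>i\<in>I. f i = (z + w * x) * c i + (w * y) * d i"
    by (simp add: f e algebra_simps)
  then show ?thesis unfolding in_plane_def by (intro exI)
qed

text \<open>In the ring modulo \<open>lin I c\<close>, again a polynomial ring, the forms
  \<open>d a\<close> are primes that do not divide \<open>B\<close>; so a common multiple of their
  product and of \<open>B\<close> is a multiple of both together.\<close>

lemma in_ideal2_prod_combine:
  assumes "finite I" "finite K" "nz_on I c"
    and indep: "\<And>a. a \<in> K \<Longrightarrow> \<not> lindep I c (d a)"
    and B: "\<And>a. a \<in> K \<Longrightarrow> \<not> in_ideal2 (lin I c) (lin I (d a)) B"
    and "in_ideal2 (lin I c) (\<Prod>a\<in>K. lin I (d a)) f" "in_ideal2 (lin I c) B f"
  shows "in_ideal2 (lin I c) ((\<Prod>a\<in>K. lin I (d a)) * B) f"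
  using assms(2,4-6)
proof (induction K rule: finite_induct)
  case empty
  then show ?case using assms(7) by simp
next
  case (insert a K)
  define A where "A = (\<Prod>a\<in>K. lin I (d a))"
  obtain w z where f1: "f = lin I c * w + (lin I (d a) * A) * z"
    using insert.prems(3) insert.hyps unfolding in_ideal2_def A_def by auto
  have "f = lin I c * w + A * (lin I (d a) * z)"
    using f1 by (simp add: mult_ac)
  then have "in_ideal2 (lin I c) A f" unfolding in_ideal2_def by (intro exI)
  then have "in_ideal2 (lin I c) (A * B) f"
    using insert.IH insert.prems unfolding A_def by blast
  then obtain v u where f2: "f = lin I c * v + A * B * u"
    unfolding in_ideal2_def by blast
  \<comment> \<open>Both expressions for \<open>f\<close> contain the factor \<open>A\<close>, which
    the prime \<open>lin I c\<close> does not divide. After cancelling it,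
    \<open>lin I (d a)\<close> divides \<open>B * u\<close>, hence \<open>u\<close>, modulo
    \<open>lin I c\<close>.\<close>
  have "A * (B * u - lin I (d a) * z) = lin I c * (w - v)"
    using f1 f2 by (simp add: algebra_simps)
  then have "lin I c dvd A * (B * u - lin I (d a) * z)" by simp
  moreover have "\<not> lin I c dvd A"
  proof
    assume "lin I c dvd A"
    then obtain j where "j \<in> K" "lin I c dvd lin I (d j)"
      using lin_dvd_prodD[OF assms(1,3)] unfolding A_def by blast
    then show False using lin_dvd_linD[OF assms(1,3)] insert.prems(1) by blast
  qed
  ultimately have "lin I c dvd B * u - lin I (d a) * z"
    using prime_lin_nz[OF assms(1,3)] by blast
  then obtain y where "B * u - lin I (d a) * z = lin I c * y" by auto
  then have "B * u = lin I c * y + lin I (d a) * z" by (simp add: algebra_simps)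
  then have "in_ideal2 (lin I c) (lin I (d a)) (B * u)" unfolding in_ideal2_def by (intro exI)
  moreover have "\<exists>j\<in>I. c j \<noteq> 0" using assms(3) unfolding nz_on_def .
  ultimately have "in_ideal2 (lin I c) (lin I (d a)) u"
    using prime_ideal2[OF assms(1)] insert.prems(1,2) by blast
  then obtain s t where "u = lin I c * s + lin I (d a) * t" unfolding in_ideal2_def by blast
  then have "f = lin I c * (v + A * B * s) + (lin I (d a) * A * B) * t"
    using f2 by (simp add: algebra_simps)
  then have "in_ideal2 (lin I c) (lin I (d a) * A * B) f" unfolding in_ideal2_def by (intro exI)
  then show ?case using insert.hyps by (simp add: A_def)
qed

text \<open>By unique factorisation in the polynomial ring modulo \<open>lin I (c n)\<close>, the obstruction to
  solving the congruence at \<open>n\<close> splits into contributions of the planes through \<open>c n\<close>.\<close>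

lemma extension_criterion:
  assumes "finite I" "finite J"
    and nz: "\<And>j. j \<in> J \<Longrightarrow> nz_on I (c j)"
    and indep: "\<And>j k. j \<in> J \<Longrightarrow> k \<in> J \<Longrightarrow> j \<noteq> k \<Longrightarrow> \<not> lindep I (c j) (c k)"
    and planes: "\<And>n k. n \<in> J \<Longrightarrow> k \<in> J \<Longrightarrow> n \<noteq> k \<Longrightarrow>
      \<exists>g. \<forall>j\<in>J. in_plane I (c n) (c k) (c j) \<longrightarrow> lin I (c j) dvd g - f j"
  shows "\<exists>g. \<forall>j\<in>J. lin I (c j) dvd g - f j"
  using assms(2-)
proof (induction J rule: finite_induct)
  case (insert n J)
  have "\<exists>g. \<forall>j\<in>J. lin I (c j) dvd g - f j"
  proof (rule insert.IH)
    fix m k assume "m \<in> J" "k \<in> J" "m \<noteq> k"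
    then show "\<exists>g. \<forall>j\<in>J. in_plane I (c m) (c k) (c j) \<longrightarrow> lin I (c j) dvd g - f j"
      using insert.prems(3)[of m k] by blast
  qed (use insert.prems in auto)
  then obtain g where g: "\<And>j. j \<in> J \<Longrightarrow> lin I (c j) dvd g - f j" by blast
  have nzn: "nz_on I (c n)" using insert.prems(1) by simp
  have indn: "\<not> lindep I (c n) (c j)" if "j \<in> J" for j
    using insert.prems(2)[of n j] insert.hyps that by auto
  \<comment> \<open>The obstruction \<open>f n - g\<close> has to vanish modulo \<open>c n\<close>
    and the product of all other labels; the product is built up by splitting off one plane at a
    time.\<close>
  have D: "in_ideal2 (lin I (c n)) (\<Prod>j\<in>K. lin I (c j)) (f n - g)" if "finite K" "K \<subseteq> J" for K
    using that
  proof (induction "card K" arbitrary: K rule: less_induct)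
    case less
    show ?case
    proof (cases "K = {}")
      case True
      then show ?thesis unfolding in_ideal2_def by (intro exI[of _ 0] exI[of _ "f n - g"]) simp
    next
      case False
      then obtain k where k: "k \<in> K" by blast
      \<comment> \<open>All labels of \<open>K\<close> in the plane of \<open>c n\<close> and
        \<open>c k\<close>. The hypothesis for this plane provides \<open>h\<close>, and
        \<open>h - g\<close> is divisible by every label in \<open>K1\<close>.\<close>
      define K1 where "K1 = {j\<in>K. in_plane I (c n) (c k) (c j)}"
      have kK1: "k \<in> K1"
      proof -
        have "\<forall>i\<in>I. c k i = 0 * c n i + 1 * c k i" by simp
        then have "in_plane I (c n) (c k) (c k)" unfolding in_plane_def by (intro exI)
        then show ?thesis using k by (simp add: K1_def)
      qed
      have K1: "finite K1" "K1 \<subseteq> J" using less.prems by (auto simp: K1_def)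
      have "card (K - K1) < card K"
        using kK1 k less.prems by (intro psubset_card_mono) auto
      then have IH: "in_ideal2 (lin I (c n)) (\<Prod>j\<in>K - K1. lin I (c j)) (f n - g)"
        using less.hyps less.prems by blast
      obtain h where h: "\<And>j. j \<in> insert n J \<Longrightarrow> in_plane I (c n) (c k) (c j) \<Longrightarrow> lin I (c j) dvd h - f j"
        using insert.prems(3)[of n k] k less.prems insert.hyps by blast
      have "\<forall>i\<in>I. c n i = 1 * c n i + 0 * c k i" by simp
      then have "in_plane I (c n) (c k) (c n)" unfolding in_plane_def by (intro exI)
      then have hn: "lin I (c n) dvd h - f n" using h by blast
      have "(\<Prod>j\<in>K1. lin I (c j)) dvd h - g"
      proof (rule prod_lin_dvd[OF assms(1) K1(1)])
        fix j assume "j \<in> K1"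
        then have "lin I (c j) dvd h - f j" "lin I (c j) dvd g - f j"
          using h g K1(2) by (auto simp: K1_def)
        then have "lin I (c j) dvd (h - f j) - (g - f j)" by (rule dvd_diff)
        then show "lin I (c j) dvd h - g" by simp
      next
        show "\<not> lindep I (c j) (c k)" if "j \<in> K1" "k \<in> K1" "j \<noteq> k" for j k
          using insert.prems(2)[of j k] that K1(2) by auto
      qed (use insert.prems(1) K1 in auto)
      with hn obtain u v where "h - f n = lin I (c n) * u" "h - g = (\<Prod>j\<in>K1. lin I (c j)) * v"
        unfolding dvd_def by blast
      then have "f n - g = lin I (c n) * (- u) + (\<Prod>j\<in>K1. lin I (c j)) * v"
        by (simp add: algebra_simps)
      then have D1: "in_ideal2 (lin I (c n)) (\<Prod>j\<in>K1. lin I (c j)) (f n - g)"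
        unfolding in_ideal2_def by (intro exI)
      have "in_ideal2 (lin I (c n)) ((\<Prod>j\<in>K1. lin I (c j)) * (\<Prod>j\<in>K - K1. lin I (c j))) (f n - g)"
      proof (rule in_ideal2_prod_combine[OF assms(1) K1(1) nzn _ _ D1 IH])
        fix a assume a: "a \<in> K1"
        then show "\<not> lindep I (c n) (c a)" using indn K1 by blast
        \<comment> \<open>A label of \<open>K1\<close> that divides the remaining product modulo
          \<open>c n\<close> would divide one of its factors, and that factor would lie in the same
          plane.\<close>
        show "\<not> in_ideal2 (lin I (c n)) (lin I (c a)) (\<Prod>j\<in>K - K1. lin I (c j))"
        proof
          assume *: "in_ideal2 (lin I (c n)) (lin I (c a)) (\<Prod>j\<in>K - K1. lin I (c j))"
          have ex: "\<exists>j\<in>I. c n j \<noteq> 0" using nzn unfolding nz_on_def .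
          have not1: "\<not> in_ideal2 (lin I (c n)) (lin I (c a)) 1"
          proof
            assume "in_ideal2 (lin I (c n)) (lin I (c a)) 1"
            then obtain u v where "1 = lin I (c n) * u + lin I (c a) * v" unfolding in_ideal2_def by blast
            \<comment> \<open>Setting all variables to zero kills both linear forms but not the
              constant \<open>1\<close>.\<close>
            then have "psubst (\<lambda>_. 0) (1 :: 'a qpoly) = psubst (\<lambda>_. 0) (lin I (c n) * u + lin I (c a) * v)"
              by simp
            then have "(1 :: 'a qpoly) = 0"
              by (simp add: psubst_add psubst_mult lin_def psubst_sum del: psubst_1) (simp add: psubst_1)
            then show False by simp
          qed
          have "\<exists>j\<in>L. in_ideal2 (lin I (c n)) (lin I (c a)) (lin I (c j))"
            if "finite L" "in_ideal2 (lin I (c n)) (lin I (c a)) (\<Prod>j\<in>L. lin I (c j))" for L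
            using that
          proof (induction L rule: finite_induct)
            case (insert l L)
            then show ?case
              using prime_ideal2[OF assms(1) ex \<open>\<not> lindep I (c n) (c a)\<close>] by auto
          qed (use not1 in auto)
          from this[OF _ *] obtain j where j: "j \<in> K - K1" "in_ideal2 (lin I (c n)) (lin I (c a)) (lin I (c j))"
            using less.prems by auto
          have "in_plane I (c n) (c a) (c j)"
            using in_ideal2_linD[OF assms(1) ex \<open>\<not> lindep I (c n) (c a)\<close> j(2)] unfolding in_plane_def .
          moreover have "in_plane I (c n) (c k) (c a)" using a by (simp add: K1_def)
          ultimately have "in_plane I (c n) (c k) (c j)" using in_plane_trans by blast
          then show False using j by (simp add: K1_def)
        qed
      qed
      moreover have "(\<Prod>j\<in>K1. lin I (c j)) * (\<Prod>j\<in>K - K1. lin I (c j)) = (\<Prod>j\<in>K. lin I (c j))"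
        using less.prems by (subst prod.subset_diff[of K1 K]) (auto simp: K1_def mult.commute)
      ultimately show ?thesis by simp
    qed
  qed
  obtain u v where uv: "f n - g = lin I (c n) * u + (\<Prod>j\<in>J. lin I (c j)) * v"
    using D[OF insert.hyps(1) subset_refl] unfolding in_ideal2_def by blast
  show ?case
  \<comment> \<open>The correction is a multiple of all labels in \<open>J\<close>, so it disturbs
    no earlier congruence.\<close>
  proof (intro exI[of _ "g + (\<Prod>j\<in>J. lin I (c j)) * v"] ballI)
    fix j assume "j \<in> insert n J"
    then consider "j = n" | "j \<in> J" by blast
    then show "lin I (c j) dvd g + (\<Prod>j\<in>J. lin I (c j)) * v - f j"
    proof cases
      case 1
      have "g + (\<Prod>j\<in>J. lin I (c j)) * v - f n = lin I (c n) * (- u)"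
        using uv by (simp add: algebra_simps)
      then show ?thesis using 1 by simp
    next
      case 2
      have "lin I (c j) dvd (\<Prod>j\<in>J. lin I (c j)) * v"
        using 2 insert.hyps by (intro dvd_mult2 dvd_prodI) auto
      then have "lin I (c j) dvd (g - f j) + (\<Prod>j\<in>J. lin I (c j)) * v"
        using g[OF 2] by (rule dvd_add[rotated])
      then show ?thesis by (simp add: algebra_simps)
    qed
  qed
qed simp

lemma congruence_pair:
  assumes "in_ideal2 a b (p - q)"
  shows "\<exists>g. a dvd g - p \<and> b dvd g - q"
proof -
  obtain u v where "p - q = a * u + b * v" using assms unfolding in_ideal2_def by blast
  then have "p - a * u - p = a * (- u)" "p - a * u - q = b * v" by (auto simp: algebra_simps)
  then show ?thesis by (metis dvd_triv_left)
qed

text \<open>The six points are the vertices of the moment graph of the flag variety of \<open>SL\<^sub>3\<close> except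
  for the top one, with the three reflections in \<open>a\<close>, \<open>b\<close> and \<open>a + b\<close>.\<close>

lemma hexagon_extension:
  assumes "finite I" "nz_on I c" "nz_on I (\<lambda>j. c j + d j)"
    and nd: "\<not> lindep I (\<lambda>j. c j + d j) c" "\<not> lindep I (\<lambda>j. c j + d j) d"
    and a: "a = lin I c" and b: "b = lin I d"
    and 1: "b dvd f12 - fA" "a + b dvd f12 - fB"
    and 2: "a dvd f23 - fB" "a + b dvd f23 - fA"
    and 3: "a dvd fA - f13" "b dvd fB - f13"
  shows "\<exists>g. a dvd g - f12 \<and> b dvd g - f23 \<and> a + b dvd g - f13"
proof -
  let ?s = "a + b"
  have s: "?s = lin I (\<lambda>j. c j + d j)" by (simp add: a b lin_add)
  have prime: "?s dvd p" if "?s dvd lin I e * p" "\<not> lindep I (\<lambda>j. c j + d j) e" for e p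
    using prime_lin_nz[OF assms(1,3), of "lin I e" p] lin_dvd_linD[OF assms(1,3), of e] that
    unfolding s by blast
  obtain p where p: "fA - f13 = a * p" using 3 by auto
  obtain q where q: "fB - f13 = b * q" using 3 by auto
  obtain r where r: "f12 - fA = b * r" using 1 by auto
  obtain t where t: "f23 - fB = a * t" using 2 by auto
  \<comment> \<open>Around the square \<open>f12\<close>, \<open>fA\<close>, \<open>f13\<close>,
    \<open>fB\<close> the differences add up to zero; since \<open>a\<close> equals
    \<open>- b\<close> modulo \<open>a + b\<close>, this gives \<open>r = p + q\<close> modulo
    \<open>a + b\<close>.\<close>
  have "f12 - fB = (f12 - fA) + (fA - f13) - (fB - f13)" by simp
  also have "\<dots> = b * (r - p - q) + ?s * p"
    unfolding p q r by (simp add: algebra_simps)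
  finally have "?s dvd b * (r - p - q) + ?s * p" using 1 by simp
  then have "?s dvd b * (r - p - q)" by (simp add: dvd_add_left_iff)
  then have "?s dvd r - p - q" using prime nd(2) unfolding b by blast
  then obtain h where "r - p - q = ?s * h" by auto
  then have h: "r = p + q + ?s * h" by (simp add: algebra_simps)
  have "f23 - fA = (f23 - fB) + (fB - f13) - (fA - f13)" by simp
  also have "\<dots> = a * (t - p - q) + ?s * q"
    unfolding p q t by (simp add: algebra_simps)
  finally have "?s dvd a * (t - p - q) + ?s * q" using 2 by simp
  then have "?s dvd a * (t - p - q)" by (simp add: dvd_add_left_iff)
  then have "?s dvd t - p - q" using prime nd(1) unfolding a by blast
  then obtain k where "t - p - q = ?s * k" by auto
  then have k: "t = p + q + ?s * k" by (simp add: algebra_simps)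
  \<comment> \<open>The correction is a multiple of \<open>a + b\<close> that agrees with
    \<open>f12 - f13\<close> modulo \<open>a\<close>, where \<open>a + b\<close> is
    \<open>b\<close>, and with \<open>f23 - f13\<close> modulo \<open>b\<close>, where
    \<open>a + b\<close> is \<open>a\<close>.\<close>
  define g where "g = f13 + ?s * (p + q + b * h + a * k)"
  have "g - f12 = (g - f13) - ((f12 - fA) + (fA - f13))" by simp
  also have "\<dots> = a * (q + ?s * k)"
    unfolding p r h g_def by (simp add: algebra_simps)
  finally have g1: "a dvd g - f12" by simp
  have "g - f23 = (g - f13) - ((f23 - fB) + (fB - f13))" by simp
  also have "\<dots> = b * (p + ?s * h)"
    unfolding q t k g_def by (simp add: algebra_simps)
  finally have g2: "b dvd g - f23" by simp
  have "?s dvd g - f13" by (simp add: g_def)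
  then show ?thesis using g1 g2 by blast
qed

text \<open>Both products are values of the polynomial with roots \<open>e j\<close>, and values of
  a polynomial at \<open>x\<close> and \<open>y\<close> differ by a multiple of
  \<open>x - y\<close>.\<close>

lemma dvd_prod_shift_diff:
  fixes x y :: "'r::comm_ring_1"
  shows "x - y dvd (\<Prod>j\<in>J. x - e j) - (\<Prod>j\<in>J. y - e j)"
proof (induction J rule: infinite_finite_induct)
  case (insert j J)
  have "(x - e j) * X - (y - e j) * Y = (x - y) * X + (y - e j) * (X - Y)" for X Y
    by (simp add: algebra_simps)
  then show ?case using insert by auto
qed auto

section \<open>Newton interpolation for a pencil of labels\<close>

lemma pconst_of_int: "(pconst (of_int k) :: 'i qpoly) = of_int k"
  by (simp add: single_of_int)

lemma of_int_qpoly_unit: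
  assumes "k \<noteq> 0"
  shows "pconst (1 / of_int k) * of_int k = (1 :: 'i qpoly)"
proof -
  have "pconst (1 / of_int k) * pconst (of_int k) = (1 :: 'i qpoly)"
    using assms by (simp add: mult_single del: single_of_int)
  then show ?thesis by (simp only: pconst_of_int)
qed

text \<open>A bipartite graph with the integers on both sides, in which \<open>a\<close> and
  \<open>b\<close> are joined by an edge with label \<open>lab (a + b)\<close>. The values
  \<open>va\<close> and \<open>vb\<close> form a class of degree one on it, and within one side two
  values differ by an integer multiple of \<open>lin I d\<close>.\<close>

locale bipartite_labels =
  fixes I :: "'i set" and c d :: "'i \<Rightarrow> rat"
  assumes finite_I: "finite I" and nz_d: "nz_on I d" and ndep: "\<not> lindep I d c"
begin

definition lab :: "int \<Rightarrow> 'i qpoly" where "lab k = lin I (\<lambda>i. c i - of_int k * d i)"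
definition va :: "int \<Rightarrow> 'i qpoly" where "va k = of_int k * lin I d"
definition vb :: "int \<Rightarrow> 'i qpoly" where "vb k = lin I c - of_int k * lin I d"

lemma lab_eq: "lab k = lin I c - of_int k * lin I d"
  by (simp add: lab_def lin_diff lin_scale)

lemma vb_minus_va: "vb b - va a = lab (a + b)"
  by (simp add: lab_eq va_def vb_def algebra_simps)

lemma nz_lab: "nz_on I (\<lambda>i. c i - of_int k * d i)"
proof -
  obtain i where "i \<in> I" "c i - of_int k * d i \<noteq> 0" by (rule not_lindepE[OF ndep])
  then show ?thesis unfolding nz_on_def by blast
qed

lemma indep_lab:
  assumes "k \<noteq> l"
  shows "\<not> lindep I (\<lambda>i. c i - of_int k * d i) (\<lambda>i. c i - of_int l * d i)"
proof
  assume "lindep I (\<lambda>i. c i - of_int k * d i) (\<lambda>i. c i - of_int l * d i)"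
  then obtain x where x: "\<And>i. i \<in> I \<Longrightarrow> c i - of_int l * d i = x * (c i - of_int k * d i)"
    unfolding lindep_def by blast
  show False
  proof (cases "x = 1")
    case True
    obtain i where "i \<in> I" "d i \<noteq> 0" using nz_d unfolding nz_on_def by blast
    have "(of_int l - of_int k) * q = 0" if "p - of_int l * q = 1 * (p - of_int k * q)" for p q :: rat
      using that by (auto simp: algebra_simps)
    from this[OF x[OF \<open>i \<in> I\<close>, unfolded True]] have "(of_int l - of_int k) * d i = 0" .
    then show False using \<open>d i \<noteq> 0\<close> assms by simp
  next
    case False
    have *: "p = (of_int l - x * of_int k) / (1 - x) * q"
      if "p - of_int l * q = x * (p - of_int k * q)" for p q :: rat
    proof -
      have "p * (1 - x) = (of_int l - x * of_int k) * q" using that by (simp add: algebra_simps)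
      then show ?thesis using False by (simp add: eq_divide_eq)
    qed
    have "\<forall>i\<in>I. c i = (of_int l - x * of_int k) / (1 - x) * d i"
      using *[OF x] by (rule ballI)
    then have "lindep I d c" unfolding lindep_def by (rule exI)
    then show False using ndep by contradiction
  qed
qed

text \<open>The prime \<open>lab k\<close> does not divide \<open>lin I d\<close>, since that would
  make \<open>c\<close> a multiple of \<open>d\<close>; so powers of \<open>lin I d\<close> can be
  cancelled.\<close>

lemma lab_cancel:
  assumes "lab k dvd lin I d ^ n * p"
  shows "lab k dvd p"
  using assms
proof (induction n)
  case (Suc n)
  then have "lab k dvd lin I d * (lin I d ^ n * p)" by (simp add: mult_ac)
  moreover have "\<not> lab k dvd lin I d"
  proof
    assume "lab k dvd lin I d"
    then have "lindep I (\<lambda>i. c i - of_int k * d i) d"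
      unfolding lab_def using lin_dvd_linD[OF finite_I nz_lab] by blast
    then obtain x where x: "\<And>i. i \<in> I \<Longrightarrow> d i = x * (c i - of_int k * d i)"
      unfolding lindep_def by blast
    obtain j where "j \<in> I" "d j \<noteq> 0" using nz_d unfolding nz_on_def by blast
    then have "x \<noteq> 0" using x[of j] by (metis mult_zero_left)
    have "c i = (1 / x + of_int k) * d i" if "i \<in> I" for i
    proof -
      have "c i - of_int k * d i = 1 / x * d i"
        using x[OF that] \<open>x \<noteq> 0\<close> by (simp add: field_simps)
      then show ?thesis by (simp add: algebra_simps)
    qed
    then have "lindep I d c" unfolding lindep_def by (intro exI ballI)
    then show False using ndep by contradiction
  qed
  ultimately have "lab k dvd lin I d ^ n * p"
    using prime_lin_nz[OF finite_I nz_lab] unfolding lab_def by blast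
  then show ?case by (rule Suc.IH)
qed simp

lemma prod_lab_dvd:
  assumes "finite J" "inj_on k J" "\<And>j. j \<in> J \<Longrightarrow> lab (k j) dvd p"
  shows "(\<Prod>j\<in>J. lab (k j)) dvd p"
  unfolding lab_def
proof (rule prod_lin_dvd[OF finite_I assms(1) nz_lab])
  fix j l assume "j \<in> J" "l \<in> J" "j \<noteq> l"
  then have "k j \<noteq> k l" using assms(2) by (auto dest: inj_onD)
  then show "\<not> lindep I (\<lambda>i. c i - of_int (k j) * d i) (\<lambda>i. c i - of_int (k l) * d i)"
    by (rule indep_lab)
qed (use assms(3) in \<open>simp add: lab_def\<close>)

text \<open>A Newton basis: in terms of the degree one class \<open>v\<close> with values \<open>va\<close> and \<open>vb\<close>, this is
  the product of the differences of \<open>v\<close> to \<open>p\<close> points of one side and \<open>q\<close> points of the other side,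
  divided by \<open>lin I d ^ q\<close>.\<close>

definition newton_a :: "(nat \<Rightarrow> int) \<Rightarrow> (nat \<Rightarrow> int) \<Rightarrow> nat \<Rightarrow> nat \<Rightarrow> int \<Rightarrow> 'i qpoly" where
  "newton_a \<beta> \<alpha> p q k = (\<Prod>j<p. va k - vb (\<beta> j)) * (\<Prod>j<q. of_int (k - \<alpha> j))"

definition newton_b :: "(nat \<Rightarrow> int) \<Rightarrow> (nat \<Rightarrow> int) \<Rightarrow> nat \<Rightarrow> nat \<Rightarrow> int \<Rightarrow> 'i qpoly" where
  "newton_b \<beta> \<alpha> p q k = lin I d ^ (p - q) * ((\<Prod>j<p. of_int (\<beta> j - k)) * (\<Prod>j<q. vb k - va (\<alpha> j)))"

text \<open>After multiplication by \<open>lin I d ^ q\<close> both terms are values of one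
  polynomial, at \<open>va a\<close> and at \<open>vb b\<close>, and these two points differ by the
  label up to sign. The power of \<open>lin I d\<close> is then cancelled. For
  \<open>q \<le> p\<close> the exponent \<open>p - q\<close> in \<open>newton_b\<close> is a true
  difference.\<close>

lemma newton_class:
  assumes "q \<le> p"
  shows "lab (a + b) dvd newton_a \<beta> \<alpha> p q a - newton_b \<beta> \<alpha> p q b"
proof (rule lab_cancel)
  let ?P = "\<lambda>v. \<Prod>x\<in>{..<p} <+> {..<q}. v - (case x of Inl j \<Rightarrow> vb (\<beta> j) | Inr j \<Rightarrow> va (\<alpha> j))"
  have split: "?P v = (\<Prod>j<p. v - vb (\<beta> j)) * (\<Prod>j<q. v - va (\<alpha> j))" for v
    by (simp add: prod.Plus)
  have "lin I d ^ q * newton_a \<beta> \<alpha> p q a = ?P (va a)"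
    unfolding split newton_a_def by (simp add: va_def prod.distrib left_diff_distrib[symmetric])
  moreover have "lin I d ^ q * newton_b \<beta> \<alpha> p q b = ?P (vb b)"
  proof -
    have "lin I d ^ q * lin I d ^ (p - q) = lin I d ^ p"
      using assms by (simp flip: power_add)
    moreover have "(\<Prod>j<p. vb b - vb (\<beta> j)) = lin I d ^ p * (\<Prod>j<p. of_int (\<beta> j - b))"
    proof -
      have "vb b - vb (\<beta> j) = lin I d * of_int (\<beta> j - b)" for j
        by (simp add: vb_def algebra_simps)
      then show ?thesis by (simp add: prod.distrib)
    qed
    ultimately show ?thesis unfolding split newton_b_def by (simp only: mult.assoc[symmetric])
  qed
  moreover have "lab (a + b) dvd ?P (va a) - ?P (vb b)"
  proof -
    have "lab (a + b) = - (va a - vb b)" by (simp flip: vb_minus_va)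
    then show ?thesis by (simp only: minus_dvd_iff dvd_prod_shift_diff)
  qed
  ultimately show "lab (a + b) dvd lin I d ^ q * (newton_a \<beta> \<alpha> p q a - newton_b \<beta> \<alpha> p q b)"
    by (simp add: right_diff_distrib)
qed

text \<open>The value at the missing point \<open>a = 0\<close> is read off from a class on all
  integers that interpolates the given values. Points are added alternately, \<open>b = 0\<close>,
  \<open>a = n - 1\<close>, \<open>b = 1\<close>, \<open>a = n - 2\<close> and so on: then the value
  of the next Newton class at the new point is a non-zero number times the product of the labels to
  the points already used, without a power of \<open>lin I d\<close>.\<close>

lemma bipartite_extension:
  fixes fa fb :: "int \<Rightarrow> 'i qpoly" and n :: nat
  assumes cong: "\<And>a b. 1 \<le> a \<Longrightarrow> a < int n \<Longrightarrow> 0 \<le> b \<Longrightarrow> b < int n \<Longrightarrow> lab (a + b) dvd fa a - fb b"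
  shows "\<exists>g. \<forall>b. 0 \<le> b \<longrightarrow> b < int n \<longrightarrow> lab b dvd g - fb b"
proof (cases "n = 0")
  case False
  define \<alpha> where "\<alpha> = (\<lambda>j::nat. int n - 1 - int j)"
  define good where "good = (\<lambda>p q (ga :: int \<Rightarrow> 'i qpoly) (gb :: int \<Rightarrow> 'i qpoly).
    (\<forall>a b. lab (a + b) dvd ga a - gb b) \<and> (\<forall>j<q. ga (\<alpha> j) = fa (\<alpha> j)) \<and> (\<forall>j<p. gb (int j) = fb (int j)))"
  have add_class: "\<forall>a b. lab (a + b) dvd (ga a + h * newton_a int \<alpha> p q a) - (gb b + h * newton_b int \<alpha> p q b)"
    if "\<forall>a b. lab (a + b) dvd ga a - gb b" "q \<le> p" for ga gb h p q
  proof (intro allI)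
    fix a b
    have "lab (a + b) dvd (ga a - gb b) + h * (newton_a int \<alpha> p q a - newton_b int \<alpha> p q b)"
      using that newton_class[OF that(2)] by (intro dvd_add dvd_mult) auto
    then show "lab (a + b) dvd (ga a + h * newton_a int \<alpha> p q a) - (gb b + h * newton_b int \<alpha> p q b)"
      by (simp add: algebra_simps)
  qed
  have stepb: "\<exists>ga gb. good (Suc q) q ga gb" if "good q q ga gb" "q < n" for q ga gb
  proof -
    \<comment> \<open>The error at the new point is divisible by the labels to all points of the
      other side where class and data already agree.\<close>
    have "lab (\<alpha> j + int q) dvd fb (int q) - gb (int q)" if "j < q" for j
    proof -
      have "lab (\<alpha> j + int q) dvd fa (\<alpha> j) - gb (int q)"
        using \<open>good q q ga gb\<close> that unfolding good_def by metis
      moreover have "lab (\<alpha> j + int q) dvd fa (\<alpha> j) - fb (int q)"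
        using that \<open>q < n\<close> by (intro cong) (auto simp: \<alpha>_def)
      ultimately have "lab (\<alpha> j + int q) dvd (fa (\<alpha> j) - gb (int q)) - (fa (\<alpha> j) - fb (int q))"
        by (rule dvd_diff)
      then show ?thesis by simp
    qed
    then have "(\<Prod>j<q. lab (\<alpha> j + int q)) dvd fb (int q) - gb (int q)"
      by (intro prod_lab_dvd) (auto simp: inj_on_def \<alpha>_def)
    then obtain h where h: "fb (int q) - gb (int q) = (\<Prod>j<q. lab (\<alpha> j + int q)) * h" by auto
    \<comment> \<open>The numerical factor of the Newton class at the new point; it is non-zero,
      hence invertible over the rationals.\<close>
    define k where "k = (\<Prod>j<q. int j - int q)"
    have k: "k \<noteq> 0" by (simp add: k_def)
    define H where "H = pconst (1 / of_int k) * h"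
    have "newton_b int \<alpha> q q (int q) = of_int k * (\<Prod>j<q. lab (\<alpha> j + int q))"
      by (simp add: newton_b_def vb_minus_va k_def)
    then have "H * newton_b int \<alpha> q q (int q) = (pconst (1 / of_int k) * of_int k) * (h * (\<Prod>j<q. lab (\<alpha> j + int q)))"
      by (simp add: H_def mult_ac)
    then have H: "H * newton_b int \<alpha> q q (int q) = fb (int q) - gb (int q)"
      unfolding h of_int_qpoly_unit[OF k] by (simp only: mult_1 mult.commute)
    have "newton_a int \<alpha> q q (\<alpha> j) = 0" "newton_b int \<alpha> q q (int j) = 0" if "j < q" for j
    proof -
      have "(\<Prod>i<q. of_int (\<alpha> j - \<alpha> i)) = (0 :: 'i qpoly)" "(\<Prod>i<q. of_int (int i - int j)) = (0 :: 'i qpoly)"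
        using that by (intro prod_zero; auto)+
      then show "newton_a int \<alpha> q q (\<alpha> j) = 0" "newton_b int \<alpha> q q (int j) = 0"
        by (simp_all add: newton_a_def newton_b_def)
    qed
    then have "good (Suc q) q (\<lambda>a. ga a + H * newton_a int \<alpha> q q a) (\<lambda>b. gb b + H * newton_b int \<alpha> q q b)"
      using that(1) add_class[of ga gb q q H] H unfolding good_def by (auto simp: less_Suc_eq)
    then show ?thesis by blast
  qed
  have stepa: "\<exists>ga gb. good (Suc q) (Suc q) ga gb" if "good (Suc q) q ga gb" "Suc q < n" for q ga gb
  proof -
    have "lab (\<alpha> q + int j) dvd fa (\<alpha> q) - ga (\<alpha> q)" if "j < Suc q" for j
    proof -
      have "lab (\<alpha> q + int j) dvd ga (\<alpha> q) - fb (int j)"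
        using \<open>good (Suc q) q ga gb\<close> that unfolding good_def by metis
      moreover have *: "lab (\<alpha> q + int j) dvd fa (\<alpha> q) - fb (int j)"
        using that \<open>Suc q < n\<close> by (intro cong) (auto simp: \<alpha>_def)
      ultimately have "lab (\<alpha> q + int j) dvd (fa (\<alpha> q) - fb (int j)) - (ga (\<alpha> q) - fb (int j))"
        by (intro dvd_diff[OF *])
      then show ?thesis by simp
    qed
    then have "(\<Prod>j<Suc q. lab (\<alpha> q + int j)) dvd fa (\<alpha> q) - ga (\<alpha> q)"
      by (intro prod_lab_dvd) (auto simp: inj_on_def)
    then obtain h where h: "fa (\<alpha> q) - ga (\<alpha> q) = (\<Prod>j<Suc q. lab (\<alpha> q + int j)) * h" by auto
    \<comment> \<open>The sign collects the \<open>Suc q\<close> factors \<open>va x - vb y\<close>,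
      each of which is minus a label.\<close>
    define k where "k = (-1) ^ Suc q * (\<Prod>j<q. \<alpha> q - \<alpha> j)"
    have k: "k \<noteq> 0" by (auto simp: k_def \<alpha>_def)
    define H where "H = pconst (1 / of_int k) * h"
    have neg: "va x - vb y = - 1 * lab (x + y)" for x y
      by (simp flip: vb_minus_va)
    have "newton_a int \<alpha> (Suc q) q (\<alpha> q) = of_int k * (\<Prod>j<Suc q. lab (\<alpha> q + int j))"
      unfolding newton_a_def neg k_def prod.distrib by (simp add: mult_ac)
    then have "H * newton_a int \<alpha> (Suc q) q (\<alpha> q) =
        (pconst (1 / of_int k) * of_int k) * (h * (\<Prod>j<Suc q. lab (\<alpha> q + int j)))"
      by (simp add: H_def mult_ac)
    then have H: "H * newton_a int \<alpha> (Suc q) q (\<alpha> q) = fa (\<alpha> q) - ga (\<alpha> q)"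
      unfolding h of_int_qpoly_unit[OF k] by (simp only: mult_1 mult.commute)
    have "newton_a int \<alpha> (Suc q) q (\<alpha> j) = 0" if "j < q" for j
    proof -
      have "(\<Prod>i<q. of_int (\<alpha> j - \<alpha> i)) = (0 :: 'i qpoly)" using that by (intro prod_zero) auto
      then show ?thesis by (simp add: newton_a_def)
    qed
    moreover have "newton_b int \<alpha> (Suc q) q (int j) = 0" if "j < Suc q" for j
    proof -
      have "(\<Prod>i<Suc q. of_int (int i - int j)) = (0 :: 'i qpoly)"
        using that by (intro prod_zero) auto
      then show ?thesis by (simp add: newton_b_def)
    qed
    ultimately have "good (Suc q) (Suc q) (\<lambda>a. ga a + H * newton_a int \<alpha> (Suc q) q a) (\<lambda>b. gb b + H * newton_b int \<alpha> (Suc q) q b)"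
      using that(1) add_class[of ga gb q "Suc q" H] H unfolding good_def by (auto simp: less_Suc_eq)
    then show ?thesis by blast
  qed
  have "\<exists>ga gb. good (Suc q) q ga gb" if "q < n" for q
    using that
  proof (induction q)
    case 0
    have "good 0 0 (\<lambda>_. 0) (\<lambda>_. 0)" by (simp add: good_def)
    then show ?case using stepb 0 by blast
  next
    case (Suc q)
    then obtain ga gb where "good (Suc q) q ga gb" by auto
    then obtain ga gb where "good (Suc q) (Suc q) ga gb" using stepa Suc.prems by blast
    then show ?case using stepb Suc.prems by blast
  qed
  \<comment> \<open>All \<open>n\<close> points \<open>b\<close> and the \<open>n - 1\<close> points
    \<open>a \<ge> 1\<close> are matched; the point \<open>a = 0\<close> that is left has the labels
    \<open>lab b\<close>.\<close>
  from this[of "n - 1"] obtain ga gb where g: "good n (n - 1) ga gb" using False by auto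
  show ?thesis
  proof (intro exI[of _ "ga 0"] allI impI)
    fix b assume "0 \<le> b" "b < int n"
    then have "gb b = fb b" using g unfolding good_def by (metis nat_0_le nat_less_iff)
    moreover have "lab (0 + b) dvd ga 0 - gb b" using g unfolding good_def by blast
    ultimately show "lab b dvd ga 0 - fb b" by simp
  qed
qed auto

end

section \<open>The coefficient ring and homogeneous parts\<close>

lemma poly_ring_0 [simp]: "0 \<in> poly_ring I"
  by (simp add: poly_ring_def)

lemma poly_ring_add: "p \<in> poly_ring I \<Longrightarrow> q \<in> poly_ring I \<Longrightarrow> p + q \<in> poly_ring I"
  using Poly_Mapping.keys_add[of p q] by (auto simp: poly_ring_def)

lemma poly_ring_uminus: "p \<in> poly_ring I \<Longrightarrow> - p \<in> poly_ring I"
  by (auto simp: poly_ring_def in_keys_iff)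

lemma poly_ring_diff: "p \<in> poly_ring I \<Longrightarrow> q \<in> poly_ring I \<Longrightarrow> p - q \<in> poly_ring I"
  using poly_ring_add[of p I "- q"] poly_ring_uminus by force

lemma keys_plus_nat: "Poly_Mapping.keys (m + n :: 'i \<Rightarrow>\<^sub>0 nat) = Poly_Mapping.keys m \<union> Poly_Mapping.keys n"
  by (auto simp: in_keys_iff lookup_add)

lemma poly_ring_mult: "p \<in> poly_ring I \<Longrightarrow> q \<in> poly_ring I \<Longrightarrow> p * q \<in> poly_ring I"
  using Poly_Mapping.keys_mult[of p q] by (fastforce simp: poly_ring_def keys_plus_nat)

lemma poly_ring_pconst [simp]: "pconst c \<in> poly_ring I"
  by (simp add: poly_ring_def)

lemma poly_ring_1 [simp]: "1 \<in> poly_ring I"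
  using poly_ring_pconst[of 1] by simp

lemma poly_ring_pvar: "j \<in> I \<Longrightarrow> pvar j \<in> poly_ring I"
  by (simp add: poly_ring_def pvar_def)

lemma poly_ring_sum: "(\<And>x. x \<in> A \<Longrightarrow> f x \<in> poly_ring I) \<Longrightarrow> sum f A \<in> poly_ring I"
  by (induction A rule: infinite_finite_induct) (auto intro: poly_ring_add)

lemma poly_ring_prod: "(\<And>x. x \<in> A \<Longrightarrow> f x \<in> poly_ring I) \<Longrightarrow> prod f A \<in> poly_ring I"
  by (induction A rule: infinite_finite_induct) (auto intro: poly_ring_mult)

lemma poly_ring_power: "p \<in> poly_ring I \<Longrightarrow> p ^ n \<in> poly_ring I"
  by (induction n) (auto intro: poly_ring_mult)

lemma poly_ring_lin: "lin I c \<in> poly_ring I"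
  unfolding lin_def by (intro poly_ring_sum poly_ring_mult poly_ring_pconst poly_ring_pvar)

definition restrict_vars :: "'i set \<Rightarrow> 'i qpoly \<Rightarrow> 'i qpoly" where
  "restrict_vars I = psubst (\<lambda>j. if j \<in> I then pvar j else 0)"

lemma restrict_vars_in: "restrict_vars I p \<in> poly_ring I"
  unfolding restrict_vars_def psubst_def pmono_def
  by (intro poly_ring_sum poly_ring_mult poly_ring_pconst poly_ring_prod poly_ring_power)
     (simp add: poly_ring_pvar)

lemma restrict_vars_id: "p \<in> poly_ring I \<Longrightarrow> restrict_vars I p = p"
  unfolding restrict_vars_def by (intro psubst_pvar_id) (auto simp: poly_ring_def pvars_def)

text \<open>Divisibility is meant among polynomials in all variables of the index type; the
  retraction that discards the variables outside \<open>I\<close> carries the quotient into the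
  subring.\<close>

lemma dvd_in_poly_ring:
  assumes "a dvd p" "a \<in> poly_ring I" "p \<in> poly_ring I"
  shows "\<exists>r\<in>poly_ring I. p = a * r"
proof -
  obtain r where "p = a * r" using assms(1) by auto
  then have "restrict_vars I p = restrict_vars I a * restrict_vars I r"
    by (simp add: restrict_vars_def psubst_mult)
  then show ?thesis using restrict_vars_in assms restrict_vars_id by metis
qed

lemma monom_degree_add: "monom_degree (m + n) = monom_degree m + monom_degree n"
proof -
  have *: "monom_degree k = (\<Sum>j\<in>Poly_Mapping.keys m \<union> Poly_Mapping.keys n. Poly_Mapping.lookup k j)"
    if "Poly_Mapping.keys k \<subseteq> Poly_Mapping.keys m \<union> Poly_Mapping.keys n" for k
    unfolding monom_degree_def using that
    by (intro sum.mono_neutral_left) (auto simp: in_keys_iff)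
  show ?thesis by (simp add: * keys_plus_nat lookup_add sum.distrib)
qed

lemma monom_degree_single [simp]: "monom_degree (Poly_Mapping.single j k) = k"
  by (simp add: monom_degree_def)

lemma homogeneous_0 [simp]: "homogeneous n 0"
  by (simp add: homogeneous_def)

lemma homogeneous_mult: "homogeneous m p \<Longrightarrow> homogeneous n q \<Longrightarrow> homogeneous (m + n) (p * q)"
  unfolding homogeneous_def using Poly_Mapping.keys_mult[of p q] by (fastforce simp: monom_degree_add)

lemma homogeneous_lin: "homogeneous 1 (lin I c)"
proof -
  have "Poly_Mapping.keys (lin I c) \<subseteq> (\<Union>j\<in>I. Poly_Mapping.keys (pconst (c j) * pvar j))"
    unfolding lin_def by (rule Poly_Mapping.keys_sum)
  also have "\<dots> \<subseteq> (\<lambda>j. Poly_Mapping.single j 1) ` I"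
    by (auto simp: pvar_def mult_single split: if_splits)
  finally show ?thesis by (auto simp: homogeneous_def)
qed

lemma homogeneous_1: "homogeneous 0 1"
  by (simp add: homogeneous_def monom_degree_def)

lemma homogeneous_prod:
  assumes "\<And>x. x \<in> A \<Longrightarrow> homogeneous 1 (f x)"
  shows "homogeneous (card A) (prod f A)"
  using assms
proof (induction A rule: infinite_finite_induct)
  case (insert x A)
  then have "homogeneous (1 + card A) (f x * prod f A)" by (intro homogeneous_mult) auto
  then show ?case using insert by simp
qed (simp_all add: homogeneous_1)

lemma poly_degree_homogeneous:
  assumes "homogeneous n p" "p \<noteq> 0"
  shows "poly_degree p = n"
proof -
  obtain m where "m \<in> Poly_Mapping.keys p" using assms(2) by (metis all_not_in_conv keys_eq_empty)
  then have "monom_degree ` Poly_Mapping.keys p = {n}"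
    using assms(1) unfolding homogeneous_def by auto
  then show ?thesis unfolding poly_degree_def by simp
qed

definition hom_part :: "nat \<Rightarrow> 'i qpoly \<Rightarrow> 'i qpoly" where
  "hom_part n p = (\<Sum>m\<in>{m\<in>Poly_Mapping.keys p. monom_degree m = n}. Poly_Mapping.single m (Poly_Mapping.lookup p m))"

lemma lookup_hom_part:
  "Poly_Mapping.lookup (hom_part n p) m = (if monom_degree m = n then Poly_Mapping.lookup p m else 0)"
  by (simp add: hom_part_def lookup_sum lookup_single when_def in_keys_iff)

lemma keys_hom_part: "Poly_Mapping.keys (hom_part n p) = {m\<in>Poly_Mapping.keys p. monom_degree m = n}"
  by (auto simp: in_keys_iff lookup_hom_part split: if_splits)

lemma hom_part_add: "hom_part n (p + q) = hom_part n p + hom_part n q"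
  by (rule poly_mapping_eqI) (simp add: lookup_hom_part lookup_add)

lemma hom_part_diff: "hom_part n (p - q) = hom_part n p - hom_part n q"
  by (rule poly_mapping_eqI) (simp add: lookup_hom_part lookup_minus)

lemma hom_part_0 [simp]: "hom_part n 0 = 0"
  by (rule poly_mapping_eqI) (simp add: lookup_hom_part)

lemma hom_part_sum: "hom_part n (sum f A) = (\<Sum>x\<in>A. hom_part n (f x))"
  by (induction A rule: infinite_finite_induct) (auto simp: hom_part_add)

lemma hom_part_single:
  "hom_part n (Poly_Mapping.single m c) = (if monom_degree m = n then Poly_Mapping.single m c else 0)"
  by (rule poly_mapping_eqI) (auto simp: lookup_hom_part lookup_single when_def)

lemma homogeneous_hom_part: "homogeneous n (hom_part n p)"
  by (simp add: homogeneous_def keys_hom_part)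

lemma hom_part_id: "homogeneous n p \<Longrightarrow> hom_part n p = p"
  by (rule poly_mapping_eqI) (auto simp: lookup_hom_part homogeneous_def in_keys_iff)

lemma hom_part_poly_ring: "p \<in> poly_ring I \<Longrightarrow> hom_part n p \<in> poly_ring I"
  by (auto simp: poly_ring_def keys_hom_part)

text \<open>Multiplication by a linear form raises every degree by one, so the homogeneous parts of
  a multiple are again multiples.\<close>

lemma lin_dvd_hom_part:
  assumes "lin I c dvd p"
  shows "lin I c dvd hom_part n p"
proof -
  have "lin I c dvd hom_part n (lin I c * r)" for r
  proof (induction r rule: poly_mapping_induct_single)
    case (single m d)
    have "lin I c * Poly_Mapping.single m d = (\<Sum>j\<in>I. Poly_Mapping.single (Poly_Mapping.single j 1 + m) (c j * d))"
      by (simp add: lin_def pvar_def mult_single sum_distrib_right)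
    then have "hom_part n (lin I c * Poly_Mapping.single m d) =
        (if monom_degree m + 1 = n then lin I c * Poly_Mapping.single m d else 0)"
      by (simp add: hom_part_sum hom_part_single monom_degree_add)
    then show ?case by simp
  qed (simp add: distrib_left hom_part_add)
  then show ?thesis using assms by auto
qed

text \<open>The geometric input is \<open>extension\<close>: a class on a set \<open>D\<close> that
  is closed under arcs and contains the targets of all arcs leaving \<open>x\<close> has a value at
  \<open>x\<close>. The rest, homogeneity included, follows from the growth of \<open>W\<close>
  along arcs and from non-zero labels that are pairwise independent at a common source.\<close>

locale gkm_graph = wf_digraph G
  for I :: "'i set" and G :: "('x, 'x set \<times> 'x \<times> 'x) pre_digraph" and \<alpha> :: "'x set \<Rightarrow> ('i \<Rightarrow> int)" +
  fixes W :: "'x \<Rightarrow> int"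
  assumes finite_I: "finite I" and finite_verts: "finite (verts G)" and finite_arcs: "finite (arcs G)"
    and tail_G: "tail G = (\<lambda>(E, x, y). x)" and head_G: "head G = (\<lambda>(E, x, y). y)"
    and W_less: "(E, x, y) \<in> arcs G \<Longrightarrow> W x < W y"
    and label_nz: "(E, x, y) \<in> arcs G \<Longrightarrow> nz_on I (\<lambda>j. of_int (\<alpha> E j))"
    and label_indep: "(E, x, y) \<in> arcs G \<Longrightarrow> (E', x, y') \<in> arcs G \<Longrightarrow> (E, y) \<noteq> (E', y') \<Longrightarrow>
      \<not> lindep I (\<lambda>j. of_int (\<alpha> E j)) (\<lambda>j. of_int (\<alpha> E' j))"
    and extension: "x \<in> verts G \<Longrightarrow> D \<subseteq> verts G \<Longrightarrow>
      (\<And>E u v. (E, u, v) \<in> arcs G \<Longrightarrow> u \<in> D \<Longrightarrow> v \<in> D) \<Longrightarrow>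
      (\<And>E y. (E, x, y) \<in> arcs G \<Longrightarrow> y \<in> D) \<Longrightarrow>
      (\<And>E u v. (E, u, v) \<in> arcs G \<Longrightarrow> u \<in> D \<Longrightarrow> char_poly I (\<alpha> E) dvd f u - f v) \<Longrightarrow>
      \<exists>g. \<forall>E y. (E, x, y) \<in> arcs G \<longrightarrow> char_poly I (\<alpha> E) dvd g - f y"
begin

section \<open>Knutson-Tao classes on an acyclic graph\<close>

definition closed_under :: "'x set \<Rightarrow> bool" where
  "closed_under D \<longleftrightarrow> D \<subseteq> verts G \<and> (\<forall>E u v. (E, u, v) \<in> arcs G \<longrightarrow> u \<in> D \<longrightarrow> v \<in> D)"

lemma arc_verts: "(E, u, v) \<in> arcs G \<Longrightarrow> u \<in> verts G \<and> v \<in> verts G"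
  using tail_in_verts[of "(E, u, v)"] head_in_verts[of "(E, u, v)"] by (simp add: tail_G head_G)

lemma arcs_ends_iff: "(u, v) \<in> arcs_ends G \<longleftrightarrow> (\<exists>E. (E, u, v) \<in> arcs G)"
  unfolding arcs_ends_def arc_to_ends_def by (force simp: tail_G head_G)

text \<open>Vertices are added by decreasing \<open>W\<close>: all arcs leaving a vertex of maximal
  \<open>W\<close> outside \<open>D\<close> end in \<open>D\<close>.\<close>

lemma closed_induct [consumes 0, case_names empty insert]:
  assumes "P {}"
    and "\<And>D v. closed_under D \<Longrightarrow> v \<in> verts G \<Longrightarrow> v \<notin> D \<Longrightarrow> closed_under (insert v D) \<Longrightarrow>
      (\<And>E y. (E, v, y) \<in> arcs G \<Longrightarrow> y \<in> D) \<Longrightarrow> P D \<Longrightarrow> P (insert v D)"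
  shows "P (verts G)"
proof -
  have "P (verts G)" if "closed_under D" "P D" for D
    using that
  proof (induction "card (verts G - D)" arbitrary: D rule: less_induct)
    case less
    have sub: "D \<subseteq> verts G" using less.prems(1) by (simp add: closed_under_def)
    show ?case
    proof (cases "D = verts G")
      case False
      then have ne: "verts G - D \<noteq> {}" using sub by blast
      have fin: "finite (W ` (verts G - D))" using finite_verts by simp
      have "Max (W ` (verts G - D)) \<in> W ` (verts G - D)" using Max_in[OF fin] ne by simp
      then obtain v where "v \<in> verts G - D" "Max (W ` (verts G - D)) = W v" by (elim imageE)
      moreover have "W u \<le> Max (W ` (verts G - D))" if "u \<in> verts G - D" for u
        using that fin by simp
      ultimately have v: "v \<in> verts G - D" "\<And>u. u \<in> verts G - D \<Longrightarrow> W u \<le> W v"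
        by simp_all
      have nb: "y \<in> D" if "(E, v, y) \<in> arcs G" for E y
        using W_less[OF that] arc_verts[OF that] v(2)[of y] by force
      then have cl: "closed_under (insert v D)"
        using less.prems(1) v(1) unfolding closed_under_def by blast
      have "card (verts G - insert v D) < card (verts G - D)"
        using v(1) finite_verts by (intro psubset_card_mono) auto
      moreover have "P (insert v D)"
        using v(1) nb by (intro assms(2)[OF less.prems(1) _ _ cl _ less.prems(2)]) auto
      ultimately show ?thesis using less.hyps cl by blast
    qed (use less in simp)
  qed
  then show ?thesis using assms(1) unfolding closed_under_def by blast
qed

lemma reachable_W: "u \<rightarrow>\<^sup>*\<^bsub>G\<^esub> v \<Longrightarrow> W u \<le> W v \<and> (W u = W v \<longrightarrow> u = v)"
proof (induction rule: reachable_induct)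
  case (step x y)
  then obtain E where "(E, x, y) \<in> arcs G" using arcs_ends_iff by blast
  then show ?case using W_less[of E x y] step by linarith
qed auto

lemma closed_reachable:
  assumes "u \<rightarrow>\<^sup>*\<^bsub>G\<^esub> v" "closed_under D" "u \<in> D"
  shows "v \<in> D"
  using assms
proof (induction rule: reachable_induct)
  case (step x y)
  then show ?case using arcs_ends_iff unfolding closed_under_def by blast
qed auto

abbreviation clab :: "'x set \<Rightarrow> 'i qpoly" where "clab E \<equiv> char_poly I (\<alpha> E)"

lemma clab_in: "clab E \<in> poly_ring I"
  by (simp add: char_poly_eq_lin poly_ring_lin)

lemma clab_dvd_hom_part: "clab E dvd p \<Longrightarrow> clab E dvd hom_part n p"
  unfolding char_poly_eq_lin by (rule lin_dvd_hom_part)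

definition euler :: "'x \<Rightarrow> 'i qpoly" where
  "euler x = (\<Prod>(E, _)\<in>out_arcs G x. clab E)"

lemma finite_out_arcs: "finite (out_arcs G x)"
  using finite_arcs by (simp add: out_arcs_def)

lemma euler_nz: "euler x \<noteq> 0"
proof -
  have "(\<Prod>(E, _)\<in>A. clab E) \<noteq> 0" if "finite A" "A \<subseteq> arcs G" for A
    using that
  proof (induction A rule: finite_induct)
    case (insert a A)
    obtain E u v where a: "a = (E, u, v)" by (cases a)
    then have "clab E \<noteq> 0"
      using label_nz[of E u v] insert.prems finite_I
      by (auto simp: char_poly_eq_lin lin_eq_0_iff nz_on_def)
    then show ?case using insert a qpoly_no_zero_divisors by auto
  qed simp
  then show ?thesis unfolding euler_def using finite_out_arcs by (simp add: out_arcs_def)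
qed

lemma euler_in: "euler x \<in> poly_ring I"
  unfolding euler_def by (intro poly_ring_prod) (auto simp: clab_in)

lemma homogeneous_euler: "homogeneous (card (out_arcs G x)) (euler x)"
  unfolding euler_def
  by (intro homogeneous_prod) (auto simp: char_poly_eq_lin homogeneous_lin[unfolded One_nat_def])

lemma poly_degree_euler: "poly_degree (euler x) = card (out_arcs G x)"
  by (rule poly_degree_homogeneous[OF homogeneous_euler euler_nz])

text \<open>The labels of the arcs leaving one vertex are pairwise independent primes.\<close>

lemma euler_dvd:
  assumes "\<And>E y. (E, x, y) \<in> arcs G \<Longrightarrow> clab E dvd p"
  shows "euler x dvd p"
proof -
  have "(\<Prod>a\<in>out_arcs G x. lin I (\<lambda>j. of_int (\<alpha> (fst a) j))) dvd p"
  proof (rule prod_lin_dvd[OF finite_I finite_out_arcs])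
    fix a a' assume "a \<in> out_arcs G x" "a' \<in> out_arcs G x" "a \<noteq> a'"
    then show "\<not> lindep I (\<lambda>j. of_int (\<alpha> (fst a) j)) (\<lambda>j. of_int (\<alpha> (fst a') j))"
      using label_indep[of "fst a" x "snd (snd a)" "fst a'" "snd (snd a')"]
      by (cases a; cases a') (auto simp: tail_G)
  qed (use assms label_nz in \<open>auto simp: tail_G char_poly_eq_lin\<close>)
  then show ?thesis by (simp add: euler_def char_poly_eq_lin case_prod_unfold)
qed

lemma clab_dvd_euler: "(E, x, y) \<in> arcs G \<Longrightarrow> clab E dvd euler x"
  unfolding euler_def using finite_out_arcs[of x]
  by (intro dvd_trans[OF _ dvd_prodI[of _ "(E, x, y)"]]) (auto simp: tail_G)

text \<open>The value at \<open>x\<close> is the prescribed product, the value at vertices that do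
  not reach \<open>x\<close> is zero, and only the remaining values need
  \<open>extension\<close>.\<close>

lemma KT_class_exists:
  assumes x: "x \<in> verts G"
  shows "\<exists>p. KT_class I G \<alpha> x p"
proof -
  define N where "N = card (out_arcs G x)"
  define ok where "ok = (\<lambda>D p.
    (\<forall>y\<in>D. p y \<in> poly_ring I \<and> homogeneous N (p y) \<and> (\<not> y \<rightarrow>\<^sup>*\<^bsub>G\<^esub> x \<longrightarrow> p y = 0)) \<and>
    (\<forall>E u v. (E, u, v) \<in> arcs G \<longrightarrow> u \<in> D \<longrightarrow> clab E dvd p u - p v) \<and>
    (x \<in> D \<longrightarrow> p x = euler x))"
  have "\<exists>p. ok (verts G) p"
  proof (induction rule: closed_induct)
    case empty
    then show ?case by (auto simp: ok_def)
  next
    case (insert D v)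
    then obtain p where p: "ok D p" by blast
    have sub: "D \<subseteq> verts G" using insert by (simp add: closed_under_def)
    have "\<exists>q. q \<in> poly_ring I \<and> homogeneous N q \<and> (\<not> v \<rightarrow>\<^sup>*\<^bsub>G\<^esub> x \<longrightarrow> q = 0) \<and> (v = x \<longrightarrow> q = euler x) \<and>
        (\<forall>E y. (E, v, y) \<in> arcs G \<longrightarrow> clab E dvd q - p y)"
    proof (cases "v = x \<or> \<not> v \<rightarrow>\<^sup>*\<^bsub>G\<^esub> x")
      case True
      \<comment> \<open>If a target \<open>y\<close> reached \<open>x\<close>, so would
        \<open>v\<close>; this leaves only \<open>v = x\<close>, which contradicts the growth of
        \<open>W\<close>. So \<open>p\<close> vanishes at all targets.\<close>
      have z: "p y = 0" if "(E, v, y) \<in> arcs G" for E y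
      proof -
        have "\<not> y \<rightarrow>\<^sup>*\<^bsub>G\<^esub> x"
        proof
          assume yx: "y \<rightarrow>\<^sup>*\<^bsub>G\<^esub> x"
          from that have "v \<rightarrow>\<^bsub>G\<^esub> y" using arcs_ends_iff by blast
          then have "v \<rightarrow>\<^sup>*\<^bsub>G\<^esub> x" using yx by (rule adj_reachable_trans)
          then have "v = x" using True by blast
          then show False using W_less[OF that] reachable_W[OF yx] by simp
        qed
        then show ?thesis using p insert.hyps that unfolding ok_def by blast
      qed
      show ?thesis
      proof (cases "v = x")
        case True
        have "clab E dvd euler x - p y" if "(E, v, y) \<in> arcs G" for E y
          using clab_dvd_euler[of E x y] that z[OF that] by (simp add: True)
        moreover have "v \<rightarrow>\<^sup>*\<^bsub>G\<^esub> x" using x True by simp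
        ultimately show ?thesis
          using euler_in homogeneous_euler unfolding N_def by (intro exI[of _ "euler x"]) simp
      next
        case False
        then show ?thesis using z by (intro exI[of _ 0]) simp
      qed
    next
      case False
      have "\<exists>g. \<forall>E y. (E, v, y) \<in> arcs G \<longrightarrow> clab E dvd g - p y"
        using p insert.hyps by (intro extension[OF _ sub]) (auto simp: ok_def closed_under_def)
      then obtain g where g: "\<And>E y. (E, v, y) \<in> arcs G \<Longrightarrow> clab E dvd g - p y" by blast
      \<comment> \<open>The solution \<open>g\<close> may be inhomogeneous and contain variables
        outside \<open>I\<close>. Both operations preserve divisibility by a label and fix the
        values \<open>p y\<close>.\<close>
      define q where "q = hom_part N (restrict_vars I g)"
      have "clab E dvd q - p y" if e: "(E, v, y) \<in> arcs G" for E y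
      proof -
        have y: "p y \<in> poly_ring I" "homogeneous N (p y)"
          using p insert.hyps that unfolding ok_def by blast+
        obtain r where "g - p y = clab E * r" using g[OF e] by auto
        then have "restrict_vars I g - restrict_vars I (p y) = restrict_vars I (clab E) * restrict_vars I r"
          by (simp add: restrict_vars_def flip: psubst_mult psubst_diff)
        then have "clab E dvd restrict_vars I g - p y"
          using y clab_in by (simp add: restrict_vars_id)
        then have "clab E dvd hom_part N (restrict_vars I g - p y)" by (rule clab_dvd_hom_part)
        then show ?thesis using y by (simp add: q_def hom_part_diff hom_part_id)
      qed
      then show ?thesis using False
        by (intro exI[of _ q]) (auto simp: q_def homogeneous_hom_part hom_part_poly_ring restrict_vars_in)
    qed
    then obtain q where "q \<in> poly_ring I \<and> homogeneous N q \<and> (\<not> v \<rightarrow>\<^sup>*\<^bsub>G\<^esub> x \<longrightarrow> q = 0) \<and> (v = x \<longrightarrow> q = euler x) \<and>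
        (\<forall>E y. (E, v, y) \<in> arcs G \<longrightarrow> clab E dvd q - p y)" by (elim exE)
    then have q: "q \<in> poly_ring I" "homogeneous N q" "\<not> v \<rightarrow>\<^sup>*\<^bsub>G\<^esub> x \<Longrightarrow> q = 0" "v = x \<Longrightarrow> q = euler x"
      "\<And>E y. (E, v, y) \<in> arcs G \<Longrightarrow> clab E dvd q - p y" by simp_all
    have "ok (insert v D) (p(v := q))"
      unfolding ok_def
    proof (intro conjI allI impI ballI)
      fix E u w assume a: "(E, u, w) \<in> arcs G" "u \<in> insert v D"
      have "w \<in> D"
      proof (cases "u = v")
        case True
        then show ?thesis using a(1) insert.hyps(5) by simp
      next
        case False
        then show ?thesis using a insert.hyps(1) unfolding closed_under_def by simp
      qed
      then have "w \<noteq> v" using insert.hyps by blast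
      then show "clab E dvd (p(v := q)) u - (p(v := q)) w"
        using a p q(5) unfolding ok_def by (cases "u = v") simp_all
    next
      fix y assume "y \<in> insert v D"
      then show "(p(v := q)) y \<in> poly_ring I" "homogeneous N ((p(v := q)) y)"
        using p q(1,2) unfolding ok_def by auto
      assume "\<not> y \<rightarrow>\<^sup>*\<^bsub>G\<^esub> x"
      then show "(p(v := q)) y = 0"
        using p q(3) \<open>y \<in> insert v D\<close> unfolding ok_def by (cases "y = v") simp_all
    next
      assume "x \<in> insert v D"
      then show "(p(v := q)) x = euler x" using p q(4) unfolding ok_def by (cases "x = v") simp_all
    qed
    then show ?case by blast
  qed
  then obtain p where p: "ok (verts G) p" by blast
  have "KT_class I G \<alpha> x (restrict p (verts G))"
    unfolding KT_class_def
  proof (intro conjI)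
    show "restrict p (verts G) \<in> equiv_cohomology I G \<alpha>"
      unfolding equiv_cohomology_def
    proof (rule CollectI, intro conjI ballI)
      show "restrict p (verts G) \<in> verts G \<rightarrow>\<^sub>E poly_ring I" using p by (auto simp: ok_def)
      fix a assume "a \<in> arcs G"
      moreover obtain E u v where a: "a = (E, u, v)" by (cases a)
      ultimately have arc: "(E, u, v) \<in> arcs G" by simp
      have uv: "u \<in> verts G" "v \<in> verts G" using arc_verts[OF arc] by auto
      have "\<exists>r\<in>poly_ring I. p u - p v = clab E * r"
        using p arc uv unfolding ok_def by (intro dvd_in_poly_ring poly_ring_diff clab_in) auto
      then show "case a of (E, u, v) \<Rightarrow> \<exists>r\<in>poly_ring I. restrict p (verts G) u - restrict p (verts G) v = clab E * r"
        using uv a by simp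
    qed
    have px: "p x = euler x" using p x by (simp add: ok_def)
    then show "restrict p (verts G) x = (\<Prod>(E, _)\<in>out_arcs G x. clab E)" using x by (simp add: euler_def)
    show "\<forall>y\<in>verts G. homogeneous (poly_degree (restrict p (verts G) x)) (restrict p (verts G) y)"
      using p x by (simp add: px poly_degree_euler ok_def N_def)
    show "\<forall>y\<in>verts G. \<not> y \<rightarrow>\<^sup>*\<^bsub>G\<^esub> x \<longrightarrow> restrict p (verts G) y = 0"
      using p by (simp add: ok_def)
  qed
  then show ?thesis by blast
qed

text \<open>The classes are triangular: \<open>p x\<close> is supported on the vertices that reach
  \<open>x\<close>, and its value at \<open>x\<close> is non-zero and divides the value at
  \<open>x\<close> of every class that vanishes at the targets of the arcs leaving
  \<open>x\<close>.\<close>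

lemma KT_basis_exists: "\<exists>P. KT_basis I G \<alpha> P"
proof -
  obtain p where p: "\<And>x. x \<in> verts G \<Longrightarrow> KT_class I G \<alpha> x (p x)"
    using KT_class_exists by metis
  have pxx: "p x x = euler x" if "x \<in> verts G" for x
    using p[OF that] by (simp add: KT_class_def euler_def)
  have supp: "y \<rightarrow>\<^sup>*\<^bsub>G\<^esub> x" if "x \<in> verts G" "y \<in> verts G" "p x y \<noteq> 0" for x y
    using p[OF that(1)] that by (auto simp: KT_class_def)
  have pring: "p x y \<in> poly_ring I" if "x \<in> verts G" "y \<in> verts G" for x y
    using p[OF that(1)] that by (auto simp: KT_class_def equiv_cohomology_def)
  have pdvd: "clab E dvd p x u - p x v" if "x \<in> verts G" "(E, u, v) \<in> arcs G" for x E u v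
    using p[OF that(1)] that by (fastforce simp: KT_class_def equiv_cohomology_def)
  have inj: "inj_on p (verts G)"
  proof (rule inj_onI)
    fix x y assume xy: "x \<in> verts G" "y \<in> verts G" "p x = p y"
    have "x \<rightarrow>\<^sup>*\<^bsub>G\<^esub> y" "y \<rightarrow>\<^sup>*\<^bsub>G\<^esub> x"
      using supp[of y x] supp[of x y] xy pxx[of x] pxx[of y] euler_nz by auto
    then show "x = y" using reachable_W by (metis order_antisym)
  qed
  have span: "\<exists>c. (\<forall>x. c x \<in> poly_ring I) \<and> (\<forall>y\<in>verts G. f y = (\<Sum>x\<in>verts G. c x * p x y))"
    if f: "f \<in> equiv_cohomology I G \<alpha>" for f
  proof (induction rule: closed_induct)
    case empty
    then show ?case by (intro exI[of _ "\<lambda>_. 0"]) auto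
  next
    case (insert D v)
    then obtain c where c: "\<And>x. c x \<in> poly_ring I" "\<And>y. y \<in> D \<Longrightarrow> f y = (\<Sum>x\<in>D. c x * p x y)" by blast
    have sub: "D \<subseteq> verts G" using insert by (simp add: closed_under_def)
    have fin: "finite D" using sub finite_verts finite_subset by blast
    \<comment> \<open>What is left of \<open>f\<close> after the classes of \<open>D\<close> are
      used up. It vanishes on \<open>D\<close>, hence its value at \<open>v\<close> is divisible by
      \<open>euler v\<close>.\<close>
    define h where "h = (\<lambda>y. f y - (\<Sum>x\<in>D. c x * p x y))"
    have "clab E dvd h v" if "(E, v, y) \<in> arcs G" for E y
    proof -
      have "h y = 0" using c(2) insert.hyps that by (simp add: h_def)
      have "h v - h y = (f v - f y) - (\<Sum>x\<in>D. c x * (p x v - p x y))"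
        by (simp add: h_def sum_subtractf right_diff_distrib)
      moreover have "clab E dvd f v - f y" using f that by (fastforce simp: equiv_cohomology_def)
      moreover have "clab E dvd (\<Sum>x\<in>D. c x * (p x v - p x y))"
        using pdvd that sub by (intro dvd_sum dvd_mult) auto
      ultimately have "clab E dvd h v - h y" by (simp only: dvd_diff)
      then show ?thesis using \<open>h y = 0\<close> by simp
    qed
    then have "euler v dvd h v" by (rule euler_dvd)
    moreover have "h v \<in> poly_ring I"
      unfolding h_def using f c pring sub insert.hyps
      by (intro poly_ring_diff poly_ring_sum poly_ring_mult) (auto simp: equiv_cohomology_def)
    ultimately obtain r where r: "r \<in> poly_ring I" "h v = euler v * r"
      using dvd_in_poly_ring euler_in by blast
    have "f y = (\<Sum>x\<in>insert v D. (c(v := r)) x * p x y)" if "y \<in> insert v D" for y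
    proof -
      have s: "(\<Sum>x\<in>insert v D. (c(v := r)) x * p x y) = r * p v y + (\<Sum>x\<in>D. c x * p x y)"
      proof -
        have "(\<Sum>x\<in>D. (c(v := r)) x * p x y) = (\<Sum>x\<in>D. c x * p x y)"
          using insert.hyps by (intro sum.cong) auto
        then show ?thesis using fin insert.hyps by simp
      qed
      show ?thesis
      proof (cases "y = v")
        case True
        then show ?thesis using s r pxx[of v] insert.hyps by (simp add: h_def algebra_simps)
      next
        case False
        then have "y \<in> D" using that by simp
        \<comment> \<open>Otherwise \<open>y\<close> reaches \<open>v\<close>, and closedness of
          \<open>D\<close> would force \<open>v\<close> into \<open>D\<close>.\<close>
        then have "p v y = 0" using supp[of v y] closed_reachable[of y v D] insert.hyps sub by blast
        then show ?thesis using s c(2)[OF \<open>y \<in> D\<close>] by simp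
      qed
    qed
    then show ?case using c(1) r(1) by (intro exI[of _ "c(v := r)"]) auto
  qed
  have indep: "\<forall>x\<in>verts G. c x = 0" if c: "\<forall>y\<in>verts G. (\<Sum>x\<in>verts G. c x * p x y) = 0" for c
  proof (induction rule: closed_induct)
    case (insert D v)
    \<comment> \<open>A class \<open>p x\<close> that does not vanish at \<open>v\<close> belongs to
      a vertex reachable from \<open>v\<close>, whose coefficient is already known to be
      zero.\<close>
    have "c x * p x v = 0" if "x \<in> verts G - {v}" for x
    proof (cases "p x v = 0")
      case False
      then have "v \<rightarrow>\<^sup>*\<^bsub>G\<^esub> x" using supp that insert.hyps by blast
      then have "x \<in> insert v D" using closed_reachable insert.hyps by blast
      then show ?thesis using insert.IH that by simp
    qed simp
    then have "(\<Sum>x\<in>verts G. c x * p x v) = c v * p v v"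
      using finite_verts insert.hyps by (subst sum.remove[of _ v]) auto
    then have "c v * euler v = 0" using c insert.hyps pxx by auto
    then have "c v = 0" using qpoly_no_zero_divisors euler_nz by blast
    then show ?case using insert.IH by simp
  qed simp
  have "KT_basis I G \<alpha> (p ` verts G)"
    unfolding KT_basis_def module_basis_def
  proof (intro conjI ballI impI)
    show "acyclic (arcs_ends G)"
      using W_less arcs_ends_iff by (intro acyclicI_order[of _ "\<lambda>x. - W x"]) force
    show "p ` verts G \<subseteq> equiv_cohomology I G \<alpha>" using p by (auto simp: KT_class_def)
    fix f assume "f \<in> equiv_cohomology I G \<alpha>"
    then obtain c where c: "\<forall>x. c x \<in> poly_ring I" "\<forall>y\<in>verts G. f y = (\<Sum>x\<in>verts G. c x * p x y)"
      using span by blast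
    have "\<forall>y\<in>verts G. f y = (\<Sum>q\<in>p ` verts G. c (the_inv_into (verts G) p q) * q y)"
      using c(2) by (simp add: sum.reindex[OF inj] the_inv_into_f_f[OF inj])
    then show "\<exists>c\<in>p ` verts G \<rightarrow> poly_ring I. \<forall>x\<in>verts G. f x = (\<Sum>q\<in>p ` verts G. c q * q x)"
      using c(1) by (intro bexI[of _ "\<lambda>q. c (the_inv_into (verts G) p q)"]) auto
  next
    fix c q assume "c \<in> p ` verts G \<rightarrow> poly_ring I" "\<forall>x\<in>verts G. (\<Sum>p\<in>p ` verts G. c p * p x) = 0"
      "q \<in> p ` verts G"
    then show "c q = 0" using indep[of "\<lambda>x. c (p x)"] by (auto simp: sum.reindex[OF inj])
  qed (use p finite_verts in auto)
  then show ?thesis by blast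
qed

end

section \<open>Strings\<close>

definition cong2 :: "'i set \<Rightarrow> ('i \<Rightarrow> rat) \<Rightarrow> ('i \<Rightarrow> rat) \<Rightarrow> 'i qpoly \<Rightarrow> 'i qpoly \<Rightarrow> bool" where
  "cong2 I c d p q \<longleftrightarrow> in_ideal2 (lin I c) (lin I d) (p - q)"

lemma cong2_trans: "cong2 I c d p q \<Longrightarrow> cong2 I c d q r \<Longrightarrow> cong2 I c d p r"
proof -
  assume "cong2 I c d p q" "cong2 I c d q r"
  then obtain u v u' v' where "p - q = lin I c * u + lin I d * v" "q - r = lin I c * u' + lin I d * v'"
    unfolding cong2_def in_ideal2_def by (elim exE)
  then have "p - r = lin I c * (u + u') + lin I d * (v + v')"
    by (simp add: algebra_simps)
  then show ?thesis unfolding cong2_def in_ideal2_def by (intro exI)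
qed

lemma cong2_sym: "cong2 I c d p q \<Longrightarrow> cong2 I c d q p"
proof -
  assume "cong2 I c d p q"
  then obtain u v where "p - q = lin I c * u + lin I d * v"
    unfolding cong2_def in_ideal2_def by (elim exE)
  then have "q - p = lin I c * (- u) + lin I d * (- v)" by (simp add: algebra_simps)
  then show ?thesis unfolding cong2_def in_ideal2_def by (intro exI)
qed

lemma cong2_refl: "cong2 I c d p p"
  unfolding cong2_def in_ideal2_def by (intro exI[of _ 0]) simp

lemma cong2_lin:
  assumes "lin I e dvd p - q" "\<And>i. i \<in> I \<Longrightarrow> e i = x * c i + y * d i"
  shows "cong2 I c d p q"
proof -
  have "lin I e = lin I (\<lambda>i. x * c i + y * d i)" using assms(2) by (rule lin_cong)
  then have e: "lin I e = pconst x * lin I c + pconst y * lin I d" by (simp only: lin_add lin_scale)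
  obtain u where "p - q = lin I e * u" using assms(1) unfolding dvd_def by (elim exE)
  then have "p - q = lin I c * (pconst x * u) + lin I d * (pconst y * u)"
    unfolding e by (simp add: algebra_simps)
  then show ?thesis unfolding cong2_def in_ideal2_def by (intro exI)
qed

lemma cong2_commute: "cong2 I c d p q \<longleftrightarrow> cong2 I d c p q"
  unfolding cong2_def in_ideal2_def by (metis add.commute)

text \<open>In the coordinates of the strings a label is a root \<open>e_s' - e_s\<close> of type A.
  If a root is a combination of two others with both coefficients non-zero, these two share an index
  and the third is, up to sign, their sum or difference.\<close>

lemma root_relation:
  fixes x y :: rat
  assumes "s \<noteq> s'" "t \<noteq> t'" "u \<noteq> u'" "(s, s') \<noteq> (t, t')" "(s, s') \<noteq> (t', t)" "x \<noteq> 0" "y \<noteq> 0"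
    and E: "\<And>w. w \<in> {s, s', t, t', u, u'} \<Longrightarrow> of_bool (w = u') - of_bool (w = u) =
      x * (of_bool (w = s') - of_bool (w = s)) + y * (of_bool (w = t') - of_bool (w = t))"
  shows "(s = t \<and> y = - x \<and> (u = t' \<and> u' = s' \<and> x = 1 \<or> u = s' \<and> u' = t' \<and> x = -1)) \<or>
    (s' = t' \<and> y = - x \<and> (u = s \<and> u' = t \<and> x = 1 \<or> u = t \<and> u' = s \<and> x = -1)) \<or>
    (s' = t \<and> y = x \<and> (u = s \<and> u' = t' \<and> x = 1 \<or> u = t' \<and> u' = s \<and> x = -1)) \<or>
    (s = t' \<and> y = x \<and> (u = t \<and> u' = s' \<and> x = 1 \<or> u = s' \<and> u' = t \<and> x = -1))"
proof -
  \<comment> \<open>An index at which the combination does not vanish is an endpoint of the third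
    root.\<close>
  have plus: "w = u' \<and> z = 1 \<or> w = u \<and> z = -1"
    if "w \<in> {s, s', t, t', u, u'}" "z \<noteq> 0"
      "x * (of_bool (w = s') - of_bool (w = s)) + y * (of_bool (w = t') - of_bool (w = t)) = z" for w z
    using E[OF that(1)] that(2) unfolding that(3)
    by (cases "w = u"; cases "w = u'") auto
  consider "s = t" "s' \<noteq> t'" | "s' = t'" "s \<noteq> t" | "s' = t" "s \<noteq> t'" | "s = t'" "s' \<noteq> t"
    | "s \<noteq> t" "s \<noteq> t'" "s' \<noteq> t" "s' \<noteq> t'"
    using assms(4,5) by auto
  then show ?thesis
  proof cases
    case 1
    then have "s' = u' \<and> x = 1 \<or> s' = u \<and> x = -1" "t' = u' \<and> y = 1 \<or> t' = u \<and> y = -1"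
      using assms(1-3,6,7) by (intro plus; simp)+
    then show ?thesis using 1 by auto
  next
    case 2
    then have "s = u' \<and> - x = 1 \<or> s = u \<and> - x = -1" "t = u' \<and> - y = 1 \<or> t = u \<and> - y = -1"
      using assms(1-3,6,7) by (intro plus; simp)+
    then show ?thesis using 2 by auto
  next
    case 3
    then have "s = u' \<and> - x = 1 \<or> s = u \<and> - x = -1" "t' = u' \<and> y = 1 \<or> t' = u \<and> y = -1"
      using assms(1-3,6,7) by (intro plus; simp)+
    then show ?thesis using 3 by auto
  next
    case 4
    then have "s' = u' \<and> x = 1 \<or> s' = u \<and> x = -1" "t = u' \<and> - y = 1 \<or> t = u \<and> - y = -1"
      using assms(1-3,6,7) by (intro plus; simp)+
    then show ?thesis using 4 by auto
  next
    \<comment> \<open>Here \<open>s\<close>, \<open>s'\<close> and \<open>t\<close> are three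
      distinct indices that would all be endpoints of the third root.\<close>
    case 5
    then have "s' = u' \<and> x = 1 \<or> s' = u \<and> x = -1" "s = u' \<and> - x = 1 \<or> s = u \<and> - x = -1"
      "t = u' \<and> - y = 1 \<or> t = u \<and> - y = -1"
      using assms(1-3,6,7) by (intro plus; simp)+
    then show ?thesis using 5 assms(1) by auto
  qed
qed

text \<open>The \<open>m\<close>-th element of the string \<open>s\<close> lies over the vertex \<open>V s m\<close> of the quiver, has weight
  \<open>wt s m\<close> and is scaled by the character \<open>ep s m\<close>. The assumption \<open>step\<close> is what alignment says: an
  element of smaller weight over the same vertex has a successor over the same arrow, again of smaller
  weight, whenever the larger one has a successor.\<close>

locale string_model =
  fixes S :: "'s set" and A :: "'a set" and L :: "'s \<Rightarrow> nat" and V :: "'s \<Rightarrow> nat \<Rightarrow> 'v"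
    and wt :: "'s \<Rightarrow> nat \<Rightarrow> int" and ep :: "'s \<Rightarrow> nat \<Rightarrow> 's + 'a \<Rightarrow> int"
  assumes finite_S: "finite S" and finite_A: "finite A"
    and step: "s \<in> S \<Longrightarrow> s' \<in> S \<Longrightarrow> m < L s \<Longrightarrow> Suc m' < L s' \<Longrightarrow> V s m = V s' m' \<Longrightarrow>
      wt s m < wt s' m' \<Longrightarrow> Suc m < L s \<and> V s (Suc m) = V s' (Suc m') \<and>
        wt s (Suc m) < wt s' (Suc m') \<and> (\<forall>i. ep s' (Suc m') i - ep s (Suc m) i = ep s' m' i - ep s m i)"
    and wt_inj: "s \<in> S \<Longrightarrow> s' \<in> S \<Longrightarrow> m < L s \<Longrightarrow> m' < L s' \<Longrightarrow> V s m = V s' m' \<Longrightarrow>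
      wt s m = wt s' m' \<Longrightarrow> s = s' \<and> m = m'"
    and ep_Inl: "s \<in> S \<Longrightarrow> t \<in> S \<Longrightarrow> m < L s \<Longrightarrow> ep s m (Inl t) = of_bool (t = s)"
    and ep_deg: "s \<in> S \<Longrightarrow> m < L s \<Longrightarrow> (\<Sum>a\<in>A. ep s m (Inr a)) = int m"
begin

section \<open>Matched positions and moves between states\<close>

definition match :: "'s \<Rightarrow> nat \<Rightarrow> 's \<Rightarrow> nat \<Rightarrow> bool" where
  "match s m s' m' \<longleftrightarrow> s \<in> S \<and> s' \<in> S \<and> m < L s \<and> m' < L s' \<and> V s m = V s' m' \<and> wt s m < wt s' m'"

abbreviation Ix :: "('s + 'a) set" where "Ix \<equiv> S <+> A"

definition elab :: "'s \<Rightarrow> nat \<Rightarrow> 's \<Rightarrow> nat \<Rightarrow> 's + 'a \<Rightarrow> rat" where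
  "elab s m s' m' i = of_int (ep s' m' i - ep s m i)"

lemma match_shift:
  assumes "match s m s' m'" "m' + j < L s'"
  shows "match s (m + j) s' (m' + j)" "ep s' (m' + j) i - ep s (m + j) i = ep s' m' i - ep s m i"
proof -
  have "match s (m + j) s' (m' + j) \<and> (\<forall>i. ep s' (m' + j) i - ep s (m + j) i = ep s' m' i - ep s m i)"
    using assms(2)
  proof (induction j)
    case (Suc j)
    then have "match s (m + j) s' (m' + j)" by simp
    then show ?case
      using step[of s s' "m + j" "m' + j"] Suc unfolding match_def by auto
  qed (use assms(1) in simp)
  then show "match s (m + j) s' (m' + j)" "ep s' (m' + j) i - ep s (m + j) i = ep s' m' i - ep s m i"
    by auto
qed

lemma elab_shift:
  assumes "match s m s' m'" "m' + j < L s'"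
  shows "elab s (m + j) s' (m' + j) = elab s m s' m'"
  using match_shift(2)[OF assms] by (simp add: elab_def fun_eq_iff)

text \<open>The smaller of two matched elements runs in parallel to the larger one until the string
  of the latter ends.\<close>

lemma match_len:
  assumes "match s m s' m'"
  shows "L s' - m' \<le> L s - m"
proof -
  have "m' < L s'" using assms by (simp add: match_def)
  then have "match s (m + (L s' - m' - 1)) s' (m' + (L s' - m' - 1))"
    using assms by (intro match_shift) auto
  then show ?thesis using \<open>m' < L s'\<close> by (auto simp: match_def)
qed

text \<open>On one string the tail of the smaller element is at least as long, so the smaller
  element comes first.\<close>

lemma match_same: "match s m s m' \<Longrightarrow> m < m'"
  using match_len[of s m s m'] by (auto simp: match_def intro: le_neq_implies_less)

lemma match_trans: "match s m s' m' \<Longrightarrow> match s' m' s'' m'' \<Longrightarrow> match s m s'' m''"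
  by (auto simp: match_def)

lemma match_linear:
  assumes "s \<in> S" "s' \<in> S" "m < L s" "m' < L s'" "V s m = V s' m'" "(s, m) \<noteq> (s', m')"
  shows "match s m s' m' \<or> match s' m' s m"
  using assms wt_inj[of s s' m m'] unfolding match_def by force

text \<open>A state \<open>x\<close> records the first position present on each string. The
  \<open>r\<close> elements of \<open>s'\<close> just before \<open>x s'\<close> are to replace the
  first \<open>r\<close> present elements of \<open>s\<close>; that \<open>s\<close> has so many
  follows from the matching of the two first ones.\<close>

definition edge :: "('s \<Rightarrow> nat) \<Rightarrow> 's \<Rightarrow> 's \<Rightarrow> nat \<Rightarrow> bool" where
  "edge x s s' r \<longleftrightarrow> 0 < r \<and> r \<le> x s' \<and> x s' \<le> L s' \<and> match s (x s) s' (x s' - r)"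

definition move :: "('s \<Rightarrow> nat) \<Rightarrow> 's \<Rightarrow> 's \<Rightarrow> nat \<Rightarrow> 's \<Rightarrow> nat" where
  "move x s s' r = x(s := x s + r, s' := x s' - r)"

text \<open>By \<open>match_len\<close>, the present part of \<open>s\<close> is strictly longer
  than that of \<open>s'\<close>; this is what excludes opposite arcs and cyclic chains of arcs at
  one state.\<close>

lemma edge_size:
  assumes "edge x s s' r"
  shows "L s' - x s' < L s - x s" "x s + r \<le> L s" "x s < L s" "s \<in> S" "s' \<in> S"
  using match_len[of s "x s" s' "x s' - r"] assms unfolding edge_def match_def by auto

lemma edge_neq: "edge x s s' r \<Longrightarrow> s \<noteq> s'"
  using edge_size by blast

lemma edge_asym: "edge x s s' r \<Longrightarrow> \<not> edge x s' s r'"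
  using edge_size(1)[of x s s' r] edge_size(1)[of x s' s r'] by force

lemma move_move: "s \<noteq> s' \<Longrightarrow> move (move x s s' r) s s' r' = move x s s' (r + r')"
  by (auto simp: move_def fun_eq_iff)

abbreviation labl :: "('s \<Rightarrow> nat) \<Rightarrow> 's \<Rightarrow> 's \<Rightarrow> nat \<Rightarrow> 's + 'a \<Rightarrow> rat" where
  "labl x s s' r \<equiv> elab s (x s) s' (x s' - r)"

lemma labl_Inl:
  assumes "edge x s s' r" "w \<in> S"
  shows "labl x s s' r (Inl w) = of_bool (w = s') - of_bool (w = s)"
proof -
  have "x s' - r < L s'" using assms unfolding edge_def match_def by auto
  then show ?thesis
    using assms edge_size[OF assms(1)] by (simp add: elab_def ep_Inl)
qed

lemma elab_deg:
  assumes "match s m s' m'"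
  shows "(\<Sum>a\<in>A. elab s m s' m' (Inr a)) = of_int (int m' - int m)"
  using assms unfolding elab_def match_def
  by (simp add: sum_subtractf ep_deg flip: of_int_sum)

lemma labl_deg:
  assumes "edge x s s' r"
  shows "(\<Sum>a\<in>A. labl x s s' r (Inr a)) = of_int (int (x s' - r) - int (x s))"
  using assms elab_deg unfolding edge_def by blast

lemma labl_nz: "edge x s s' r \<Longrightarrow> nz_on Ix (labl x s s' r)"
  using labl_Inl[of x s s' r s'] edge_neq[of x s s' r] edge_size(5)[of x s s' r]
  unfolding nz_on_def by (intro bexI[of _ "Inl s'"]) auto

text \<open>The string coordinates determine the pair of strings up to order, the lengths of the
  present parts exclude the opposite order, and the sum of the arrow coordinates determines
  \<open>r\<close>.\<close>

lemma labl_indep: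
  assumes "edge x s s' r" "edge x t t' r'" "lindep Ix (labl x s s' r) (labl x t t' r')"
  shows "(s, s', r) = (t, t', r')"
proof -
  obtain z where z: "\<And>i. i \<in> Ix \<Longrightarrow> labl x t t' r' i = z * labl x s s' r i"
    using assms(3) unfolding lindep_def by blast
  have S: "s \<in> S" "s' \<in> S" "t \<in> S" "t' \<in> S" using edge_size assms by blast+
  have Z: "of_bool (w = t') - of_bool (w = t) = z * (of_bool (w = s') - of_bool (w = s))" if "w \<in> S" for w
    using z[OF InlI[OF that]] labl_Inl[OF assms(1) that] labl_Inl[OF assms(2) that] by simp
  have ne: "s \<noteq> s'" "t \<noteq> t'" using edge_neq assms by blast+
  have "t = s' \<and> z = -1 \<or> t = s \<and> z = 1"
    using Z[OF S(3)] ne by (cases "t = s"; cases "t = s'") auto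
  moreover have "t' = s' \<and> z = 1 \<or> t' = s \<and> z = -1"
    using Z[OF S(4)] ne by (cases "t' = s"; cases "t' = s'") auto
  ultimately have "(t = s \<and> t' = s' \<and> z = 1) \<or> (t = s' \<and> t' = s)" by auto
  then have *: "t = s" "t' = s'" "z = 1"
    using edge_asym assms by blast+
  have "(\<Sum>a\<in>A. labl x t t' r' (Inr a)) = (\<Sum>a\<in>A. labl x s s' r (Inr a))"
    using z * by (intro sum.cong) auto
  then have "x s' - r = x s' - r'"
    using assms(1,2) unfolding * by (simp add: labl_deg)
  then show ?thesis using * assms unfolding edge_def by auto
qed

end

text \<open>Here \<open>x\<close> is the state to which the class \<open>f\<close>, given on the
  closed set \<open>D\<close> of states, is to be extended.\<close>

locale string_model_class = string_model S A L V wt ep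
  for S :: "'s set" and A :: "'a set" and L :: "'s \<Rightarrow> nat" and V :: "'s \<Rightarrow> nat \<Rightarrow> 'v"
    and wt :: "'s \<Rightarrow> nat \<Rightarrow> int" and ep :: "'s \<Rightarrow> nat \<Rightarrow> 's + 'a \<Rightarrow> int" +
  fixes x :: "'s \<Rightarrow> nat" and D :: "('s \<Rightarrow> nat) set" and f :: "('s \<Rightarrow> nat) \<Rightarrow> ('s + 'a) qpoly"
  assumes D_closed: "y \<in> D \<Longrightarrow> edge y s s' r \<Longrightarrow> move y s s' r \<in> D"
    and f_class: "y \<in> D \<Longrightarrow> edge y s s' r \<Longrightarrow> lin Ix (labl y s s' r) dvd f y - f (move y s s' r)"
    and x_bound: "s \<in> S \<Longrightarrow> x s \<le> L s"
    and x_edges: "edge x s s' r \<Longrightarrow> move x s s' r \<in> D"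
begin

text \<open>Two elements over one vertex are comparable, so a move between states of
  \<open>D\<close> is an arc in one direction or the other, and reversal only changes the sign of
  the label. Later comparisons need not know the direction.\<close>

lemma f_adj:
  assumes "y \<in> D" "move y s s' r \<in> D" "s \<in> S" "s' \<in> S" "s \<noteq> s'"
    and "r \<le> y s'" "y s' \<le> L s'" "y s + r \<le> L s" "V s (y s) = V s' (y s' - r)" "0 < r"
  shows "lin Ix (labl y s s' r) dvd f y - f (move y s s' r)"
proof -
  let ?y = "move y s s' r"
  have lt: "y s < L s" "y s' - r < L s'" using assms by auto
  consider "match s (y s) s' (y s' - r)" | "match s' (y s' - r) s (y s)"
    using match_linear[OF assms(3,4) lt assms(9)] assms(5) by blast
  then show ?thesis
  proof cases
    case 1
    then show ?thesis using f_class assms unfolding edge_def by simp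
  next
    case 2
    have y: "?y s = y s + r" "?y s' = y s' - r" using assms(5) by (auto simp: move_def)
    have inv: "move ?y s' s r = y" using assms(5,6) by (auto simp: move_def fun_eq_iff)
    have "edge ?y s' s r" using 2 assms unfolding edge_def y by simp
    then have "lin Ix (labl ?y s' s r) dvd f ?y - f y" using f_class[OF assms(2)] inv by metis
    moreover have "lin Ix (labl ?y s' s r) = - lin Ix (labl y s s' r)"
    proof -
      have "lin Ix (labl ?y s' s r) = lin Ix (\<lambda>i. (-1) * labl y s s' r i)"
        by (intro lin_cong) (simp add: elab_def y)
      also have "\<dots> = - lin Ix (labl y s s' r)"
        by (simp only: lin_scale) (simp add: single_uminus)
      finally show ?thesis .
    qed
    ultimately show ?thesis by (metis dvd_minus_iff minus_diff_eq minus_dvd_iff)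
  qed
qed

end

section \<open>Two or three arcs leaving a state\<close>

context string_model_class
begin

lemma cong2_label1: "lin I c dvd p - q \<Longrightarrow> cong2 I c d p q"
  by (rule cong2_lin[where x = 1 and y = 0]) simp_all

lemma cong2_label2: "lin I d dvd p - q \<Longrightarrow> cong2 I c d p q"
  by (rule cong2_lin[where x = 0 and y = 1]) simp_all

text \<open>The two moves commute and span a square whose opposite sides have equal labels.\<close>

lemma pair_disjoint:
  assumes n: "edge x s s' r" and k: "edge x t t' r'" and "s \<noteq> t" "s \<noteq> t'" "s' \<noteq> t" "s' \<noteq> t'"
  shows "cong2 Ix (labl x s s' r) (labl x t t' r') (f (move x s s' r)) (f (move x t t' r'))"
proof -
  have e1: "edge (move x s s' r) t t' r'" and e2: "edge (move x t t' r') s s' r"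
    using assms by (simp_all add: edge_def move_def)
  have comm: "move (move x s s' r) t t' r' = move (move x t t' r') s s' r"
    using assms(3-) by (auto simp: move_def fun_eq_iff)
  have l1: "labl (move x s s' r) t t' r' = labl x t t' r'" and l2: "labl (move x t t' r') s s' r = labl x s s' r"
    using assms(3-) by (simp_all add: move_def)
  have "cong2 Ix (labl x s s' r) (labl x t t' r') (f (move x s s' r)) (f (move (move x s s' r) t t' r'))"
    using f_class[OF x_edges[OF n] e1] unfolding l1 by (rule cong2_label2)
  moreover have "cong2 Ix (labl x s s' r) (labl x t t' r') (f (move x t t' r')) (f (move (move x s s' r) t t' r'))"
    using f_class[OF x_edges[OF k] e2] unfolding l2 comm by (rule cong2_label1)
  ultimately show ?thesis by (rule cong2_trans[OF _ cong2_sym])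
qed

text \<open>After the move from \<open>s\<close> to \<open>a\<close>, a move from \<open>a\<close>
  to \<open>b\<close> is possible, and its label is the difference of the two given ones. The result
  differs from the other target only in how much was moved from \<open>s\<close> to
  \<open>a\<close>, and that move has the first label.\<close>

lemma pair_source_aux:
  assumes n: "edge x s a r" and k: "edge x s b r'" and ab: "a \<noteq> b"
    and m: "match a (x a - r) b (x b - r')"
  shows "cong2 Ix (labl x s a r) (labl x s b r') (f (move x s a r)) (f (move x s b r'))"
proof -
  let ?n = "move x s a r" and ?k = "move x s b r'"
  have ne: "s \<noteq> a" "s \<noteq> b" using edge_neq n k by auto
  have nv: "?n s = x s + r" "?n a = x a - r" "?n b = x b" and kv: "?k s = x s + r'" "?k a = x a" "?k b = x b - r'"
    using ne ab by (auto simp: move_def)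
  have e: "edge ?n a b r'" using m k unfolding edge_def nv by simp
  define w where "w = move ?n a b r'"
  have wv: "w s = x s + r" "w a = x a - r + r'" "w b = x b - r'"
    using ne ab by (auto simp: w_def move_def)
  have wD: "w \<in> D" using D_closed[OF x_edges[OF n] e] by (simp add: w_def)
  have bounds: "x a - r + r' \<le> L a" "x s + r \<le> L s" "x s + r' \<le> L s" "r \<le> x a" "x a \<le> L a"
    "s \<in> S" "a \<in> S" "b \<in> S"
    using edge_size(2)[OF e] edge_size(2,4,5)[OF n] edge_size(2,5)[OF k] n unfolding nv edge_def by simp_all
  have mn: "match s (x s) a (x a - r)" using n by (simp add: edge_def)
  have "cong2 Ix (labl x s a r) (labl x s b r') (f ?n) (f w)"
  proof (rule cong2_lin[where x = "-1" and y = 1])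
    show "lin Ix (labl ?n a b r') dvd f ?n - f w"
      using f_class[OF x_edges[OF n] e] by (simp add: w_def)
  qed (simp add: elab_def nv)
  moreover have "cong2 Ix (labl x s a r) (labl x s b r') (f w) (f ?k)"
  proof -
    \<comment> \<open>The state \<open>w\<close> is the second target itself or is joined to it by a
      move of length \<open>\<bar>r - r'\<bar>\<close> from \<open>s\<close> to \<open>a\<close>,
      starting at the state in which less has been moved off \<open>s\<close>.\<close>
    consider "r = r'" | "r < r'" | "r' < r" by linarith
    then show ?thesis
    proof cases
      case 1
      then have "w = ?k" using ne ab bounds by (auto simp: w_def move_def fun_eq_iff)
      then show ?thesis by (simp add: cong2_refl)
    next
      case 2
      have mv: "move w s a (r' - r) = ?k"
        using 2 ne ab bounds by (auto simp: w_def move_def fun_eq_iff)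
      have lt: "x a - r + r < L a" using 2 bounds by simp
      have "lin Ix (labl w s a (r' - r)) dvd f w - f (move w s a (r' - r))"
        using 2 bounds wD ne x_edges[OF k] match_shift(1)[OF mn lt]
        by (intro f_adj) (auto simp: mv wv match_def)
      moreover have "labl w s a (r' - r) = labl x s a r"
        using elab_shift[OF mn lt] 2 bounds by (simp add: wv)
      ultimately show ?thesis unfolding mv by (metis cong2_label1)
    next
      case 3
      have mv: "move ?k s a (r - r') = w"
        using 3 ne ab bounds by (auto simp: w_def move_def fun_eq_iff)
      have lt: "x a - r + r' < L a" using 3 bounds by simp
      have eq: "x a - r + r' = x a - (r - r')" using 3 bounds by simp
      have "lin Ix (labl ?k s a (r - r')) dvd f ?k - f (move ?k s a (r - r'))"
        using 3 bounds wD ne x_edges[OF k] match_shift(1)[OF mn lt]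
        by (intro f_adj) (auto simp: mv kv match_def eq)
      moreover have "labl ?k s a (r - r') = labl x s a r"
        using elab_shift[OF mn lt] by (simp add: kv eq)
      ultimately show ?thesis unfolding mv by (metis cong2_label1 cong2_sym)
    qed
  qed
  ultimately show ?thesis by (rule cong2_trans)
qed

lemma pair_source:
  assumes n: "edge x s a r" and k: "edge x s b r'" and ab: "a \<noteq> b"
  shows "cong2 Ix (labl x s a r) (labl x s b r') (f (move x s a r)) (f (move x s b r'))"
proof -
  have "match a (x a - r) b (x b - r') \<or> match b (x b - r') a (x a - r)"
    using n k ab by (intro match_linear) (auto simp: edge_def match_def)
  then show ?thesis
    using pair_source_aux[OF n k ab] pair_source_aux[OF k n ab[symmetric]]
    by (metis cong2_commute cong2_sym)
qed

text \<open>The shorter move is completed to the length of the longer one: once \<open>t\<close> is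
  matched with the last \<open>r'\<close> of the new elements of \<open>c\<close>, the other
  \<open>r - r'\<close> are matched with \<open>s\<close>, under the first label. The result differs
  from the first target by a move from \<open>s\<close> to \<open>t\<close>, whose label is the
  difference.\<close>

lemma pair_target_aux:
  assumes n: "edge x s c r" and k: "edge x t c r'" and st: "s \<noteq> t" and le: "r' \<le> r"
  shows "cong2 Ix (labl x s c r) (labl x t c r') (f (move x s c r)) (f (move x t c r'))"
proof -
  let ?n = "move x s c r" and ?k = "move x t c r'"
  have ne: "s \<noteq> c" "t \<noteq> c" using edge_neq n k by auto
  have kv: "?k s = x s" "?k t = x t + r'" "?k c = x c - r'"
    using ne st by (auto simp: move_def)
  have bounds: "x s + r \<le> L s" "x t + r' \<le> L t" "r \<le> x c" "x c \<le> L c" "s \<in> S" "t \<in> S" "c \<in> S" "0 < r'" "0 < r"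
    using edge_size[OF n] edge_size[OF k] n k by (auto simp: edge_def)
  have mn: "match s (x s) c (x c - r)" and mk: "match t (x t) c (x c - r')"
    using n k by (simp_all add: edge_def)
  have lt: "x c - r + (r - r') < L c" and eq: "x c - r + (r - r') = x c - r'" using bounds le by auto
  define w where "w = (if r' = r then ?k else move ?k s c (r - r'))"
  have wv: "w s = x s + (r - r')" "w t = x t + r'" "w c = x c - r"
    using ne st bounds le by (auto simp: w_def move_def)
  have w: "w \<in> D \<and> cong2 Ix (labl x s c r) (labl x t c r') (f ?k) (f w)"
  proof (cases "r' = r")
    case True
    then show ?thesis using x_edges[OF k] by (simp add: w_def cong2_refl)
  next
    case False
    have "r - r' \<le> x c - r'" "x c - r' \<le> L c" "0 < r - r'" using bounds le False by linarith+
    then have e: "edge ?k s c (r - r')" using mn le unfolding edge_def kv by simp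
    have "labl ?k s c (r - r') = labl x s c r" using False le bounds by (simp add: kv)
    then have "cong2 Ix (labl x s c r) (labl x t c r') (f ?k) (f w)"
      using f_class[OF x_edges[OF k] e] False by (intro cong2_label1) (simp add: w_def)
    then show ?thesis using D_closed[OF x_edges[OF k] e] False by (simp add: w_def)
  qed
  have mv: "move w s t r' = ?n"
    using ne st bounds le by (auto simp: w_def move_def fun_eq_iff)
  have V: "V s (x s + (r - r')) = V t (x t)"
    using match_shift(1)[OF mn lt] mk unfolding eq match_def by simp
  have "cong2 Ix (labl x s c r) (labl x t c r') (f w) (f ?n)"
  proof (rule cong2_lin[where x = 1 and y = "-1"])
    have "lin Ix (labl w s t r') dvd f w - f (move w s t r')"
      using w bounds ne st V le x_edges[OF n] by (intro f_adj) (auto simp: mv wv)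
    then show "lin Ix (labl w s t r') dvd f w - f ?n" unfolding mv .
  next
    fix i
    show "labl w s t r' i = 1 * labl x s c r i + - 1 * labl x t c r' i"
      using elab_shift[OF mn lt, THEN fun_cong, of i] unfolding eq by (simp add: wv elab_def)
  qed
  then show ?thesis by (rule cong2_sym[OF cong2_trans[OF conjunct2[OF w]]])
qed

lemma pair_target:
  assumes n: "edge x s c r" and k: "edge x t c r'" and st: "s \<noteq> t"
  shows "cong2 Ix (labl x s c r) (labl x t c r') (f (move x s c r)) (f (move x t c r'))"
  using pair_target_aux[OF n k st] pair_target_aux[OF k n st[symmetric]] cong2_commute cong2_sym
  by (metis nat_le_linear)

lemma match_chain:
  assumes n: "edge x s m r" and k: "edge x m t r'"
  shows "match s (x s + r) t (x t - r')" "s \<noteq> t"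
    "elab s (x s + r) t (x t - r') i = labl x s m r i + labl x m t r' i"
proof -
  have mn: "match s (x s) m (x m - r)" and mk: "match m (x m) t (x t - r')" and "r \<le> x m"
    using n k by (simp_all add: edge_def)
  moreover have lt: "x m - r + r < L m" using edge_size[OF k] \<open>r \<le> x m\<close> by simp
  ultimately show "match s (x s + r) t (x t - r')"
    using match_trans[OF match_shift(1)[OF mn lt]] by simp
  show "s \<noteq> t" using edge_size[OF n] edge_size[OF k] by auto
  show "elab s (x s + r) t (x t - r') i = labl x s m r i + labl x m t r' i"
    using elab_shift[OF mn lt, THEN fun_cong, of i] \<open>r \<le> x m\<close> by (simp add: elab_def)
qed

lemma chain_edges:
  assumes n: "edge x s m r" and k: "edge x m t r'"
  shows "edge (move x s m r) s t r'" "edge (move x m t r') s m (r + r')"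
    "move (move x m t r') s m (r + r') = move (move x s m r) s t r'"
    "labl (move x s m r) s t r' = elab s (x s + r) t (x t - r')"
    "labl (move x m t r') s m (r + r') = labl x s m r"
proof -
  have ne: "s \<noteq> m" "m \<noteq> t" "s \<noteq> t" using edge_neq n k match_chain(2)[OF n k] by auto
  have b: "r \<le> x m" "r' \<le> x t" "x m + r' \<le> L m" "0 < r" "0 < r'" "x t \<le> L t"
    using n k edge_size[OF k] by (auto simp: edge_def)
  show "edge (move x s m r) s t r'" using match_chain(1)[OF n k] ne b by (simp add: edge_def move_def)
  show "edge (move x m t r') s m (r + r')" using n ne b by (simp add: edge_def move_def)
  show "move (move x m t r') s m (r + r') = move (move x s m r) s t r'"
    using ne b by (auto simp: move_def fun_eq_iff)
  show "labl (move x s m r) s t r' = elab s (x s + r) t (x t - r')"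
    "labl (move x m t r') s m (r + r') = labl x s m r"
    using ne by (simp_all add: move_def)
qed

text \<open>Both targets lead to a common state: the first by a move from \<open>s\<close> to
  \<open>t\<close>, whose label is the sum, the second by a longer move from \<open>s\<close> to
  \<open>m\<close> with the old label.\<close>

lemma pair_chain:
  assumes n: "edge x s m r" and k: "edge x m t r'"
  shows "cong2 Ix (labl x s m r) (labl x m t r') (f (move x s m r)) (f (move x m t r'))"
proof -
  note e = chain_edges[OF n k]
  have "cong2 Ix (labl x s m r) (labl x m t r') (f (move x s m r)) (f (move (move x s m r) s t r'))"
  proof (rule cong2_lin[where x = 1 and y = 1])
    show "lin Ix (elab s (x s + r) t (x t - r')) dvd f (move x s m r) - f (move (move x s m r) s t r')"
      using f_class[OF x_edges[OF n] e(1)] unfolding e(4) .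
  qed (simp add: match_chain(3)[OF n k])
  moreover have "cong2 Ix (labl x s m r) (labl x m t r') (f (move x m t r')) (f (move (move x s m r) s t r'))"
    using f_class[OF x_edges[OF k] e(2)] unfolding e(3,5) by (rule cong2_label1)
  ultimately show ?thesis by (rule cong2_trans[OF _ cong2_sym])
qed

text \<open>The three targets and the states \<open>tA\<close> and \<open>tB\<close> are the lower
  vertices of a hexagon with top \<open>x\<close>; its long arc from \<open>x\<close> ends at
  \<open>?T13\<close>, to which \<open>tA\<close> and \<open>tB\<close> both lead.\<close>

lemma triangle_extension:
  assumes e12: "edge x p q r" and e23: "edge x q w r'" and e13: "edge x p w r''"
    and sum: "\<And>i. i \<in> Ix \<Longrightarrow> labl x p w r'' i = labl x p q r i + labl x q w r' i"
  shows "\<exists>g. lin Ix (labl x p q r) dvd g - f (move x p q r) \<and>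
    lin Ix (labl x q w r') dvd g - f (move x q w r') \<and>
    lin Ix (labl x p w r'') dvd g - f (move x p w r'')"
proof -
  let ?T12 = "move x p q r" and ?T23 = "move x q w r'" and ?T13 = "move x p w r''"
  have b: "r \<le> x q" "r' \<le> x w" "r'' \<le> x w" "0 < r" "0 < r'" "0 < r''"
      "x w \<le> L w" "x q \<le> L q" "x q + r' \<le> L q" "x p + r'' \<le> L p" "x q < L q"
    using e12 e23 e13 edge_size[OF e23] edge_size[OF e13] by (auto simp: edge_def)
  \<comment> \<open>Comparing the sums of the arrow coordinates turns the relation between the
    labels into \<open>r'' = r + r'\<close>.\<close>
  have "(\<Sum>a\<in>A. labl x p w r'' (Inr a)) = (\<Sum>a\<in>A. labl x p q r (Inr a) + labl x q w r' (Inr a))"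
    by (intro sum.cong refl sum InrI)
  then have "(of_int (int (x w - r'') - int (x p)) :: rat) =
      of_int (int (x q - r) - int (x p)) + of_int (int (x w - r') - int (x q))"
    by (simp only: sum.distrib labl_deg[OF e12] labl_deg[OF e23] labl_deg[OF e13])
  then have "int (x w - r'') - int (x p) = (int (x q - r) - int (x p)) + (int (x w - r') - int (x q))"
    by (simp only: of_int_add[symmetric] of_int_eq_iff)
  then have r'': "r'' = r + r'" using b by linarith
  note ch = chain_edges[OF e12 e23] and mc = match_chain[OF e12 e23]
  have ne: "p \<noteq> q" "q \<noteq> w" "p \<noteq> w" using edge_neq e12 e23 e13 by auto
  have m12: "match p (x p) q (x q - r)" and m23: "match q (x q) w (x w - r')" and m13: "match p (x p) w (x w - (r + r'))"
    using e12 e23 e13 by (simp_all add: edge_def r'')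
  have lt12: "x q - r + r < L q" and lt13: "x w - (r + r') + r < L w" and eqw: "x w - (r + r') + r = x w - r'"
    using b r'' by auto
  \<comment> \<open>Were the order reversed, shifting both elements by \<open>r\<close> would
    reverse the known order of the elements \<open>x q\<close> and \<open>x w - r'\<close>.\<close>
  have mA: "match q (x q - r) w (x w - (r + r'))"
  proof (rule ccontr)
    assume no: "\<not> match q (x q - r) w (x w - (r + r'))"
    have "match w (x w - (r + r')) q (x q - r)"
      using match_linear[of q w "x q - r" "x w - (r + r')"] no m12 m13 ne by (auto simp: match_def)
    from match_shift(1)[OF this lt12] have "match w (x w - r') q (x q)"
      using eqw b by simp
    then show False using m23 by (auto simp: match_def)
  qed
  define tA where "tA = move ?T12 q w (r + r')"
  define tB where "tB = move ?T12 p w r'"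
  have v12: "?T12 p = x p + r" "?T12 q = x q - r" "?T12 w = x w"
    and v23: "?T23 p = x p" "?T23 q = x q + r'" "?T23 w = x w - r'"
    using ne by (auto simp: move_def)
  have vA: "tA p = x p + r" "tA q = x q + r'" "tA w = x w - (r + r')"
    and vB: "tB p = x p + r + r'" "tB q = x q - r" "tB w = x w - r'"
    using ne b by (auto simp: tA_def tB_def move_def)
  have l23: "elab q (x q - r) w (x w - (r + r')) = labl x q w r'"
    using elab_shift[OF mA lt13] b eqw by simp
  have l13: "elab p (x p + r) w (x w - r') = labl x p w r''"
    using elab_shift[OF m13 lt13] eqw by (simp add: r'')
  have l12: "elab p (x p + r) q (x q) = labl x p q r"
    using elab_shift[OF m12 lt12] b by simp
  have wb: "r \<le> x w - r'" "x w - r' \<le> L w" using b r'' by linarith+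
  have eA1: "edge ?T12 q w (r + r')" using mA b r'' unfolding edge_def v12 by simp
  have eA2: "edge ?T23 p w r" using m13 b wb unfolding edge_def v23 by (simp add: add.commute)
  have DA: "tA \<in> D" unfolding tA_def by (rule D_closed[OF x_edges[OF e12] eA1])
  have DB: "tB \<in> D" unfolding tB_def by (rule D_closed[OF x_edges[OF e12] ch(1)])
  have eA3: "edge tA p q r'"
    using match_shift(1)[OF m12 lt12] b unfolding edge_def vA by simp
  have eB3: "edge tB q w r"
    using mA b wb unfolding edge_def vB by (simp add: add.commute)
  have mvA2: "move ?T23 p w r = tA" and mvA3: "move tA p q r' = ?T13" and mvB3: "move tB q w r = ?T13"
    using ne b r'' by (auto simp: tA_def tB_def move_def fun_eq_iff)
  have wrr: "x w - r' - r = x w - (r + r')" by simp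
  have s: "lin Ix (labl x p q r) + lin Ix (labl x q w r') = lin Ix (labl x p w r'')"
    unfolding lin_add[symmetric] by (rule lin_cong) (simp add: sum)
  have s': "lin Ix (\<lambda>i. labl x p q r i + labl x q w r' i) = lin Ix (labl x p w r'')"
    by (rule lin_cong) (simp add: sum)
  have nl: "\<not> lindep Ix (\<lambda>i. labl x p q r i + labl x q w r' i) d"
    if "\<not> lindep Ix (labl x p w r'') d" for d
    using that sum unfolding lindep_def by auto
  have nz: "nz_on Ix (\<lambda>i. labl x p q r i + labl x q w r' i)"
    using labl_nz[OF e13] sum unfolding nz_on_def by auto
  have 1: "lin Ix (labl x q w r') dvd f ?T12 - f tA"
    using f_class[OF x_edges[OF e12] eA1] l23 unfolding tA_def v12 by simp
  have 2: "lin Ix (labl x p w r'') dvd f ?T12 - f tB"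
    using f_class[OF x_edges[OF e12] ch(1)] l13 unfolding tB_def v12 by simp
  have 3: "lin Ix (labl x p q r) dvd f ?T23 - f tB"
    using f_class[OF x_edges[OF e23] ch(2)] ch(3,5) unfolding tB_def by simp
  have 4: "lin Ix (labl x p w r'') dvd f ?T23 - f tA"
    using f_class[OF x_edges[OF e23] eA2] unfolding mvA2 v23 r'' wrr .
  have 5: "lin Ix (labl x p q r) dvd f tA - f ?T13"
    using f_class[OF DA eA3] l12 unfolding mvA3 vA by simp
  have 6: "lin Ix (labl x q w r') dvd f tB - f ?T13"
    using f_class[OF DB eB3] l23 unfolding mvB3 vB wrr by simp
  have "\<exists>g. lin Ix (labl x p q r) dvd g - f ?T12 \<and> lin Ix (labl x q w r') dvd g - f ?T23 \<and>
    lin Ix (labl x p q r) + lin Ix (labl x q w r') dvd g - f ?T13"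
  proof (rule hexagon_extension[OF _ labl_nz[OF e12] nz nl nl refl refl, where fA = "f tA" and fB = "f tB"])
    show "finite Ix" using finite_S finite_A by simp
    show "\<not> lindep Ix (labl x p w r'') (labl x p q r)" using labl_indep[OF e13 e12] ne by blast
    show "\<not> lindep Ix (labl x p w r'') (labl x q w r')" using labl_indep[OF e13 e23] ne by blast
  qed (use 1 2 3 4 5 6 s in simp_all)
  then show ?thesis unfolding s .
qed

end

section \<open>Several arcs between the same two strings\<close>

context string_model_class
begin

text \<open>A string matched with itself at distance \<open>N\<close> runs in parallel to its own
  shift, hence is periodic, and each period adds the same character.\<close>

lemma periodic:
  assumes m: "match s y s (y + N)" and le: "y + j + k * N < L s"
  shows "V s (y + j + k * N) = V s (y + j)"
    and "ep s (y + j + k * N) i - ep s (y + j) i = int k * (ep s (y + N) i - ep s y i)"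
proof -
  have "V s (y + j + k * N) = V s (y + j) \<and>
    ep s (y + j + k * N) i - ep s (y + j) i = int k * (ep s (y + N) i - ep s y i)"
    using le
  proof (induction k)
    case (Suc k)
    have lt: "y + N + (j + k * N) < L s" using Suc.prems by (simp add: algebra_simps)
    have eq: "y + N + (j + k * N) = y + j + Suc k * N" "y + (j + k * N) = y + j + k * N"
      by (simp_all add: algebra_simps)
    note ms = match_shift(1)[OF m lt, unfolded eq] match_shift(2)[OF m lt, of i, unfolded eq]
    have "V s (y + j + Suc k * N) = V s (y + j + k * N)" using ms(1) unfolding match_def by simp
    moreover have "ep s (y + j + Suc k * N) i - ep s (y + j) i =
        (ep s (y + j + Suc k * N) i - ep s (y + j + k * N) i) + (ep s (y + j + k * N) i - ep s (y + j) i)"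
      by simp
    moreover have "V s (y + j + k * N) = V s (y + j) \<and>
      ep s (y + j + k * N) i - ep s (y + j) i = int k * (ep s (y + N) i - ep s y i)"
      using Suc.IH Suc.prems by simp
    ultimately show ?case unfolding ms(2) by (simp add: algebra_simps)
  qed simp
  then show "V s (y + j + k * N) = V s (y + j)"
    and "ep s (y + j + k * N) i - ep s (y + j) i = int k * (ep s (y + N) i - ep s y i)" by auto
qed

lemma match_before:
  assumes "s \<in> S" "y < q" "q < L s" "V s q = V s y"
  shows "match s y s q"
  using match_linear[of s s y q] match_same[of s q y] assms by auto

text \<open>The new segments of the arcs from \<open>s\<close> to \<open>s'\<close> begin at visits
  of \<open>s'\<close> to one vertex. With \<open>N\<close> the distance of consecutive visits and
  \<open>v\<close> the distance from the last one to \<open>x s'\<close>, the targets are the moves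
  by \<open>v + b N\<close>. The moves by \<open>a N\<close> supply the other side of a bipartite
  graph as in \<open>bipartite_labels\<close>, and \<open>x\<close> itself is its point
  \<open>a = 0\<close>.\<close>

lemma pencil_extension:
  assumes e1: "edge x s s' r1" and e2: "edge x s s' r2" and r12: "r1 < r2"
  shows "\<exists>g. \<forall>r. edge x s s' r \<longrightarrow> lin Ix (labl x s s' r) dvd g - f (move x s s' r)"
proof -
  define X where "X = x s'"
  have S: "s \<in> S" "s' \<in> S" "s \<noteq> s'" and XL: "X \<le> L s'" and xs: "x s < L s"
    using edge_size[OF e1] edge_neq[OF e1] e1 by (auto simp: edge_def X_def)
  \<comment> \<open>The longest move begins at the first of the relevant visits,
    \<open>y\<close>.\<close>
  define rm where "rm = Max {r. edge x s s' r}"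
  have fin: "finite {r. edge x s s' r}"
    by (rule finite_subset[of _ "{..X}"]) (auto simp: edge_def X_def)
  have rm: "edge x s s' rm" using Max_in[OF fin] e1 unfolding rm_def by blast
  have rm_max: "r \<le> rm" if "edge x s s' r" for r using Max_ge[OF fin] that unfolding rm_def by blast
  define y where "y = X - rm"
  have rmX: "0 < rm" "rm \<le> X" using rm by (auto simp: edge_def X_def)
  have my: "match s (x s) s' y" using rm by (simp add: edge_def y_def X_def)
  define N where "N = (LEAST N. 0 < N \<and> y + N < X \<and> V s' (y + N) = V s' y)"
  have "0 < rm - r1 \<and> y + (rm - r1) < X \<and> V s' (y + (rm - r1)) = V s' y"
  proof -
    have r: "r1 < rm" "0 < r1" using rm_max[OF e2] r12 e1 by (auto simp: edge_def)
    have "y + (rm - r1) = X - r1" using r rmX by (simp add: y_def)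
    moreover have "V s' (X - r1) = V s' y" using e1 my by (simp add: edge_def match_def X_def)
    ultimately show ?thesis using r rmX by simp
  qed
  then have N: "0 < N \<and> y + N < X \<and> V s' (y + N) = V s' y"
    unfolding N_def by (rule LeastI)
  have Nmin: "N \<le> N'" if "0 < N'" "y + N' < X" "V s' (y + N') = V s' y" for N'
    unfolding N_def using that by (intro Least_le) simp
  have mN: "match s' y s' (y + N)" using N S XL by (intro match_before) auto
  define K where "K = (X - y - 1) div N"
  \<comment> \<open>In the range from \<open>1\<close> to \<open>N\<close> rather than from
    \<open>0\<close> to \<open>N - 1\<close>, because a move is never empty.\<close>
  define v where "v = (X - y - 1) mod N + 1"
  have "X - y - 1 = K * N + (X - y - 1) mod N" unfolding K_def by (simp only: div_mult_mod_eq)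
  then have XK: "X = y + K * N + v" unfolding v_def using N by linarith
  have v: "0 < v" "v \<le> N" using N by (simp_all add: v_def Suc_le_eq)
  have K: "0 < K" using N XK v by (cases K) auto
  define dd where "dd = (\<lambda>i. ep s' (y + N) i - ep s' y i)"
  define d where "d = (\<lambda>i. of_int (dd i) :: rat)"
  define c where "c = labl x s s' v"
  have per: "V s' (y + j + k * N) = V s' (y + j)" "ep s' (y + j + k * N) i - ep s' (y + j) i = int k * dd i"
    if "y + j + k * N < X" for j k i
    using periodic[OF mN, of j k] that XL unfolding dd_def by auto
  have visit: "match s (x s) s' (y + k * N)" if "k \<le> K" for k
  proof (cases "k = 0")
    case False
    have "k * N \<le> K * N" using that by simp
    then have lt: "y + k * N < X" using XK v by linarith
    have "0 < k * N" using False N by simp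
    moreover have "V s' (y + k * N) = V s' y" using per(1)[of 0 k] lt by simp
    ultimately have "match s' y s' (y + k * N)"
      using lt XL S by (intro match_before) auto
    then show ?thesis using my match_trans by blast
  qed (use my in simp)
  have rB: "X - (v + b * N) = y + (K - b) * N" if le: "b \<le> K" for b
  proof -
    obtain j where "K = b + j" using le_Suc_ex[OF le] by (elim exE)
    then have kj: "K - b = j" and "K * N = b * N + j * N" by (simp_all add: add_mult_distrib)
    then have "X = y + (b * N + j * N) + v" using XK by simp
    then show ?thesis unfolding kj by linarith
  qed
  have vB: "v + b * N \<le> X" if "b \<le> K" for b
  proof -
    have "b * N \<le> K * N" using that by simp
    then show ?thesis using XK by linarith
  qed
  have eB: "edge x s s' (v + b * N)" if "b \<le> K" for b
    unfolding edge_def using visit[of "K - b"] rB[OF that] vB[OF that] v XL by (simp add: X_def)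
  \<comment> \<open>By minimality of \<open>N\<close> and periodicity, the visits are exactly at the
    positions \<open>y + k N\<close>.\<close>
  have onlyB: "\<exists>b\<le>K. r = v + b * N" if r: "edge x s s' r" for r
  proof -
    have r': "0 < r" "r \<le> rm" "r \<le> X" using r rm_max[OF r] by (auto simp: edge_def X_def)
    define m where "m = rm - r"
    have m: "X - r = y + m" "y + m < X" using r' rmX by (simp_all add: m_def y_def)
    have Vm: "V s' (y + m) = V s' y" using r my m(1) by (simp add: edge_def match_def X_def)
    have ym: "y + m mod N + (m div N) * N = y + m" by simp
    have "V s' (y + m mod N) = V s' y"
      using per(1)[of "m mod N" "m div N", unfolded ym, OF m(2)] Vm by (rule trans[OF sym])
    moreover have "y + m mod N < X" using m(2) by (meson add_le_cancel_left le_less_trans mod_less_eq_dividend)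
    moreover have "m mod N < N" using N by simp
    ultimately have "m mod N = 0" using Nmin[of "m mod N"] by force
    then obtain k where k: "m = k * N" by (metis dvd_def mod_0_imp_dvd mult.commute)
    have kK: "k \<le> K"
    proof (rule ccontr)
      assume "\<not> k \<le> K"
      then have "Suc K * N \<le> k * N" by (intro mult_le_mono1) simp
      then show False using m(2) XK v k by simp
    qed
    have "r = X - (y + k * N)" using m r' k by linarith
    also have "\<dots> = v + (K - k) * N"
    proof -
      obtain j where "K = k + j" using kK le_Suc_ex by blast
      then show ?thesis using XK by (simp add: algebra_simps)
    qed
    finally show ?thesis by (intro exI[of _ "K - k"]) simp
  qed
  have lB: "labl x s s' (v + b * N) i = c i - of_int (int b) * d i" if "b \<le> K" for b i
  proof -
    have lt: "y + (K - b) * N < X" "y + K * N < X"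
    proof -
      have "(K - b) * N \<le> K * N" by simp
      then show "y + (K - b) * N < X" "y + K * N < X" using XK v by linarith+
    qed
    have "ep s' (y + (K - b) * N) i - ep s' y i = int (K - b) * dd i"
      "ep s' (y + K * N) i - ep s' y i = int K * dd i"
      using per(2)[of 0 "K - b" i] per(2)[of 0 K i] lt by simp_all
    moreover have "int (K - b) = int K - int b" using that by simp
    ultimately have E: "ep s' (y + (K - b) * N) i = ep s' (y + K * N) i - int b * dd i"
      by (simp add: algebra_simps)
    have "labl x s s' (v + b * N) i = of_int (ep s' (y + (K - b) * N) i - ep s (x s) i)"
      using rB[OF that] by (simp add: elab_def X_def)
    moreover have "c i = of_int (ep s' (y + K * N) i - ep s (x s) i)"
      using rB[of 0] by (simp add: c_def elab_def X_def)
    ultimately show ?thesis unfolding E d_def by simp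
  qed
  \<comment> \<open>The arrow coordinates of \<open>d\<close> add up to \<open>N\<close>, so it is
    not zero; its coordinate at \<open>s'\<close> vanishes while that of \<open>c\<close> is
    \<open>1\<close>.\<close>
  interpret bl: bipartite_labels Ix c d
  proof
    show "finite Ix" using finite_S finite_A by simp
    have "(\<Sum>a\<in>A. dd (Inr a)) = int N"
      using ep_deg[of s' "y + N"] ep_deg[of s' y] mN unfolding dd_def match_def by (simp add: sum_subtractf)
    then have "\<exists>a\<in>A. dd (Inr a) \<noteq> 0" using N by (metis of_nat_0_eq_iff sum.neutral less_numeral_extra(3))
    then show "nz_on Ix d" unfolding nz_on_def d_def by auto
    show "\<not> lindep Ix d c"
    proof
      assume "lindep Ix d c"
      then obtain z where z: "\<forall>i\<in>Ix. c i = z * d i" unfolding lindep_def by (elim exE)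
      have "d (Inl s') = 0" using mN S unfolding d_def dd_def match_def by (simp add: ep_Inl)
      moreover have "c (Inl s') = 1" using labl_Inl[OF eB[of 0]] S unfolding c_def by simp
      ultimately show False using z[rule_format, OF InlI[OF S(2)]] by simp
    qed
  qed
  define fa where "fa = (\<lambda>a :: int. f (move x s s' (nat a * N)))"
  define fb where "fb = (\<lambda>b :: int. f (move x s s' (v + nat b * N)))"
  have mv: "move x s s' r s = x s + r" "move x s s' r s' = X - r" for r
    using S by (auto simp: move_def X_def)
  have DB: "move x s s' (v + b * N) \<in> D" if "b \<le> K" for b using x_edges[OF eB[OF that]] .
  have L1: "x s + (v + K * N) \<le> L s" using edge_size(2)[OF eB[of K]] by simp
  have ls: "x s + j < L s" "match s (x s + j) s' (y + j)" if "y + j < X" for j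
    using match_shift(1)[OF my, of j] that XL by (auto simp: match_def)
  have XaN: "X - a * N = y + v + (K - a) * N" if le: "a \<le> K" for a
  proof -
    obtain j where "K = a + j" using le_Suc_ex[OF le] by (elim exE)
    then have kj: "K - a = j" and "K * N = a * N + j * N" by (simp_all add: add_mult_distrib)
    then have "X = y + (a * N + j * N) + v" using XK by simp
    then show ?thesis unfolding kj by linarith
  qed
  have aX: "a * N \<le> X" if "a \<le> K" for a
  proof -
    have "a * N \<le> K * N" using that by simp
    then show ?thesis using XK by linarith
  qed
  \<comment> \<open>The move by \<open>v\<close> leads into \<open>D\<close>, and a further move by
    \<open>a N - v\<close> stays there; the two lengths may also coincide, for \<open>a = 1\<close>
    and \<open>v = N\<close>.\<close>
  have DA: "move x s s' (a * N) \<in> D" if a: "1 \<le> a" "a \<le> K" for a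
  proof (cases "v = a * N")
    case True
    then show ?thesis using DB[of 0] by simp
  next
    case False
    have aN: "N \<le> a * N" using a by simp
    then have va: "v < a * N" using False v by linarith
    have lt: "y + (K - a) * N + v < X" using XaN[OF a(2)] aN N aX[OF a(2)] by linarith
    have "match s (x s + v) s' (y + (K - a) * N + v)"
      using match_shift(1)[OF visit[of "K - a"], of v] lt XL by simp
    moreover have "X - v - (a * N - v) = y + (K - a) * N + v" using XaN[OF a(2)] va by simp
    moreover have "0 < a * N - v" "a * N - v \<le> X - v" "X - v \<le> L s'"
      using va aX[OF a(2)] XL by linarith+
    ultimately have "edge (move x s s' v) s s' (a * N - v)"
      unfolding edge_def mv by simp
    from D_closed[OF DB[of 0, simplified] this] show ?thesis
      using S va by (simp add: move_move)
  qed
  \<comment> \<open>The moves by \<open>a N\<close> and by \<open>v + b N\<close> differ by a move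
    between the same two strings, which is possible by periodicity; the shorter of the two is its
    source.\<close>
  have cong: "bl.lab (int a + int b) dvd fa (int a) - fb (int b)" if a: "1 \<le> a" "a \<le> K" and b: "b \<le> K" for a b
  proof -
    have lab: "bl.lab (int a + int b) = lin Ix (\<lambda>i. c i - of_int (int a + int b) * d i)"
      by (simp add: bl.lab_def)
    consider "a * N < v + b * N" | "a * N = v + b * N" | "v + b * N < a * N" by linarith
    then show ?thesis
    proof cases
      case 1
      define r where "r = v + b * N - a * N"
      have mm: "move (move x s s' (a * N)) s s' r = move x s s' (v + b * N)"
        using S 1 by (simp add: move_move r_def)
      have Xr: "X - a * N - r = y + (K - b) * N" using rB[OF b] 1 by (simp add: r_def)
      have lt: "y + a * N < X"
      proof -
        have "a * N \<le> K * N" using a by simp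
        then show ?thesis using XK v by linarith
      qed
      have lt': "y + (K - b) * N < X" using rB[OF b] vB[OF b] v XK by linarith
      have "lin Ix (labl (move x s s' (a * N)) s s' r) dvd f (move x s s' (a * N)) - f (move x s s' (v + b * N))"
      proof (rule f_adj[OF DA[OF a], of s s' r, unfolded mm])
        show "move x s s' (v + b * N) \<in> D" by (rule DB[OF b])
        show "move x s s' (a * N) s + r \<le> L s" using edge_size(2)[OF eB[OF b]] 1 by (simp add: mv r_def)
        show "V s (move x s s' (a * N) s) = V s' (move x s s' (a * N) s' - r)"
          unfolding mv Xr using ls(2)[OF lt] per(1)[of 0 a] per(1)[of 0 "K - b"] lt lt'
          by (simp add: match_def)
      qed (use S vB[OF b] XL 1 in \<open>auto simp: mv r_def\<close>)
      moreover have "labl (move x s s' (a * N)) s s' r i = c i - of_int (int a + int b) * d i" for i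
      proof -
        have "ep s' (y + a * N) i - ep s (x s + a * N) i = ep s' y i - ep s (x s) i"
          using match_shift(2)[OF my, of "a * N" i] lt XL by simp
        moreover have "ep s' (y + a * N) i - ep s' y i = int a * dd i" using per(2)[of 0 a i] lt by simp
        ultimately have E: "ep s (x s + a * N) i = ep s (x s) i + int a * dd i" by linarith
        have "labl (move x s s' (a * N)) s s' r i = of_int (ep s' (y + (K - b) * N) i - ep s (x s) i - int a * dd i)"
          unfolding mv Xr by (simp add: elab_def E)
        also have "\<dots> = labl x s s' (v + b * N) i - of_int (int a) * d i"
          using rB[OF b] by (simp add: elab_def X_def d_def)
        also have "\<dots> = c i - of_int (int a + int b) * d i"
          unfolding lB[OF b] by (simp add: algebra_simps)
        finally show ?thesis .
      qed
      then have "labl (move x s s' (a * N)) s s' r = (\<lambda>i. c i - of_int (int a + int b) * d i)" by (rule ext)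
      ultimately show ?thesis unfolding lab fa_def fb_def by (simp only: nat_int)
    next
      case 2
      then show ?thesis unfolding fa_def fb_def by simp
    next
      case 3
      define r where "r = a * N - (v + b * N)"
      have mm: "move (move x s s' (v + b * N)) s s' r = move x s s' (a * N)"
        using S 3 by (simp add: move_move r_def)
      have Xr: "X - (v + b * N) - r = y + v + (K - a) * N" using XaN[OF a(2)] 3 by (simp add: r_def)
      have lt: "y + (v + b * N) < X"
      proof -
        have "a * N \<le> K * N" using a by simp
        then show ?thesis using XK v 3 by linarith
      qed
      have lt': "y + v + (K - a) * N < X" using Xr 3 XaN[OF a(2)] aX[OF a(2)] by linarith
      have "lin Ix (labl (move x s s' (v + b * N)) s s' r) dvd f (move x s s' (v + b * N)) - f (move x s s' (a * N))"
      proof (rule f_adj[OF DB[OF b], of s s' r, unfolded mm])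
        show "move x s s' (a * N) \<in> D" by (rule DA[OF a])
        have "x s + a * N \<le> L s"
        proof -
          have "a * N \<le> K * N" using a by simp
          then show ?thesis using L1 by linarith
        qed
        then show "move x s s' (v + b * N) s + r \<le> L s" using 3 by (simp add: mv r_def)
        show "V s (move x s s' (v + b * N) s) = V s' (move x s s' (v + b * N) s' - r)"
          unfolding mv Xr using ls(2)[OF lt] per(1)[of v b] per(1)[of v "K - a"] lt lt'
          by (simp add: match_def add.assoc)
      qed (use S aX[OF a(2)] XL 3 in \<open>auto simp: mv r_def\<close>)
      moreover have "labl (move x s s' (v + b * N)) s s' r i = c i - of_int (int a + int b) * d i" for i
      proof -
        have "ep s' (y + (v + b * N)) i - ep s (x s + (v + b * N)) i = ep s' y i - ep s (x s) i"
          using match_shift(2)[OF my lt[THEN less_le_trans, OF XL], of i] .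
        moreover have "ep s' (y + (v + b * N)) i - ep s' (y + v) i = int b * dd i"
          using per(2)[of v b i] lt by (simp add: add.assoc)
        moreover have "ep s' (y + v + (K - a) * N) i - ep s' (y + v) i = int (K - a) * dd i"
          using per(2)[of v "K - a" i] lt' by simp
        moreover have "int (K - a) = int K - int a" using a by simp
        moreover have "ep s' (y + K * N) i - ep s' y i = int K * dd i"
          using per(2)[of 0 K i] XK v by simp
        ultimately have "ep s' (y + v + (K - a) * N) i - ep s (x s + (v + b * N)) i =
            (ep s' (y + K * N) i - ep s (x s) i) - (int a + int b) * dd i"
          by (simp add: algebra_simps)
        moreover have "c i = of_int (ep s' (y + K * N) i - ep s (x s) i)"
          using rB[of 0] by (simp add: c_def elab_def X_def)
        moreover have "labl (move x s s' (v + b * N)) s s' r i =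
            of_int (ep s' (y + v + (K - a) * N) i - ep s (x s + (v + b * N)) i)"
          unfolding mv Xr by (simp add: elab_def)
        ultimately show ?thesis by (simp add: d_def)
      qed
      then have "labl (move x s s' (v + b * N)) s s' r = (\<lambda>i. c i - of_int (int a + int b) * d i)" by (rule ext)
      ultimately have "bl.lab (int a + int b) dvd fb (int b) - fa (int a)"
        unfolding lab fa_def fb_def by (simp only: nat_int)
      then show ?thesis using dvd_minus_iff minus_diff_eq by metis
    qed
  qed
  have "\<exists>g. \<forall>b. 0 \<le> b \<longrightarrow> b < int (Suc K) \<longrightarrow> bl.lab b dvd g - fb b"
  proof (rule bl.bipartite_extension)
    fix a b :: int assume "1 \<le> a" "a < int (Suc K)" "0 \<le> b" "b < int (Suc K)"
    then show "bl.lab (a + b) dvd fa a - fb b" using cong[of "nat a" "nat b"] by simp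
  qed
  then obtain g where g: "\<And>b. 0 \<le> b \<Longrightarrow> b < int (Suc K) \<Longrightarrow> bl.lab b dvd g - fb b" by blast
  show ?thesis
  proof (intro exI[of _ g] allI impI)
    fix r assume "edge x s s' r"
    then obtain b where b: "b \<le> K" "r = v + b * N" using onlyB by blast
    have "labl x s s' r = (\<lambda>i. c i - of_int (int b) * d i)" unfolding b(2) using lB[OF b(1)] by (simp add: fun_eq_iff)
    then have "lin Ix (labl x s s' r) = bl.lab (int b)" unfolding bl.lab_def by simp
    moreover have "fb (int b) = f (move x s s' r)" by (simp add: fb_def b)
    ultimately show "lin Ix (labl x s s' r) dvd g - f (move x s s' r)" using g[of "int b"] b by simp
  qed
qed

end

section \<open>Labels in one plane\<close>

context string_model_class
begin

lemma pair_extension: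
  assumes n: "edge x s s' r" and k: "edge x t t' r'" and ne: "(s, s') \<noteq> (t, t')"
  shows "cong2 Ix (labl x s s' r) (labl x t t' r') (f (move x s s' r)) (f (move x t t' r'))"
proof -
  consider "s = t" "s' \<noteq> t'" | "s' = t'" "s \<noteq> t" | "s' = t" | "t' = s"
    | "s \<noteq> t" "s \<noteq> t'" "s' \<noteq> t" "s' \<noteq> t'"
    using ne by auto
  then show ?thesis
  proof cases
    case 1
    then show ?thesis using pair_source n k by simp
  next
    case 2
    then show ?thesis using pair_target n k by simp
  next
    case 3
    then show ?thesis using pair_chain n k by simp
  next
    case 4
    then show ?thesis using pair_chain[of t s r' s' r] n k cong2_commute cong2_sym by metis
  next
    case 5
    then show ?thesis using pair_disjoint n k by simp
  qed
qed

definition good :: "('s + 'a) qpoly \<Rightarrow> 's \<times> 's \<times> nat \<Rightarrow> bool" where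
  "good g = (\<lambda>(s, s', r). lin Ix (labl x s s' r) dvd g - f (move x s s' r))"

lemma triangle_good:
  assumes "edge x p q r" "edge x q w r'" "edge x p w r''"
    and "\<And>i. i \<in> Ix \<Longrightarrow> labl x p w r'' i = labl x p q r i + labl x q w r' i"
  shows "\<exists>g. good g (p, q, r) \<and> good g (q, w, r') \<and> good g (p, w, r'')"
  using triangle_extension[OF assms] unfolding good_def by simp

text \<open>The configurations in which the third label is the combination of the first two with
  coefficients \<open>\<sigma>\<close> and \<open>\<tau>\<close>: common source, common target, or a
  chain, each in two orders.\<close>

definition triangle_rel :: "'s \<Rightarrow> 's \<Rightarrow> 's \<Rightarrow> 's \<Rightarrow> 's \<Rightarrow> 's \<Rightarrow> rat \<Rightarrow> rat \<Rightarrow> bool" where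
  "triangle_rel s s' t t' u u' \<sigma> \<tau> \<longleftrightarrow>
    (s = t \<and> u = t' \<and> u' = s' \<and> \<sigma> = 1 \<and> \<tau> = -1) \<or> (s = t \<and> u = s' \<and> u' = t' \<and> \<sigma> = -1 \<and> \<tau> = 1) \<or>
    (s' = t' \<and> u = s \<and> u' = t \<and> \<sigma> = 1 \<and> \<tau> = -1) \<or> (s' = t' \<and> u = t \<and> u' = s \<and> \<sigma> = -1 \<and> \<tau> = 1) \<or>
    (s' = t \<and> u = s \<and> u' = t' \<and> \<sigma> = 1 \<and> \<tau> = 1) \<or> (s = t' \<and> u = t \<and> u' = s' \<and> \<sigma> = 1 \<and> \<tau> = 1)"

lemma plane_root_relation:
  assumes n: "edge x s s' r" and k: "edge x t t' r'" and j: "edge x u u' r''"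
    and ne: "(s, s') \<noteq> (t, t')" and jn: "(u, u', r'') \<notin> {(s, s', r), (t, t', r')}"
    and plane: "in_plane Ix (labl x s s' r) (labl x t t' r') (labl x u u' r'')"
  shows "\<exists>\<sigma> \<tau>. (\<forall>i\<in>Ix. labl x u u' r'' i = \<sigma> * labl x s s' r i + \<tau> * labl x t t' r' i) \<and>
    triangle_rel s s' t t' u u' \<sigma> \<tau>"
proof -
  obtain \<sigma> \<tau> where st: "\<forall>i\<in>Ix. labl x u u' r'' i = \<sigma> * labl x s s' r i + \<tau> * labl x t t' r' i"
    using plane unfolding in_plane_def by (elim exE)
  have S: "s \<in> S" "s' \<in> S" "t \<in> S" "t' \<in> S" "u \<in> S" "u' \<in> S"
    using edge_size n k j by blast+
  have "\<sigma> \<noteq> 0"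
  proof
    assume "\<sigma> = 0"
    then have "lindep Ix (labl x t t' r') (labl x u u' r'')" using st unfolding lindep_def by simp
    then show False using labl_indep[OF k j] jn by simp
  qed
  moreover have "\<tau> \<noteq> 0"
  proof
    assume "\<tau> = 0"
    then have "lindep Ix (labl x s s' r) (labl x u u' r'')" using st unfolding lindep_def by simp
    then show False using labl_indep[OF n j] jn by simp
  qed
  moreover have "of_bool (w = u') - of_bool (w = u) =
      \<sigma> * (of_bool (w = s') - of_bool (w = s)) + \<tau> * (of_bool (w = t') - of_bool (w = t))"
    if "w \<in> {s, s', t, t', u, u'}" for w
  proof -
    have w: "w \<in> S" using that S by blast
    show ?thesis
      using st[rule_format, OF InlI[OF w]] labl_Inl[OF n w] labl_Inl[OF k w] labl_Inl[OF j w] by simp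
  qed
  moreover have "(s, s') \<noteq> (t', t)" using edge_asym n k by blast
  ultimately have rel: "(s = t \<and> \<tau> = - \<sigma> \<and> (u = t' \<and> u' = s' \<and> \<sigma> = 1 \<or> u = s' \<and> u' = t' \<and> \<sigma> = -1)) \<or>
    (s' = t' \<and> \<tau> = - \<sigma> \<and> (u = s \<and> u' = t \<and> \<sigma> = 1 \<or> u = t \<and> u' = s \<and> \<sigma> = -1)) \<or>
    (s' = t \<and> \<tau> = \<sigma> \<and> (u = s \<and> u' = t' \<and> \<sigma> = 1 \<or> u = t' \<and> u' = s \<and> \<sigma> = -1)) \<or>
    (s = t' \<and> \<tau> = \<sigma> \<and> (u = t \<and> u' = s' \<and> \<sigma> = 1 \<or> u = s' \<and> u' = t \<and> \<sigma> = -1))"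
    using ne edge_neq[OF n] edge_neq[OF k] edge_neq[OF j]
    by (intro root_relation) auto
  \<comment> \<open>In a cyclic chain of three arcs the lengths of the present parts would decrease
    strictly around a cycle.\<close>
  have "\<not> (s' = t \<and> u = t' \<and> u' = s)" "\<not> (s = t' \<and> u = s' \<and> u' = t)"
    using edge_size(1)[OF n] edge_size(1)[OF k] edge_size(1)[OF j] by auto
  then have "triangle_rel s s' t t' u u' \<sigma> \<tau>" using rel unfolding triangle_rel_def by (elim disjE conjE) simp_all
  then show ?thesis using st by (intro exI[of _ \<sigma>] exI[of _ \<tau>] conjI)
qed

text \<open>Two further labels come from the same configuration of \<open>triangle_rel\<close> or
  from its reversal, which would give opposite arcs. So they have equal coefficients, hence are
  equal, and \<open>labl_indep\<close> identifies the arcs.\<close>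

lemma plane_unique:
  assumes n: "edge x s s' r" and k: "edge x t t' r'" and j: "edge x u u' a" and j': "edge x w w' b"
    and ne: "(s, s') \<noteq> (t, t')"
    and jn: "(u, u', a) \<notin> {(s, s', r), (t, t', r')}" and jn': "(w, w', b) \<notin> {(s, s', r), (t, t', r')}"
    and plane: "in_plane Ix (labl x s s' r) (labl x t t' r') (labl x u u' a)"
    and plane': "in_plane Ix (labl x s s' r) (labl x t t' r') (labl x w w' b)"
  shows "(u, u', a) = (w, w', b)"
proof -
  obtain \<sigma> \<tau> where 1: "\<forall>i\<in>Ix. labl x u u' a i = \<sigma> * labl x s s' r i + \<tau> * labl x t t' r' i"
    "triangle_rel s s' t t' u u' \<sigma> \<tau>"
    using plane_root_relation[OF n k j ne jn plane] by (elim exE conjE)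
  obtain \<sigma>' \<tau>' where 2: "\<forall>i\<in>Ix. labl x w w' b i = \<sigma>' * labl x s s' r i + \<tau>' * labl x t t' r' i"
    "triangle_rel s s' t t' w w' \<sigma>' \<tau>'"
    using plane_root_relation[OF n k j' ne jn' plane'] by (elim exE conjE)
  have asym: "\<not> (u = w' \<and> u' = w)" using edge_asym[OF j, of b] j' by auto
  have nn: "s \<noteq> s'" "t \<noteq> t'" using edge_neq n k by blast+
  have nk: "\<not> (s = t' \<and> s' = t)" using edge_asym[OF n, of r'] k by auto
  have "\<sigma> = \<sigma>' \<and> \<tau> = \<tau>'"
    using 1(2) 2(2) asym nn nk ne unfolding triangle_rel_def by (elim disjE) simp_all
  then have "\<forall>i\<in>Ix. labl x w w' b i = 1 * labl x u u' a i" using 1(1) 2(1) by simp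
  then have "lindep Ix (labl x u u' a) (labl x w w' b)" unfolding lindep_def by (rule exI)
  then show ?thesis using labl_indep[OF j j'] by simp
qed

text \<open>Either the two labels belong to one pair of strings, and then all labels in the plane
  do, or at most one further label lies in the plane.\<close>

lemma plane_extension:
  assumes n: "edge x s s' r" and k: "edge x t t' r'" and nk: "(s, s', r) \<noteq> (t, t', r')"
  shows "\<exists>g. \<forall>u u' a. edge x u u' a \<longrightarrow> in_plane Ix (labl x s s' r) (labl x t t' r') (labl x u u' a) \<longrightarrow> good g (u, u', a)"
proof (cases "(s, s') = (t, t')")
  case True
  then have k': "edge x s s' r'" and "r \<noteq> r'" using k nk by auto
  then obtain g where g: "\<And>r. edge x s s' r \<Longrightarrow> lin Ix (labl x s s' r) dvd g - f (move x s s' r)"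
    using pencil_extension[OF n k'] pencil_extension[OF k' n] by (metis linorder_neqE_nat)
  show ?thesis
  proof (intro exI[of _ g] allI impI)
    fix u u' a assume e: "edge x u u' a" and pl: "in_plane Ix (labl x s s' r) (labl x t t' r') (labl x u u' a)"
    obtain z y where zy: "\<forall>i\<in>Ix. labl x u u' a i = z * labl x s s' r i + y * labl x t t' r' i"
      using pl unfolding in_plane_def by (elim exE)
    have Z: "of_bool (w = u') - of_bool (w = u) = (z + y) * (of_bool (w = s') - of_bool (w = s))" if w: "w \<in> S" for w
      using zy[rule_format, OF InlI[OF w]] labl_Inl[OF n w] labl_Inl[OF k w] labl_Inl[OF e w] True
      by (simp add: algebra_simps)
    have S: "u \<in> S" "u' \<in> S" using edge_size[OF e] by auto
    have ne: "s \<noteq> s'" "u \<noteq> u'" using edge_neq n e by blast+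
    have "u = s' \<and> z + y = -1 \<or> u = s \<and> z + y = 1"
      using Z[OF S(1)] ne by (cases "u = s"; cases "u = s'") auto
    moreover have "u' = s' \<and> z + y = 1 \<or> u' = s \<and> z + y = -1"
      using Z[OF S(2)] ne by (cases "u' = s"; cases "u' = s'") auto
    ultimately have "(u = s \<and> u' = s') \<or> (u = s' \<and> u' = s)" by auto
    then have "u = s" "u' = s'" using edge_asym[OF n, of a] e by auto
    then show "good g (u, u', a)" using g e by (simp add: good_def)
  qed
next
  case False
  show ?thesis
  proof (cases "\<exists>u u' a. edge x u u' a \<and> in_plane Ix (labl x s s' r) (labl x t t' r') (labl x u u' a) \<and>
      (u, u', a) \<notin> {(s, s', r), (t, t', r')}")
    case True
    then obtain u u' a where j: "edge x u u' a" and pl: "in_plane Ix (labl x s s' r) (labl x t t' r') (labl x u u' a)"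
      and jn: "(u, u', a) \<notin> {(s, s', r), (t, t', r')}" by (elim exE conjE)
    obtain \<sigma> \<tau> where 1: "\<forall>i\<in>Ix. labl x u u' a i = \<sigma> * labl x s s' r i + \<tau> * labl x t t' r' i"
      and 2: "triangle_rel s s' t t' u u' \<sigma> \<tau>"
      using plane_root_relation[OF n k j False jn pl] by (elim exE conjE)
    have "\<exists>g. good g (s, s', r) \<and> good g (t, t', r') \<and> good g (u, u', a)"
      using 2 unfolding triangle_rel_def
    proof (elim disjE conjE)
      assume *: "s = t" "u = t'" "u' = s'" "\<sigma> = 1" "\<tau> = -1"
      show ?thesis using triangle_good[of t t' r' s' a r] n k j 1 unfolding * by auto
    next
      assume *: "s = t" "u = s'" "u' = t'" "\<sigma> = -1" "\<tau> = 1"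
      show ?thesis using triangle_good[of t s' r t' a r'] n k j 1 unfolding * by auto
    next
      assume *: "s' = t'" "u = s" "u' = t" "\<sigma> = 1" "\<tau> = -1"
      show ?thesis using triangle_good[of s t a t' r' r] n k j 1 unfolding * by auto
    next
      assume *: "s' = t'" "u = t" "u' = s" "\<sigma> = -1" "\<tau> = 1"
      show ?thesis using triangle_good[of t s a t' r r'] n k j 1 unfolding * by auto
    next
      assume *: "s' = t" "u = s" "u' = t'" "\<sigma> = 1" "\<tau> = 1"
      show ?thesis using triangle_good[of s t r t' r' a] n k j 1 unfolding * by auto
    next
      assume *: "s = t'" "u = t" "u' = s'" "\<sigma> = 1" "\<tau> = 1"
      show ?thesis using triangle_good[of t t' r' s' r a] n k j 1 unfolding * by (auto simp: add.commute)
    qed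
    then obtain g where g: "good g (s, s', r)" "good g (t, t', r')" "good g (u, u', a)" by (elim exE conjE)
    show ?thesis
    proof (intro exI[of _ g] allI impI)
      fix w w' b assume e: "edge x w w' b" and pl': "in_plane Ix (labl x s s' r) (labl x t t' r') (labl x w w' b)"
      show "good g (w, w', b)"
      proof (cases "(w, w', b) \<in> {(s, s', r), (t, t', r')}")
        case False
        then show ?thesis
          using plane_unique[OF n k j e \<open>(s, s') \<noteq> (t, t')\<close> jn False pl pl'] g(3) by simp
      qed (use g(1,2) in auto)
    qed
  next
    case none: False
    obtain g where "lin Ix (labl x s s' r) dvd g - f (move x s s' r)" "lin Ix (labl x t t' r') dvd g - f (move x t t' r')"
      using congruence_pair[OF pair_extension[OF n k False, unfolded cong2_def]] by (elim exE conjE)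
    then have "good g (s, s', r)" "good g (t, t', r')" by (simp_all add: good_def)
    then show ?thesis using none by (intro exI[of _ g]) auto
  qed
qed

theorem string_extension:
  "\<exists>g. \<forall>s s' r. edge x s s' r \<longrightarrow> lin Ix (labl x s s' r) dvd g - f (move x s s' r)"
proof -
  define J where "J = {(s, s', r). edge x s s' r}"
  have "J \<subseteq> S \<times> S \<times> {..Max (x ` S)}"
  proof
    fix j assume "j \<in> J"
    moreover obtain s s' r where j: "j = (s, s', r)" by (cases j)
    ultimately have e: "edge x s s' r" by (simp add: J_def)
    have "r \<le> x s'" using e by (simp add: edge_def)
    also have "\<dots> \<le> Max (x ` S)" using edge_size(5)[OF e] finite_S by simp
    finally show "j \<in> S \<times> S \<times> {..Max (x ` S)}" using edge_size(4,5)[OF e] j by simp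
  qed
  then have "finite J" by (rule finite_subset) (simp add: finite_S)
  have "\<exists>g. \<forall>j\<in>J. lin Ix ((\<lambda>(s, s', r). labl x s s' r) j) dvd g - (\<lambda>(s, s', r). f (move x s s' r)) j"
  proof (rule extension_criterion)
    show "finite Ix" using finite_S finite_A by simp
    show "finite J" by fact
    show "nz_on Ix ((\<lambda>(s, s', r). labl x s s' r) j)" if "j \<in> J" for j
      using that labl_nz by (auto simp: J_def)
    show "\<not> lindep Ix ((\<lambda>(s, s', r). labl x s s' r) j) ((\<lambda>(s, s', r). labl x s s' r) k)"
      if "j \<in> J" "k \<in> J" "j \<noteq> k" for j k
      using that labl_indep by (auto simp: J_def)
    show "\<exists>g. \<forall>j\<in>J. in_plane Ix ((\<lambda>(s, s', r). labl x s s' r) n) ((\<lambda>(s, s', r). labl x s s' r) k)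
          ((\<lambda>(s, s', r). labl x s s' r) j) \<longrightarrow>
        lin Ix ((\<lambda>(s, s', r). labl x s s' r) j) dvd g - (\<lambda>(s, s', r). f (move x s s' r)) j"
      if "n \<in> J" "k \<in> J" "n \<noteq> k" for n k
    proof -
      obtain s s' r t t' r' where nk: "n = (s, s', r)" "k = (t, t', r')" by (cases n; cases k)
      have "edge x s s' r" "edge x t t' r'" "(s, s', r) \<noteq> (t, t', r')"
        using that by (auto simp: J_def nk)
      from plane_extension[OF this] show ?thesis unfolding nk J_def good_def by auto
    qed
  qed
  then show ?thesis by (auto simp: J_def)
qed

end

section \<open>Topology of Grassmannians\<close>

lemma family_independentI:
  fixes w :: "'j \<Rightarrow> complex ^ 'n::finite"
  assumes "finite A" and *: "\<And>d l. (\<Sum>l\<in>A. d l *s w l) = 0 \<Longrightarrow> l \<in> A \<Longrightarrow> d l = 0"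
  shows "inj_on w A" "vec.independent (w ` A)"
proof -
  show inj: "inj_on w A"
  proof (rule inj_onI, rule ccontr)
    fix i j assume ij: "i \<in> A" "j \<in> A" "w i = w j" "i \<noteq> j"
    define d :: "'j \<Rightarrow> complex" where "d = (\<lambda>l. if l = i then 1 else if l = j then -1 else 0)"
    have "(\<Sum>l\<in>A. d l *s w l) = (\<Sum>l\<in>{i, j}. d l *s w l)"
      using ij assms(1) by (intro sum.mono_neutral_right) (auto simp: d_def)
    also have "\<dots> = 0" using ij by (simp add: d_def)
    finally have "d i = 0" using * ij(1) by blast
    then show False by (simp add: d_def)
  qed
  show "vec.independent (w ` A)"
  proof
    assume "vec.dependent (w ` A)"
    then obtain u where u: "\<exists>v\<in>w ` A. u v \<noteq> 0" "(\<Sum>v\<in>w ` A. u v *s v) = 0"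
      using assms(1) by (auto simp: vec.dependent_finite)
    have "(\<Sum>l\<in>A. u (w l) *s w l) = 0" using u(2) inj by (simp add: sum.reindex)
    then show False using u(1) *[of "\<lambda>l. u (w l)"] by auto
  qed
qed

abbreviation tuple_top :: "nat \<Rightarrow> (nat \<Rightarrow> complex ^ 'n::finite) topology" where
  "tuple_top k \<equiv> product_topology (\<lambda>_. euclidean) {..<k}"

text \<open>Coordinates dual to \<open>w0\<close> turn \<open>w0\<close> into the identity matrix;
  for nearby tuples the matrix stays diagonally dominant, so they remain independent.\<close>

lemma frames_open:
  assumes w0: "w0 \<in> frames k (UNIV :: (complex ^ 'n::finite) set)"
  shows "\<exists>N. openin (tuple_top k) N \<and> w0 \<in> N \<and> N \<subseteq> frames k UNIV"
proof -
  define B where "B = vec.extend_basis (w0 ` {..<k})"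
  have ind: "vec.independent (w0 ` {..<k})" and inj: "inj_on w0 {..<k}" and ext: "w0 \<in> {..<k} \<rightarrow>\<^sub>E UNIV"
    using w0 by (auto simp: frames_def)
  have B: "vec.independent B" "w0 ` {..<k} \<subseteq> B" "vec.span B = UNIV"
    unfolding B_def using ind vec.independent_extend_basis vec.extend_basis_superset vec.span_extend_basis by blast+
  define \<psi> where "\<psi> = (\<lambda>j v. vec.representation B v (w0 j))"
  have add: "\<psi> j (u + v) = \<psi> j u + \<psi> j v" for j u v
    using B by (simp add: \<psi>_def vec.representation_add)
  have scale: "\<psi> j (c *s v) = c * \<psi> j v" for j c v
    using B by (simp add: \<psi>_def vec.representation_scale)
  have "linear (\<psi> j)" for j
  proof (rule linearI)
    show "\<psi> j (r *\<^sub>R v) = r *\<^sub>R \<psi> j v" for r v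
    proof -
      have "r *\<^sub>R v = complex_of_real r *s v" by (simp add: vec_eq_iff scaleR_conv_of_real[where 'a = complex])
      then show ?thesis by (simp add: scale scaleR_conv_of_real)
    qed
  qed (rule add)
  then have cont: "continuous_on UNIV (\<psi> j)" for j
    by (simp add: linear_continuous_on linear_conv_bounded_linear)
  have \<psi>0: "\<psi> j (w0 l) = of_bool (j = l)" if "j < k" "l < k" for j l
    using B that inj by (auto simp: \<psi>_def vec.representation_basis subset_iff inj_on_eq_iff)
  have \<psi>sum: "\<psi> j (sum g A) = (\<Sum>a\<in>A. \<psi> j (g a))" for j A and g :: "nat \<Rightarrow> complex ^ 'n"
    using linear_sum[OF \<open>linear (\<psi> j)\<close>] .
  \<comment> \<open>Small enough for \<open>k\<close> errors to add up to less than
    \<open>1\<close>, also for \<open>k = 0\<close>.\<close>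
  define \<epsilon> where "\<epsilon> = 1 / (real k + 1)"
  have \<epsilon>: "0 < \<epsilon>" "real k * \<epsilon> < 1" by (simp_all add: \<epsilon>_def)
  define N where "N = (\<Inter>(j, l)\<in>{..<k} \<times> {..<k}. {w \<in> topspace (tuple_top k). \<psi> j (w l) \<in> ball (of_bool (j = l)) \<epsilon>})
    \<inter> topspace (tuple_top k)"
  have "openin (tuple_top k) N"
    unfolding N_def
  proof (rule openin_INT)
    fix p assume "p \<in> {..<k} \<times> {..<k}"
    then obtain j l where p: "p = (j, l)" "l < k" by auto
    have "continuous_map (tuple_top k) euclidean (\<psi> j \<circ> (\<lambda>w. w l))"
      using p(2) cont by (intro continuous_map_compose[OF continuous_map_product_projection]) (auto simp: continuous_map_iff_continuous2)
    from openin_continuous_map_preimage[OF this, of "ball (of_bool (j = l)) \<epsilon>"]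
    show "openin (tuple_top k) (case p of (j, l) \<Rightarrow> {w \<in> topspace (tuple_top k). \<psi> j (w l) \<in> ball (of_bool (j = l)) \<epsilon>})"
      by (simp add: p(1))
  qed simp
  moreover have "w0 \<in> N" using ext \<epsilon>(1) by (auto simp: N_def \<psi>0)
  moreover have "N \<subseteq> frames k UNIV"
  proof
    fix w assume w: "w \<in> N"
    then have near: "cmod (\<psi> j (w l) - of_bool (j = l)) < \<epsilon>" if "j < k" "l < k" for j l
      using that by (force simp: N_def dist_norm norm_minus_commute)
    have dz: "d l = 0" if d: "(\<Sum>l\<in>{..<k}. d l *s w l) = 0" "l \<in> {..<k}" for d l
    proof -
      have ne: "(\<lambda>l. cmod (d l)) ` {..<k} \<noteq> {}" using d(2) by auto
      \<comment> \<open>The coefficient of largest absolute value is bounded by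
        \<open>k \<epsilon> < 1\<close> times itself, so all coefficients vanish.\<close>
      have "Max ((\<lambda>l. cmod (d l)) ` {..<k}) \<in> (\<lambda>l. cmod (d l)) ` {..<k}"
        using ne by (intro Max_in) auto
      then obtain m where m: "m < k" "Max ((\<lambda>l. cmod (d l)) ` {..<k}) = cmod (d m)" by auto
      have max: "cmod (d l) \<le> cmod (d m)" if "l < k" for l
        unfolding m(2)[symmetric] using that by (intro Max_ge) auto
      have "0 = \<psi> m (\<Sum>l\<in>{..<k}. d l *s w l)" using d(1) scale[of m 0 0] by simp
      also have "\<dots> = (\<Sum>l<k. d l * \<psi> m (w l))" by (simp add: \<psi>sum scale)
      also have "\<dots> = (\<Sum>l<k. d l * (\<psi> m (w l) - of_bool (m = l)) + (if l = m then d m else 0))"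
        by (intro sum.cong) (auto simp: algebra_simps)
      also have "\<dots> = (\<Sum>l<k. d l * (\<psi> m (w l) - of_bool (m = l))) + d m"
        using m(1) by (simp add: sum.distrib)
      finally have "d m = - (\<Sum>l<k. d l * (\<psi> m (w l) - of_bool (m = l)))"
        by (metis add.commute add_eq_0_iff)
      then have "cmod (d m) = cmod (\<Sum>l<k. d l * (\<psi> m (w l) - of_bool (m = l)))"
        by (metis norm_minus_cancel)
      also have "\<dots> \<le> (\<Sum>l<k. cmod (d l * (\<psi> m (w l) - of_bool (m = l))))" by (rule norm_sum)
      also have "\<dots> \<le> (\<Sum>l<k. cmod (d m) * \<epsilon>)"
      proof (rule sum_mono)
        fix l assume "l \<in> {..<k}"
        then show "cmod (d l * (\<psi> m (w l) - of_bool (m = l))) \<le> cmod (d m) * \<epsilon>"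
          unfolding norm_mult using max[of l] near[OF m(1), of l] by (intro mult_mono) auto
      qed
      also have "\<dots> = cmod (d m) * (real k * \<epsilon>)" by simp
      finally have le: "cmod (d m) \<le> cmod (d m) * (real k * \<epsilon>)" .
      have "cmod (d m) = 0"
      proof (rule ccontr)
        assume "cmod (d m) \<noteq> 0"
        then have "cmod (d m) * (real k * \<epsilon>) < cmod (d m) * 1"
          using \<epsilon>(2) by (intro mult_strict_left_mono) auto
        then show False using le by simp
      qed
      then show ?thesis using max[of l] d(2) by simp
    qed
    have "inj_on w {..<k}" "vec.independent (w ` {..<k})"
      by (rule family_independentI, simp, rule dz, assumption+)+
    then show "w \<in> frames k UNIV"
      using w by (auto simp: N_def frames_def)
  qed
  ultimately show ?thesis by blast
qed

lemma Gr_frame: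
  assumes "U \<in> Gr k V"
  shows "\<exists>w\<in>frames (nat k) V. vec.span (w ` {..<nat k}) = U"
proof -
  have U: "vec.subspace U" "U \<subseteq> V" "vec.dim U = nat k" using assms by (auto simp: Gr_def)
  obtain B where B: "B \<subseteq> U" "vec.independent B" "U \<subseteq> vec.span B" "card B = vec.dim U"
    using vec.basis_exists[of U] by blast
  have fin: "finite B" using vec.finiteI_independent[OF B(2)] .
  then obtain h where h: "bij_betw h {..<nat k} B"
    using ex_bij_betw_nat_finite[OF fin] B(4) U(3) by (auto simp: atLeast0LessThan)
  define w where "w = restrict h {..<nat k}"
  have img: "w ` {..<nat k} = B" using h by (simp add: w_def bij_betw_def)
  have "w \<in> frames (nat k) V"
    using h B U img unfolding frames_def by (auto simp: w_def bij_betw_def inj_on_def)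
  moreover have "vec.span B = U" using B(1,3) U(1) vec.span_minimal by blast
  ultimately show ?thesis using img by blast
qed

lemma frames_UNIV: "frames k V = frames k UNIV \<inter> ({..<k} \<rightarrow>\<^sub>E V)"
  by (auto simp: frames_def)

lemma span_frame_in_Gr:
  assumes "vec.subspace V" "0 \<le> k" "w \<in> frames (nat k) V"
  shows "vec.span (w ` {..<nat k}) \<in> Gr k V"
proof -
  have "w ` {..<nat k} \<subseteq> V" using assms by (auto simp: frames_def)
  then have "vec.span (w ` {..<nat k}) \<subseteq> V" using assms(1) by (rule vec.span_minimal)
  moreover have "vec.dim (vec.span (w ` {..<nat k})) = nat k"
    using assms by (simp add: frames_def vec.dim_eq_card_independent card_image)
  ultimately show ?thesis using assms by (simp add: Gr_def)
qed

lemma continuous_map_span: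
  assumes "vec.subspace V" "0 \<le> k"
  shows "continuous_map (subtopology (tuple_top (nat k)) (frames (nat k) V)) (Gr_top k V)
    (\<lambda>w. vec.span (w ` {..<nat k}))"
  unfolding continuous_map_def
proof (intro conjI allI impI)
  let ?F = "subtopology (tuple_top (nat k)) (frames (nat k) V)"
  have F: "topspace ?F = frames (nat k) V" by (auto simp: frames_def)
  show "(\<lambda>w. vec.span (w ` {..<nat k})) \<in> topspace ?F \<rightarrow> topspace (Gr_top k V)"
    unfolding F topspace_Gr_top[OF assms(1)] using span_frame_in_Gr[OF assms] by blast
  show "openin ?F {w \<in> topspace ?F. vec.span (w ` {..<nat k}) \<in> S}" if "openin (Gr_top k V) S" for S
    using that unfolding F openin_Gr_top Gr_openin_def by blast
qed

text \<open>The span map is open: if \<open>w\<close> has the same span as a frame \<open>w1\<close>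
  in \<open>A\<close>, then \<open>w1\<close> arises from \<open>w\<close> by a matrix
  \<open>g\<close> of scalars. The same matrix turns each tuple \<open>u\<close> near
  \<open>w\<close> into a frame in \<open>A\<close> with the span of \<open>u\<close>.\<close>

lemma span_frames_openin:
  assumes V: "vec.subspace V" "0 \<le> k" and A: "openin (tuple_top (nat k)) A"
  shows "openin (Gr_top k V) ((\<lambda>w. vec.span (w ` {..<nat k})) ` (A \<inter> frames (nat k) V))"
proof -
  let ?k = "nat k"
  let ?sp = "\<lambda>w. vec.span (w ` {..<?k})"
  let ?S = "?sp ` (A \<inter> frames ?k V)"
  have "openin (subtopology (tuple_top ?k) (frames ?k V)) {w \<in> frames ?k V. ?sp w \<in> ?S}"
  proof (subst openin_subopen, intro ballI)
    fix w assume w: "w \<in> {w \<in> frames ?k V. ?sp w \<in> ?S}"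
    then obtain w1 where w1: "w1 \<in> A" "w1 \<in> frames ?k V" "?sp w1 = ?sp w" by auto
    have inj: "inj_on w {..<?k}" and indw: "vec.independent (w ` {..<?k})" using w by (auto simp: frames_def)
    have "\<exists>g. w1 j = (\<Sum>l<?k. g l *s w l)" if "j < ?k" for j
    proof -
      have "w1 j \<in> ?sp w1" using that by (intro vec.span_base) auto
      then have in_span: "w1 j \<in> ?sp w" using w1(3) by simp
      have "w1 j = (\<Sum>v\<in>w ` {..<?k}. vec.representation (w ` {..<?k}) (w1 j) v *s v)"
        using vec.sum_representation_eq[OF indw in_span, of "w ` {..<?k}"] by simp
      also have "\<dots> = (\<Sum>l<?k. vec.representation (w ` {..<?k}) (w1 j) (w l) *s w l)"
        using inj by (simp add: sum.reindex)
      finally show ?thesis by (rule exI[of _ "\<lambda>l. vec.representation (w ` {..<?k}) (w1 j) (w l)"])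
    qed
    then obtain g where g: "\<And>j. j < ?k \<Longrightarrow> w1 j = (\<Sum>l<?k. g j l *s w l)" by metis
    define \<Gamma> where "\<Gamma> = (\<lambda>u :: nat \<Rightarrow> complex ^ 'a. \<lambda>j\<in>{..<?k}. \<Sum>l<?k. g j l *s u l)"
    have \<Gamma>w: "\<Gamma> w = w1"
    proof
      fix j
      show "\<Gamma> w j = w1 j"
      proof (cases "j < ?k")
        case True
        then show ?thesis by (simp add: \<Gamma>_def flip: g)
      next
        case False
        have "w1 \<in> {..<?k} \<rightarrow>\<^sub>E V" using w1(2) by (simp add: frames_def)
        then show ?thesis using False PiE_arb[of w1 "{..<?k}" "\<lambda>_. V" j] by (simp add: \<Gamma>_def)
      qed
    qed
    have cont: "continuous_map (tuple_top ?k) (tuple_top ?k) \<Gamma>"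
      unfolding continuous_map_componentwise
    proof (intro conjI ballI)
      show "\<Gamma> ` topspace (tuple_top ?k) \<subseteq> extensional {..<?k}" by (auto simp: \<Gamma>_def)
      fix j assume j: "j \<in> {..<?k}"
      have "continuous_map (tuple_top ?k) euclidean (\<lambda>u :: nat \<Rightarrow> complex ^ 'a. \<Sum>l<?k. g j l *s u l)"
      proof (intro continuous_map_sum)
        fix l assume l: "l \<in> {..<?k}"
        have "continuous_on UNIV (\<lambda>v :: complex ^ 'a. g j l *s v)"
          unfolding vector_scalar_mult_def by (intro continuous_intros)
        then have "continuous_map (euclidean :: (complex ^ 'a) topology) euclidean (\<lambda>v. g j l *s v)"
          by (simp add: continuous_map_iff_continuous2)
        from continuous_map_compose[OF continuous_map_product_projection[OF l] this]
        show "continuous_map (tuple_top ?k) euclidean (\<lambda>u :: nat \<Rightarrow> complex ^ 'a. g j l *s u l)" by (simp add: o_def)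
      qed auto
      then show "continuous_map (tuple_top ?k) euclidean (\<lambda>u. \<Gamma> u j)" using j by (simp add: \<Gamma>_def)
    qed
    obtain N where N: "openin (tuple_top ?k) N" "w1 \<in> N" "N \<subseteq> frames ?k UNIV"
      using frames_open[of w1 ?k] w1(2) frames_UNIV[of ?k V] by auto
    have T: "openin (tuple_top ?k) {u \<in> topspace (tuple_top ?k). \<Gamma> u \<in> A \<inter> N}"
      by (rule openin_continuous_map_preimage[OF cont openin_Int[OF A N(1)]])
    let ?T = "frames ?k V \<inter> {u \<in> topspace (tuple_top ?k). \<Gamma> u \<in> A \<inter> N}"
    have "openin (subtopology (tuple_top ?k) (frames ?k V)) ?T"
      using T by (auto simp: openin_subtopology_alt)
    moreover have "w \<in> ?T" using w w1 N \<Gamma>w by (auto simp: frames_def)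
    moreover have "?T \<subseteq> {w \<in> frames ?k V. ?sp w \<in> ?S}"
    proof
      fix u assume u: "u \<in> ?T"
      have uV: "u ` {..<?k} \<subseteq> V" using u by (auto simp: frames_def)
      have sub: "\<Gamma> u ` {..<?k} \<subseteq> ?sp u"
      proof (rule image_subsetI)
        fix j assume "j \<in> {..<?k}"
        then show "\<Gamma> u j \<in> ?sp u"
          unfolding \<Gamma>_def by (auto intro!: vec.span_sum vec.span_scale intro: vec.span_base[OF imageI])
      qed
      then have sub': "?sp (\<Gamma> u) \<subseteq> ?sp u" by (intro vec.span_minimal) auto
      have fr: "\<Gamma> u \<in> frames ?k UNIV" using u N(3) by blast
      have "?sp u \<subseteq> V" using uV V(1) by (rule vec.span_minimal)
      then have fr': "\<Gamma> u \<in> frames ?k V"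
        using fr sub unfolding frames_UNIV[of ?k V] by (auto simp: \<Gamma>_def)
      have "vec.dim (?sp (\<Gamma> u)) = ?k" "vec.dim (?sp u) = ?k"
        using fr u by (auto simp: frames_def vec.dim_eq_card_independent card_image)
      then have "?sp (\<Gamma> u) = ?sp u" using sub' by (intro vec.subspace_dim_equal) auto
      then show "u \<in> {w \<in> frames ?k V. ?sp w \<in> ?S}" using u fr' by auto
    qed
    ultimately show "\<exists>T. openin (subtopology (tuple_top ?k) (frames ?k V)) T \<and> w \<in> T \<and>
        T \<subseteq> {w \<in> frames ?k V. ?sp w \<in> ?S}" by blast
  qed
  moreover have "?S \<subseteq> Gr k V" using span_frame_in_Gr[OF V] by auto
  ultimately show ?thesis unfolding openin_Gr_top Gr_openin_def by simp
qed

text \<open>A vector \<open>w0' j\<close> of the second space outside the first one extends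
  \<open>w0\<close> to a frame with one more vector. Independence is an open condition, so it
  persists for frames \<open>w\<close> and \<open>w'\<close> near the given ones, and their spans
  differ.\<close>

lemma Hausdorff_Gr_top:
  assumes V: "vec.subspace V"
  shows "Hausdorff_space (Gr_top k V)"
  unfolding Hausdorff_space_def topspace_Gr_top[OF V]
proof (intro allI impI, elim conjE)
  fix U U' assume U: "U \<in> Gr k V" "U' \<in> Gr k V" "U \<noteq> U'"
  let ?k = "nat k"
  let ?sp = "\<lambda>w. vec.span (w ` {..<?k})"
  have k: "0 \<le> k" using U(1) by (auto simp: Gr_def)
  obtain w0 w0' where w0: "w0 \<in> frames ?k V" "?sp w0 = U" and w0': "w0' \<in> frames ?k V" "?sp w0' = U'"
    using Gr_frame U by metis
  have "\<exists>j<?k. w0' j \<notin> U"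
  proof (rule ccontr)
    assume "\<not> (\<exists>j<?k. w0' j \<notin> U)"
    then have "w0' ` {..<?k} \<subseteq> U" by auto
    then have "?sp w0' \<subseteq> U" using U(1) by (intro vec.span_minimal) (auto simp: Gr_def)
    then have "U' \<subseteq> U" by (simp only: w0'(2))
    then have "U' = U" using U by (intro vec.subspace_dim_equal) (auto simp: Gr_def)
    then show False using U(3) by simp
  qed
  then obtain j where j: "j < ?k" "w0' j \<notin> U" by blast
  define \<Theta> where "\<Theta> = (\<lambda>(w :: nat \<Rightarrow> complex ^ 'a, w'). \<lambda>l\<in>{..<Suc ?k}. if l < ?k then w l else w' j)"
  have img: "\<Theta> (w, w') ` {..<Suc ?k} = insert (w' j) (w ` {..<?k})" for w w'
    unfolding \<Theta>_def lessThan_Suc by auto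
  have "\<Theta> (w0, w0') \<in> frames (Suc ?k) UNIV"
  proof -
    have "inj_on (\<Theta> (w0, w0')) {..<Suc ?k}"
      unfolding lessThan_Suc
    proof (subst inj_on_insert, intro conjI)
      have "w0' j \<notin> w0 ` {..<?k}"
      proof
        assume "w0' j \<in> w0 ` {..<?k}"
        then have "w0' j \<in> ?sp w0" by (rule vec.span_base)
        then show False using j(2) w0(2) by simp
      qed
      then show "\<Theta> (w0, w0') ?k \<notin> \<Theta> (w0, w0') ` ({..<?k} - {?k})" by (auto simp: \<Theta>_def)
      show "inj_on (\<Theta> (w0, w0')) {..<?k}" using w0(1) by (auto simp: \<Theta>_def frames_def inj_on_def)
    qed
    moreover have "vec.independent (insert (w0' j) (w0 ` {..<?k}))"
    proof (rule vec.independent_insertI)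
      show "w0' j \<notin> ?sp w0" using j(2) w0(2) by simp
      show "vec.independent (w0 ` {..<?k})" using w0(1) by (simp add: frames_def)
    qed
    moreover have "\<Theta> (w0, w0') \<in> {..<Suc ?k} \<rightarrow>\<^sub>E UNIV" by (simp add: \<Theta>_def)
    ultimately show ?thesis unfolding frames_def img[symmetric] by simp
  qed
  then obtain N where N: "openin (tuple_top (Suc ?k)) N" "\<Theta> (w0, w0') \<in> N" "N \<subseteq> frames (Suc ?k) UNIV"
    using frames_open by blast
  have "continuous_map (prod_topology (tuple_top ?k) (tuple_top ?k)) (tuple_top (Suc ?k)) \<Theta>"
    unfolding continuous_map_componentwise
  proof (intro conjI ballI)
    show "\<Theta> ` topspace (prod_topology (tuple_top ?k) (tuple_top ?k)) \<subseteq> extensional {..<Suc ?k}"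
      by (auto simp: \<Theta>_def)
    fix l assume l: "l \<in> {..<Suc ?k}"
    show "continuous_map (prod_topology (tuple_top ?k) (tuple_top ?k)) euclidean (\<lambda>p. \<Theta> p l)"
    proof (cases "l < ?k")
      case True
      have "continuous_map (prod_topology (tuple_top ?k) (tuple_top ?k)) euclidean ((\<lambda>w :: nat \<Rightarrow> complex ^ 'a. w l) \<circ> fst)"
        using True by (intro continuous_map_compose[OF continuous_map_fst] continuous_map_product_projection) auto
      then show ?thesis using True l by (simp add: \<Theta>_def o_def case_prod_unfold)
    next
      case False
      have "continuous_map (prod_topology (tuple_top ?k) (tuple_top ?k)) euclidean ((\<lambda>w :: nat \<Rightarrow> complex ^ 'a. w j) \<circ> snd)"
        using j by (intro continuous_map_compose[OF continuous_map_snd] continuous_map_product_projection) auto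
      then show ?thesis using False l by (simp add: \<Theta>_def o_def case_prod_unfold)
    qed
  qed
  from openin_continuous_map_preimage[OF this N(1)]
  have "openin (prod_topology (tuple_top ?k) (tuple_top ?k))
    {p \<in> topspace (prod_topology (tuple_top ?k) (tuple_top ?k)). \<Theta> p \<in> N}" .
  moreover have "(w0, w0') \<in> {p \<in> topspace (prod_topology (tuple_top ?k) (tuple_top ?k)). \<Theta> p \<in> N}"
    using w0 w0' N(2) by (auto simp: frames_def)
  ultimately obtain A A' where A: "openin (tuple_top ?k) A" "openin (tuple_top ?k) A'" "w0 \<in> A" "w0' \<in> A'"
    "A \<times> A' \<subseteq> {p \<in> topspace (prod_topology (tuple_top ?k) (tuple_top ?k)). \<Theta> p \<in> N}"
    unfolding openin_prod_topology_alt by meson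
  let ?S = "?sp ` (A \<inter> frames ?k V)" and ?S' = "?sp ` (A' \<inter> frames ?k V)"
  have "disjnt ?S ?S'"
  proof (rule ccontr)
    assume "\<not> disjnt ?S ?S'"
    then obtain w w' where w: "w \<in> A" "w' \<in> A'" "?sp w = ?sp w'" "w \<in> frames ?k V"
      unfolding disjnt_def by auto
    have fr: "\<Theta> (w, w') \<in> frames (Suc ?k) UNIV" using A(5) N(3) w by blast
    have inj: "inj_on (\<Theta> (w, w')) {..<Suc ?k}" and ind: "vec.independent (insert (w' j) (w ` {..<?k}))"
      using fr by (auto simp: frames_def img)
    have "w' j \<notin> w ` {..<?k}"
    proof
      assume "w' j \<in> w ` {..<?k}"
      then obtain l where "l < ?k" "w' j = w l" by auto
      then have "\<Theta> (w, w') l = \<Theta> (w, w') ?k" by (simp add: \<Theta>_def)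
      then show False using inj \<open>l < ?k\<close> by (auto dest: inj_onD)
    qed
    moreover have "w' j \<in> ?sp w" using j(1) w(3) by (simp add: vec.span_base)
    ultimately show False using ind by (simp add: vec.independent_insert)
  qed
  moreover have "openin (Gr_top k V) ?S" "openin (Gr_top k V) ?S'"
    using A V k by (auto intro: span_frames_openin)
  moreover have "U \<in> ?S" "U' \<in> ?S'" using A w0 w0' by auto
  ultimately show "\<exists>S S'. openin (Gr_top k V) S \<and> openin (Gr_top k V) S' \<and> U \<in> S \<and> U' \<in> S' \<and> disjnt S S'"
    by blast
qed

lemma Hausdorff_quiver_Gr_top:
  assumes "quiver_rep Q M"
  shows "Hausdorff_space (quiver_Gr_top Q M e)"
  unfolding quiver_Gr_top_def
  using assms by (intro Hausdorff_space_subtopology)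
    (auto simp: Hausdorff_space_product_topology quiver_rep_def intro: Hausdorff_Gr_top)

section \<open>The strings of a straight representation\<close>

context wf_digraph
begin

lemma arcs_ends_mk_symmetric:
  "arcs_ends (with_proj (mk_symmetric G)) = (\<Union>e\<in>arcs G. {(tail G e, head G e), (head G e, tail G e)})"
  by (auto simp: arcs_ends_def arc_to_ends_def parcs_mk_symmetric)

lemma weak_component_refl: "x \<in> verts G \<Longrightarrow> x \<in> weak_component G x"
  by (simp add: weak_component_def reachable_def)

lemma weak_component_sub: "weak_component G x \<subseteq> verts G"
  unfolding weak_component_def using reachable_in_vertsE by fastforce

lemma weak_component_eq:
  assumes "y \<in> weak_component G x"
  shows "weak_component G y = weak_component G x"
proof -
  let ?H = "with_proj (mk_symmetric G)"
  have xy: "x \<rightarrow>\<^sup>*\<^bsub>?H\<^esub> y" using assms by (simp add: weak_component_def)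
  have yx: "y \<rightarrow>\<^sup>*\<^bsub>?H\<^esub> x" by (rule symmetric_reachable[OF symmetric_mk_symmetric xy])
  show ?thesis unfolding weak_component_def
  proof (intro Collect_cong iffI)
    fix z
    show "x \<rightarrow>\<^sup>*\<^bsub>?H\<^esub> z" if "y \<rightarrow>\<^sup>*\<^bsub>?H\<^esub> z"
      using xy that unfolding reachable_def by (rule rtrancl_on_trans)
    show "y \<rightarrow>\<^sup>*\<^bsub>?H\<^esub> z" if "x \<rightarrow>\<^sup>*\<^bsub>?H\<^esub> z"
      using yx that unfolding reachable_def by (rule rtrancl_on_trans)
  qed
qed

lemma weak_component_arc:
  assumes "f \<in> arcs G"
  shows "head G f \<in> weak_component G (tail G f)"
proof -
  have "(tail G f, head G f) \<in> arcs_ends (with_proj (mk_symmetric G))"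
    using assms unfolding arcs_ends_mk_symmetric by blast
  then have "(tail G f, head G f) \<in> rtrancl_on (verts G) (arcs_ends (with_proj (mk_symmetric G)))"
    using assms by (intro rtrancl_on_into_rtrancl_on[OF rtrancl_on_refl]) auto
  then show ?thesis by (simp add: weak_component_def reachable_def)
qed

lemma weak_componentsD: "C \<in> weak_components G \<Longrightarrow> x \<in> C \<Longrightarrow> weak_component G x = C"
  unfolding weak_components_def using weak_component_eq by blast

lemma weak_components_sub: "C \<in> weak_components G \<Longrightarrow> C \<subseteq> verts G"
  unfolding weak_components_def using weak_component_sub by blast

lemma weak_component_in: "x \<in> verts G \<Longrightarrow> weak_component G x \<in> weak_components G"
  unfolding weak_components_def by blast

end

locale straight_rep =
  fixes Q :: "('v, 'a) pre_digraph" and M :: "('v, 'a, 'n::finite) rep"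
    and b :: "'v \<Rightarrow> nat \<Rightarrow> complex ^ 'n"
  assumes finQ: "fin_digraph Q" and repM: "quiver_rep Q M" and strB: "straightening_basis Q M b"
    and normB: "normalized Q M b" and aliB: "aligned Q M b"
begin

sublocale Q: fin_digraph Q by (rule finQ)

abbreviation "CQ \<equiv> coeff_quiver Q M b"
abbreviation "cf \<equiv> coeff M b"
abbreviation "I \<equiv> TM_index Q M b"
definition bb :: "'v \<times> nat \<Rightarrow> complex ^ 'n" where "bb y = b (fst y) (snd y)"

lemma vsp_subspace: "i \<in> verts Q \<Longrightarrow> vec.subspace (vsp M i)"
  using repM by (simp add: quiver_rep_def)

lemma basis:
  assumes "i \<in> verts Q"
  shows "inj_on (b i) (bix M i)" "vec.independent (b i ` bix M i)" "vec.span (b i ` bix M i) = vsp M i"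
  using strB assms by (simp_all add: straightening_basis_def indexed_basis_def)

lemma b_in: "i \<in> verts Q \<Longrightarrow> k \<in> bix M i \<Longrightarrow> b i k \<in> vsp M i"
  using basis(3)[of i] vec.span_base[of "b i k" "b i ` bix M i"] by auto

lemma cf_expand:
  assumes "i \<in> verts Q" "v \<in> vsp M i"
  shows "(\<Sum>k\<in>bix M i. cf i k v *s b i k) = v"
proof -
  have "(\<Sum>u\<in>b i ` bix M i. vec.representation (b i ` bix M i) v u *s u) = v"
    using basis[OF assms(1)] assms(2) by (intro vec.sum_representation_eq) auto
  then show ?thesis using basis(1)[OF assms(1)] by (simp add: sum.reindex coeff_def)
qed

lemma cf_basis:
  assumes "i \<in> verts Q" "k \<in> bix M i" "l \<in> bix M i"
  shows "cf i l (b i k) = of_bool (l = k)"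
  using basis[OF assms(1)] assms by (simp add: coeff_def vec.representation_basis inj_on_eq_iff)

lemma cf_add:
  assumes "i \<in> verts Q" "u \<in> vsp M i" "v \<in> vsp M i"
  shows "cf i k (u + v) = cf i k u + cf i k v"
  using basis[OF assms(1)] assms by (simp add: coeff_def vec.representation_add)

lemma cf_scale:
  assumes "i \<in> verts Q" "v \<in> vsp M i"
  shows "cf i k (c *s v) = c * cf i k v"
  using basis[OF assms(1)] assms by (simp add: coeff_def vec.representation_scale)

lemma cf_0: "i \<in> verts Q \<Longrightarrow> cf i k 0 = 0"
  using basis(2)[of i] by (simp add: coeff_def vec.representation_zero)

lemma cf_sum:
  assumes "i \<in> verts Q" "\<And>x. x \<in> A \<Longrightarrow> f x \<in> vsp M i"
  shows "cf i k (sum f A) = (\<Sum>x\<in>A. cf i k (f x))"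
  using assms(2)
proof (induction A rule: infinite_finite_induct)
  case (insert x A)
  then have "sum f A \<in> vsp M i" by (intro vec.subspace_sum vsp_subspace assms(1)) auto
  then show ?case using insert by (simp add: cf_add[OF assms(1)])
qed (simp_all add: cf_0 assms(1))

lemma cf_eqI:
  assumes "i \<in> verts Q" "u \<in> vsp M i" "v \<in> vsp M i" "\<And>k. k \<in> bix M i \<Longrightarrow> cf i k u = cf i k v"
  shows "u = v"
proof -
  have "u = (\<Sum>k\<in>bix M i. cf i k u *s b i k)" using cf_expand[OF assms(1,2)] by simp
  also have "\<dots> = (\<Sum>k\<in>bix M i. cf i k v *s b i k)" using assms(4) by (intro sum.cong) auto
  also have "\<dots> = v" using cf_expand[OF assms(1,3)] .
  finally show ?thesis .
qed

lemma vmap_in: "a \<in> arcs Q \<Longrightarrow> v \<in> vsp M (tail Q a) \<Longrightarrow> vmap M a v \<in> vsp M (head Q a)"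
  using repM unfolding quiver_rep_def by blast

lemma vmap_add: "a \<in> arcs Q \<Longrightarrow> u \<in> vsp M (tail Q a) \<Longrightarrow> v \<in> vsp M (tail Q a) \<Longrightarrow>
    vmap M a (u + v) = vmap M a u + vmap M a v"
  using repM by (auto simp: quiver_rep_def)

lemma vmap_scale: "a \<in> arcs Q \<Longrightarrow> v \<in> vsp M (tail Q a) \<Longrightarrow> vmap M a (c *s v) = c *s vmap M a v"
  using repM by (auto simp: quiver_rep_def)

lemma vmap_0: "a \<in> arcs Q \<Longrightarrow> vmap M a 0 = 0"
  using vmap_scale[of a 0 0] vec.subspace_0[OF vsp_subspace, of "tail Q a"] by simp

lemma vmap_sum:
  assumes "a \<in> arcs Q" "\<And>x. x \<in> A \<Longrightarrow> f x \<in> vsp M (tail Q a)"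
  shows "vmap M a (sum f A) = (\<Sum>x\<in>A. vmap M a (f x))"
  using assms(2)
proof (induction A rule: infinite_finite_induct)
  case (insert x A)
  then have "sum f A \<in> vsp M (tail Q a)"
    using assms(1) by (intro vec.subspace_sum vsp_subspace) auto
  then show ?case using insert by (simp add: vmap_add[OF assms(1)])
qed (simp_all add: vmap_0 assms(1))

lemma verts_CQ: "verts CQ = (SIGMA i : verts Q. bix M i)"
  by (simp add: coeff_quiver_def)

lemma tail_CQ: "tail CQ = (\<lambda>(a, k, l). (tail Q a, k))" and head_CQ: "head CQ = (\<lambda>(a, k, l). (head Q a, l))"
  by (simp_all add: coeff_quiver_def)

lemma bb_in: "y \<in> verts CQ \<Longrightarrow> bb y \<in> vsp M (fst y)"
  by (auto simp: verts_CQ bb_def intro: b_in)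

lemma cf_bb: "y \<in> verts CQ \<Longrightarrow> z \<in> verts CQ \<Longrightarrow> fst y = fst z \<Longrightarrow> cf (fst y) (snd y) (bb z) = of_bool (y = z)"
  by (auto simp: verts_CQ bb_def cf_basis)

text \<open>For a normalized basis a non-zero coefficient means that the image is that basis vector
  itself.\<close>

lemma arcs_CQ:
  "(a, k, l) \<in> arcs CQ \<longleftrightarrow> a \<in> arcs Q \<and> k \<in> bix M (tail Q a) \<and> l \<in> bix M (head Q a) \<and>
    vmap M a (b (tail Q a) k) = b (head Q a) l"
proof -
  have "cf (head Q a) l (vmap M a (b (tail Q a) k)) \<noteq> 0 \<longleftrightarrow> vmap M a (b (tail Q a) k) = b (head Q a) l"
    if a: "a \<in> arcs Q" and k: "k \<in> bix M (tail Q a)" and l: "l \<in> bix M (head Q a)"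
  proof -
    have h: "head Q a \<in> verts Q" using a by simp
    consider "vmap M a (b (tail Q a) k) = 0" | l' where "l' \<in> bix M (head Q a)" "vmap M a (b (tail Q a) k) = b (head Q a) l'"
      using normB a k unfolding normalized_def by blast
    then show ?thesis
    proof cases
      case 1
      then show ?thesis using cf_basis[OF h l l] by (auto simp: cf_0[OF h])
    next
      case (2 l')
      then show ?thesis using cf_basis[OF h 2(1) l] basis(1)[OF h] l by (auto simp: inj_on_eq_iff)
    qed
  qed
  then show ?thesis by (auto simp: coeff_quiver_def)
qed

lemma finite_verts_CQ: "finite (verts CQ)"
  unfolding verts_CQ by (intro finite_SigmaI) auto

sublocale CQ: wf_digraph CQ
  by unfold_locales (auto simp: arcs_CQ tail_CQ head_CQ verts_CQ simp del: One_nat_def)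

abbreviation "comps \<equiv> weak_components CQ"

lemma finite_comps: "finite comps"
  unfolding weak_components_def using finite_verts_CQ by simp

text \<open>An enumeration of the component along its arrows, fixed by choice, so that positions on
  strings become numbers.\<close>

definition strg :: "('v \<times> nat) set \<Rightarrow> ('v \<times> nat) list \<times> ('a \<times> nat \<times> nat) list" where
  "strg C = (SOME (xs, as). distinct xs \<and> set xs = C \<and> distinct as \<and> set as = arcs (CQ \<restriction> C) \<and>
      length xs = Suc (length as) \<and>
      (\<forall>k<length as. tail CQ (as ! k) = xs ! k \<and> head CQ (as ! k) = xs ! Suc k))"

definition len :: "('v \<times> nat) set \<Rightarrow> nat" where "len C = length (fst (strg C))"
definition el :: "('v \<times> nat) set \<Rightarrow> nat \<Rightarrow> 'v \<times> nat" where "el C m = fst (strg C) ! m"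
definition ar :: "('v \<times> nat) set \<Rightarrow> nat \<Rightarrow> 'a \<times> nat \<times> nat" where "ar C m = snd (strg C) ! m"
definition qa :: "('v \<times> nat) set \<Rightarrow> nat \<Rightarrow> 'a" where "qa C m = fst (ar C m)"

lemma strg:
  assumes "C \<in> comps"
  shows "distinct (fst (strg C))" "set (fst (strg C)) = C" "distinct (snd (strg C))"
    "set (snd (strg C)) = arcs (CQ \<restriction> C)" "len C = Suc (length (snd (strg C)))"
    "Suc m < len C \<Longrightarrow> tail CQ (ar C m) = el C m" "Suc m < len C \<Longrightarrow> head CQ (ar C m) = el C (Suc m)"
proof -
  have "\<exists>p. case p of (xs, as) \<Rightarrow> distinct xs \<and> set xs = C \<and> distinct as \<and> set as = arcs (CQ \<restriction> C) \<and>
      length xs = Suc (length as) \<and>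
      (\<forall>k<length as. tail CQ (as ! k) = xs ! k \<and> head CQ (as ! k) = xs ! Suc k)"
    using strB assms unfolding straightening_basis_def equioriented_string_def by auto
  from someI_ex[OF this] have *: "distinct (fst (strg C)) \<and> set (fst (strg C)) = C \<and> distinct (snd (strg C)) \<and>
      set (snd (strg C)) = arcs (CQ \<restriction> C) \<and> length (fst (strg C)) = Suc (length (snd (strg C))) \<and>
      (\<forall>k<length (snd (strg C)). tail CQ (snd (strg C) ! k) = fst (strg C) ! k \<and>
        head CQ (snd (strg C) ! k) = fst (strg C) ! Suc k)"
    unfolding strg_def by (simp add: case_prod_unfold)
  show "distinct (fst (strg C))" "set (fst (strg C)) = C" "distinct (snd (strg C))"
    "set (snd (strg C)) = arcs (CQ \<restriction> C)" "len C = Suc (length (snd (strg C)))"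
    "Suc m < len C \<Longrightarrow> tail CQ (ar C m) = el C m" "Suc m < len C \<Longrightarrow> head CQ (ar C m) = el C (Suc m)"
    using * by (simp_all add: len_def el_def ar_def)
qed

lemma el_in: "C \<in> comps \<Longrightarrow> m < len C \<Longrightarrow> el C m \<in> C"
  using strg(2)[of C] nth_mem[of m "fst (strg C)"] by (simp add: el_def len_def)

lemma el_in_verts: "C \<in> comps \<Longrightarrow> m < len C \<Longrightarrow> el C m \<in> verts CQ"
  using el_in CQ.weak_components_sub by blast

lemma el_comp: "C \<in> comps \<Longrightarrow> m < len C \<Longrightarrow> weak_component CQ (el C m) = C"
  using el_in CQ.weak_componentsD by blast

lemma el_inj:
  assumes "C \<in> comps" "C' \<in> comps" "m < len C" "m' < len C'" "el C m = el C' m'"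
  shows "C = C' \<and> m = m'"
proof -
  have "C = C'" using el_comp assms by metis
  then show ?thesis using assms strg(1)[of C] by (auto simp: el_def len_def nth_eq_iff_index_eq)
qed

lemma el_surj:
  assumes "y \<in> verts CQ"
  shows "\<exists>C\<in>comps. \<exists>m<len C. y = el C m"
proof -
  have C: "weak_component CQ y \<in> comps" "y \<in> weak_component CQ y"
    using assms CQ.weak_component_in CQ.weak_component_refl by blast+
  then have "y \<in> set (fst (strg (weak_component CQ y)))" using strg(2) by blast
  then obtain m where "m < len (weak_component CQ y)" "el (weak_component CQ y) m = y"
    unfolding in_set_conv_nth el_def len_def by (elim exE conjE)
  then show ?thesis using C(1) by (intro bexI[of _ "weak_component CQ y"] exI[of _ m]) simp_all
qed

lemma ar_arc:
  assumes "C \<in> comps" "Suc m < len C"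
  shows "ar C m \<in> arcs CQ"
proof -
  have "ar C m \<in> set (snd (strg C))" using assms strg(5)[of C] by (simp add: ar_def)
  then show ?thesis using strg(4)[OF assms(1)] by (simp add: induce_subgraph_def)
qed

lemma arc_ar:
  assumes "f \<in> arcs CQ"
  shows "\<exists>C\<in>comps. \<exists>m. Suc m < len C \<and> f = ar C m"
proof -
  let ?C = "weak_component CQ (tail CQ f)"
  have C: "?C \<in> comps" using assms by (intro CQ.weak_component_in) simp
  have "tail CQ f \<in> ?C" "head CQ f \<in> ?C"
    using assms CQ.weak_component_refl CQ.weak_component_arc by auto
  then have "f \<in> set (snd (strg ?C))" using assms strg(4)[OF C] by (simp add: induce_subgraph_def)
  then obtain m where "m < length (snd (strg ?C))" "ar ?C m = f"
    unfolding in_set_conv_nth ar_def by (elim exE conjE)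
  then show ?thesis using C strg(5)[OF C] by (intro bexI[of _ ?C] exI[of _ m]) simp_all
qed

lemma qa_props:
  assumes "C \<in> comps" "Suc m < len C"
  shows "qa C m \<in> arcs Q" "tail Q (qa C m) = fst (el C m)" "head Q (qa C m) = fst (el C (Suc m))"
    "vmap M (qa C m) (bb (el C m)) = bb (el C (Suc m))"
proof -
  obtain a k l where f: "ar C m = (a, k, l)" by (cases "ar C m")
  have e: "el C m = (tail Q a, k)" "el C (Suc m) = (head Q a, l)"
    using strg(6,7)[OF assms] unfolding f tail_CQ head_CQ by simp_all
  have "(a, k, l) \<in> arcs CQ" using ar_arc[OF assms] f by simp
  then have "a \<in> arcs Q" "vmap M a (b (tail Q a) k) = b (head Q a) l" by (simp_all add: arcs_CQ)
  then show "qa C m \<in> arcs Q" "tail Q (qa C m) = fst (el C m)" "head Q (qa C m) = fst (el C (Suc m))"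
    "vmap M (qa C m) (bb (el C m)) = bb (el C (Suc m))"
    by (simp_all add: qa_def f e bb_def)
qed

lemma vmap_nonzero:
  assumes "C \<in> comps" "m < len C" "a \<in> arcs Q" "tail Q a = fst (el C m)" "vmap M a (bb (el C m)) \<noteq> 0"
  shows "Suc m < len C \<and> a = qa C m"
proof -
  let ?k = "snd (el C m)"
  have y: "el C m = (tail Q a, ?k)" using assms(4) by (simp add: prod_eq_iff)
  have k: "?k \<in> bix M (tail Q a)" using el_in_verts[OF assms(1,2)] y by (auto simp: verts_CQ)
  have nz: "vmap M a (b (tail Q a) ?k) \<noteq> 0" using assms(4,5) by (simp add: bb_def)
  then obtain l where l: "l \<in> bix M (head Q a)" "vmap M a (b (tail Q a) ?k) = b (head Q a) l"
    using normB assms(3) k unfolding normalized_def by blast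
  then have "(a, ?k, l) \<in> arcs CQ" using assms(3) k by (simp add: arcs_CQ)
  then obtain C' m' where C': "C' \<in> comps" "Suc m' < len C'" "(a, ?k, l) = ar C' m'" using arc_ar by blast
  have "el C' m' = el C m" using strg(6)[OF C'(1,2)] y unfolding C'(3)[symmetric] tail_CQ by simp
  then have "C' = C \<and> m' = m" using el_inj C' assms(1,2) by (meson Suc_lessD)
  then show ?thesis using C' by (metis fst_conv qa_def)
qed

lemma vmap_el:
  assumes "C \<in> comps" "m < len C" "a \<in> arcs Q" "tail Q a = fst (el C m)"
  shows "vmap M a (bb (el C m)) = (if Suc m < len C \<and> a = qa C m then bb (el C (Suc m)) else 0)"
  using vmap_nonzero[OF assms] qa_props[OF assms(1), of m] by auto

lemma bb_nz: "y \<in> verts CQ \<Longrightarrow> bb y \<noteq> 0"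
  using cf_bb[of y y] cf_0[of "fst y"] by (auto simp: verts_CQ)

text \<open>The exponents of the character by which the torus scales \<open>el C m\<close>: that of
  the starting vertex of the string, and for each arrow of the quiver the number of times it was
  passed.\<close>

definition ep :: "('v \<times> nat) set \<Rightarrow> nat \<Rightarrow> ('v, 'a) tindex \<Rightarrow> int" where
  "ep C m i = (case i of Inl C' \<Rightarrow> of_bool (C' = C) | Inr a \<Rightarrow> int (card {j. j < m \<and> qa C j = a}))"

lemma qa_supp: "C \<in> comps \<Longrightarrow> Suc m < len C \<Longrightarrow> qa C m \<in> supp_arcs Q M"
  using qa_props[of C m] bb_in[OF el_in_verts, of C m] bb_nz[OF el_in_verts, of C "Suc m"]
  unfolding supp_arcs_def by (auto intro!: bexI[of _ "bb (el C m)"])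

lemma ep_Suc: "ep C (Suc m) i = ep C m i + of_bool (i = Inr (qa C m))"
proof (cases i)
  case (Inr a)
  have "{j. j < Suc m \<and> qa C j = a} = {j. j < m \<and> qa C j = a} \<union> (if qa C m = a then {m} else {})"
    by (auto simp: less_Suc_eq)
  then show ?thesis using Inr by (auto simp: ep_def)
qed (simp add: ep_def)

lemma finite_supp_arcs: "finite (supp_arcs Q M)"
  unfolding supp_arcs_def by simp

text \<open>The indices of the basis vectors serve as weights. Over one vertex an attractive grading
  orders basis vectors in the same way, and alignment is a statement about indices.\<close>

sublocale sm: string_model comps "supp_arcs Q M" len "\<lambda>C m. fst (el C m)" "\<lambda>C m. int (snd (el C m))" ep
proof
  show "finite comps" by (rule finite_comps)
  show "finite (supp_arcs Q M)" by (rule finite_supp_arcs)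
next
  fix s s' m m'
  assume *: "s \<in> comps" "s' \<in> comps" "m < len s" "Suc m' < len s'" "fst (el s m) = fst (el s' m')"
    "int (snd (el s m)) < int (snd (el s' m'))"
  let ?a = "qa s' m'"
  note a = qa_props[OF *(2,4)]
  have k: "snd (el s m) \<in> bix M (tail Q ?a)" using el_in_verts[OF *(1,3)] *(5) a by (auto simp: verts_CQ)
  have k': "snd (el s' m') \<in> bix M (tail Q ?a)" using el_in_verts[OF *(2), of m'] *(4) a by (auto simp: verts_CQ)
  have nz': "vmap M ?a (bb (el s' m')) \<noteq> 0" using a(4) bb_nz[OF el_in_verts[OF *(2,4)]] by simp
  \<comment> \<open>First condition of alignment: a vector killed by the arrow has a larger index
    than one that is not.\<close>
  have "vmap M ?a (b (tail Q ?a) (snd (el s m))) \<noteq> 0"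
  proof
    assume "vmap M ?a (b (tail Q ?a) (snd (el s m))) = 0"
    moreover have "vmap M ?a (b (tail Q ?a) (snd (el s' m'))) \<noteq> 0" using nz' a by (simp add: bb_def)
    ultimately have "snd (el s m) > snd (el s' m')"
      using aliB a(1) k k' unfolding aligned_def by blast
    then show False using *(6) by simp
  qed
  then have nz: "vmap M ?a (bb (el s m)) \<noteq> 0" using a *(5) by (simp add: bb_def)
  then have s: "Suc m < len s" "?a = qa s m"
    using vmap_nonzero[OF *(1,3) a(1)] a(2) *(5) by auto
  note a2 = qa_props[OF *(1) s(1)]
  have heads: "fst (el s (Suc m)) = head Q ?a" "fst (el s' (Suc m')) = head Q ?a" using a a2 s by auto
  have l: "snd (el s (Suc m)) \<in> bix M (head Q ?a)" "snd (el s' (Suc m')) \<in> bix M (head Q ?a)"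
    using el_in_verts[OF *(1) s(1)] el_in_verts[OF *(2,4)] heads by (auto simp: verts_CQ)
  have "vmap M ?a (b (tail Q ?a) (snd (el s' m'))) = b (head Q ?a) (snd (el s' (Suc m')))"
    "vmap M ?a (b (tail Q ?a) (snd (el s m))) = b (head Q ?a) (snd (el s (Suc m)))"
  proof -
    have e: "bb (el s' m') = b (tail Q ?a) (snd (el s' m'))" "bb (el s m) = b (tail Q ?a) (snd (el s m))"
      "bb (el s' (Suc m')) = b (head Q ?a) (snd (el s' (Suc m')))" "bb (el s (Suc m)) = b (head Q ?a) (snd (el s (Suc m)))"
      using a(2) *(5) heads by (simp_all add: bb_def)
    show "vmap M ?a (b (tail Q ?a) (snd (el s' m'))) = b (head Q ?a) (snd (el s' (Suc m')))"
      using a(4) unfolding e .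
    show "vmap M ?a (b (tail Q ?a) (snd (el s m))) = b (head Q ?a) (snd (el s (Suc m)))"
      using a2(4) unfolding s(2)[symmetric] e .
  qed
  moreover have "\<forall>k'\<in>bix M (head Q ?a). \<forall>l'\<in>bix M (head Q ?a).
      vmap M ?a (b (tail Q ?a) (snd (el s' m'))) = b (head Q ?a) l' \<and>
      vmap M ?a (b (tail Q ?a) (snd (el s m))) = b (head Q ?a) k' \<and> snd (el s' m') > snd (el s m) \<longrightarrow> l' > k'"
    using aliB a(1) k k' unfolding aligned_def by blast
  ultimately have "snd (el s (Suc m)) < snd (el s' (Suc m'))"
    using l *(6) by (meson of_nat_less_iff)
  then show "Suc m < len s \<and> fst (el s (Suc m)) = fst (el s' (Suc m')) \<and>
      int (snd (el s (Suc m))) < int (snd (el s' (Suc m'))) \<and>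
      (\<forall>i. ep s' (Suc m') i - ep s (Suc m) i = ep s' m' i - ep s m i)"
    using s heads by (simp add: ep_Suc)
next
  fix s s' m m'
  assume "s \<in> comps" "s' \<in> comps" "m < len s" "m' < len s'" "fst (el s m) = fst (el s' m')"
    "int (snd (el s m)) = int (snd (el s' m'))"
  then show "s = s' \<and> m = m'" by (intro el_inj) (auto simp: prod_eq_iff)
next
  fix s t m
  show "ep s m (Inl t) = of_bool (t = s)" by (simp add: ep_def)
next
  fix s m assume s: "s \<in> comps" "m < len s"
  have "(\<Sum>a\<in>supp_arcs Q M. ep s k (Inr a)) = int k" if "k \<le> m" for k
    using that
  proof (induction k)
    case (Suc k)
    then have "qa s k \<in> supp_arcs Q M" using s by (intro qa_supp) auto
    then show ?case using Suc finite_supp_arcs by (simp add: ep_Suc sum.distrib)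
  qed (simp add: ep_def)
  then show "(\<Sum>a\<in>supp_arcs Q M. ep s m (Inr a)) = int m" by simp
qed

lemma I_eq: "I = comps <+> supp_arcs Q M"
  by (simp add: TM_index_def)

lemma finite_I: "finite I"
  unfolding I_eq using finite_comps finite_supp_arcs by simp

lemma reachable_el:
  assumes "C \<in> comps" "m < len C" "m' \<le> m"
  shows "el C m' \<rightarrow>\<^sup>*\<^bsub>CQ\<^esub> el C m"
  using assms(3,2)
proof (induction rule: dec_induct)
  case base
  then show ?case using el_in_verts[OF assms(1)] by simp
next
  case (step n)
  have "(el C n, el C (Suc n)) \<in> arcs_ends CQ"
    using ar_arc[OF assms(1) step.prems] strg(6,7)[OF assms(1) step.prems]
    unfolding arcs_ends_def arc_to_ends_def by (intro image_eqI[of _ _ "ar C n"]) simp_all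
  then show ?case using step CQ.reachable_adj_trans by (meson Suc_lessD)
qed

lemma reachable_elD:
  assumes "el C m' \<rightarrow>\<^sup>*\<^bsub>CQ\<^esub> y" "C \<in> comps" "m' < len C"
  shows "\<exists>m\<ge>m'. m < len C \<and> y = el C m"
  using assms
proof (induction rule: CQ.reachable_induct)
  case (step y z)
  then obtain m where m: "m \<ge> m'" "m < len C" "y = el C m" by blast
  obtain f where f: "f \<in> arcs CQ" "tail CQ f = y" "head CQ f = z" using step.hyps by auto
  obtain C' k where k: "C' \<in> comps" "Suc k < len C'" "f = ar C' k" using arc_ar[OF f(1)] by blast
  have "el C' k = el C m" using strg(6)[OF k(1,2)] f m k by simp
  then have "C' = C" "k = m" using el_inj[OF k(1) step.prems(1), of k m] k m by auto
  then show ?case using strg(7)[OF k(1,2)] f k m by (intro exI[of _ "Suc m"]) auto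
qed auto

lemma ar_inj: "C \<in> comps \<Longrightarrow> inj_on (ar C) {j. Suc j < len C}"
  using strg(3,5)[of C] by (auto simp: inj_on_def ar_def nth_eq_iff_index_eq)

text \<open>The arrows whose head reaches \<open>el C m\<close> are the first \<open>m\<close>
  arrows of its string.\<close>

lemma TM_scale_el:
  assumes "C \<in> comps" "m < len C" and t: "t \<in> torus I"
  shows "TM_scale Q M b t (el C m) = char_eval I (ep C m) t"
proof -
  have "{f \<in> arcs CQ. head CQ f \<rightarrow>\<^sup>*\<^bsub>CQ\<^esub> el C m} = ar C ` {..<m}"
  proof (intro equalityI subsetI)
    fix f assume f: "f \<in> {f \<in> arcs CQ. head CQ f \<rightarrow>\<^sup>*\<^bsub>CQ\<^esub> el C m}"
    obtain C' k where k: "C' \<in> comps" "Suc k < len C'" "f = ar C' k" using arc_ar f by blast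
    have "el C' (Suc k) \<rightarrow>\<^sup>*\<^bsub>CQ\<^esub> el C m" using strg(7)[OF k(1,2)] f k by simp
    from reachable_elD[OF this k(1,2)] obtain n where n: "n \<ge> Suc k" "n < len C'" "el C m = el C' n" by blast
    then have "C = C'" "m = n" using el_inj[OF assms(1) k(1) assms(2)] by auto
    then show "f \<in> ar C ` {..<m}" using n k by auto
  next
    fix f assume "f \<in> ar C ` {..<m}"
    then obtain k where k: "k < m" "f = ar C k" by auto
    then have "Suc k < len C" using assms(2) by simp
    then show "f \<in> {f \<in> arcs CQ. head CQ f \<rightarrow>\<^sup>*\<^bsub>CQ\<^esub> el C m}"
      using ar_arc[OF assms(1)] strg(7)[OF assms(1)] reachable_el[OF assms(1,2), of "Suc k"] k by auto
  qed
  then have "(\<Prod>(a, k, l)\<in>{f \<in> arcs CQ. head CQ f \<rightarrow>\<^sup>*\<^bsub>CQ\<^esub> el C m}. t (Inr a)) = (\<Prod>f\<in>ar C ` {..<m}. t (Inr (fst f)))"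
    by (simp add: case_prod_unfold)
  also have "\<dots> = (\<Prod>j<m. t (Inr (qa C j)))"
  proof (subst prod.reindex)
    show "inj_on (ar C) {..<m}" by (rule inj_on_subset[OF ar_inj[OF assms(1)]]) (use assms(2) in auto)
  qed (simp add: qa_def o_def)
  finally have 1: "TM_scale Q M b t (el C m) = t (Inl C) * (\<Prod>j<m. t (Inr (qa C j)))"
    unfolding TM_scale_def el_comp[OF assms(1,2)] by simp
  have "(\<Prod>j<k. t (Inr (qa C j))) = (\<Prod>a\<in>supp_arcs Q M. t (Inr a) powi ep C k (Inr a))" if "k \<le> m" for k
    using that
  proof (induction k)
    case (Suc k)
    have q: "qa C k \<in> supp_arcs Q M" using assms Suc.prems by (intro qa_supp) auto
    have nz: "t (Inr a) \<noteq> 0" if "a \<in> supp_arcs Q M" for a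
      using t that by (auto simp: torus_def I_eq PiE_iff)
    have "(\<Prod>a\<in>supp_arcs Q M. t (Inr a) powi ep C (Suc k) (Inr a)) =
        (\<Prod>a\<in>supp_arcs Q M. t (Inr a) powi ep C k (Inr a) * (if a = qa C k then t (Inr a) else 1))"
      using nz by (intro prod.cong) (auto simp: ep_Suc power_int_add)
    also have "\<dots> = (\<Prod>a\<in>supp_arcs Q M. t (Inr a) powi ep C k (Inr a)) * t (Inr (qa C k))"
      using q finite_supp_arcs by (simp add: prod.distrib)
    finally show ?case using Suc by simp
  qed (simp add: ep_def)
  moreover have "(\<Prod>C'\<in>comps. t (Inl C') powi ep C m (Inl C')) = t (Inl C)"
  proof -
    have "(\<Prod>C'\<in>comps. t (Inl C') powi ep C m (Inl C')) = (\<Prod>C'\<in>comps. if C' = C then t (Inl C') else 1)"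
      by (intro prod.cong) (auto simp: ep_def)
    then show ?thesis using assms(1) finite_comps by simp
  qed
  ultimately show ?thesis
    unfolding 1 char_eval_def I_eq using finite_comps finite_supp_arcs by (simp add: prod.Plus)
qed

end

section \<open>Fixed points and curves\<close>

lemma span_family:
  fixes w :: "'j \<Rightarrow> complex ^ 'n::finite"
  assumes "finite A"
  shows "vec.span (w ` A) = range (\<lambda>d. \<Sum>p\<in>A. d p *s w p)"
proof
  show "vec.span (w ` A) \<subseteq> range (\<lambda>d. \<Sum>p\<in>A. d p *s w p)"
  proof (rule vec.span_minimal)
    show "w ` A \<subseteq> range (\<lambda>d. \<Sum>p\<in>A. d p *s w p)"
    proof
      fix v assume "v \<in> w ` A"
      then obtain p where p: "p \<in> A" "v = w p" by blast
      have "(\<Sum>q\<in>A. (if q = p then 1 else 0) *s w q) = (\<Sum>q\<in>A. if q = p then w q else 0)"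
        by (intro sum.cong) auto
      also have "\<dots> = v" using p assms by simp
      finally show "v \<in> range (\<lambda>d. \<Sum>p\<in>A. d p *s w p)"
        by (intro range_eqI[of _ _ "\<lambda>q. if q = p then 1 else 0"]) simp
    qed
    show "vec.subspace (range (\<lambda>d. \<Sum>p\<in>A. d p *s w p))"
    proof (rule vec.subspaceI)
      show "0 \<in> range (\<lambda>d. \<Sum>p\<in>A. d p *s w p)"
        by (intro range_eqI[of _ _ "\<lambda>_. 0"]) simp
      fix u v assume "u \<in> range (\<lambda>d. \<Sum>p\<in>A. d p *s w p)" "v \<in> range (\<lambda>d. \<Sum>p\<in>A. d p *s w p)"
      then obtain d d' where "u = (\<Sum>p\<in>A. d p *s w p)" "v = (\<Sum>p\<in>A. d' p *s w p)" by blast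
      then show "u + v \<in> range (\<lambda>d. \<Sum>p\<in>A. d p *s w p)"
        by (intro range_eqI[of _ _ "\<lambda>p. d p + d' p"]) (simp add: sum.distrib vec.scale_left_distrib)
    next
      fix c u assume "u \<in> range (\<lambda>d. \<Sum>p\<in>A. d p *s w p)"
      then obtain d where "u = (\<Sum>p\<in>A. d p *s w p)" by blast
      then show "c *s u \<in> range (\<lambda>d. \<Sum>p\<in>A. d p *s w p)"
        by (intro range_eqI[of _ _ "\<lambda>p. c * d p"]) (simp add: vec.scale_sum_right)
    qed
  qed
  show "range (\<lambda>d. \<Sum>p\<in>A. d p *s w p) \<subseteq> vec.span (w ` A)"
    by (auto intro!: vec.span_sum vec.span_scale intro: vec.span_base[OF imageI])
qed

lemma span_family_scale:
  fixes w :: "'j \<Rightarrow> complex ^ 'n::finite"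
  assumes "finite A" "\<And>p. p \<in> A \<Longrightarrow> k p \<noteq> 0"
  shows "vec.span ((\<lambda>p. k p *s w p) ` A) = vec.span (w ` A)"
proof -
  have "w p \<in> vec.span ((\<lambda>p. k p *s w p) ` A)" if "p \<in> A" for p
  proof -
    have "(1 / k p) *s (k p *s w p) \<in> vec.span ((\<lambda>p. k p *s w p) ` A)"
      using that by (intro vec.span_scale vec.span_base) auto
    then show ?thesis using assms(2)[OF that] by simp
  qed
  moreover have "k p *s w p \<in> vec.span (w ` A)" if "p \<in> A" for p
    using that by (intro vec.span_scale vec.span_base) auto
  ultimately show ?thesis by (intro equalityI vec.span_minimal) auto
qed

lemma char_eval_mult:
  assumes "finite J" "\<And>j. j \<in> J \<Longrightarrow> t j \<noteq> 0"
  shows "char_eval J (\<lambda>j. m j + n j) t = char_eval J m t * char_eval J n t"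
  unfolding char_eval_def using assms by (simp add: power_int_add prod.distrib)

lemma char_eval_cong: "(\<And>j. j \<in> J \<Longrightarrow> m j = n j) \<Longrightarrow> char_eval J m t = char_eval J n t"
  unfolding char_eval_def by (intro prod.cong) auto

lemma char_eval_nz:
  assumes "finite J" "\<And>j. j \<in> J \<Longrightarrow> t j \<noteq> 0"
  shows "char_eval J m t \<noteq> 0"
  unfolding char_eval_def using assms by simp

lemma torus_nz: "t \<in> torus J \<Longrightarrow> j \<in> J \<Longrightarrow> t j \<noteq> 0"
  by (auto simp: torus_def PiE_iff)

section \<open>Coordinate subrepresentations and the curves between them\<close>

context straight_rep
begin

abbreviation "edge \<equiv> sm.edge"
abbreviation "move \<equiv> sm.move"

abbreviation ce :: "'v \<times> nat \<Rightarrow> complex ^ 'n \<Rightarrow> complex" where "ce y v \<equiv> cf (fst y) (snd y) v"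
abbreviation ev :: "('v \<times> nat) set \<times> nat \<Rightarrow> 'v \<times> nat" where "ev p \<equiv> el (fst p) (snd p)"

definition idx :: "(('v \<times> nat) set \<Rightarrow> nat) \<Rightarrow> 'v \<Rightarrow> (('v \<times> nat) set \<times> nat) set" where
  "idx x i = {(t, m). t \<in> comps \<and> x t \<le> m \<and> m < len t \<and> fst (el t m) = i}"

lemma finite_idx: "finite (idx x i)"
proof (rule finite_subset)
  show "idx x i \<subseteq> (SIGMA t : comps. {..<len t})" by (auto simp: idx_def)
qed (use finite_comps in auto)

lemma idx_ev: "p \<in> idx x i \<Longrightarrow> ev p \<in> verts CQ \<and> fst (ev p) = i"
  by (auto simp: idx_def intro: el_in_verts)

lemma ev_inj: "p \<in> idx x i \<Longrightarrow> q \<in> idx x' i' \<Longrightarrow> ev p = ev q \<Longrightarrow> p = q"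
  using el_inj[of "fst p" "fst q" "snd p" "snd q"] by (auto simp: idx_def prod_eq_iff)

text \<open>For \<open>p\<close> in the segment that is moved along an edge, \<open>a *s p + c *s q\<close> with \<open>q\<close> the
  corresponding element of the new segment. The parameters \<open>a\<close> and \<open>c\<close> are homogeneous coordinates
  on the closure of the orbit of the edge.\<close>

definition wv :: "(('v \<times> nat) set \<Rightarrow> nat) \<Rightarrow> ('v \<times> nat) set \<Rightarrow> ('v \<times> nat) set \<Rightarrow> nat \<Rightarrow> complex \<Rightarrow> complex \<Rightarrow>
    ('v \<times> nat) set \<times> nat \<Rightarrow> complex ^ 'n" where
  "wv x s s' r a c p = (if fst p = s \<and> snd p < x s + r
     then a *s bb (ev p) + c *s bb (el s' (x s' - r + (snd p - x s))) else bb (ev p))"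

definition Phi :: "(('v \<times> nat) set \<Rightarrow> nat) \<Rightarrow> 'v \<Rightarrow> (complex ^ 'n) set" where
  "Phi x = (\<lambda>i\<in>verts Q. vec.span ((\<lambda>p. bb (ev p)) ` idx x i))"

text \<open>The family passes through \<open>Phi x\<close> at \<open>(1, 0)\<close> and, along an
  edge, through \<open>Phi (move x s s' r)\<close> at \<open>(0, 1)\<close>.\<close>

definition Psi :: "(('v \<times> nat) set \<Rightarrow> nat) \<Rightarrow> ('v \<times> nat) set \<Rightarrow> ('v \<times> nat) set \<Rightarrow> nat \<Rightarrow> complex \<Rightarrow> complex \<Rightarrow>
    'v \<Rightarrow> (complex ^ 'n) set" where
  "Psi x s s' r a c = (\<lambda>i\<in>verts Q. vec.span (wv x s s' r a c ` idx x i))"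

text \<open>Extensional, so that a state is determined by its values on the strings and
  \<open>Phi\<close> can be injective.\<close>

definition bounded_state :: "(('v \<times> nat) set \<Rightarrow> nat) \<Rightarrow> bool" where
  "bounded_state x \<longleftrightarrow> x \<in> comps \<rightarrow>\<^sub>E UNIV \<and> (\<forall>C\<in>comps. x C \<le> len C)"

lemma Psi_1_0: "Psi x s s' r 1 0 = Phi x"
proof -
  have "wv x s s' r 1 0 = (\<lambda>p. bb (ev p))" by (rule ext) (simp add: wv_def)
  then show ?thesis by (simp add: Psi_def Phi_def)
qed

lemma seg:
  assumes e: "edge x s s' r" and p: "p \<in> idx x i" "fst p = s" "snd p < x s + r"
  shows "x s' - r + (snd p - x s) < x s'" "x s' - r + (snd p - x s) < len s'"
    "fst (el s' (x s' - r + (snd p - x s))) = i" "el s' (x s' - r + (snd p - x s)) \<in> verts CQ"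
    "sm.match (fst p) (snd p) s' (x s' - r + (snd p - x s))"
proof -
  define j where "j = snd p - x s"
  have j: "j < r" "snd p = x s + j" using p by (auto simp: j_def idx_def)
  have "r \<le> x s'" "x s' \<le> len s'" and m: "sm.match s (x s) s' (x s' - r)" using e by (auto simp: sm.edge_def)
  then have lt: "x s' - r + j < x s'" "x s' - r + j < len s'" using j by auto
  from sm.match_shift(1)[OF m lt(2)] have m': "sm.match (fst p) (snd p) s' (x s' - r + j)" using j p by simp
  show "x s' - r + (snd p - x s) < x s'" "x s' - r + (snd p - x s) < len s'"
    "sm.match (fst p) (snd p) s' (x s' - r + (snd p - x s))"
    using lt m' by (simp_all add: j_def)
  have "fst (el s' (x s' - r + j)) = i" using m' p(1) by (auto simp: sm.match_def idx_def)
  then show "fst (el s' (x s' - r + (snd p - x s))) = i" by (simp add: j_def)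
  show "el s' (x s' - r + (snd p - x s)) \<in> verts CQ"
    using lt m' by (auto simp: sm.match_def j_def intro!: el_in_verts)
qed

text \<open>The new segment ends before \<open>x s'\<close>, where the present part of
  \<open>s'\<close> begins.\<close>

lemma seg_notin:
  assumes e: "edge x s s' r" and p: "p \<in> idx x i" "fst p = s" "snd p < x s + r" and q: "q \<in> idx x i"
  shows "el s' (x s' - r + (snd p - x s)) \<noteq> ev q"
proof
  assume eq: "el s' (x s' - r + (snd p - x s)) = ev q"
  have fq: "fst q \<in> comps" "snd q < len (fst q)" "x (fst q) \<le> snd q" using q by (auto simp: idx_def)
  have "s' = fst q \<and> x s' - r + (snd p - x s) = snd q"
    by (rule el_inj[OF sm.edge_size(5)[OF e] fq(1) seg(2)[OF e p] fq(2) eq])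
  then show False using fq(3) seg(1)[OF e p] by (metis not_less)
qed

lemma wv_in:
  assumes e: "edge x s s' r" and p: "p \<in> idx x i" and i: "i \<in> verts Q"
  shows "wv x s s' r a c p \<in> vsp M i"
proof -
  note sub = vsp_subspace[OF i]
  have "bb (ev p) \<in> vsp M i" using bb_in[of "ev p"] idx_ev[OF p] by auto
  moreover have "bb (el s' (x s' - r + (snd p - x s))) \<in> vsp M i" if "fst p = s" "snd p < x s + r"
    using bb_in[OF seg(4)[OF e p that]] seg(3)[OF e p that] by simp
  ultimately show ?thesis
    unfolding wv_def using sub by (auto intro!: vec.subspace_add vec.subspace_scale)
qed

lemma ce_ev: "p \<in> idx x i \<Longrightarrow> q \<in> idx x i \<Longrightarrow> ce (ev q) (bb (ev p)) = of_bool (p = q)"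
  using cf_bb[of "ev q" "ev p"] idx_ev[of p x i] idx_ev[of q x i] ev_inj[of p x i q x i] by auto

lemma ce_wv:
  assumes e: "edge x s s' r" and p: "p \<in> idx x i" and q: "q \<in> idx x i" and i: "i \<in> verts Q"
  shows "ce (ev q) (wv x s s' r a c p) = (if p = q then (if fst p = s \<and> snd p < x s + r then a else 1) else 0)"
proof (cases "fst p = s \<and> snd p < x s + r")
  case True
  let ?z = "el s' (x s' - r + (snd p - x s))"
  have z: "?z \<in> verts CQ" "fst ?z = i" "?z \<noteq> ev q"
    using seg[OF e p] seg_notin[OF e p _ _ q] True by auto
  have in1: "bb (ev p) \<in> vsp M i" "bb ?z \<in> vsp M i" using bb_in[of "ev p"] bb_in[OF z(1)] idx_ev[OF p] z by auto
  have "ce (ev q) (bb ?z) = 0" using cf_bb[of "ev q" ?z] idx_ev[OF q] z by auto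
  then show ?thesis
    using True idx_ev[OF q] in1 ce_ev[OF p q] vsp_subspace[OF i]
    by (cases "p = q") (simp_all add: wv_def cf_add[OF i] cf_scale[OF i] vec.subspace_scale)
next
  case False
  then show ?thesis using ce_ev[OF p q] by (auto simp: wv_def)
qed

lemma ce_wv_new:
  assumes e: "edge x s s' r" and p: "p \<in> idx x i" and q: "q \<in> idx x i" "fst q = s" "snd q < x s + r"
    and i: "i \<in> verts Q"
  shows "ce (el s' (x s' - r + (snd q - x s))) (wv x s s' r a c p) = (if p = q then c else 0)"
proof -
  let ?y = "el s' (x s' - r + (snd q - x s))"
  have y: "?y \<in> verts CQ" "fst ?y = i" "?y \<noteq> ev p" using seg[OF e q] seg_notin[OF e q p] by auto
  have p0: "ce ?y (bb (ev p)) = 0" using cf_bb[of ?y "ev p"] idx_ev[OF p] y by auto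
  show ?thesis
  proof (cases "fst p = s \<and> snd p < x s + r")
    case True
    let ?z = "el s' (x s' - r + (snd p - x s))"
    have z: "?z \<in> verts CQ" "fst ?z = i" "x s' - r + (snd p - x s) < len s'" using seg[OF e p] True by auto
    have in1: "bb (ev p) \<in> vsp M i" "bb ?z \<in> vsp M i" using bb_in[of "ev p"] bb_in[OF z(1)] idx_ev[OF p] z by auto
    have "?y = ?z \<longleftrightarrow> p = q"
    proof
      assume "?y = ?z"
      then have "x s' - r + (snd q - x s) = x s' - r + (snd p - x s)"
        using el_inj[of s' s'] seg(2)[OF e q] z(3) sm.edge_size(5)[OF e] by blast
      moreover have "x s \<le> snd p" "x s \<le> snd q" using p q True by (auto simp: idx_def)
      ultimately show "p = q" using True q by (auto simp: prod_eq_iff)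
    qed simp
    then have "ce ?y (bb ?z) = of_bool (p = q)" using cf_bb[of ?y ?z] y z by auto
    then show ?thesis
      using True y in1 p0 vsp_subspace[OF i]
      by (simp add: wv_def cf_add[OF i] cf_scale[OF i] vec.subspace_scale)
  next
    case False
    then have "p \<noteq> q" using q by auto
    then show ?thesis using False p0 by (simp add: wv_def if_not_P)
  qed
qed

lemma ce_sum:
  assumes i: "i \<in> verts Q" and y: "fst y = i" and A: "\<And>p. p \<in> A \<Longrightarrow> w p \<in> vsp M i"
  shows "ce y (\<Sum>p\<in>A. d p *s w p) = (\<Sum>p\<in>A. d p * ce y (w p))"
  using A y vsp_subspace[OF i] by (simp add: cf_sum[OF i] cf_scale[OF i] vec.subspace_scale)

text \<open>The coordinate at an old element reads off \<open>a\<close> times a coefficient, the one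
  at the matched new element \<open>c\<close> times it; one of them suffices since \<open>a\<close>
  and \<open>c\<close> are not both zero.\<close>

lemma wv_family:
  assumes e: "edge x s s' r" and ac: "(a, c) \<noteq> (0, 0)" and i: "i \<in> verts Q"
  shows "inj_on (wv x s s' r a c) (idx x i)" "vec.independent (wv x s s' r a c ` idx x i)"
proof -
  have zero: "d q = 0" if d: "(\<Sum>p\<in>idx x i. d p *s wv x s s' r a c p) = 0" "q \<in> idx x i" for d q
  proof -
    have co: "(\<Sum>p\<in>idx x i. d p * ce y (wv x s s' r a c p)) = 0" if "fst y = i" for y
      using ce_sum[OF i that, of "idx x i" "wv x s s' r a c" d] wv_in[OF e _ i] d(1) cf_0[OF i] that by auto
    show ?thesis
    proof (cases "fst q = s \<and> snd q < x s + r")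
      case True
      have "d q * a = (\<Sum>p\<in>idx x i. d p * ce (ev q) (wv x s s' r a c p))"
      proof -
        have "(\<Sum>p\<in>idx x i. d p * ce (ev q) (wv x s s' r a c p)) = (\<Sum>p\<in>idx x i. if p = q then d q * a else 0)"
          using ce_wv[OF e _ d(2) i] True by (intro sum.cong) auto
        then show ?thesis using d(2) finite_idx by simp
      qed
      then have "d q * a = 0" using co idx_ev[OF d(2)] by simp
      moreover have "d q * c = (\<Sum>p\<in>idx x i. d p * ce (el s' (x s' - r + (snd q - x s))) (wv x s s' r a c p))"
      proof -
        have "(\<Sum>p\<in>idx x i. d p * ce (el s' (x s' - r + (snd q - x s))) (wv x s s' r a c p)) =
            (\<Sum>p\<in>idx x i. if p = q then d q * c else 0)"
          using ce_wv_new[OF e _ d(2) _ _ i] True by (intro sum.cong) auto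
        then show ?thesis using d(2) finite_idx by simp
      qed
      then have "d q * c = 0" using co seg(3)[OF e d(2)] True by simp
      ultimately show ?thesis using ac by auto
    next
      case False
      have "(\<Sum>p\<in>idx x i. d p * ce (ev q) (wv x s s' r a c p)) = (\<Sum>p\<in>idx x i. if p = q then d q else 0)"
        using ce_wv[OF e _ d(2) i] False by (intro sum.cong) auto
      then show ?thesis using d(2) finite_idx co[of "ev q"] idx_ev[OF d(2)] by simp
    qed
  qed
  show "inj_on (wv x s s' r a c) (idx x i)" "vec.independent (wv x s s' r a c ` idx x i)"
    by (rule family_independentI, rule finite_idx, rule zero, assumption+)+
qed

lemma ev_family:
  assumes i: "i \<in> verts Q"
  shows "inj_on (\<lambda>p. bb (ev p)) (idx x i)" "vec.independent ((\<lambda>p. bb (ev p)) ` idx x i)"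
proof -
  have inn: "bb (ev p) \<in> vsp M i" if "p \<in> idx x i" for p using bb_in[of "ev p"] idx_ev[OF that] by auto
  have zero: "d q = 0" if d: "(\<Sum>p\<in>idx x i. d p *s bb (ev p)) = 0" "q \<in> idx x i" for d q
  proof -
    have "(\<Sum>p\<in>idx x i. d p * ce (ev q) (bb (ev p))) = 0"
      using ce_sum[OF i, of "ev q" "idx x i" "\<lambda>p. bb (ev p)" d] inn d(1) cf_0[OF i] idx_ev[OF d(2)] by auto
    moreover have "(\<Sum>p\<in>idx x i. d p * ce (ev q) (bb (ev p))) = (\<Sum>p\<in>idx x i. if p = q then d q else 0)"
      using ce_ev[OF _ d(2)] by (intro sum.cong) auto
    ultimately show ?thesis using d(2) finite_idx by simp
  qed
  show "inj_on (\<lambda>p. bb (ev p)) (idx x i)" "vec.independent ((\<lambda>p. bb (ev p)) ` idx x i)"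
    by (rule family_independentI, rule finite_idx, rule zero, assumption+)+
qed

lemma dim_Phi: "i \<in> verts Q \<Longrightarrow> vec.dim (Phi x i) = card (idx x i)"
  using ev_family[of i x] by (simp add: Phi_def vec.dim_eq_card_independent card_image)

lemma dim_Psi:
  assumes "edge x s s' r" "(a, c) \<noteq> (0, 0)" "i \<in> verts Q"
  shows "vec.dim (Psi x s s' r a c i) = card (idx x i)"
  using wv_family[OF assms] assms(3) by (simp add: Psi_def vec.dim_eq_card_independent card_image)

text \<open>Along the moved segment both strings follow the same arrows, so a vector of the family
  goes to the next one or to zero. After its last element the two summands go separately to basis
  vectors in the span, or to zero.\<close>

lemma vmap_wv:
  assumes x: "\<forall>C\<in>comps. x C \<le> len C" and e: "edge x s s' r" and a: "\<alpha> \<in> arcs Q"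
    and p: "p \<in> idx x (tail Q \<alpha>)"
  shows "vmap M \<alpha> (wv x s s' r a c p) \<in> vec.span (wv x s s' r a c ` idx x (head Q \<alpha>))"
proof -
  obtain t m where tm: "p = (t, m)" by (cases p)
  have t: "t \<in> comps" "x t \<le> m" "m < len t" "fst (el t m) = tail Q \<alpha>" using p tm by (auto simp: idx_def)
  have sv: "s' \<in> comps" "s \<in> comps" "s \<noteq> s'" using sm.edge_size(4,5)[OF e] sm.edge_neq[OF e] by auto
  let ?w = "wv x s s' r a c"
  let ?W = "vec.span (?w ` idx x (head Q \<alpha>))"
  have nxt: "vmap M \<alpha> (bb (el u k)) = (if Suc k < len u \<and> \<alpha> = qa u k then bb (el u (Suc k)) else 0)"
    if "u \<in> comps" "k < len u" "fst (el u k) = tail Q \<alpha>" for u k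
    using vmap_el[OF that(1,2) a] that(3) by simp
  have inW: "(u, k) \<in> idx x (head Q \<alpha>)" if "u \<in> comps" "x u \<le> k" "k < len u" "fst (el u k) = head Q \<alpha>" for u k
    using that by (simp add: idx_def)
  have heads: "fst (el u (Suc k)) = head Q \<alpha>" if "u \<in> comps" "Suc k < len u" "\<alpha> = qa u k" for u k
    using qa_props(3)[OF that(1,2)] that(3) by simp
  show ?thesis
  proof (cases "t = s \<and> m < x s + r")
    case False
    then have w: "?w p = bb (el t m)" unfolding wv_def tm fst_conv snd_conv by (simp only: if_False)
    show ?thesis
    proof (cases "Suc m < len t \<and> \<alpha> = qa t m")
      case True
      then have "(t, Suc m) \<in> idx x (head Q \<alpha>)" using t heads[of t m] by (intro inW) auto
      then have "?w (t, Suc m) \<in> ?W" by (intro vec.span_base imageI)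
      moreover have "?w (t, Suc m) = bb (el t (Suc m))" using False t by (auto simp: wv_def)
      ultimately show ?thesis using True nxt[OF t(1,3,4)] w by simp
    next
      case F: False
      then show ?thesis using nxt[OF t(1,3,4)] w vec.span_zero by auto
    qed
  next
    case True
    define n where "n = x s' - r + (m - x s)"
    note sg = seg[OF e p]
    have n: "n < x s'" "n < len s'" "fst (el s' n) = tail Q \<alpha>" "sm.match s m s' n"
      using sg True by (simp_all add: n_def tm)
    have w: "?w p = a *s bb (el s m) + c *s bb (el s' n)" using True by (simp add: wv_def tm n_def)
    have in1: "bb (el s m) \<in> vsp M (tail Q \<alpha>)" "bb (el s' n) \<in> vsp M (tail Q \<alpha>)"
      using bb_in[OF el_in_verts[OF t(1,3)]] bb_in[OF el_in_verts[OF sv(1) n(2)]] True t n by auto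
    have v: "vmap M \<alpha> (?w p) = a *s vmap M \<alpha> (bb (el s m)) + c *s vmap M \<alpha> (bb (el s' n))"
      unfolding w using in1 vsp_subspace[of "tail Q \<alpha>"] a
      by (simp add: vmap_add[OF a] vmap_scale[OF a] vec.subspace_scale)
    have rr: "r \<le> x s'" using e by (simp add: sm.edge_def)
    show ?thesis
    proof (cases "Suc m < len s \<and> \<alpha> = qa s m")
      case A: True
      have m1: "(s, Suc m) \<in> idx x (head Q \<alpha>)" using A t True heads[of s m] by (intro inW) auto
      have v1: "vmap M \<alpha> (bb (el s m)) = bb (el s (Suc m))" using nxt[of s m] A True t by simp
      show ?thesis
      proof (cases "Suc m < x s + r")
        case B: True
        have n1: "Suc n < x s'" "Suc n = x s' - r + (Suc m - x s)" using B t True rr by (auto simp: n_def)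
        then have "Suc n < len s'" using x sv(1) by force
        moreover from this have "qa s' n = qa s m"
          using sm.step[of s s' m n] n(4)
        proof -
          have "vmap M (qa s' n) (bb (el s' n)) = bb (el s' (Suc n))" "tail Q (qa s' n) = fst (el s m)" "qa s' n \<in> arcs Q"
            using qa_props[OF sv(1) \<open>Suc n < len s'\<close>] n t True by auto
          \<comment> \<open>The difference of the characters is constant along matched elements, so
            both strings take the same arrow.\<close>
          have "ep s' (Suc n) (Inr (qa s' n)) - ep s (Suc m) (Inr (qa s' n)) = ep s' n (Inr (qa s' n)) - ep s m (Inr (qa s' n))"
            using sm.match_shift(2)[OF n(4), of 1 "Inr (qa s' n)"] \<open>Suc n < len s'\<close> by simp
          then show ?thesis by (simp add: ep_Suc split: if_splits)
        qed
        ultimately have v2: "vmap M \<alpha> (bb (el s' n)) = bb (el s' (Suc n))" using nxt[OF sv(1) n(2,3)] A by simp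
        have "?w (s, Suc m) \<in> ?W" using m1 by (intro vec.span_base imageI)
        moreover have "?w (s, Suc m) = a *s bb (el s (Suc m)) + c *s bb (el s' (Suc n))"
          using B n1 by (simp add: wv_def)
        ultimately show ?thesis unfolding v v1 v2 by simp
      next
        case B: False
        then have mr: "Suc m = x s + r" using True t by auto
        then have nr: "Suc n = x s'" using rr t True by (auto simp: n_def)
        have "?w (s, Suc m) \<in> ?W" using m1 by (intro vec.span_base imageI)
        then have w1: "bb (el s (Suc m)) \<in> ?W" using mr by (simp add: wv_def)
        have w2: "vmap M \<alpha> (bb (el s' n)) \<in> ?W"
        proof (cases "Suc n < len s' \<and> \<alpha> = qa s' n")
          case C: True
          then have "(s', Suc n) \<in> idx x (head Q \<alpha>)" using sv nr heads[of s' n] by (intro inW) auto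
          then have "?w (s', Suc n) \<in> ?W" by (intro vec.span_base imageI)
          moreover have "?w (s', Suc n) = bb (el s' (Suc n))" using sv by (auto simp: wv_def)
          ultimately show ?thesis using C nxt[OF sv(1) n(2,3)] by simp
        next
          case C: False
          then show ?thesis using nxt[OF sv(1) n(2,3)] vec.span_zero by auto
        qed
        show ?thesis unfolding v v1 by (intro vec.span_add vec.span_scale w1 w2)
      qed
    next
      case A: False
      then have v1: "vmap M \<alpha> (bb (el s m)) = 0" using nxt[of s m] True t by auto
      \<comment> \<open>If the larger element continued along \<open>\<alpha>\<close>, alignment
        would make the smaller one, on \<open>s\<close>, continue along it as well.\<close>
      have "vmap M \<alpha> (bb (el s' n)) = 0"
      proof (rule ccontr)
        assume "vmap M \<alpha> (bb (el s' n)) \<noteq> 0"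
        then have B: "Suc n < len s'" "\<alpha> = qa s' n" using nxt[OF sv(1) n(2,3)] by (auto split: if_splits)
        then have "ep s' (Suc n) (Inr \<alpha>) - ep s (Suc m) (Inr \<alpha>) = ep s' n (Inr \<alpha>) - ep s m (Inr \<alpha>)"
          using sm.match_shift(2)[OF n(4), of 1 "Inr \<alpha>"] by simp
        then have "\<alpha> = qa s m" using B by (simp add: ep_Suc split: if_splits)
        moreover have "Suc m < len s" using sm.match_shift(1)[OF n(4), of 1] B by (simp add: sm.match_def)
        ultimately show False using A by simp
      qed
      then show ?thesis unfolding v v1 using vec.span_zero by simp
    qed
  qed
qed

end

lemma limitin_in_closure_of:
  assumes "limitin X f l F" "eventually (\<lambda>z. f z \<in> S) F" "F \<noteq> bot"
  shows "l \<in> X closure_of S"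
  unfolding in_closure_of
proof (intro conjI allI impI)
  show "l \<in> topspace X" using assms(1) by (simp add: limitin_def)
  fix T assume "l \<in> T \<and> openin X T"
  then have "eventually (\<lambda>z. f z \<in> T) F" using assms(1) by (auto simp: limitin_def)
  then have "eventually (\<lambda>z. f z \<in> S \<and> f z \<in> T) F" by (intro eventually_conj assms(2))
  from eventually_happens'[OF assms(3) this] show "\<exists>y. y \<in> S \<and> y \<in> T" by blast
qed

section \<open>The torus action on the curves\<close>

context straight_rep
begin

abbreviation scal :: "(('v, 'a) tindex \<Rightarrow> complex) \<Rightarrow> 'v \<times> nat \<Rightarrow> complex" where
  "scal \<equiv> TM_scale Q M b"
abbreviation actv :: "(('v, 'a) tindex \<Rightarrow> complex) \<Rightarrow> 'v \<Rightarrow> complex ^ 'n \<Rightarrow> complex ^ 'n" where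
  "actv \<equiv> TM_act_vec Q M b"
abbreviation act :: "(('v, 'a) tindex \<Rightarrow> complex) \<Rightarrow> ('v \<Rightarrow> (complex ^ 'n) set) \<Rightarrow> 'v \<Rightarrow> (complex ^ 'n) set" where
  "act \<equiv> TM_act Q M b"

lemma scal_nz:
  assumes "t \<in> torus I" "y \<in> verts CQ"
  shows "scal t y \<noteq> 0"
proof -
  obtain C m where "C \<in> comps" "m < len C" "y = el C m" using el_surj[OF assms(2)] by blast
  then show ?thesis
    using TM_scale_el[of C m t] assms(1) char_eval_nz[OF finite_I torus_nz[OF assms(1)]] by simp
qed

lemma actv_in: "i \<in> verts Q \<Longrightarrow> actv t i v \<in> vsp M i"
  unfolding TM_act_vec_def by (intro vec.subspace_sum vec.subspace_scale vsp_subspace b_in)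

lemma cf_actv:
  assumes i: "i \<in> verts Q" and k: "k \<in> bix M i"
  shows "cf i k (actv t i v) = scal t (i, k) * cf i k v"
proof -
  have "cf i k (actv t i v) = (\<Sum>l\<in>bix M i. (scal t (i, l) * cf i l v) * cf i k (b i l))"
    using ce_sum[OF i, of "(i, k)" "bix M i" "b i" "\<lambda>l. scal t (i, l) * cf i l v"] b_in[OF i]
    unfolding TM_act_vec_def fst_conv snd_conv by blast
  also have "\<dots> = (\<Sum>l\<in>bix M i. if l = k then scal t (i, k) * cf i k v else 0)"
    using cf_basis[OF i _ k] by (intro sum.cong) (auto simp del: One_nat_def)
  also have "\<dots> = scal t (i, k) * cf i k v" using k by simp
  finally show ?thesis .
qed

lemma actv_sum:
  assumes i: "i \<in> verts Q" and w: "\<And>p. p \<in> A \<Longrightarrow> w p \<in> vsp M i"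
  shows "actv t i (\<Sum>p\<in>A. d p *s w p) = (\<Sum>p\<in>A. d p *s actv t i (w p))"
proof (rule cf_eqI[OF i actv_in[OF i]])
  show "(\<Sum>p\<in>A. d p *s actv t i (w p)) \<in> vsp M i"
    by (intro vec.subspace_sum vec.subspace_scale vsp_subspace actv_in i)
  fix k assume k: "k \<in> bix M i"
  have "cf i k (\<Sum>p\<in>A. d p *s w p) = (\<Sum>p\<in>A. d p * cf i k (w p))"
    using ce_sum[OF i, of "(i, k)" A w d] w by simp
  moreover have "cf i k (\<Sum>p\<in>A. d p *s actv t i (w p)) = (\<Sum>p\<in>A. d p * cf i k (actv t i (w p)))"
    using ce_sum[OF i, of "(i, k)" A "\<lambda>p. actv t i (w p)" d] actv_in[OF i] by simp
  ultimately show "cf i k (actv t i (\<Sum>p\<in>A. d p *s w p)) = cf i k (\<Sum>p\<in>A. d p *s actv t i (w p))"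
    by (simp add: cf_actv[OF i k] sum_distrib_left mult_ac)
qed

lemma actv_bb:
  assumes y: "y \<in> verts CQ"
  shows "actv t (fst y) (bb y) = scal t y *s bb y"
proof -
  have i: "fst y \<in> verts Q" using y by (auto simp: verts_CQ)
  show ?thesis
  proof (rule cf_eqI[OF i actv_in[OF i] vec.subspace_scale[OF vsp_subspace[OF i] bb_in[OF y]]])
    fix k assume k: "k \<in> bix M (fst y)"
    have "(fst y, k) \<in> verts CQ" using i k by (simp add: verts_CQ)
    then have "cf (fst y) k (bb y) = of_bool ((fst y, k) = y)" using cf_bb[of "(fst y, k)" y] y by simp
    then show "cf (fst y) k (actv t (fst y) (bb y)) = cf (fst y) k (scal t y *s bb y)"
      using bb_in[OF y] by (auto simp: cf_actv[OF i k] cf_scale[OF i] prod_eq_iff)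
  qed
qed

lemma actv_span:
  assumes i: "i \<in> verts Q" and A: "finite A" and w: "\<And>p. p \<in> A \<Longrightarrow> w p \<in> vsp M i"
    and act: "\<And>p. p \<in> A \<Longrightarrow> actv t i (w p) = k p *s w' p" and k: "\<And>p. p \<in> A \<Longrightarrow> k p \<noteq> 0"
  shows "actv t i ` vec.span (w ` A) = vec.span (w' ` A)"
proof -
  have "actv t i ` vec.span (w ` A) = range (\<lambda>d. \<Sum>p\<in>A. d p *s actv t i (w p))"
    unfolding span_family[OF A] image_image by (simp add: actv_sum[OF i w])
  also have "\<dots> = range (\<lambda>d. \<Sum>p\<in>A. d p *s (k p *s w' p))"
    using act by (intro image_cong sum.cong) auto
  also have "\<dots> = vec.span ((\<lambda>p. k p *s w' p) ` A)" by (simp add: span_family[OF A])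
  also have "\<dots> = vec.span (w' ` A)" by (rule span_family_scale[OF A k])
  finally show ?thesis .
qed

lemma act_Phi:
  assumes t: "t \<in> torus I"
  shows "act t (Phi x) = Phi x"
proof -
  have "actv t i ` Phi x i = Phi x i" if i: "i \<in> verts Q" for i
  proof -
    have "actv t i ` vec.span ((\<lambda>p. bb (ev p)) ` idx x i) = vec.span ((\<lambda>p. bb (ev p)) ` idx x i)"
    proof (rule actv_span[OF i finite_idx])
      fix p assume p: "p \<in> idx x i"
      note y = idx_ev[OF p]
      show "bb (ev p) \<in> vsp M i" using bb_in[of "ev p"] y by auto
      show "actv t i (bb (ev p)) = scal t (ev p) *s bb (ev p)" using actv_bb[of "ev p" t] y by auto
      show "scal t (ev p) \<noteq> 0" using scal_nz[OF t] y by blast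
    qed
    then show ?thesis using i by (simp add: Phi_def)
  qed
  then show ?thesis unfolding TM_act_def by (auto simp: Phi_def fun_eq_iff)
qed

definition ilab :: "(('v \<times> nat) set \<Rightarrow> nat) \<Rightarrow> ('v \<times> nat) set \<Rightarrow> ('v \<times> nat) set \<Rightarrow> nat \<Rightarrow> ('v, 'a) tindex \<Rightarrow> int" where
  "ilab x s s' r = (\<lambda>i. ep s' (x s' - r) i - ep s (x s) i)"

lemma labl_ilab: "sm.labl x s s' r = (\<lambda>i. of_int (ilab x s s' r i))"
  by (rule ext) (simp add: sm.elab_def ilab_def)

lemma scal_match:
  assumes e: "edge x s s' r" and j: "j < r" and t: "t \<in> torus I"
  shows "scal t (el s' (x s' - r + j)) = char_eval I (ilab x s s' r) t * scal t (el s (x s + j))"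
proof -
  have "r \<le> x s'" "x s' \<le> len s'" and m: "sm.match s (x s) s' (x s' - r)" using e by (auto simp: sm.edge_def)
  then have lt: "x s' - r + j < len s'" using j by auto
  note m' = sm.match_shift[OF m lt]
  have "scal t (el s' (x s' - r + j)) = char_eval I (ep s' (x s' - r + j)) t"
    using m'(1) t by (intro TM_scale_el) (auto simp: sm.match_def)
  also have "\<dots> = char_eval I (\<lambda>i. ilab x s s' r i + ep s (x s + j) i) t"
  proof (rule char_eval_cong)
    fix i show "ep s' (x s' - r + j) i = ilab x s s' r i + ep s (x s + j) i"
      using m'(2)[of i] by (simp add: ilab_def)
  qed
  also have "\<dots> = char_eval I (ilab x s s' r) t * char_eval I (ep s (x s + j)) t"
    by (rule char_eval_mult[OF finite_I torus_nz[OF t]])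
  also have "char_eval I (ep s (x s + j)) t = scal t (el s (x s + j))"
    using m'(1) t by (intro TM_scale_el[symmetric]) (auto simp: sm.match_def)
  finally show ?thesis .
qed

text \<open>The two summands of a family vector are scaled by factors whose quotient is the
  character \<open>ilab\<close>, the same along the whole segment; the common factor does not change
  the span.\<close>

lemma act_Psi:
  assumes e: "edge x s s' r" and t: "t \<in> torus I"
  shows "act t (Psi x s s' r a c) = Psi x s s' r a (c * char_eval I (ilab x s s' r) t)"
proof -
  let ?l = "char_eval I (ilab x s s' r) t"
  have "actv t i ` vec.span (wv x s s' r a c ` idx x i) = vec.span (wv x s s' r a (c * ?l) ` idx x i)"
    if i: "i \<in> verts Q" for i
  proof (rule actv_span[OF i finite_idx wv_in[OF e _ i]])
    fix p assume p: "p \<in> idx x i"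
    note y = idx_ev[OF p]
    show "scal t (ev p) \<noteq> 0" using scal_nz[OF t] y by blast
    have 1: "actv t i (bb (ev p)) = scal t (ev p) *s bb (ev p)" using actv_bb[of "ev p" t] y by auto
    show "actv t i (wv x s s' r a c p) = scal t (ev p) *s wv x s s' r a (c * ?l) p"
    proof (cases "fst p = s \<and> snd p < x s + r")
      case True
      define z where "z = el s' (x s' - r + (snd p - x s))"
      have z: "z \<in> verts CQ" "fst z = i" using seg[OF e p] True by (auto simp: z_def)
      have le: "x s \<le> snd p" using p True by (auto simp: idx_def)
      have 2: "actv t i (bb z) = scal t z *s bb z" using actv_bb[OF z(1), of t] z by simp
      have sz: "scal t z = ?l * scal t (ev p)"
      proof -
        have j: "snd p - x s < r" "x s + (snd p - x s) = snd p" using True le by auto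
        have s: "s = fst p" using True by simp
        from scal_match[OF e j(1) t] show ?thesis unfolding j(2) z_def by (simp only: s)
      qed
      have in1: "bb (ev p) \<in> vsp M i" "bb z \<in> vsp M i" using bb_in[of "ev p"] bb_in[OF z(1)] y z by auto
      \<comment> \<open>A sum of two terms, indexed by truth values to fit
        \<open>actv_sum\<close>.\<close>
      have "actv t i (\<Sum>q\<in>{False, True}. (if q then a else c) *s (if q then bb (ev p) else bb z)) =
          (\<Sum>q\<in>{False, True}. (if q then a else c) *s actv t i (if q then bb (ev p) else bb z))"
        using in1 by (intro actv_sum[OF i]) auto
      then have "actv t i (a *s bb (ev p) + c *s bb z) = a *s actv t i (bb (ev p)) + c *s actv t i (bb z)"
        by (simp add: add.commute)
      also have "\<dots> = scal t (ev p) *s (a *s bb (ev p) + (c * ?l) *s bb z)"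
        unfolding 1 2 sz by (simp add: vec.scale_right_distrib vec.scale_scale mult_ac)
      finally show ?thesis using True by (simp add: wv_def z_def)
    next
      case False
      then have "wv x s s' r a c p = bb (ev p)" "wv x s s' r a (c * ?l) p = bb (ev p)" for a c
        unfolding wv_def by (simp_all only: if_False)
      then show ?thesis using 1 by simp
    qed
  qed
  then show ?thesis unfolding TM_act_def Psi_def by (auto simp: fun_eq_iff)
qed

text \<open>Scaling both parameters scales exactly the moved vectors of the family.\<close>

lemma Psi_scale:
  assumes "k \<noteq> 0"
  shows "Psi x s s' r (k * a) (k * c) = Psi x s s' r a c"
proof -
  let ?k = "\<lambda>p. if fst p = s \<and> snd p < x s + r then k else 1"
  have w: "wv x s s' r (k * a) (k * c) = (\<lambda>p. ?k p *s wv x s s' r a c p)"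
    by (rule ext) (simp add: wv_def vec.scale_right_distrib vec.scale_scale)
  have "vec.span ((\<lambda>p. ?k p *s wv x s s' r a c p) ` idx x i) = vec.span (wv x s s' r a c ` idx x i)" for i
    using assms by (intro span_family_scale finite_idx) auto
  then show ?thesis unfolding Psi_def w by simp
qed

lemma span_wv_coords:
  assumes e: "edge x s s' r" and i: "i \<in> verts Q" and v: "v \<in> vec.span (wv x s s' r 1 c ` idx x i)"
  shows "v = (\<Sum>q\<in>idx x i. ce (ev q) v *s wv x s s' r 1 c q)"
proof -
  obtain d where d: "v = (\<Sum>p\<in>idx x i. d p *s wv x s s' r 1 c p)"
    using v unfolding span_family[OF finite_idx] by blast
  have "ce (ev q) v = d q" if q: "q \<in> idx x i" for q
  proof -
    have "ce (ev q) v = (\<Sum>p\<in>idx x i. d p * ce (ev q) (wv x s s' r 1 c p))"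
      unfolding d using idx_ev[OF q] wv_in[OF e _ i] by (intro ce_sum[OF i]) auto
    also have "\<dots> = (\<Sum>p\<in>idx x i. if p = q then d q else 0)"
      using ce_wv[OF e _ q i] by (intro sum.cong) auto
    finally show ?thesis using q finite_idx by simp
  qed
  then have "(\<Sum>q\<in>idx x i. ce (ev q) v *s wv x s s' r 1 c q) = (\<Sum>q\<in>idx x i. d q *s wv x s s' r 1 c q)"
    by (intro sum.cong) simp_all
  then show ?thesis using d by simp
qed

lemma edge_idx:
  assumes e: "edge x s s' r"
  shows "(s, x s) \<in> idx x (fst (el s (x s)))" "fst (el s (x s)) \<in> verts Q"
  using sm.edge_size(3,4)[OF e] el_in_verts[of s "x s"] by (auto simp: idx_def verts_CQ)

text \<open>For \<open>a = 1\<close> a vector of the span is determined by its coordinates at the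
  positions of the state, so the first moved vector is the same in both families; its coordinate at
  the new element is the parameter.\<close>

lemma Psi_inj:
  assumes e: "edge x s s' r" and eq: "Psi x s s' r 1 c = Psi x s s' r 1 c'"
  shows "c = c'"
proof -
  define i where "i = fst (el s (x s))"
  define p where "p = (s, x s)"
  have p: "p \<in> idx x i" and i: "i \<in> verts Q" using edge_idx[OF e] by (simp_all add: p_def i_def)
  have r: "fst p = s" "snd p < x s + r" using e by (auto simp: p_def sm.edge_def)
  have "wv x s s' r 1 c p \<in> Psi x s s' r 1 c i" using p i by (auto simp: Psi_def intro!: vec.span_base)
  then have "wv x s s' r 1 c p \<in> vec.span (wv x s s' r 1 c' ` idx x i)" unfolding eq using i by (simp add: Psi_def)
  from span_wv_coords[OF e i this]
  have "wv x s s' r 1 c p = (\<Sum>q\<in>idx x i. ce (ev q) (wv x s s' r 1 c p) *s wv x s s' r 1 c' q)" .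
  also have "(\<Sum>q\<in>idx x i. ce (ev q) (wv x s s' r 1 c p) *s wv x s s' r 1 c' q) =
      (\<Sum>q\<in>idx x i. if q = p then wv x s s' r 1 c' p else 0)"
  proof (rule sum.cong[OF refl])
    fix q assume q: "q \<in> idx x i"
    show "ce (ev q) (wv x s s' r 1 c p) *s wv x s s' r 1 c' q = (if q = p then wv x s s' r 1 c' p else 0)"
      unfolding ce_wv[OF e p q i] using r by auto
  qed
  also have "(\<Sum>q\<in>idx x i. if q = p then wv x s s' r 1 c' p else 0) = wv x s s' r 1 c' p"
    using p finite_idx by simp
  finally have w: "wv x s s' r 1 c p = wv x s s' r 1 c' p" .
  have "c = ce (el s' (x s' - r + (snd p - x s))) (wv x s s' r 1 c p)"
    unfolding ce_wv_new[OF e p p r i] by (simp only: if_True simp_thms)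
  also have "\<dots> = c'" unfolding w ce_wv_new[OF e p p r i] by (simp only: if_True simp_thms)
  finally show ?thesis .
qed

text \<open>For \<open>a = 0\<close> the moved segment is replaced by the matched one, which lies
  just in front of the present part of \<open>s'\<close>.\<close>

lemma Psi_0_1:
  assumes e: "edge x s s' r"
  shows "Psi x s s' r 0 1 = Phi (move x s s' r)"
proof -
  let ?x = "move x s s' r"
  have ne: "s \<noteq> s'" and S: "s \<in> comps" "s' \<in> comps" using sm.edge_neq[OF e] sm.edge_size[OF e] by auto
  have mv: "?x s = x s + r" "?x s' = x s' - r" "t \<noteq> s \<Longrightarrow> t \<noteq> s' \<Longrightarrow> ?x t = x t" for t
    using ne by (auto simp: sm.move_def)
  have rx: "r \<le> x s'" "x s' \<le> len s'" using e by (auto simp: sm.edge_def)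
  have "wv x s s' r 0 1 ` idx x i = (\<lambda>p. bb (ev p)) ` idx ?x i" for i
  proof (intro equalityI image_subsetI)
    fix p assume p: "p \<in> idx x i"
    show "wv x s s' r 0 1 p \<in> (\<lambda>p. bb (ev p)) ` idx ?x i"
    proof (cases "fst p = s \<and> snd p < x s + r")
      case True
      note sg = seg[OF e p]
      show ?thesis
        by (rule image_eqI[of _ _ "(s', x s' - r + (snd p - x s))"])
          (use True sg S in \<open>auto simp: wv_def idx_def mv\<close>)
    next
      case False
      then have w: "wv x s s' r 0 1 p = bb (ev p)" unfolding wv_def by (simp only: if_False)
      have "?x (fst p) \<le> snd p"
      proof -
        have le: "x (fst p) \<le> snd p" using p by (auto simp: idx_def)
        consider "fst p = s" | "fst p = s'" | "fst p \<noteq> s" "fst p \<noteq> s'" by blast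
        then show ?thesis
        proof cases
          case 1
          then show ?thesis using False mv(1) by simp
        next
          case 2
          then show ?thesis using le mv(2) by simp
        next
          case 3
          then show ?thesis using le mv(3)[of "fst p"] by simp
        qed
      qed
      then have "p \<in> idx ?x i" using p by (auto simp: idx_def)
      then show ?thesis unfolding w by (rule imageI)
    qed
  next
    fix p assume p: "p \<in> idx ?x i"
    show "bb (ev p) \<in> wv x s s' r 0 1 ` idx x i"
    proof (cases "fst p = s' \<and> snd p < x s'")
      case True
      define j where "j = snd p - (x s' - r)"
      have j: "snd p = x s' - r + j" "j < r" using p True mv rx by (auto simp: j_def idx_def)
      have m: "sm.match s (x s) s' (x s' - r)" using e by (simp add: sm.edge_def)
      have lt: "x s' - r + j < len s'" using j rx by simp
      note m' = sm.match_shift(1)[OF m lt]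
      have "(s, x s + j) \<in> idx x i" using m' p True j by (auto simp: idx_def sm.match_def)
      moreover have "wv x s s' r 0 1 (s, x s + j) = bb (ev p)" using True j by (simp add: wv_def)
      ultimately show ?thesis by (metis imageI)
    next
      case False
      have "x (fst p) \<le> snd p" "\<not> (fst p = s \<and> snd p < x s + r)"
      proof -
        have le: "?x (fst p) \<le> snd p" using p by (auto simp: idx_def)
        consider "fst p = s" | "fst p = s'" | "fst p \<noteq> s" "fst p \<noteq> s'" by blast
        then have "x (fst p) \<le> snd p \<and> \<not> (fst p = s \<and> snd p < x s + r)"
        proof cases
          case 1
          then show ?thesis using le mv(1) by simp
        next
          case 2
          then show ?thesis using False ne by simp
        next
          case 3
          then show ?thesis using le mv(3)[of "fst p"] by simp
        qed
        then show "x (fst p) \<le> snd p" "\<not> (fst p = s \<and> snd p < x s + r)" by blast+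
      qed
      then have "p \<in> idx x i" "wv x s s' r 0 1 p = bb (ev p)" using p unfolding wv_def by (auto simp: idx_def)
      then show ?thesis by (metis imageI)
    qed
  qed
  then show ?thesis unfolding Psi_def Phi_def by (simp only:)
qed

end

section \<open>The curves in the quiver Grassmannian\<close>

locale straight_Gr = straight_rep Q M b for Q :: "('v, 'a) pre_digraph" and M :: "('v, 'a, 'n::finite) rep"
    and b :: "'v \<Rightarrow> nat \<Rightarrow> complex ^ 'n" +
  fixes e :: "'v \<Rightarrow> int"
begin

definition state :: "(('v \<times> nat) set \<Rightarrow> nat) \<Rightarrow> bool" where
  "state x \<longleftrightarrow> bounded_state x \<and> Phi x \<in> quiver_Gr Q M e"

abbreviation "X \<equiv> quiver_Gr_top Q M e"

lemma topspace_X: "topspace X = quiver_Gr Q M e"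
  by (rule topspace_quiver_Gr_top[OF repM])

lemma Hausdorff_X: "Hausdorff_space X"
  by (rule Hausdorff_quiver_Gr_top[OF repM])

lemma state_dim:
  assumes "state x" "i \<in> verts Q"
  shows "int (card (idx x i)) = e i"
proof -
  have "Phi x i \<in> Gr (e i) (vsp M i)"
    using assms unfolding state_def quiver_Gr_def by (blast dest: PiE_mem)
  then show ?thesis using dim_Phi[OF assms(2), of x] by (simp add: Gr_def)
qed

lemma Psi_in:
  assumes x: "state x" and ed: "edge x s s' r" and ac: "(a, c) \<noteq> (0, 0)"
  shows "Psi x s s' r a c \<in> quiver_Gr Q M e"
  unfolding quiver_Gr_def
proof (intro CollectI conjI ballI PiE_I)
  fix i assume i: "i \<in> verts Q"
  have "vec.span (wv x s s' r a c ` idx x i) \<subseteq> vsp M i"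
    using wv_in[OF ed _ i] by (intro vec.span_minimal vsp_subspace i) auto
  then show "Psi x s s' r a c i \<in> Gr (e i) (vsp M i)"
    using dim_Psi[OF ed ac i] state_dim[OF x i] i by (simp add: Gr_def Psi_def)
next
  fix i assume "i \<notin> verts Q"
  then show "Psi x s s' r a c i = undefined" by (simp add: Psi_def)
next
  fix \<alpha> assume a: "\<alpha> \<in> arcs Q"
  let ?w = "wv x s s' r a c"
  have xb: "\<forall>C\<in>comps. x C \<le> len C" using x by (simp add: state_def bounded_state_def)
  have t: "tail Q \<alpha> \<in> verts Q" "head Q \<alpha> \<in> verts Q" using a by auto
  show "vmap M \<alpha> ` Psi x s s' r a c (tail Q \<alpha>) \<subseteq> Psi x s s' r a c (head Q \<alpha>)"
  proof (rule image_subsetI)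
    fix v assume "v \<in> Psi x s s' r a c (tail Q \<alpha>)"
    then obtain d where d: "v = (\<Sum>p\<in>idx x (tail Q \<alpha>). d p *s ?w p)"
      using t by (auto simp: Psi_def span_family[OF finite_idx])
    have in1: "?w p \<in> vsp M (tail Q \<alpha>)" if "p \<in> idx x (tail Q \<alpha>)" for p using wv_in[OF ed that t(1)] .
    have "vmap M \<alpha> v = (\<Sum>p\<in>idx x (tail Q \<alpha>). d p *s vmap M \<alpha> (?w p))"
      unfolding d using in1 vsp_subspace[OF t(1)]
      by (simp add: vmap_sum[OF a] vmap_scale[OF a] vec.subspace_scale)
    also have "\<dots> \<in> vec.span (?w ` idx x (head Q \<alpha>))"
      by (intro vec.span_sum vec.span_scale vmap_wv[OF xb ed a])
    finally show "vmap M \<alpha> v \<in> Psi x s s' r a c (head Q \<alpha>)" using t by (simp add: Psi_def)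
  qed
qed

lemma state_move:
  assumes x: "state x" and ed: "edge x s s' r"
  shows "state (move x s s' r)"
proof -
  have "Phi (move x s s' r) \<in> quiver_Gr Q M e"
    using Psi_in[OF x ed, of 0 1] Psi_0_1[OF ed] by simp
  moreover have "bounded_state (move x s s' r)"
    using x sm.edge_size[OF ed] ed
    unfolding state_def bounded_state_def sm.move_def sm.edge_def by (auto simp: PiE_iff extensional_def)
  ultimately show ?thesis by (simp add: state_def)
qed

text \<open>An enumeration of the positions turns the family into frames that depend continuously on
  the parameters, and taking spans is continuous.\<close>

lemma continuous_map_Psi:
  assumes x: "state x" and ed: "edge x s s' r"
  shows "continuous_map (top_of_set (- {(0, 0)})) X (\<lambda>z. Psi x s s' r (fst z) (snd z))"
proof -
  let ?T = "top_of_set (- {(0, 0)}) :: (complex \<times> complex) topology"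
  have comp: "continuous_map ?T (Gr_top (e i) (vsp M i)) (\<lambda>z. Psi x s s' r (fst z) (snd z) i)" if i: "i \<in> verts Q" for i
  proof -
    define k where "k = nat (e i)"
    have k: "card (idx x i) = k" "0 \<le> e i" using state_dim[OF x i] by (auto simp: k_def)
    obtain h where h: "bij_betw h {..<k} (idx x i)"
      using ex_bij_betw_nat_finite[OF finite_idx, of x i] k(1) by (auto simp: atLeast0LessThan)
    define w where "w = (\<lambda>z. \<lambda>j\<in>{..<k}. wv x s s' r (fst z) (snd z) (h j))"
    have img: "w z ` {..<k} = wv x s s' r (fst z) (snd z) ` idx x i" for z
      using h by (simp add: w_def bij_betw_def flip: image_image)
    have fr: "w z \<in> frames k (vsp M i)" if z: "z \<noteq> (0, 0)" for z
    proof -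
      note fam = wv_family[OF ed _ i, of "fst z" "snd z"]
      have "inj_on (w z) {..<k}"
      proof -
        have "inj_on (wv x s s' r (fst z) (snd z) \<circ> h) {..<k}"
          using h fam(1) z by (intro comp_inj_on) (auto simp: bij_betw_def prod_eq_iff)
        then show ?thesis by (simp add: w_def inj_on_def)
      qed
      moreover have "w z \<in> {..<k} \<rightarrow>\<^sub>E vsp M i"
      proof (rule PiE_I)
        fix j assume "j \<in> {..<k}"
        then have "h j \<in> idx x i" using bij_betwE[OF h] by blast
        then show "w z j \<in> vsp M i" using wv_in[OF ed _ i] \<open>j \<in> {..<k}\<close> by (simp add: w_def)
      qed (simp add: w_def)
      ultimately show ?thesis using fam(2) z unfolding frames_def img[symmetric] by (auto simp: prod_eq_iff)
    qed
    have "continuous_map ?T (subtopology (tuple_top k) (frames k (vsp M i))) w"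
      unfolding continuous_map_in_subtopology
    proof
      show "w \<in> topspace ?T \<rightarrow> frames k (vsp M i)" using fr by auto
      show "continuous_map ?T (tuple_top k) w"
        unfolding continuous_map_componentwise
      proof (intro conjI ballI)
        show "w ` topspace ?T \<subseteq> extensional {..<k}" by (auto simp: w_def)
        fix j assume j: "j \<in> {..<k}"
        have cw: "continuous_on A (\<lambda>z :: complex \<times> complex. fst z *s u + snd z *s v)" for A and u v :: "complex ^ 'n"
          unfolding vector_scalar_mult_def by (intro continuous_intros)
        have "continuous_on (- {(0, 0)}) (\<lambda>z. wv x s s' r (fst z) (snd z) (h j))"
        proof (cases "fst (h j) = s \<and> snd (h j) < x s + r")
          case True
          then show ?thesis unfolding wv_def using cw by simp
        next
          case False
          then have w: "wv x s s' r a c (h j) = bb (ev (h j))" for a c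
            unfolding wv_def by (simp only: if_False)
          show ?thesis unfolding w by (rule continuous_on_const)
        qed
        then show "continuous_map ?T euclidean (\<lambda>z. w z j)" using j by (simp add: w_def)
      qed
    qed
    from continuous_map_compose[OF this continuous_map_span[OF vsp_subspace[OF i] k(2), folded k_def]]
    have "continuous_map ?T (Gr_top (e i) (vsp M i)) (\<lambda>z. vec.span (w z ` {..<k}))" by (simp add: o_def)
    then show ?thesis unfolding img using i by (simp add: Psi_def)
  qed
  show ?thesis
    unfolding quiver_Gr_top_def continuous_map_in_subtopology continuous_map_componentwise
  proof (intro conjI ballI)
    show "(\<lambda>z. Psi x s s' r (fst z) (snd z)) ` topspace ?T \<subseteq> extensional (verts Q)" by (auto simp: Psi_def)
    show "(\<lambda>z. Psi x s s' r (fst z) (snd z)) \<in> topspace ?T \<rightarrow> quiver_Gr Q M e"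
      using Psi_in[OF x ed] by (auto simp: prod_eq_iff)
  qed (rule comp)
qed

definition orb :: "(('v \<times> nat) set \<Rightarrow> nat) \<Rightarrow> ('v \<times> nat) set \<Rightarrow> ('v \<times> nat) set \<Rightarrow> nat \<Rightarrow> ('v \<Rightarrow> (complex ^ 'n) set) set" where
  "orb x s s' r = Psi x s s' r 1 ` (- {0})"

lemma orb_subset: "state x \<Longrightarrow> edge x s s' r \<Longrightarrow> orb x s s' r \<subseteq> quiver_Gr Q M e"
  using Psi_in unfolding orb_def by auto

text \<open>The set is the image of the unit sphere of pairs of complex numbers, hence compact in a
  Hausdorff space.\<close>

lemma closedin_orb:
  assumes x: "state x" and ed: "edge x s s' r"
  shows "closedin X (orb x s s' r \<union> {Phi x, Phi (move x s s' r)})"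
proof -
  let ?P = "\<lambda>z. Psi x s s' r (fst z) (snd z)"
  let ?S = "sphere 0 1 :: (complex \<times> complex) set"
  have sub: "?S \<subseteq> - {(0, 0)}" by auto
  have "compactin (top_of_set (- {(0, 0)})) ?S"
    using sub by (simp add: compactin_subtopology)
  from image_compactin[OF this continuous_map_Psi[OF x ed]]
  have "closedin X (?P ` ?S)" by (rule compactin_imp_closedin[OF Hausdorff_X])
  moreover have "?P ` ?S = orb x s s' r \<union> {Phi x, Phi (move x s s' r)}"
  proof (intro equalityI subsetI)
    fix U assume "U \<in> ?P ` ?S"
    then obtain a c where ac: "(a, c) \<in> ?S" "U = Psi x s s' r a c" by auto
    consider "a = 0" | "c = 0" "a \<noteq> 0" | "a \<noteq> 0" "c \<noteq> 0" by blast
    then show "U \<in> orb x s s' r \<union> {Phi x, Phi (move x s s' r)}"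
    proof cases
      case 1
      then have "c \<noteq> 0" using ac(1) by auto
      then have "U = Psi x s s' r 0 1" using Psi_scale[of c x s s' r 0 1] ac(2) 1 by simp
      then show ?thesis by (simp add: Psi_0_1[OF ed])
    next
      case 2
      then have "U = Psi x s s' r 1 0" using Psi_scale[of a x s s' r 1 0] ac(2) by simp
      then show ?thesis by (simp add: Psi_1_0)
    next
      case 3
      then have "U = Psi x s s' r 1 (c / a)" using Psi_scale[of a x s s' r 1 "c / a"] ac(2) by simp
      then show ?thesis using 3 by (auto simp: orb_def)
    qed
  next
    fix U assume "U \<in> orb x s s' r \<union> {Phi x, Phi (move x s s' r)}"
    then consider c where "U = Psi x s s' r 1 c" | "U = Psi x s s' r 1 0" | "U = Psi x s s' r 0 1"
      unfolding Psi_0_1[OF ed] Psi_1_0 orb_def by blast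
    then have "\<exists>a c. (a, c) \<noteq> (0, 0) \<and> U = Psi x s s' r a c"
      by cases (metis one_neq_zero Pair_inject)+
    then obtain a c where ac: "(a, c) \<noteq> (0, 0)" "U = Psi x s s' r a c" by (elim exE conjE)
    define k where "k = complex_of_real (1 / norm (a, c))"
    have n: "norm (a, c) \<noteq> 0" using ac(1) by (metis norm_eq_zero zero_prod_def)
    then have "k \<noteq> 0" by (simp add: k_def)
    have "(k * a, k * c) = (1 / norm (a, c)) *\<^sub>R (a, c)" by (simp add: k_def scaleR_conv_of_real)
    then have "norm (k * a, k * c) = \<bar>1 / norm (a, c)\<bar> * norm (a, c)" by (simp only: norm_scaleR)
    then have "norm (k * a, k * c) = 1" using n by (simp del: norm_Pair)
    moreover have "U = ?P (k * a, k * c)" using Psi_scale[OF \<open>k \<noteq> 0\<close>] ac(2) by simp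
    ultimately show "U \<in> ?P ` ?S" by (intro image_eqI[of _ _ "(k * a, k * c)"]) auto
  qed
  ultimately show ?thesis by simp
qed

lemma limitin_Psi_0:
  assumes x: "state x" and ed: "edge x s s' r" and g: "(g \<longlongrightarrow> 0) F"
  shows "limitin X (\<lambda>z. Psi x s s' r 1 (g z)) (Phi x) F"
proof -
  have "continuous_map euclidean (top_of_set (- {(0, 0)})) (\<lambda>c :: complex. (1 :: complex, c))"
    unfolding continuous_map_in_subtopology by (auto simp: continuous_map_iff_continuous2 intro!: continuous_intros)
  from continuous_map_compose[OF this continuous_map_Psi[OF x ed]]
  have "continuous_map euclidean X (\<lambda>c. Psi x s s' r 1 c)" by (simp add: o_def)
  then show ?thesis
    using continuous_map_limit[of euclidean X "\<lambda>c. Psi x s s' r 1 c" g 0 F] g Psi_1_0[of x s s' r] by (simp add: o_def)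
qed

lemma limitin_Psi_infinity:
  assumes x: "state x" and ed: "edge x s s' r" and g: "(g \<longlongrightarrow> 0) F"
  shows "limitin X (\<lambda>z. Psi x s s' r (g z) 1) (Phi (move x s s' r)) F"
proof -
  have "continuous_map euclidean (top_of_set (- {(0, 0)})) (\<lambda>c :: complex. (c, 1 :: complex))"
    unfolding continuous_map_in_subtopology by (auto simp: continuous_map_iff_continuous2 intro!: continuous_intros)
  from continuous_map_compose[OF this continuous_map_Psi[OF x ed]]
  have "continuous_map euclidean X (\<lambda>c. Psi x s s' r c 1)" by (simp add: o_def)
  then show ?thesis
    using continuous_map_limit[of euclidean X "\<lambda>c. Psi x s s' r c 1" g 0 F] g Psi_0_1[OF ed] by (simp add: o_def)
qed

lemma closure_orb:
  assumes x: "state x" and ed: "edge x s s' r"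
  shows "X closure_of (orb x s s' r) = orb x s s' r \<union> {Phi x, Phi (move x s s' r)}"
proof
  show "X closure_of (orb x s s' r) \<subseteq> orb x s s' r \<union> {Phi x, Phi (move x s s' r)}"
    by (intro closure_of_minimal closedin_orb[OF x ed]) auto
  have sub: "orb x s s' r \<subseteq> X closure_of (orb x s s' r)"
    using orb_subset[OF x ed] by (intro closure_of_subset) (simp add: topspace_X)
  have g: "((\<lambda>c :: complex. c) \<longlongrightarrow> 0) (at 0)" by (rule tendsto_ident_at)
  have "Phi x \<in> X closure_of (orb x s s' r)"
  proof (rule limitin_in_closure_of[OF limitin_Psi_0[OF x ed g]])
    show "\<forall>\<^sub>F c in at 0. Psi x s s' r 1 c \<in> orb x s s' r"
      by (auto simp: orb_def eventually_at intro: exI[of _ 1])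
  qed simp
  moreover have "Phi (move x s s' r) \<in> X closure_of (orb x s s' r)"
  proof (rule limitin_in_closure_of[OF limitin_Psi_infinity[OF x ed g]])
    have "Psi x s s' r c 1 \<in> orb x s s' r" if "c \<noteq> 0" for c
      using Psi_scale[OF that, of x s s' r 1 "1 / c"] that by (auto simp: orb_def)
    then show "\<forall>\<^sub>F c in at 0. Psi x s s' r c 1 \<in> orb x s s' r"
      by (auto simp: eventually_at intro: exI[of _ 1])
  qed simp
  ultimately show "orb x s s' r \<union> {Phi x, Phi (move x s s' r)} \<subseteq> X closure_of (orb x s s' r)"
    using sub by simp
qed

end

section \<open>Classification of orbits\<close>

text \<open>Elimination over the integers: a coordinate is cleared by cross-multiplication with a
  pivot \<open>z\<close> instead of division.\<close>

lemma int_relation_exists: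
  fixes v :: "'a \<Rightarrow> 'i \<Rightarrow> int"
  assumes "finite I" "finite A" "card I < card A"
  shows "\<exists>c. (\<forall>j\<in>I. (\<Sum>a\<in>A. c a * v a j) = 0) \<and> (\<exists>a\<in>A. c a \<noteq> 0)"
  using assms
proof (induction I arbitrary: A v rule: finite_induct)
  case empty
  then show ?case by (intro exI[of _ "\<lambda>_. 1"]) (auto simp: card_gt_0_iff)
next
  case (insert j I)
  have card: "card I < card A" using insert by simp
  show ?case
  proof (cases "\<forall>a\<in>A. v a j = 0")
    case True
    obtain c where "\<forall>j\<in>I. (\<Sum>a\<in>A. c a * v a j) = 0" "\<exists>a\<in>A. c a \<noteq> 0"
      using insert.IH[OF insert.prems(1) card] by blast
    then show ?thesis using True by (intro exI[of _ c]) simp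
  next
    case False
    then obtain z where z: "z \<in> A" "v z j \<noteq> 0" by blast
    let ?B = "A - {z}"
    have B: "finite ?B" "card I < card ?B" using insert z by auto
    obtain c where c: "\<And>i. i \<in> I \<Longrightarrow> (\<Sum>a\<in>?B. c a * (v z j * v a i - v a j * v z i)) = 0" "\<exists>a\<in>?B. c a \<noteq> 0"
      using insert.IH[OF B, of "\<lambda>a i. v z j * v a i - v a j * v z i"] by blast
    \<comment> \<open>The other coefficients are multiplied by \<open>v z j\<close>, and that of the
      pivot is chosen to make coordinate \<open>j\<close> vanish.\<close>
    define d where "d = (\<lambda>a. if a = z then - (\<Sum>a\<in>?B. c a * v a j) else v z j * c a)"
    have d: "(\<Sum>a\<in>A. d a * v a i) = (\<Sum>a\<in>?B. c a * (v z j * v a i - v a j * v z i))" for i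
    proof -
      have "(\<Sum>a\<in>A. d a * v a i) = d z * v z i + (\<Sum>a\<in>?B. d a * v a i)"
        by (rule sum.remove[OF insert.prems(1) z(1)])
      also have "(\<Sum>a\<in>?B. d a * v a i) = (\<Sum>a\<in>?B. v z j * c a * v a i)"
        by (intro sum.cong) (auto simp: d_def)
      also have "d z * v z i = - (\<Sum>a\<in>?B. c a * v a j * v z i)"
        by (simp add: d_def sum_distrib_right)
      finally show ?thesis by (simp add: sum_subtractf algebra_simps)
    qed
    have "(\<Sum>a\<in>A. d a * v a i) = 0" if "i \<in> insert j I" for i
      using that c(1) unfolding d by (cases "i = j") (auto simp: mult.commute)
    moreover have "\<exists>a\<in>A. d a \<noteq> 0" using c(2) z by (auto simp: d_def)
    ultimately show ?thesis by blast
  qed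
qed

lemma int_independent_card_le:
  assumes "finite I" "int_independent I S"
  shows "card S \<le> card I"
proof (rule ccontr)
  assume "\<not> card S \<le> card I"
  moreover have "finite S" using assms(2) by (simp add: int_independent_def)
  ultimately obtain c :: "('a \<Rightarrow> int) \<Rightarrow> int" where "\<forall>j\<in>I. (\<Sum>m\<in>S. c m * m j) = 0" "\<exists>m\<in>S. c m \<noteq> 0"
    using int_relation_exists[OF assms(1), of S "\<lambda>m. m"] by auto
  then show False using assms(2) by (auto simp: int_independent_def)
qed

lemma card_le_orbit_dim:
  assumes "finite I" "S \<subseteq> orbit_characters I act p" "int_independent I S"
  shows "card S \<le> orbit_dim I act p"
  unfolding orbit_dim_def
proof (rule Max_ge)
  have "card ` {S. S \<subseteq> orbit_characters I act p \<and> int_independent I S} \<subseteq> {..card I}"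
    using int_independent_card_le[OF assms(1)] by blast
  then show "finite (card ` {S. S \<subseteq> orbit_characters I act p \<and> int_independent I S})"
    by (rule finite_subset) simp
  show "card S \<in> card ` {S. S \<subseteq> orbit_characters I act p \<and> int_independent I S}"
    using assms(2,3) by blast
qed

lemma orbit_dim_le:
  assumes "\<And>S. S \<subseteq> orbit_characters I act p \<Longrightarrow> int_independent I S \<Longrightarrow> card S \<le> n"
  shows "orbit_dim I act p \<le> n"
  unfolding orbit_dim_def
proof (rule Max.boundedI)
  have "card ` {S. S \<subseteq> orbit_characters I act p \<and> int_independent I S} \<subseteq> {..n}"
    using assms by blast
  then show "finite (card ` {S. S \<subseteq> orbit_characters I act p \<and> int_independent I S})"
    by (rule finite_subset) simp
  have "int_independent I {}" by (simp add: int_independent_def)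
  then show "card ` {S. S \<subseteq> orbit_characters I act p \<and> int_independent I S} \<noteq> {}" by blast
qed (use assms in blast)

lemma power_int_2_eq_1:
  assumes "(2 :: complex) powi k = 1"
  shows "k = 0"
proof -
  have n: "(2 :: real) powi k = 1" using assms norm_power_int[of "2 :: complex" k] by simp
  show ?thesis
  proof (rule ccontr)
    assume "k \<noteq> 0"
    then consider "0 < k" | "k < 0" by linarith
    then show False
      using power_int_strict_increasing[of 0 k "2 :: real"] power_int_strict_increasing[of k 0 "2 :: real"] n
      by cases auto
  qed
qed

lemma char_eval_two_points:
  assumes "finite I" "j \<in> I" "j0 \<in> I" "j \<noteq> j0"
  shows "char_eval I m (\<lambda>i\<in>I. if i = j then u else if i = j0 then v else 1) = u powi m j * v powi m j0"
proof -
  let ?t = "\<lambda>i. if i = j then u else if i = j0 then v else 1"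
  have "char_eval I m (\<lambda>i\<in>I. ?t i) = (\<Prod>i\<in>I. ?t i powi m i)"
    unfolding char_eval_def by (intro prod.cong) auto
  also have "\<dots> = (\<Prod>i\<in>{j, j0}. ?t i powi m i)"
    using assms by (intro prod.mono_neutral_right) auto
  also have "\<dots> = u powi m j * v powi m j0" using assms(4) by simp
  finally show ?thesis .
qed

lemma char_eval_one_point:
  assumes "finite I" "j \<in> I"
  shows "char_eval I m (\<lambda>i\<in>I. if i = j then u else 1) = u powi m j"
proof -
  let ?t = "\<lambda>i. if i = j then u else 1"
  have "char_eval I m (\<lambda>i\<in>I. ?t i) = (\<Prod>i\<in>I. ?t i powi m i)"
    unfolding char_eval_def by (intro prod.cong) auto
  also have "\<dots> = (\<Prod>i\<in>{j}. ?t i powi m i)"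
    using assms by (intro prod.mono_neutral_right) auto
  finally show ?thesis by simp
qed

text \<open>The number \<open>2\<close> has infinite order, so placed at one coordinate it detects
  the exponent there.\<close>

lemma char_eval_trivial:
  assumes "finite I" "\<And>t. t \<in> torus I \<Longrightarrow> char_eval I m t = 1" "j \<in> I"
  shows "m j = 0"
proof -
  have "(\<lambda>i\<in>I. if i = j then 2 else 1) \<in> torus I" by (auto simp: torus_def)
  from assms(2)[OF this] show ?thesis
    unfolding char_eval_one_point[OF assms(1,3)] by (rule power_int_2_eq_1)
qed

text \<open>Since \<open>n\<close> has exponent \<open>1\<close> at \<open>j0\<close>, a change of
  the coordinate \<open>j\<close> can be compensated there; this gives a point of the kernel that
  compares the exponents at \<open>j\<close> and \<open>j0\<close>.\<close>

lemma char_kernel_multiple: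
  assumes "finite I" "j0 \<in> I" "n j0 = 1"
    and ker: "\<And>t. t \<in> torus I \<Longrightarrow> char_eval I n t = 1 \<Longrightarrow> char_eval I m t = 1" and j: "j \<in> I"
  shows "m j = m j0 * n j"
proof (cases "j = j0")
  case True
  then show ?thesis using assms(3) by simp
next
  case False
  let ?t = "\<lambda>i\<in>I. if i = j then 2 else if i = j0 then 2 powi (- n j) else 1 :: complex"
  have "?t \<in> torus I" by (auto simp: torus_def)
  moreover have "char_eval I n ?t = 1"
    unfolding char_eval_two_points[OF assms(1) j assms(2) False]
    by (simp add: assms(3) power_int_minus)
  ultimately have "char_eval I m ?t = 1" by (rule ker)
  then have "(2 :: complex) powi (m j + - n j * m j0) = 1"
    unfolding char_eval_two_points[OF assms(1) j assms(2) False]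
    using power_int_add[of "2 :: complex" "m j" "- n j * m j0"] power_int_mult[of "2 :: complex" "- n j" "m j0"]
    by (simp only: simp_thms) simp
  then show ?thesis using power_int_2_eq_1 by fastforce
qed

section \<open>Orbits on the curves\<close>

context straight_Gr
begin

lemma ilab_Inl:
  assumes "edge x s s' r"
  shows "ilab x s s' r (Inl s') = 1" "Inl s' \<in> I"
proof -
  have "x s' - r < len s'" "s \<noteq> s'" using assms sm.edge_neq[OF assms] by (auto simp: sm.edge_def sm.match_def)
  then show "ilab x s s' r (Inl s') = 1" by (simp add: ilab_def ep_def)
  show "Inl s' \<in> I" using sm.edge_size(5)[OF assms] unfolding I_eq by (rule InlI)
qed

lemma ilab_surj:
  assumes "edge x s s' r" "c \<noteq> 0"
  shows "\<exists>t\<in>torus I. char_eval I (ilab x s s' r) t = c"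
proof
  show "(\<lambda>i\<in>I. if i = Inl s' then c else 1) \<in> torus I" using assms(2) by (auto simp: torus_def)
  show "char_eval I (ilab x s s' r) (\<lambda>i\<in>I. if i = Inl s' then c else 1) = c"
    using char_eval_one_point[OF finite_I ilab_Inl(2)[OF assms(1)]] ilab_Inl(1)[OF assms(1)] by simp
qed

lemma torus_orbit_Psi:
  assumes e: "edge x s s' r" and c: "c \<noteq> 0"
  shows "torus_orbit I act (Psi x s s' r 1 c) = orb x s s' r"
proof -
  have "torus_orbit I act (Psi x s s' r 1 c) = (\<lambda>t. Psi x s s' r 1 (c * char_eval I (ilab x s s' r) t)) ` torus I"
    unfolding torus_orbit_def by (intro image_cong) (auto simp: act_Psi[OF e])
  also have "\<dots> = Psi x s s' r 1 ` (- {0})"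
  proof (intro equalityI image_subsetI)
    fix t assume "t \<in> torus I"
    then have "char_eval I (ilab x s s' r) t \<noteq> 0" by (intro char_eval_nz[OF finite_I] torus_nz)
    then show "Psi x s s' r 1 (c * char_eval I (ilab x s s' r) t) \<in> Psi x s s' r 1 ` (- {0})" using c by auto
  next
    fix d :: complex assume "d \<in> - {0}"
    then obtain t where "t \<in> torus I" "char_eval I (ilab x s s' r) t = d / c"
      using ilab_surj[OF e, of "d / c"] c by auto
    then show "Psi x s s' r 1 d \<in> (\<lambda>t. Psi x s s' r 1 (c * char_eval I (ilab x s s' r) t)) ` torus I"
      using c by (intro image_eqI[of _ _ t]) auto
  qed
  finally show ?thesis by (simp add: orb_def)
qed

lemma act_Psi_fixed:
  assumes e: "edge x s s' r" and c: "c \<noteq> 0" and t: "t \<in> torus I"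
  shows "act t (Psi x s s' r 1 c) = Psi x s s' r 1 c \<longleftrightarrow> char_eval I (ilab x s s' r) t = 1"
proof
  assume "act t (Psi x s s' r 1 c) = Psi x s s' r 1 c"
  then have "c * char_eval I (ilab x s s' r) t = c"
    unfolding act_Psi[OF e t] by (rule Psi_inj[OF e])
  then show "char_eval I (ilab x s s' r) t = 1" using c by simp
qed (simp add: act_Psi[OF e t])

text \<open>By \<open>char_kernel_multiple\<close> the characters trivial on the stabiliser are
  multiples of the label, so they form a lattice of rank one.\<close>

lemma orbit_dim_Psi:
  assumes e: "edge x s s' r" and c: "c \<noteq> 0"
  shows "orbit_dim I act (Psi x s s' r 1 c) = 1"
proof (rule antisym)
  let ?l = "ilab x s s' r"
  note l = ilab_Inl[OF e]
  have mult: "m j = m (Inl s') * ?l j" if m: "m \<in> orbit_characters I act (Psi x s s' r 1 c)" and j: "j \<in> I" for m j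
  proof (rule char_kernel_multiple[of I "Inl s'" ?l m j, OF finite_I l(2,1)])
    show "j \<in> I" by (rule j)
    fix t assume "t \<in> torus I" "char_eval I ?l t = 1"
    then show "char_eval I m t = 1" using m act_Psi_fixed[OF e c] by (simp add: orbit_characters_def)
  qed
  show "orbit_dim I act (Psi x s s' r 1 c) \<le> 1"
  proof (rule orbit_dim_le, rule ccontr)
    fix S assume S: "S \<subseteq> orbit_characters I act (Psi x s s' r 1 c)" "int_independent I S" "\<not> card S \<le> 1"
    then have fin: "finite S" by (simp add: int_independent_def)
    then obtain m n where mn: "m \<in> S" "n \<in> S" "m \<noteq> n"
      using S(3) card_le_Suc0_iff_eq[OF fin] by auto
    have ext: "m \<in> I \<rightarrow>\<^sub>E UNIV" "n \<in> I \<rightarrow>\<^sub>E UNIV"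
      using S(1) mn by (auto simp: orbit_characters_def characters_def)
    \<comment> \<open>Two multiples of one vector satisfy the relation with their multipliers
      crossed.\<close>
    define d where "d = (\<lambda>k. if k = m then n (Inl s') else if k = n then - m (Inl s') else 0)"
    have "(\<Sum>k\<in>S. d k * k j) = 0" if j: "j \<in> I" for j
    proof -
      have "(\<Sum>k\<in>S. d k * k j) = (\<Sum>k\<in>{m, n}. d k * k j)"
        using fin mn(1,2) by (intro sum.mono_neutral_right) (simp_all add: d_def)
      also have "\<dots> = n (Inl s') * m j - m (Inl s') * n j" using mn(3) by (simp add: d_def)
      also have "\<dots> = n (Inl s') * (m (Inl s') * ?l j) - m (Inl s') * (n (Inl s') * ?l j)"
        unfolding mult[OF subsetD[OF S(1) mn(1)] j] mult[OF subsetD[OF S(1) mn(2)] j] ..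
      finally show ?thesis by simp
    qed
    then have "\<forall>k\<in>S. d k = 0"
      by (intro S(2)[unfolded int_independent_def, THEN conjunct2, THEN spec, THEN mp] ballI)
    then have "d m = 0" "d n = 0" using mn by blast+
    then have z: "n (Inl s') = 0" "m (Inl s') = 0" using mn(3) by (auto simp: d_def)
    have "m = n"
    proof (rule PiE_ext[OF ext])
      fix j assume j: "j \<in> I"
      have "m j = 0" using mult[OF _ j, of m] S(1) mn(1) z(2) by auto
      moreover have "n j = 0" using mult[OF _ j, of n] S(1) mn(2) z(1) by auto
      ultimately show "m j = n j" by simp
    qed
    then show False using mn(3) by simp
  qed
  let ?m = "restrict ?l I"
  have "?m \<in> orbit_characters I act (Psi x s s' r 1 c)"
    unfolding orbit_characters_def
  proof (intro CollectI conjI ballI impI)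
    show "?m \<in> characters I" by (simp add: characters_def)
    fix t assume "t \<in> torus I" "act t (Psi x s s' r 1 c) = Psi x s s' r 1 c"
    then have "char_eval I ?l t = 1" using act_Psi_fixed[OF e c] by simp
    then show "char_eval I ?m t = 1" using char_eval_cong[of I ?m ?l t] by simp
  qed
  moreover have "int_independent I {?m}"
    unfolding int_independent_def using l by auto
  ultimately show "1 \<le> orbit_dim I act (Psi x s s' r 1 c)"
    using card_le_orbit_dim[OF finite_I, of "{?m}"] by simp
qed

text \<open>Only the trivial character is trivial on the whole torus, and for a set of trivial
  characters all coefficients \<open>1\<close> give a relation.\<close>

lemma orbit_dim_fixed:
  assumes "\<And>t. t \<in> torus I \<Longrightarrow> act t U = U"
  shows "orbit_dim I act U = 0"
proof -
  have zero: "m j = 0" if "m \<in> orbit_characters I act U" "j \<in> I" for m j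
    using that assms by (intro char_eval_trivial[OF finite_I _ that(2)]) (auto simp: orbit_characters_def)
  have "orbit_dim I act U \<le> 0"
  proof (rule orbit_dim_le)
    fix S assume S: "S \<subseteq> orbit_characters I act U" "int_independent I S"
    have "(\<Sum>m\<in>S. 1 * m j) = 0" if "j \<in> I" for j
      using zero that S(1) by (intro sum.neutral) auto
    then have "\<forall>m\<in>S. (1 :: int) = 0"
      using S(2)[unfolded int_independent_def, THEN conjunct2, THEN spec, of "\<lambda>_. 1"] by blast
    then show "card S \<le> 0" by auto
  qed
  then show ?thesis by simp
qed

end

section \<open>Reduced echelon forms of subrepresentations\<close>

context straight_rep
begin

text \<open>Transposed form of \<open>vmap_el\<close>: an element of a string receives only from its
  predecessor there, and only along the arrow between them.\<close>

lemma ce_vmap: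
  assumes C: "C \<in> comps" "n < len C" and a: "\<alpha> \<in> arcs Q" "head Q \<alpha> = fst (el C n)" and v: "v \<in> vsp M (tail Q \<alpha>)"
  shows "ce (el C n) (vmap M \<alpha> v) = (if 0 < n \<and> \<alpha> = qa C (n - 1) then ce (el C (n - 1)) v else 0)"
proof -
  let ?i = "tail Q \<alpha>" and ?j = "head Q \<alpha>"
  have i: "?i \<in> verts Q" "?j \<in> verts Q" using a(1) by auto
  have 1: "vmap M \<alpha> v = (\<Sum>k\<in>bix M ?i. cf ?i k v *s vmap M \<alpha> (b ?i k))"
  proof -
    have "vmap M \<alpha> v = vmap M \<alpha> (\<Sum>k\<in>bix M ?i. cf ?i k v *s b ?i k)" using cf_expand[OF i(1) v] by simp
    also have "\<dots> = (\<Sum>k\<in>bix M ?i. vmap M \<alpha> (cf ?i k v *s b ?i k))"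
      by (intro vmap_sum[OF a(1)] vec.subspace_scale vsp_subspace i b_in)
    also have "\<dots> = (\<Sum>k\<in>bix M ?i. cf ?i k v *s vmap M \<alpha> (b ?i k))"
      by (intro sum.cong refl vmap_scale[OF a(1)] b_in i)
    finally show ?thesis .
  qed
  have 2: "ce (el C n) (vmap M \<alpha> v) = (\<Sum>k\<in>bix M ?i. cf ?i k v * ce (el C n) (vmap M \<alpha> (b ?i k)))"
    unfolding 1 by (rule ce_sum[OF i(2) a(2)[symmetric]]) (intro vmap_in[OF a(1)] b_in[OF i(1)])
  have 3: "ce (el C n) (vmap M \<alpha> (b ?i k)) = of_bool (0 < n \<and> \<alpha> = qa C (n - 1) \<and> (?i, k) = el C (n - 1))"
    if k: "k \<in> bix M ?i" for k
  proof -
    have "(?i, k) \<in> verts CQ" using i k by (simp add: verts_CQ)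
    then obtain C' m where m: "C' \<in> comps" "m < len C'" "(?i, k) = el C' m" using el_surj by blast
    have bk: "b ?i k = bb (el C' m)" by (simp add: bb_def flip: m(3))
    have fst_el: "?i = fst (el C' m)" by (simp flip: m(3))
    have v: "vmap M \<alpha> (b ?i k) = (if Suc m < len C' \<and> \<alpha> = qa C' m then bb (el C' (Suc m)) else 0)"
      unfolding bk by (rule vmap_el[OF m(1,2) a(1) fst_el])
    show ?thesis
    proof (cases "Suc m < len C' \<and> \<alpha> = qa C' m")
      case True
      have y: "el C' (Suc m) \<in> verts CQ" "el C n \<in> verts CQ" using True m C by (auto intro: el_in_verts)
      have "fst (el C n) = fst (el C' (Suc m))" using qa_props(3)[OF m(1), of m] True a(2) by simp
      then have "ce (el C n) (vmap M \<alpha> (b ?i k)) = of_bool (el C n = el C' (Suc m))"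
        unfolding v using True cf_bb[OF y(2,1)] by simp
      moreover have "el C n = el C' (Suc m) \<longleftrightarrow> 0 < n \<and> \<alpha> = qa C (n - 1) \<and> (?i, k) = el C (n - 1)"
      proof
        assume "el C n = el C' (Suc m)"
        then have "C = C' \<and> n = Suc m" using el_inj[OF C(1) m(1) C(2)] True by blast
        then show "0 < n \<and> \<alpha> = qa C (n - 1) \<and> (?i, k) = el C (n - 1)" using True m(3) by simp
      next
        assume r: "0 < n \<and> \<alpha> = qa C (n - 1) \<and> (?i, k) = el C (n - 1)"
        then have "el C' m = el C (n - 1)" using m(3) by simp
        then have "C' = C \<and> m = n - 1" using el_inj[OF m(1) C(1) m(2), of "n - 1"] C(2) by auto
        then show "el C n = el C' (Suc m)" using r by simp
      qed
      ultimately show ?thesis by simp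
    next
      case False
      have "\<not> (0 < n \<and> \<alpha> = qa C (n - 1) \<and> (?i, k) = el C (n - 1))"
      proof
        assume r: "0 < n \<and> \<alpha> = qa C (n - 1) \<and> (?i, k) = el C (n - 1)"
        then have "el C' m = el C (n - 1)" using m(3) by simp
        then have "C' = C \<and> m = n - 1" using el_inj[OF m(1) C(1) m(2), of "n - 1"] C(2) by auto
        then show False using False r C(2) by simp
      qed
      moreover have "vmap M \<alpha> (b ?i k) = 0" using v False by (simp only: if_False)
      ultimately show ?thesis using cf_0[of "fst (el C n)"] i(2) a(2) by simp
    qed
  qed
  have 4: "ce (el C n) (vmap M \<alpha> v) =
      (\<Sum>k\<in>bix M ?i. cf ?i k v * of_bool (0 < n \<and> \<alpha> = qa C (n - 1) \<and> (?i, k) = el C (n - 1)))"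
    unfolding 2 by (intro sum.cong refl) (simp only: 3)
  show ?thesis
  proof (cases "0 < n \<and> \<alpha> = qa C (n - 1)")
    case True
    let ?k = "snd (el C (n - 1))"
    have el: "el C (n - 1) = (?i, ?k)" using qa_props(2)[OF C(1), of "n - 1"] True C(2) by (simp add: prod_eq_iff)
    have "el C (n - 1) \<in> verts CQ" using C by (intro el_in_verts) auto
    then have k: "?k \<in> bix M ?i" unfolding verts_CQ using el by (metis mem_Sigma_iff)
    have "(\<Sum>k\<in>bix M ?i. cf ?i k v * of_bool (0 < n \<and> \<alpha> = qa C (n - 1) \<and> (?i, k) = el C (n - 1))) =
        (\<Sum>k\<in>bix M ?i. if k = ?k then cf ?i ?k v else 0)"
      using True el by (intro sum.cong refl) (auto simp: prod_eq_iff)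
    also have "\<dots> = cf ?i ?k v" using k by simp
    also have "\<dots> = ce (el C (n - 1)) v" using el by (metis fst_conv)
    finally show ?thesis unfolding 4 using True by simp
  next
    case False
    then show ?thesis unfolding 4 by (auto intro!: sum.neutral)
  qed
qed

end

context straight_Gr
begin

lemma quiver_GrD:
  assumes "U \<in> quiver_Gr Q M e"
  shows "i \<in> verts Q \<Longrightarrow> vec.subspace (U i)" "i \<in> verts Q \<Longrightarrow> U i \<subseteq> vsp M i"
    "i \<in> verts Q \<Longrightarrow> int (vec.dim (U i)) = e i" "U \<in> extensional (verts Q)"
    "a \<in> arcs Q \<Longrightarrow> v \<in> U (tail Q a) \<Longrightarrow> vmap M a v \<in> U (head Q a)"
proof -
  have U: "U \<in> (\<Pi>\<^sub>E i\<in>verts Q. Gr (e i) (vsp M i))" "\<forall>a\<in>arcs Q. vmap M a ` U (tail Q a) \<subseteq> U (head Q a)"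
    using assms by (simp_all add: quiver_Gr_def)
  have G: "U i \<in> Gr (e i) (vsp M i)" if "i \<in> verts Q" for i using U(1) that by (rule PiE_mem)
  show "i \<in> verts Q \<Longrightarrow> vec.subspace (U i)" "i \<in> verts Q \<Longrightarrow> U i \<subseteq> vsp M i"
    "i \<in> verts Q \<Longrightarrow> int (vec.dim (U i)) = e i"
    using G by (simp_all add: Gr_def)
  show "U \<in> extensional (verts Q)" using U(1) by (simp add: PiE_iff)
  show "a \<in> arcs Q \<Longrightarrow> v \<in> U (tail Q a) \<Longrightarrow> vmap M a v \<in> U (head Q a)" using U(2) by blast
qed

lemma quiver_Gr_eqI:
  assumes "U \<in> quiver_Gr Q M e" "N \<in> quiver_Gr Q M e" "\<And>i. i \<in> verts Q \<Longrightarrow> N i \<subseteq> U i"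
  shows "U = N"
proof (rule extensionalityI[OF quiver_GrD(4)[OF assms(1)] quiver_GrD(4)[OF assms(2)]])
  fix i assume i: "i \<in> verts Q"
  have "int (vec.dim (U i)) = int (vec.dim (N i))"
    using quiver_GrD(3)[OF assms(1) i] quiver_GrD(3)[OF assms(2) i] by simp
  then show "U i = N i"
    using vec.subspace_dim_equal[OF quiver_GrD(1)[OF assms(2) i] quiver_GrD(1)[OF assms(1) i] assms(3)[OF i]] by simp
qed

text \<open>The limit for \<open>\<lambda> \<rightarrow> 0\<close> keeps the coordinate of smallest weight, which is the one of smallest
  index; so leading coordinates are the smallest ones.\<close>

definition lead :: "('v \<Rightarrow> (complex ^ 'n) set) \<Rightarrow> 'v \<times> nat \<Rightarrow> complex ^ 'n \<Rightarrow> bool" where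
  "lead U y v \<longleftrightarrow> v \<in> U (fst y) \<and> ce y v \<noteq> 0 \<and> (\<forall>z\<in>verts CQ. fst z = fst y \<longrightarrow> snd z < snd y \<longrightarrow> ce z v = 0)"

definition piv :: "('v \<Rightarrow> (complex ^ 'n) set) \<Rightarrow> ('v \<times> nat) set" where
  "piv U = {y \<in> verts CQ. \<exists>v. lead U y v}"

lemma piv_verts: "y \<in> piv U \<Longrightarrow> y \<in> verts CQ"
  by (simp add: piv_def)

lemma fst_verts: "y \<in> verts CQ \<Longrightarrow> fst y \<in> verts Q"
  by (auto simp: verts_CQ)

text \<open>The smallest index at which \<open>v\<close> has a non-zero coordinate would be a
  pivot.\<close>

lemma eq_0_if_piv:
  assumes U: "U \<in> quiver_Gr Q M e" and i: "i \<in> verts Q" and v: "v \<in> U i"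
    and 0: "\<And>y. y \<in> piv U \<Longrightarrow> fst y = i \<Longrightarrow> ce y v = 0"
  shows "v = 0"
proof (rule ccontr)
  assume nz: "v \<noteq> 0"
  have vin: "v \<in> vsp M i" using quiver_GrD(2)[OF U i] v by blast
  have "\<exists>k. k \<in> bix M i \<and> cf i k v \<noteq> 0"
  proof (rule ccontr)
    assume "\<nexists>k. k \<in> bix M i \<and> cf i k v \<noteq> 0"
    then have "v = 0"
      by (intro cf_eqI[OF i vin vec.subspace_0[OF vsp_subspace[OF i]]]) (auto simp: cf_0[OF i])
    then show False using nz by simp
  qed
  from LeastI_ex[OF this] obtain k where k: "k \<in> bix M i" "cf i k v \<noteq> 0"
    and least: "k = (LEAST k. k \<in> bix M i \<and> cf i k v \<noteq> 0)" by blast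
  have "lead U (i, k) v"
    unfolding lead_def
  proof (intro conjI ballI impI)
    fix z assume z: "z \<in> verts CQ" "fst z = fst (i, k)" "snd z < snd (i, k)"
    then have "snd z \<in> bix M i" by (auto simp: verts_CQ)
    then show "ce z v = 0" using z not_less_Least[of "snd z" "\<lambda>k. k \<in> bix M i \<and> cf i k v \<noteq> 0"] least by auto
  qed (use v k in auto)
  then have "(i, k) \<in> piv U" using i k by (auto simp: piv_def verts_CQ)
  from 0[OF this] k show False by simp
qed

text \<open>Gaussian elimination: the coordinates at the pivots above \<open>y\<close> are cleared
  in increasing order, and clearing one changes no coordinate of smaller index.\<close>

lemma reduced_vector:
  assumes U: "U \<in> quiver_Gr Q M e" and y: "y \<in> piv U"
  shows "\<exists>v. v \<in> U (fst y) \<and> ce y v = 1 \<and>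
    (\<forall>z\<in>verts CQ. fst z = fst y \<longrightarrow> snd z < snd y \<longrightarrow> ce z v = 0) \<and>
    (\<forall>z\<in>piv U. fst z = fst y \<longrightarrow> z \<noteq> y \<longrightarrow> ce z v = 0)"
proof -
  let ?i = "fst y"
  have i: "?i \<in> verts Q" using fst_verts[OF piv_verts[OF y]] .
  note sub = quiver_GrD(1)[OF U i]
  have inn: "v \<in> vsp M ?i" if "v \<in> U ?i" for v using quiver_GrD(2)[OF U i] that by blast
  define low where "low = (\<lambda>v. \<forall>z\<in>verts CQ. fst z = ?i \<longrightarrow> snd z < snd y \<longrightarrow> ce z v = 0)"
  have "\<exists>v. v \<in> U ?i \<and> ce y v = 1 \<and> low v \<and> (\<forall>z\<in>piv U. fst z = ?i \<longrightarrow> snd y < snd z \<longrightarrow> snd z < K \<longrightarrow> ce z v = 0)" for K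
  proof (induction K)
    case 0
    obtain v where v: "v \<in> U ?i" "ce y v \<noteq> 0" "low v" using y by (auto simp: piv_def lead_def low_def)
    have "(1 / ce y v) *s v \<in> U ?i" using vec.subspace_scale[OF sub v(1)] .
    moreover have "ce y ((1 / ce y v) *s v) = 1" using cf_scale[OF i inn[OF v(1)]] v(2) by simp
    moreover have "low ((1 / ce y v) *s v)" using v(3) cf_scale[OF i inn[OF v(1)]] by (simp add: low_def)
    ultimately show ?case by (intro exI[of _ "(1 / ce y v) *s v"]) simp
  next
    case (Suc K)
    then obtain v where v: "v \<in> U ?i" "ce y v = 1" "low v"
      "\<And>z. z \<in> piv U \<Longrightarrow> fst z = ?i \<Longrightarrow> snd y < snd z \<Longrightarrow> snd z < K \<Longrightarrow> ce z v = 0" by blast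
    show ?case
    proof (cases "(?i, K) \<in> piv U \<and> snd y < K")
      case False
      have "ce z v = 0" if "z \<in> piv U" "fst z = ?i" "snd y < snd z" "snd z < Suc K" for z
      proof (cases "snd z = K")
        case True
        then have "z = (?i, K)" using that(2) by (simp add: prod_eq_iff)
        then show ?thesis using False that by auto
      next
        case False
        then show ?thesis using v(4) that by auto
      qed
      then show ?thesis using v by blast
    next
      case True
      then obtain u where u: "u \<in> U ?i" "cf ?i K u \<noteq> 0"
        "\<And>z. z \<in> verts CQ \<Longrightarrow> fst z = ?i \<Longrightarrow> snd z < K \<Longrightarrow> ce z u = 0" by (auto simp: piv_def lead_def)
      define w where "w = v + (- cf ?i K v / cf ?i K u) *s u"
      have ce_w: "ce z w = ce z v + (- cf ?i K v / cf ?i K u) * ce z u" if "fst z = ?i" for z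
        unfolding w_def that cf_add[OF i inn[OF v(1)] vec.subspace_scale[OF vsp_subspace[OF i] inn[OF u(1)]]]
          cf_scale[OF i inn[OF u(1)]] ..
      have low0: "ce z w = ce z v" if "z \<in> verts CQ" "fst z = ?i" "snd z < K" for z
        using ce_w[OF that(2)] u(3)[OF that] by simp
      have "w \<in> U ?i" unfolding w_def by (intro vec.subspace_add[OF sub] vec.subspace_scale[OF sub] u v)
      moreover have "ce y w = 1" using low0[OF piv_verts[OF y]] True v(2) by simp
      moreover have "low w" unfolding low_def
      proof (intro ballI impI)
        fix z assume z: "z \<in> verts CQ" "fst z = ?i" "snd z < snd y"
        then have "ce z v = 0" using v(3) by (simp add: low_def)
        then show "ce z w = 0" using low0[OF z(1,2)] z(3) True by simp
      qed
      moreover have "ce z w = 0" if z: "z \<in> piv U" "fst z = ?i" "snd y < snd z" "snd z < Suc K" for z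
      proof (cases "snd z = K")
        case T: True
        have "cf ?i K w = 0" using ce_w[of "(?i, K)"] u(2) by simp
        then show ?thesis using T z(2) by simp
      next
        case False
        then show ?thesis using low0[OF piv_verts[OF z(1)] z(2)] v(4)[OF z(1-3)] z(4) by simp
      qed
      ultimately show ?thesis by blast
    qed
  qed
  from this[of "Suc (vec.dim (vsp M ?i))"] obtain v where v: "v \<in> U ?i" "ce y v = 1" "low v"
    "\<And>z. z \<in> piv U \<Longrightarrow> fst z = ?i \<Longrightarrow> snd y < snd z \<Longrightarrow> snd z < Suc (vec.dim (vsp M ?i)) \<Longrightarrow> ce z v = 0" by blast
  have "ce z v = 0" if z: "z \<in> piv U" "fst z = ?i" "z \<noteq> y" for z
  proof -
    have zv: "z \<in> verts CQ" using z(1) by (rule piv_verts)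
    then have "snd z < Suc (vec.dim (vsp M ?i))" using z(2) by (auto simp: verts_CQ)
    moreover have "snd z \<noteq> snd y" using z by (auto simp: prod_eq_iff)
    moreover have "ce z v = 0" if "snd z < snd y" using v(3) zv z(2) that by (simp add: low_def)
    ultimately show ?thesis using v(4)[OF z(1,2)] by linarith
  qed
  then show ?thesis using v unfolding low_def by blast
qed

text \<open>The arrow carries a leading vector to a leading vector: a coordinate of the image below
  the next element comes from a predecessor, which alignment puts below the given element, where
  \<open>v\<close> vanishes.\<close>

lemma piv_Suc:
  assumes U: "U \<in> quiver_Gr Q M e" and C: "C \<in> comps" "Suc m < len C" and p: "el C m \<in> piv U"
  shows "el C (Suc m) \<in> piv U"
proof -
  let ?a = "qa C m"
  note a = qa_props[OF C]
  obtain v where v: "v \<in> U (fst (el C m))" "ce (el C m) v \<noteq> 0"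
    "\<And>z. z \<in> verts CQ \<Longrightarrow> fst z = fst (el C m) \<Longrightarrow> snd z < snd (el C m) \<Longrightarrow> ce z v = 0"
    using p by (auto simp: piv_def lead_def)
  have i: "fst (el C m) \<in> verts Q" using fst_verts[OF piv_verts[OF p]] .
  have vin: "v \<in> vsp M (tail Q ?a)" using quiver_GrD(2)[OF U i] v(1) a(2) by auto
  have "lead U (el C (Suc m)) (vmap M ?a v)"
    unfolding lead_def
  proof (intro conjI ballI impI)
    show "vmap M ?a v \<in> U (fst (el C (Suc m)))"
      using quiver_GrD(5)[OF U a(1)] v(1) unfolding a(2,3) by simp
    show "ce (el C (Suc m)) (vmap M ?a v) \<noteq> 0"
      using ce_vmap[OF C a(1,3) vin] v(2) by simp
    fix z assume z: "z \<in> verts CQ" "fst z = fst (el C (Suc m))" "snd z < snd (el C (Suc m))"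
    obtain C' n where n: "C' \<in> comps" "n < len C'" "z = el C' n" using el_surj[OF z(1)] by blast
    have hd: "head Q ?a = fst (el C' n)" using a(3) z(2) n(3) by simp
    note ce = ce_vmap[OF n(1,2) a(1) hd vin, folded n(3)]
    show "ce z (vmap M ?a v) = 0"
    proof (cases "0 < n \<and> ?a = qa C' (n - 1)")
      case False
      then show ?thesis using ce by (simp only: if_False)
    next
      case True
      then obtain n' where n': "n = Suc n'" by (auto simp: gr0_conv_Suc)
      have len: "Suc n' < len C'" "n' < len C'" using n n' by auto
      have qa: "?a = qa C' n'" using True n' by simp
      have same: "fst (el C' n') = fst (el C m)" using qa_props(2)[OF n(1) len(1)] qa a(2) by simp
      have "snd (el C' n') < snd (el C m)"
      proof (rule ccontr)
        assume "\<not> snd (el C' n') < snd (el C m)"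
        then have "snd (el C m) < snd (el C' n') \<or> snd (el C m) = snd (el C' n')" by linarith
        then consider "snd (el C m) < snd (el C' n')" | "el C m = el C' n'" unfolding prod_eq_iff same by blast
        then show False
        proof cases
          case 1
          then have "int (snd (el C (Suc m))) < int (snd (el C' (Suc n')))"
            using sm.step[OF C(1) n(1) _ len(1), of m] C(2) same by simp
          then show False using z(3) n(3) n' by simp
        next
          case 2
          then have "C = C' \<and> m = n'" using el_inj[OF C(1) n(1) Suc_lessD[OF C(2)] len(2)] by simp
          then show False using z(3) n(3) n' by simp
        qed
      qed
      then have "ce (el C' n') v = 0" using v(3)[OF el_in_verts[OF n(1) len(2)] same] by simp
      then show ?thesis using ce n' by simp
    qed
  qed
  then show ?thesis using el_in_verts[OF C] by (auto simp: piv_def)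
qed

text \<open>The first pivot on the string. Admitting the length of the string makes the minimum
  exist when there is no pivot.\<close>

definition pst :: "('v \<Rightarrow> (complex ^ 'n) set) \<Rightarrow> ('v \<times> nat) set \<Rightarrow> nat" where
  "pst U = (\<lambda>C\<in>comps. LEAST m. m = len C \<or> el C m \<in> piv U)"

lemma pst_le: "C \<in> comps \<Longrightarrow> pst U C \<le> len C"
  unfolding pst_def by (simp add: Least_le)

text \<open>By \<open>piv_Suc\<close> the pivots on a string form a final part of it.\<close>

lemma piv_iff:
  assumes U: "U \<in> quiver_Gr Q M e" and C: "C \<in> comps" "m < len C"
  shows "el C m \<in> piv U \<longleftrightarrow> pst U C \<le> m"
proof
  assume "el C m \<in> piv U"
  then show "pst U C \<le> m" unfolding pst_def using C(1) by (simp add: Least_le)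
next
  assume le: "pst U C \<le> m"
  have "pst U C = len C \<or> el C (pst U C) \<in> piv U"
    unfolding pst_def using C(1) LeastI[of "\<lambda>m. m = len C \<or> el C m \<in> piv U" "len C"] by simp
  then have "el C (pst U C) \<in> piv U" using le C(2) by auto
  then have "el C (pst U C + j) \<in> piv U" if "pst U C + j < len C" for j
    using that
  proof (induction j)
    case (Suc j)
    then show ?case using piv_Suc[OF U C(1), of "pst U C + j"] by simp
  qed simp
  from this[of "m - pst U C"] show "el C m \<in> piv U" using le C(2) by simp
qed

lemma ev_idx_pst:
  assumes U: "U \<in> quiver_Gr Q M e"
  shows "ev ` idx (pst U) i = {y \<in> piv U. fst y = i}"
proof (intro equalityI subsetI)
  fix y assume "y \<in> ev ` idx (pst U) i"
  then obtain p where p: "p \<in> idx (pst U) i" "y = ev p" by blast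
  then have "fst p \<in> comps" "pst U (fst p) \<le> snd p" "snd p < len (fst p)" "fst (ev p) = i" by (auto simp: idx_def)
  then show "y \<in> {y \<in> piv U. fst y = i}" using piv_iff[OF U] p(2) by simp
next
  fix y assume y: "y \<in> {y \<in> piv U. fst y = i}"
  then obtain C m where C: "C \<in> comps" "m < len C" "y = el C m" using el_surj[OF piv_verts, of y U] by blast
  then have "(C, m) \<in> idx (pst U) i" using y piv_iff[OF U C(1,2)] by (simp add: idx_def)
  then show "y \<in> ev ` idx (pst U) i" by (rule rev_image_eqI) (simp add: C(3))
qed

lemma Phi_closed:
  assumes a: "\<alpha> \<in> arcs Q"
  shows "vmap M \<alpha> ` Phi x (tail Q \<alpha>) \<subseteq> Phi x (head Q \<alpha>)"
proof (rule image_subsetI)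
  have t: "tail Q \<alpha> \<in> verts Q" "head Q \<alpha> \<in> verts Q" using a by auto
  have in1: "bb (ev p) \<in> vsp M (tail Q \<alpha>)" if "p \<in> idx x (tail Q \<alpha>)" for p
    using bb_in[of "ev p"] idx_ev[OF that] by auto
  fix v assume "v \<in> Phi x (tail Q \<alpha>)"
  then obtain d where d: "v = (\<Sum>p\<in>idx x (tail Q \<alpha>). d p *s bb (ev p))"
    using t by (auto simp: Phi_def span_family[OF finite_idx])
  have "vmap M \<alpha> v = (\<Sum>p\<in>idx x (tail Q \<alpha>). d p *s vmap M \<alpha> (bb (ev p)))"
    unfolding d using in1 vsp_subspace[OF t(1)]
    by (simp add: vmap_sum[OF a] vmap_scale[OF a] vec.subspace_scale)
  also have "\<dots> \<in> vec.span ((\<lambda>p. bb (ev p)) ` idx x (head Q \<alpha>))"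
  proof (intro vec.span_sum vec.span_scale)
    fix p assume p: "p \<in> idx x (tail Q \<alpha>)"
    then have P: "fst p \<in> comps" "snd p < len (fst p)" "tail Q \<alpha> = fst (ev p)" by (auto simp: idx_def)
    show "vmap M \<alpha> (bb (ev p)) \<in> vec.span ((\<lambda>p. bb (ev p)) ` idx x (head Q \<alpha>))"
    proof (cases "Suc (snd p) < len (fst p) \<and> \<alpha> = qa (fst p) (snd p)")
      case True
      have "(fst p, Suc (snd p)) \<in> idx x (head Q \<alpha>)"
        using p True qa_props(3)[OF P(1), of "snd p"] by (auto simp: idx_def)
      then have "bb (ev (fst p, Suc (snd p))) \<in> vec.span ((\<lambda>p. bb (ev p)) ` idx x (head Q \<alpha>))"
        by (intro vec.span_base imageI)
      then show ?thesis using vmap_el[OF P(1,2) a P(3)] True by simp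
    next
      case False
      then show ?thesis using vmap_el[OF P(1,2) a P(3)] vec.span_zero by (simp only: if_False)
    qed
  qed
  finally show "vmap M \<alpha> v \<in> Phi x (head Q \<alpha>)" using t by (simp add: Phi_def)
qed

lemma stateI:
  assumes "bounded_state x" "\<And>i. i \<in> verts Q \<Longrightarrow> int (card (idx x i)) = e i"
  shows "state x"
  unfolding state_def quiver_Gr_def
proof (intro conjI CollectI assms(1) ballI PiE_I)
  fix i assume i: "i \<in> verts Q"
  have "vec.span ((\<lambda>p. bb (ev p)) ` idx x i) \<subseteq> vsp M i"
    using bb_in idx_ev by (intro vec.span_minimal vsp_subspace i) fastforce
  then show "Phi x i \<in> Gr (e i) (vsp M i)"
    using dim_Phi[OF i, of x] assms(2)[OF i] i by (simp add: Gr_def Phi_def)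
qed (simp_all add: Phi_closed, simp add: Phi_def)

text \<open>The pivots give the state \<open>x\<close>, and the reduced vectors \<open>w\<close> are
  a basis of the subrepresentation; by the last property a vector in it is determined by its
  coordinates at the pivots.\<close>

lemma echelon:
  assumes U: "U \<in> quiver_Gr Q M e"
  obtains x w where "state x"
    "\<And>i p. i \<in> verts Q \<Longrightarrow> p \<in> idx x i \<Longrightarrow> w p \<in> U i"
    "\<And>i p q. i \<in> verts Q \<Longrightarrow> p \<in> idx x i \<Longrightarrow> q \<in> idx x i \<Longrightarrow> ce (ev q) (w p) = of_bool (p = q)"
    "\<And>p i z. i \<in> verts Q \<Longrightarrow> p \<in> idx x i \<Longrightarrow> z \<in> verts CQ \<Longrightarrow> fst z = i \<Longrightarrow> snd z < snd (ev p) \<Longrightarrow> ce z (w p) = 0"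
    "\<And>i v. i \<in> verts Q \<Longrightarrow> v \<in> U i \<Longrightarrow> (\<And>q. q \<in> idx x i \<Longrightarrow> ce (ev q) v = 0) \<Longrightarrow> v = 0"
proof -
  let ?x = "pst U"
  have "\<forall>y\<in>piv U. \<exists>v. v \<in> U (fst y) \<and> ce y v = 1 \<and>
      (\<forall>z\<in>verts CQ. fst z = fst y \<longrightarrow> snd z < snd y \<longrightarrow> ce z v = 0) \<and>
      (\<forall>z\<in>piv U. fst z = fst y \<longrightarrow> z \<noteq> y \<longrightarrow> ce z v = 0)"
    using reduced_vector[OF U] by (rule ballI)
  from bchoice[OF this] obtain g where g: "\<forall>y\<in>piv U. g y \<in> U (fst y) \<and> ce y (g y) = 1 \<and>
      (\<forall>z\<in>verts CQ. fst z = fst y \<longrightarrow> snd z < snd y \<longrightarrow> ce z (g y) = 0) \<and>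
      (\<forall>z\<in>piv U. fst z = fst y \<longrightarrow> z \<noteq> y \<longrightarrow> ce z (g y) = 0)" ..
  have pv: "ev p \<in> piv U \<and> fst (ev p) = i" if "p \<in> idx ?x i" for p i using ev_idx_pst[OF U, of i] that by blast
  define w where "w = (\<lambda>p. g (ev p))"
  have w1: "w p \<in> U i" if "p \<in> idx ?x i" for p i using bspec[OF g, of "ev p"] pv[OF that] by (simp add: w_def)
  have w2: "ce (ev q) (w p) = of_bool (p = q)" if "p \<in> idx ?x i" "q \<in> idx ?x i" for p q i
  proof -
    note p = bspec[OF g, of "ev p"] pv[OF that(1)]
    have q: "ev q \<in> piv U" "fst (ev q) = fst (ev p)" using pv[OF that(1)] pv[OF that(2)] by auto
    show ?thesis
    proof (cases "p = q")
      case True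
      then show ?thesis using p by (simp add: w_def)
    next
      case False
      then have "ev q \<noteq> ev p" using ev_inj[OF that] by metis
      then show ?thesis using p q False by (simp add: w_def)
    qed
  qed
  have w3: "ce z (w p) = 0" if "p \<in> idx ?x i" "z \<in> verts CQ" "fst z = i" "snd z < snd (ev p)" for p i z
    using bspec[OF g, of "ev p"] pv[OF that(1)] that(2-4) by (simp add: w_def)
  have w4: "v = 0" if "i \<in> verts Q" "v \<in> U i" "\<And>q. q \<in> idx ?x i \<Longrightarrow> ce (ev q) v = 0" for i v
  proof (rule eq_0_if_piv[OF U that(1,2)])
    fix y assume "y \<in> piv U" "fst y = i"
    then obtain q where "q \<in> idx ?x i" "y = ev q" using ev_idx_pst[OF U, of i] by blast
    then show "ce y v = 0" using that(3) by simp
  qed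
  have "state ?x"
  proof (rule stateI)
    show "bounded_state ?x" using pst_le by (simp add: bounded_state_def pst_def)
    fix i assume i: "i \<in> verts Q"
    note sub = quiver_GrD(1)[OF U i]
    have inn: "w p \<in> vsp M i" if "p \<in> idx ?x i" for p using w1[OF that] quiver_GrD(2)[OF U i] by blast
    have co: "ce (ev q) (\<Sum>p\<in>idx ?x i. d p *s w p) = d q" if q: "q \<in> idx ?x i" for d q
    proof -
      have "ce (ev q) (\<Sum>p\<in>idx ?x i. d p *s w p) = (\<Sum>p\<in>idx ?x i. d p * ce (ev q) (w p))"
        using idx_ev[OF q] inn by (intro ce_sum[OF i]) auto
      also have "\<dots> = (\<Sum>p\<in>idx ?x i. if p = q then d q else 0)"
        using w2[OF _ q] by (intro sum.cong refl) auto
      finally show ?thesis using q finite_idx by simp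
    qed
    have zero: "d q = 0" if "(\<Sum>p\<in>idx ?x i. d p *s w p) = 0" "q \<in> idx ?x i" for d q
      using co[OF that(2), of d] cf_0[OF i] idx_ev[OF that(2)] unfolding that(1) by simp
    have ind: "inj_on w (idx ?x i)" "vec.independent (w ` idx ?x i)"
      by (rule family_independentI, rule finite_idx, rule zero, assumption+)+
    have "vec.span (w ` idx ?x i) = U i"
    proof
      show "vec.span (w ` idx ?x i) \<subseteq> U i" using w1 by (intro vec.span_minimal sub) auto
      show "U i \<subseteq> vec.span (w ` idx ?x i)"
      proof
        fix v assume v: "v \<in> U i"
        let ?u = "\<Sum>p\<in>idx ?x i. ce (ev p) v *s w p"
        have u: "?u \<in> U i" by (intro vec.subspace_sum sub vec.subspace_scale w1)
        \<comment> \<open>Subtracting the combination with the same pivot coordinates leaves a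
          vector whose pivot coordinates all vanish.\<close>
        have "v - ?u = 0"
        proof (rule w4[OF i])
          show "v - ?u \<in> U i" by (rule vec.subspace_diff[OF sub v u])
          fix q assume q: "q \<in> idx ?x i"
          have in2: "v \<in> vsp M i" "?u \<in> vsp M i" using v u quiver_GrD(2)[OF U i] by blast+
          have "ce (ev q) (v - ?u + ?u) = ce (ev q) (v - ?u) + ce (ev q) ?u"
            using idx_ev[OF q] cf_add[OF i vec.subspace_diff[OF vsp_subspace[OF i] in2] in2(2)] by simp
          then show "ce (ev q) (v - ?u) = 0" using co[OF q, of "\<lambda>p. ce (ev p) v"] by simp
        qed
        then have "v = ?u" by simp
        also have "\<dots> \<in> vec.span (w ` idx ?x i)"
          by (intro vec.span_sum vec.span_scale vec.span_base imageI)
        finally show "v \<in> vec.span (w ` idx ?x i)" .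
      qed
    qed
    then have "vec.dim (U i) = card (idx ?x i)"
      using ind by (metis vec.dim_span vec.dim_eq_card_independent card_image)
    then show "int (card (idx ?x i)) = e i" using quiver_GrD(3)[OF U i] by simp
  qed
  then show ?thesis using that[of ?x w] w1 w2 w3 w4 by blast
qed

end

section \<open>Fixed points, curves and larger orbits\<close>

context straight_Gr
begin

lemma bb_next:
  assumes U: "U \<in> quiver_Gr Q M e" and C: "C \<in> comps" "Suc m < len C" and b: "bb (el C m) \<in> U (fst (el C m))"
  shows "bb (el C (Suc m)) \<in> U (fst (el C (Suc m)))"
  using quiver_GrD(5)[OF U qa_props(1)[OF C], of "bb (el C m)"] b
  unfolding qa_props(2-4)[OF C] by simp

lemma bb_upward:
  assumes U: "U \<in> quiver_Gr Q M e" and C: "C \<in> comps" "m' < len C" and b: "bb (el C m) \<in> U (fst (el C m))"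
    and le: "m \<le> m'"
  shows "bb (el C m') \<in> U (fst (el C m'))"
proof -
  have "bb (el C (m + j)) \<in> U (fst (el C (m + j)))" if "m + j < len C" for j
    using that
  proof (induction j)
    case (Suc j)
    then show ?case using bb_next[OF U C(1), of "m + j"] by simp
  qed (use b in simp)
  from this[of "m' - m"] show ?thesis using le C(2) by simp
qed

text \<open>The first vectors on the strings generate \<open>Phi x\<close>, and both sides have the
  same dimensions, so one inclusion suffices.\<close>

lemma eq_Phi:
  assumes x: "state x" and U: "U \<in> quiver_Gr Q M e"
    and gen: "\<And>C. C \<in> comps \<Longrightarrow> x C < len C \<Longrightarrow> bb (el C (x C)) \<in> U (fst (el C (x C)))"
  shows "U = Phi x"
proof (rule quiver_Gr_eqI[OF U])
  show "Phi x \<in> quiver_Gr Q M e" using x by (simp add: state_def)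
  fix i assume i: "i \<in> verts Q"
  have "bb (ev p) \<in> U i" if "p \<in> idx x i" for p
  proof -
    have p: "fst p \<in> comps" "x (fst p) \<le> snd p" "snd p < len (fst p)" "fst (ev p) = i"
      using that by (auto simp: idx_def)
    then have "x (fst p) < len (fst p)" by simp
    from bb_upward[OF U p(1,3) gen[OF p(1) this] p(2)] show ?thesis unfolding p(4) .
  qed
  then show "Phi x i \<subseteq> U i"
    using i unfolding Phi_def by (simp add: image_subset_iff vec.span_minimal quiver_GrD(1)[OF U i])
qed

text \<open>A subrepresentation that contains the first vector of each string of the family contains all
  of them; on \<open>s\<close>, the end of the moved segment is reached modulo the part of \<open>s'\<close> treated before.\<close>

lemma eq_Psi:
  assumes x: "state x" and U: "U \<in> quiver_Gr Q M e" and ed: "edge x s s' r"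
    and gen: "\<And>C. C \<in> comps \<Longrightarrow> x C < len C \<Longrightarrow> wv x s s' r 1 c (C, x C) \<in> U (fst (el C (x C)))"
  shows "U = Psi x s s' r 1 c"
proof (rule quiver_Gr_eqI[OF U Psi_in[OF x ed]])
  let ?w = "wv x s s' r 1 c"
  note S = sm.edge_size[OF ed] and ne = sm.edge_neq[OF ed]
  have rx: "0 < r" "r \<le> x s'" "x s' \<le> len s'" "sm.match s (x s) s' (x s' - r)" using ed by (auto simp: sm.edge_def)
  have other: "bb (el C m) \<in> U (fst (el C m))" if C: "C \<in> comps" "C \<noteq> s" "x C \<le> m" "m < len C" for C m
  proof -
    have "x C < len C" using C by simp
    from gen[OF C(1) this] have "bb (el C (x C)) \<in> U (fst (el C (x C)))" using C(2) by (simp add: wv_def)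
    then show ?thesis by (rule bb_upward[OF U C(1,4) _ C(3)])
  qed
  have start: "?w (s, x s + j) \<in> U (fst (el s (x s + j)))" if "j < r" for j
    using that
  proof (induction j)
    case 0
    then show ?case using gen[OF S(4,3)] by simp
  next
    case (Suc j)
    let ?m = "x s + j" and ?n = "x s' - r + j"
    have IH: "?w (s, ?m) \<in> U (fst (el s ?m))" using Suc by simp
    have lt: "Suc ?m < len s" "Suc ?n < len s'" using Suc.prems S(2) rx by auto
    have mt: "sm.match s ?m s' ?n" using lt by (intro sm.match_shift(1)[OF rx(4)]) simp
    have w: "?w (s, ?m) = bb (el s ?m) + c *s bb (el s' ?n)" "?w (s, x s + Suc j) = bb (el s (Suc ?m)) + c *s bb (el s' (Suc ?n))"
      using Suc.prems by (simp_all add: wv_def)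
    note a = qa_props[OF S(4) lt(1)] and a' = qa_props[OF S(5) lt(2)]
    have qa: "qa s' ?n = qa s ?m"
    proof -
      have "ep s' (Suc ?n) (Inr (qa s' ?n)) - ep s (Suc ?m) (Inr (qa s' ?n)) = ep s' ?n (Inr (qa s' ?n)) - ep s ?m (Inr (qa s' ?n))"
        using sm.match_shift(2)[OF mt, of 1 "Inr (qa s' ?n)"] lt(2) by simp
      then show ?thesis by (simp add: ep_Suc split: if_splits)
    qed
    have same: "fst (el s' ?n) = tail Q (qa s ?m)" using a'(2) unfolding qa by simp
    have in1: "bb (el s ?m) \<in> vsp M (tail Q (qa s ?m))" "bb (el s' ?n) \<in> vsp M (tail Q (qa s ?m))"
      using bb_in[OF el_in_verts[OF S(4), of ?m]] bb_in[OF el_in_verts[OF S(5), of ?n]] lt same a(2) by simp_all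
    have "vmap M (qa s ?m) (?w (s, ?m)) = bb (el s (Suc ?m)) + c *s bb (el s' (Suc ?n))"
    proof -
      have "tail Q (qa s ?m) \<in> verts Q" using a(1) by simp
      then have "c *s bb (el s' ?n) \<in> vsp M (tail Q (qa s ?m))"
        by (intro vec.subspace_scale vsp_subspace in1)
      then show ?thesis unfolding w(1) using vmap_add[OF a(1) in1(1)] vmap_scale[OF a(1) in1(2)] a(4) a'(4)[unfolded qa] by simp
    qed
    moreover have "vmap M (qa s ?m) (?w (s, ?m)) \<in> U (head Q (qa s ?m))"
      using quiver_GrD(5)[OF U a(1)] IH unfolding a(2) by simp
    ultimately show ?case unfolding w(2) using a(3) by simp
  qed
  have rest: "bb (el s (x s + r)) \<in> U (fst (el s (x s + r)))" if lt: "x s + r < len s"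
  proof -
    define m where "m = x s + (r - 1)"
    define n where "n = x s' - r + (r - 1)"
    have m: "Suc m = x s + r" "Suc n = x s'" "n < len s'" "m < x s + r" using rx by (simp_all add: m_def n_def)
    have st: "?w (s, m) \<in> U (fst (el s m))" using start[of "r - 1"] rx(1) by (simp add: m_def)
    have mt: "sm.match s m s' n" unfolding m_def n_def using m(3) by (intro sm.match_shift(1)[OF rx(4)]) (simp add: n_def)
    have w: "?w (s, m) = bb (el s m) + c *s bb (el s' n)" using m by (simp add: wv_def m_def n_def)
    have ltm: "Suc m < len s" using lt m(1) by simp
    note a = qa_props[OF S(4) ltm]
    have same: "fst (el s' n) = tail Q (qa s m)" using mt a(2) by (simp add: sm.match_def)
    have vtx: "tail Q (qa s m) \<in> verts Q" "head Q (qa s m) \<in> verts Q" using a(1) by simp_all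
    have in1: "bb (el s m) \<in> vsp M (tail Q (qa s m))" "bb (el s' n) \<in> vsp M (tail Q (qa s m))"
      using bb_in[OF el_in_verts[OF S(4), of m]] bb_in[OF el_in_verts[OF S(5) m(3)]] ltm same a(2) by simp_all
    then have "c *s bb (el s' n) \<in> vsp M (tail Q (qa s m))" by (intro vec.subspace_scale vsp_subspace vtx)
    then have v: "vmap M (qa s m) (?w (s, m)) = bb (el s (Suc m)) + c *s vmap M (qa s m) (bb (el s' n))"
      unfolding w using vmap_add[OF a(1) in1(1)] vmap_scale[OF a(1) in1(2)] a(4) by simp
    have v1: "vmap M (qa s m) (?w (s, m)) \<in> U (head Q (qa s m))"
      using quiver_GrD(5)[OF U a(1)] st unfolding a(2) by simp
    have v2: "vmap M (qa s m) (bb (el s' n)) \<in> U (head Q (qa s m))"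
    proof (cases "Suc n < len s' \<and> qa s m = qa s' n")
      case True
      then have "head Q (qa s m) = fst (el s' (x s'))" using qa_props(3)[OF S(5), of n] m(2) by simp
      moreover have "bb (el s' (x s')) \<in> U (fst (el s' (x s')))"
        using other[OF S(5) ne[symmetric]] True m(2) by simp
      ultimately show ?thesis using vmap_el[OF S(5) m(3) a(1) same[symmetric]] True m(2) by simp
    next
      case False
      then show ?thesis using vmap_el[OF S(5) m(3) a(1) same[symmetric]] vec.subspace_0[OF quiver_GrD(1)[OF U vtx(2)]]
        by (simp only: if_False)
    qed
    have "(bb (el s (Suc m)) + c *s vmap M (qa s m) (bb (el s' n))) - c *s vmap M (qa s m) (bb (el s' n)) \<in> U (head Q (qa s m))"
      using v1 v2 unfolding v by (intro vec.subspace_diff vec.subspace_scale quiver_GrD(1)[OF U vtx(2)])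
    then show ?thesis using a(3) m(1) by simp
  qed
  show "(1 :: complex, c) \<noteq> (0, 0)" by simp
  fix i assume i: "i \<in> verts Q"
  have "?w p \<in> U i" if "p \<in> idx x i" for p
  proof -
    have p: "fst p \<in> comps" "x (fst p) \<le> snd p" "snd p < len (fst p)" "fst (ev p) = i"
      using that by (auto simp: idx_def)
    show ?thesis
    proof (cases "fst p = s \<and> snd p < x s + r")
      case True
      then have j: "snd p - x s < r" "x s + (snd p - x s) = snd p" "p = (s, snd p)" using p(2) by (auto simp: prod_eq_iff)
      show ?thesis using start[OF j(1)] True p(4) unfolding j(2) by (simp flip: j(3))
    next
      case False
      then have w: "?w p = bb (ev p)" unfolding wv_def by (simp only: if_False)
      show ?thesis
      proof (cases "fst p = s")
        case True
        then have lt: "snd p < len s" "x s + r \<le> snd p" using False p(3) by auto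
        have "bb (el s (snd p)) \<in> U (fst (el s (snd p)))"
          using lt by (intro bb_upward[OF U S(4) lt(1) rest lt(2)]) simp
        then show ?thesis using w True p(4) by simp
      next
        case False
        then show ?thesis using other[OF p(1) False p(2,3)] w p(4) by simp
      qed
    qed
  qed
  then show "Psi x s s' r 1 c i \<subseteq> U i"
    using i unfolding Psi_def by (simp add: image_subset_iff vec.span_minimal quiver_GrD(1)[OF U i])
qed

lemma bb_in_Phi_iff:
  assumes y: "y \<in> verts CQ"
  shows "bb y \<in> Phi x (fst y) \<longleftrightarrow> y \<in> ev ` idx x (fst y)"
proof
  let ?i = "fst y"
  have i: "?i \<in> verts Q" using fst_verts[OF y] .
  assume "bb y \<in> Phi x ?i"
  then obtain d where d: "bb y = (\<Sum>p\<in>idx x ?i. d p *s bb (ev p))"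
    using i by (auto simp: Phi_def span_family[OF finite_idx])
  have "ce y (bb y) = (\<Sum>p\<in>idx x ?i. d p * ce y (bb (ev p)))"
    unfolding d using bb_in idx_ev by (intro ce_sum[OF i]) fastforce+
  moreover have "ce y (bb y) = 1" using cf_bb[OF y y] by simp
  ultimately have "(\<Sum>p\<in>idx x ?i. d p * ce y (bb (ev p))) \<noteq> 0" by simp
  then obtain p where p: "p \<in> idx x ?i" "d p * ce y (bb (ev p)) \<noteq> 0" using sum.not_neutral_contains_not_neutral by blast
  have "ce y (bb (ev p)) = of_bool (y = ev p)" using idx_ev[OF p(1)] by (intro cf_bb y) auto
  then have "y = ev p" using p(2) by auto
  then show "y \<in> ev ` idx x ?i" using p(1) by blast
next
  assume "y \<in> ev ` idx x (fst y)"
  then obtain p where p: "p \<in> idx x (fst y)" "y = ev p" by blast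
  have "bb (ev p) \<in> vec.span ((\<lambda>p. bb (ev p)) ` idx x (fst y))" using p(1) by (intro vec.span_base imageI)
  then show "bb y \<in> Phi x (fst y)" using fst_verts[OF y] p(2) by (simp add: Phi_def)
qed

lemma Phi_le:
  assumes "state x" "state x'" "Phi x = Phi x'" "C \<in> comps"
  shows "x' C \<le> x C"
proof (cases "x C < len C")
  case True
  let ?y = "el C (x C)"
  have y: "?y \<in> verts CQ" using assms(4) True by (rule el_in_verts)
  have "(C, x C) \<in> idx x (fst ?y)" using assms(4) True by (simp add: idx_def)
  then have "?y \<in> ev ` idx x (fst ?y)" by (rule rev_image_eqI) simp
  then have "?y \<in> ev ` idx x' (fst ?y)" unfolding bb_in_Phi_iff[OF y, symmetric] assms(3) .
  then obtain p where p: "p \<in> idx x' (fst ?y)" "?y = ev p" by blast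
  then have p': "fst p \<in> comps" "snd p < len (fst p)" "x' (fst p) \<le> snd p" by (auto simp: idx_def)
  have "fst p = C" "snd p = x C" using el_inj[OF assms(4) p'(1) True p'(2) p(2)] by metis+
  then show ?thesis using p'(3) by metis
next
  case False
  then show ?thesis using assms(2,4) by (auto simp: state_def bounded_state_def)
qed

lemma Phi_inj:
  assumes "state x" "state x'" "Phi x = Phi x'"
  shows "x = x'"
proof (rule extensionalityI[of _ comps])
  show "x \<in> extensional comps" "x' \<in> extensional comps"
    using assms by (simp_all add: state_def bounded_state_def PiE_iff)
  fix C assume "C \<in> comps"
  then show "x C = x' C" using Phi_le assms by (metis le_antisym)
qed

text \<open>The predicate \<open>G\<close> marks the non-zero coefficients, off the pivots, of the
  reduced vectors at the first positions of the strings; each belongs to an arc leaving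
  \<open>x\<close>. With none the subrepresentation is fixed, with one it lies on a curve, and with
  two both labels are trivial on the stabiliser.\<close>

lemma classify:
  assumes U: "U \<in> quiver_Gr Q M e"
  shows "(\<exists>x. state x \<and> U = Phi x) \<or>
    (\<exists>x s s' r c. state x \<and> edge x s s' r \<and> c \<noteq> 0 \<and> U = Psi x s s' r 1 c) \<or>
    (\<exists>x s s' r t t' r'. edge x s s' r \<and> edge x t t' r' \<and> (s, s', r) \<noteq> (t, t', r') \<and>
      (\<forall>u\<in>torus I. act u U = U \<longrightarrow> char_eval I (ilab x s s' r) u = 1 \<and> char_eval I (ilab x t t' r') u = 1))"
proof -
  obtain x w where x: "state x"
    and w1: "\<And>i p. i \<in> verts Q \<Longrightarrow> p \<in> idx x i \<Longrightarrow> w p \<in> U i"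
    and w2: "\<And>i p q. i \<in> verts Q \<Longrightarrow> p \<in> idx x i \<Longrightarrow> q \<in> idx x i \<Longrightarrow> ce (ev q) (w p) = of_bool (p = q)"
    and w3: "\<And>p i z. i \<in> verts Q \<Longrightarrow> p \<in> idx x i \<Longrightarrow> z \<in> verts CQ \<Longrightarrow> fst z = i \<Longrightarrow> snd z < snd (ev p) \<Longrightarrow> ce z (w p) = 0"
    and w4: "\<And>i v. i \<in> verts Q \<Longrightarrow> v \<in> U i \<Longrightarrow> (\<And>q. q \<in> idx x i \<Longrightarrow> ce (ev q) v = 0) \<Longrightarrow> v = 0"
    using echelon[OF U] by blast
  have inn: "w p \<in> vsp M i" if "i \<in> verts Q" "p \<in> idx x i" for p i
    using w1[OF that] quiver_GrD(2)[OF U that(1)] by blast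
  define G where "G = (\<lambda>(s, s', r). edge x s s' r \<and> ce (el s' (x s' - r)) (w (s, x s)) \<noteq> 0)"
  have gen: "\<exists>s' r. G (C, s', r) \<and> z = el s' (x s' - r)"
    if C: "C \<in> comps" "x C < len C" and z: "z \<in> verts CQ" "fst z = fst (el C (x C))" "z \<noteq> el C (x C)" "ce z (w (C, x C)) \<noteq> 0" for C z
  proof -
    let ?i = "fst z"
    have i: "?i \<in> verts Q" using fst_verts[OF z(1)] .
    have p: "(C, x C) \<in> idx x ?i" using C z(2) by (simp add: idx_def)
    obtain s' m where m: "s' \<in> comps" "m < len s'" "z = el s' m" using el_surj[OF z(1)] by blast
    \<comment> \<open>A reduced vector has coordinate zero at every pivot other than its
      own.\<close>
    have lt: "m < x s'"
    proof (rule ccontr)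
      assume "\<not> m < x s'"
      then have q: "(s', m) \<in> idx x ?i" using m by (simp add: idx_def)
      have "(C, x C) \<noteq> (s', m)" using m(3) z(3) by auto
      then show False using w2[OF i p q] m(3) z(4) by simp
    qed
    have "\<not> snd z < snd (el C (x C))" using w3[OF i p z(1) refl] z(4) by auto
    moreover have "snd z \<noteq> snd (el C (x C))" using z(2,3) by (auto simp: prod_eq_iff)
    ultimately have "snd (el C (x C)) < snd z" by simp
    then have "sm.match C (x C) s' m" using C m z(2) by (simp add: sm.match_def)
    moreover have "x s' \<le> len s'" using x m(1) by (simp add: state_def bounded_state_def)
    ultimately have "edge x C s' (x s' - m)" using lt by (simp add: sm.edge_def)
    then have "G (C, s', x s' - m)" using z(4) lt by (simp add: G_def flip: m(3))
    moreover have "z = el s' (x s' - (x s' - m))" using m(3) lt by simp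
    ultimately show ?thesis by blast
  qed
  \<comment> \<open>The image of a reduced vector under \<open>u\<close>, minus a suitable multiple
    of the vector, lies in \<open>U\<close> and has no pivot coordinates, hence is zero. So its
    coordinates at \<open>?z\<close> and at the pivot are scaled alike, and the label takes the
    value \<open>1\<close> at \<open>u\<close>.\<close>
  have fixed: "char_eval I (ilab x s s' r) u = 1" if G: "G (s, s', r)" and u: "u \<in> torus I" "act u U = U" for s s' r u
  proof -
    have ed: "edge x s s' r" and nz: "ce (el s' (x s' - r)) (w (s, x s)) \<noteq> 0" using G by (auto simp: G_def)
    let ?p = "(s, x s)" and ?z = "el s' (x s' - r)" and ?i = "fst (el s (x s))"
    have p: "?p \<in> idx x ?i" and i: "?i \<in> verts Q" using edge_idx[OF ed] by simp_all
    have r: "0 < r" using ed by (simp add: sm.edge_def)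
    have z: "fst ?z = ?i" "?z \<in> verts CQ" using seg(3,4)[OF ed p] r by simp_all
    have "actv u ?i (w ?p) \<in> act u U ?i" using w1[OF i p] i by (simp add: TM_act_def)
    then have a: "actv u ?i (w ?p) \<in> U ?i" unfolding u(2) .
    let ?k = "scal u (ev ?p)"
    let ?d = "actv u ?i (w ?p) - ?k *s w ?p"
    have ce_d: "ce y ?d = (scal u y - ?k) * ce y (w ?p)" if y: "y \<in> verts CQ" "fst y = ?i" for y
    proof -
      have k: "snd y \<in> bix M ?i" using y by (auto simp: verts_CQ)
      have kw: "- ?k *s w ?p \<in> vsp M ?i" by (intro vec.subspace_scale vsp_subspace i inn[OF i p])
      have "?d = actv u ?i (w ?p) + (- ?k) *s w ?p" by simp
      then have "cf ?i (snd y) ?d = cf ?i (snd y) (actv u ?i (w ?p)) + (- ?k) * cf ?i (snd y) (w ?p)"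
        by (simp only: cf_add[OF i actv_in[OF i] kw] cf_scale[OF i inn[OF i p]])
      also have "cf ?i (snd y) (actv u ?i (w ?p)) = scal u y * cf ?i (snd y) (w ?p)"
        unfolding cf_actv[OF i k] using y(2) by (metis prod.collapse)
      also have "scal u y * cf ?i (snd y) (w ?p) + (- ?k) * cf ?i (snd y) (w ?p) = (scal u y - ?k) * cf ?i (snd y) (w ?p)"
        by (simp add: left_diff_distrib)
      finally show ?thesis unfolding y(2) .
    qed
    have "?d = 0"
    proof (rule w4[OF i])
      show "?d \<in> U ?i"
        by (intro vec.subspace_diff vec.subspace_scale quiver_GrD(1)[OF U i] a w1[OF i p])
      fix q assume q: "q \<in> idx x ?i"
      show "ce (ev q) ?d = 0"
        using ce_d[of "ev q"] idx_ev[OF q] w2[OF i p q] by (cases "?p = q") auto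
    qed
    then have "(scal u ?z - ?k) * ce ?z (w ?p) = 0" using ce_d[OF z(2,1)] cf_0[OF i] z(1) by simp
    then have "scal u ?z = ?k" using nz by simp
    moreover have "scal u ?z = char_eval I (ilab x s s' r) u * ?k"
      using scal_match[OF ed r u(1)] by simp
    moreover have "?k \<noteq> 0" using scal_nz[OF u(1)] idx_ev[OF p] by simp
    ultimately show ?thesis by simp
  qed
  have wgen: "w (C, x C) \<in> U (fst (el C (x C)))" "fst (el C (x C)) \<in> verts Q" "(C, x C) \<in> idx x (fst (el C (x C)))"
    if C: "C \<in> comps" "x C < len C" for C
  proof -
    show i: "fst (el C (x C)) \<in> verts Q" using fst_verts[OF el_in_verts[OF C]] .
    show p: "(C, x C) \<in> idx x (fst (el C (x C)))" using C by (simp add: idx_def)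
    show "w (C, x C) \<in> U (fst (el C (x C)))" using w1[OF i p] .
  qed
  consider "\<forall>g. \<not> G g" | g where "G g" "\<forall>h. G h \<longrightarrow> h = g" | g h where "G g" "G h" "g \<noteq> h" by blast
  then show ?thesis
  proof cases
    case 1
    have "U = Phi x"
    proof (rule eq_Phi[OF x U])
      fix C assume C: "C \<in> comps" "x C < len C"
      let ?y = "el C (x C)"
      note wg = wgen[OF C]
      have y: "?y \<in> verts CQ" using el_in_verts[OF C] .
      have "w (C, x C) = bb ?y"
      proof (rule cf_eqI[OF wg(2) inn[OF wg(2,3)] bb_in[OF y]])
        fix k assume "k \<in> bix M (fst ?y)"
        then have z: "(fst ?y, k) \<in> verts CQ" using wg(2) by (simp add: verts_CQ)
        show "cf (fst ?y) k (w (C, x C)) = cf (fst ?y) k (bb ?y)"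
        proof (cases "(fst ?y, k) = ?y")
          case True
          then have k: "k = snd ?y" by (metis snd_conv)
          show ?thesis using w2[OF wg(2,3,3)] cf_bb[OF y y] k by simp
        next
          case False
          have "cf (fst ?y) k (w (C, x C)) = 0" using gen[OF C z _ False] 1 by auto
          moreover have "cf (fst ?y) k (bb ?y) = 0" using cf_bb[OF z y] False by simp
          ultimately show ?thesis by simp
        qed
      qed
      then show "bb ?y \<in> U (fst ?y)" using wg(1) by simp
    qed
    then show ?thesis using x by (intro disjI1 exI[of _ x] conjI)
  next
    case (2 g)
    obtain s s' r where g: "g = (s, s', r)" by (cases g)
    define c where "c = ce (el s' (x s' - r)) (w (s, x s))"
    have ed: "edge x s s' r" and c: "c \<noteq> 0" using 2(1) by (auto simp: g G_def c_def)
    have r: "0 < r" using ed by (simp add: sm.edge_def)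
    have "U = Psi x s s' r 1 c"
    proof (rule eq_Psi[OF x U ed])
      fix C assume C: "C \<in> comps" "x C < len C"
      let ?y = "el C (x C)"
      note wg = wgen[OF C]
      have y: "?y \<in> verts CQ" using el_in_verts[OF C] .
      have "w (C, x C) = wv x s s' r 1 c (C, x C)"
      proof (rule cf_eqI[OF wg(2) inn[OF wg(2,3)] wv_in[OF ed wg(3,2)]])
        fix k assume "k \<in> bix M (fst ?y)"
        then have z: "(fst ?y, k) \<in> verts CQ" using wg(2) by (simp add: verts_CQ)
        let ?u = "el s' (x s' - r)"
        have wvC: "wv x s s' r 1 c (C, x C) = (if C = s then bb ?y + c *s bb ?u else bb ?y)"
          using r by (simp add: wv_def)
        have cez: "cf (fst ?y) k (bb ?y) = of_bool ((fst ?y, k) = ?y)" using cf_bb[OF z y] by simp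
        show "cf (fst ?y) k (w (C, x C)) = cf (fst ?y) k (wv x s s' r 1 c (C, x C))"
        proof (cases "C = s")
          case True
          have u: "fst ?u = fst ?y" "?u \<in> verts CQ" "?u \<noteq> ?y"
            using seg(3,4)[OF ed wg(3)] seg_notin[OF ed wg(3) _ _ wg(3)] True r by auto
          have ceu: "cf (fst ?y) k (bb ?u) = of_bool ((fst ?y, k) = ?u)" using cf_bb[OF z u(2)] u(1) by simp
          have "bb ?u \<in> vsp M (fst ?y)" using bb_in[OF u(2)] u(1) by simp
          then have "cf (fst ?y) k (wv x s s' r 1 c (C, x C)) = of_bool ((fst ?y, k) = ?y) + c * of_bool ((fst ?y, k) = ?u)"
            using wvC True cf_add[OF wg(2) bb_in[OF y] vec.subspace_scale[OF vsp_subspace[OF wg(2)]]] cf_scale[OF wg(2)] cez ceu by simp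
          moreover have "cf (fst ?y) k (w (C, x C)) = of_bool ((fst ?y, k) = ?y) + c * of_bool ((fst ?y, k) = ?u)"
          proof -
            consider "(fst ?y, k) = ?y" | "(fst ?y, k) = ?u" | "(fst ?y, k) \<noteq> ?y" "(fst ?y, k) \<noteq> ?u" by blast
            then show ?thesis
            proof cases
              case 1
              then have k: "k = snd ?y" by (metis snd_conv)
              show ?thesis using w2[OF wg(2,3,3)] k 1 u(3) by simp
            next
              case 2
              then have k: "k = snd ?u" by (metis snd_conv)
              show ?thesis using k 2 u(1,3) True by (simp add: c_def)
            next
              case 3
              have "cf (fst ?y) k (w (C, x C)) = 0"
              proof (rule ccontr)
                assume "cf (fst ?y) k (w (C, x C)) \<noteq> 0"
                then obtain t' q where "G (C, t', q)" "(fst ?y, k) = el t' (x t' - q)"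
                  using gen[OF C z _ 3(1)] by auto
                then show False using 2(2) 3(2) g by blast
              qed
              then show ?thesis using 3 by simp
            qed
          qed
          ultimately show ?thesis by simp
        next
          case False
          show ?thesis
          proof (cases "(fst ?y, k) = ?y")
            case True
            then have k: "k = snd ?y" by (metis snd_conv)
            show ?thesis using w2[OF wg(2,3,3)] cez True k wvC False by simp
          next
            case ne: False
            have "cf (fst ?y) k (w (C, x C)) = 0"
            proof (rule ccontr)
              assume "cf (fst ?y) k (w (C, x C)) \<noteq> 0"
              then obtain t' q where "G (C, t', q)" using gen[OF C z _ ne] by auto
              then show False using 2(2) False g by blast
            qed
            then show ?thesis using cez ne wvC False by simp
          qed
        qed
      qed
      then show "wv x s s' r 1 c (C, x C) \<in> U (fst ?y)" using wg(1) by simp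
    qed
    then show ?thesis using x ed c by blast
  next
    case (3 g h)
    obtain s s' r where g: "g = (s, s', r)" by (cases g)
    obtain t t' r' where h: "h = (t, t', r')" by (cases h)
    have "edge x s s' r" "edge x t t' r'" using 3 by (auto simp: g h G_def)
    moreover have "(s, s', r) \<noteq> (t, t', r')" using 3(3) g h by simp
    moreover have "char_eval I (ilab x s s' r) u = 1 \<and> char_eval I (ilab x t t' r') u = 1" if "u \<in> torus I" "act u U = U" for u
      using fixed[OF _ that] 3(1,2) g h by blast
    ultimately show ?thesis by blast
  qed
qed

end

section \<open>The moment graph\<close>

lemma limitin_cong_eventually:
  assumes "limitin X f l F" "eventually (\<lambda>z. f z = g z) F"
  shows "limitin X g l F"
  unfolding limitin_def
proof (intro conjI allI impI)
  show "l \<in> topspace X" using assms(1) by (simp add: limitin_def)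
  fix U assume "openin X U \<and> l \<in> U"
  then have "eventually (\<lambda>z. f z \<in> U) F" using assms(1) by (simp add: limitin_def)
  then show "eventually (\<lambda>z. g z \<in> U) F" using assms(2) by eventually_elim simp
qed

lemma lin_multiple_dvd_iff:
  assumes "k \<noteq> 0"
  shows "lin I (\<lambda>j. k * c j) dvd p \<longleftrightarrow> lin I c dvd p"
proof -
  have "lin I c = lin I (\<lambda>j. (1 / k) * (k * c j))" using assms by (intro lin_cong) simp
  then have "lin I (\<lambda>j. k * c j) dvd lin I c" by (metis lin_scale dvd_triv_right)
  moreover have "lin I c dvd lin I (\<lambda>j. k * c j)" unfolding lin_scale by (rule dvd_triv_right)
  ultimately show ?thesis by (blast intro: dvd_trans)
qed

context straight_Gr
begin

lemma ilab_independent: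
  assumes ed: "edge x s s' r" "edge x t t' r'" and ne: "(s, s', r) \<noteq> (t, t', r')"
  shows "restrict (ilab x s s' r) I \<noteq> restrict (ilab x t t' r') I"
    "int_independent I {restrict (ilab x s s' r) I, restrict (ilab x t t' r') I}"
proof -
  let ?m = "restrict (ilab x s s' r) I" and ?n = "restrict (ilab x t t' r') I"
  have nl: "\<not> lindep I (sm.labl x s s' r) (sm.labl x t t' r')"
    using sm.labl_indep[OF ed] ne unfolding I_eq by blast
  show neq: "?m \<noteq> ?n"
  proof
    assume eq: "?m = ?n"
    have "ilab x t t' r' j = ilab x s s' r j" if "j \<in> I" for j using fun_cong[OF eq, of j] that by simp
    then have "lindep I (sm.labl x s s' r) (sm.labl x t t' r')"
      unfolding lindep_def labl_ilab by (intro exI[of _ 1]) simp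
    then show False using nl by simp
  qed
  show "int_independent I {?m, ?n}"
    unfolding int_independent_def
  proof (intro conjI allI impI)
    fix c :: "(('v, 'a) tindex \<Rightarrow> int) \<Rightarrow> int"
    assume "\<forall>j\<in>I. (\<Sum>k\<in>{?m, ?n}. c k * k j) = 0"
    then have c: "c ?m * ilab x s s' r j + c ?n * ilab x t t' r' j = 0" if "j \<in> I" for j
      using that neq by simp
    have n0: "c ?n = 0"
    proof (rule ccontr)
      assume nz: "c ?n \<noteq> 0"
      have "sm.labl x t t' r' j = (- of_int (c ?m) / of_int (c ?n)) * sm.labl x s s' r j" if j: "j \<in> I" for j
      proof -
        have "of_int (c ?m) * sm.labl x s s' r j + of_int (c ?n) * sm.labl x t t' r' j = (of_int (c ?m * ilab x s s' r j + c ?n * ilab x t t' r' j) :: rat)"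
          by (simp add: labl_ilab)
        then have "of_int (c ?m) * sm.labl x s s' r j + of_int (c ?n) * sm.labl x t t' r' j = 0" unfolding c[OF j] by simp
        then have "of_int (c ?n) * sm.labl x t t' r' j = - (of_int (c ?m) * sm.labl x s s' r j)" by (simp add: eq_neg_iff_add_eq_0 add.commute)
        then show ?thesis using nz by (simp add: field_simps)
      qed
      then show False using nl unfolding lindep_def by blast
    qed
    moreover have "c ?m = 0" using c[OF ilab_Inl(2)[OF ed(1)]] n0 ilab_Inl(1)[OF ed(1)] by simp
    ultimately show "\<forall>k\<in>{?m, ?n}. c k = 0" by blast
  qed simp
qed

text \<open>Otherwise two independent characters are trivial on the stabiliser, and the orbit has
  dimension at least two.\<close>

lemma orbit_dim_le_1_cases:
  assumes U: "U \<in> quiver_Gr Q M e" and dim: "orbit_dim I act U \<le> 1"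
  shows "(\<exists>x. state x \<and> U = Phi x) \<or> (\<exists>x s s' r c. state x \<and> edge x s s' r \<and> c \<noteq> 0 \<and> U = Psi x s s' r 1 c)"
proof (rule ccontr)
  assume neg: "\<not> ?thesis"
  then obtain x s s' r t t' r' where ed: "edge x s s' r" "edge x t t' r'" and ne: "(s, s', r) \<noteq> (t, t', r')"
    and fx: "\<And>u. u \<in> torus I \<Longrightarrow> act u U = U \<Longrightarrow> char_eval I (ilab x s s' r) u = 1 \<and> char_eval I (ilab x t t' r') u = 1"
    using classify[OF U] by blast
  let ?m = "restrict (ilab x s s' r) I" and ?n = "restrict (ilab x t t' r') I"
  note ind = ilab_independent[OF ed ne]
  have ch: "restrict l I \<in> orbit_characters I act U"
    if "\<And>u. u \<in> torus I \<Longrightarrow> act u U = U \<Longrightarrow> char_eval I l u = 1" for l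
  proof -
    have "char_eval I (restrict l I) u = char_eval I l u" for u by (rule char_eval_cong) simp
    then show ?thesis using that by (simp add: orbit_characters_def characters_def)
  qed
  have "{?m, ?n} \<subseteq> orbit_characters I act U" using ch[of "ilab x s s' r"] ch[of "ilab x t t' r'"] fx by simp
  from card_le_orbit_dim[OF finite_I this ind(2)] have "2 \<le> orbit_dim I act U" using ind(1) by simp
  then show False using dim by simp
qed

lemma Phi_fixed: "state x \<Longrightarrow> Phi x \<in> fixed_points I act X"
  unfolding fixed_points_def topspace_X by (simp add: state_def act_Phi)

lemma Psi_not_fixed:
  assumes "edge x s s' r" "c \<noteq> 0"
  shows "Psi x s s' r 1 c \<notin> fixed_points I act X"
proof
  assume f: "Psi x s s' r 1 c \<in> fixed_points I act X"
  obtain t where t: "t \<in> torus I" "char_eval I (ilab x s s' r) t = 2" using ilab_surj[OF assms(1), of 2] by auto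
  then show False using f act_Psi_fixed[OF assms t(1)] by (simp add: fixed_points_def)
qed

lemma fixed_points_eq: "fixed_points I act X = Phi ` {x. state x}"
proof (intro equalityI subsetI)
  fix U assume U: "U \<in> fixed_points I act X"
  then have "U \<in> quiver_Gr Q M e" "orbit_dim I act U \<le> 1"
    using orbit_dim_fixed[of U] by (simp_all add: fixed_points_def topspace_X)
  from orbit_dim_le_1_cases[OF this] show "U \<in> Phi ` {x. state x}"
    using Psi_not_fixed U by blast
qed (use Phi_fixed in blast)

lemma one_dim_orbits_iff:
  "E \<in> one_dim_orbits I act X \<longleftrightarrow> (\<exists>x s s' r. state x \<and> edge x s s' r \<and> E = orb x s s' r)"
proof
  assume "E \<in> one_dim_orbits I act X"
  then obtain U where U: "U \<in> quiver_Gr Q M e" "orbit_dim I act U = 1" "E = torus_orbit I act U"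
    by (auto simp: one_dim_orbits_def topspace_X)
  have "\<not> (\<exists>x. state x \<and> U = Phi x)" using U(2) orbit_dim_fixed[of "Phi _"] act_Phi by fastforce
  then obtain x s s' r c where "state x" "edge x s s' r" "c \<noteq> 0" "U = Psi x s s' r 1 c"
    using orbit_dim_le_1_cases[OF U(1)] U(2) by auto
  then show "\<exists>x s s' r. state x \<and> edge x s s' r \<and> E = orb x s s' r"
    using U(3) torus_orbit_Psi by (intro exI[of _ x] exI[of _ s] exI[of _ s'] exI[of _ r]) simp
next
  assume "\<exists>x s s' r. state x \<and> edge x s s' r \<and> E = orb x s s' r"
  then obtain x s s' r where E: "state x" "edge x s s' r" "E = orb x s s' r" by blast
  have "Psi x s s' r 1 1 \<in> quiver_Gr Q M e" using Psi_in[OF E(1,2)] by simp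
  then show "E \<in> one_dim_orbits I act X"
    unfolding one_dim_orbits_def topspace_X
    using orbit_dim_Psi[OF E(2), of 1] torus_orbit_Psi[OF E(2), of 1] E(3) by (intro image_eqI[of _ _ "Psi x s s' r 1 1"]) simp_all
qed

text \<open>The sum of the indices of all basis vectors in \<open>Phi x\<close>. It increases along
  arcs, since each dropped vector is replaced by a matched one of larger index, and so witnesses
  acyclicity.\<close>

definition potential :: "(('v \<times> nat) set \<Rightarrow> nat) \<Rightarrow> int" where
  "potential x = (\<Sum>C\<in>comps. \<Sum>m\<in>{x C..<len C}. int (snd (el C m)))"

lemma potential_less:
  assumes x: "state x" and ed: "edge x s s' r"
  shows "potential x < potential (move x s s' r)"
proof -
  let ?x = "move x s s' r"
  let ?f = "\<lambda>x C. \<Sum>m\<in>{x C..<len C}. int (snd (el C m))"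
  note S = sm.edge_size[OF ed] and ne = sm.edge_neq[OF ed]
  have rx: "0 < r" "r \<le> x s'" "x s' \<le> len s'" "sm.match s (x s) s' (x s' - r)" using ed by (auto simp: sm.edge_def)
  have split: "potential y = ?f y s + (?f y s' + (\<Sum>C\<in>comps - {s} - {s'}. ?f y C))" for y
  proof -
    have "potential y = ?f y s + (\<Sum>C\<in>comps - {s}. ?f y C)"
      unfolding potential_def by (rule sum.remove[OF finite_comps S(4)])
    also have "(\<Sum>C\<in>comps - {s}. ?f y C) = ?f y s' + (\<Sum>C\<in>comps - {s} - {s'}. ?f y C)"
      using S(5) ne finite_comps by (intro sum.remove) auto
    finally show ?thesis .
  qed
  have mv: "?x s = x s + r" "?x s' = x s' - r" using ne by (simp_all add: sm.move_def)
  have rest: "(\<Sum>C\<in>comps - {s} - {s'}. ?f ?x C) = (\<Sum>C\<in>comps - {s} - {s'}. ?f x C)"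
    by (intro sum.cong refl) (simp add: sm.move_def)
  have 1: "?f x s = (\<Sum>m\<in>{x s..<x s + r}. int (snd (el s m))) + ?f ?x s"
    unfolding mv using S(2) by (subst sum.atLeastLessThan_concat) auto
  have 2: "?f ?x s' = (\<Sum>m\<in>{x s' - r..<x s'}. int (snd (el s' m))) + ?f x s'"
    unfolding mv using rx by (subst sum.atLeastLessThan_concat) auto
  have "(\<Sum>m\<in>{x s..<x s + r}. int (snd (el s m))) = (\<Sum>j\<in>{0..<r}. int (snd (el s (x s + j))))"
    using sum.shift_bounds_nat_ivl[of "\<lambda>m. int (snd (el s m))" 0 "x s" r] by (simp add: add.commute)
  also have "\<dots> < (\<Sum>j\<in>{0..<r}. int (snd (el s' (x s' - r + j))))"
  proof (rule sum_strict_mono)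
    show "{0..<r} \<noteq> {}" using rx(1) by simp
    fix j assume "j \<in> {0..<r}"
    then have "x s' - r + j < len s'" using rx by auto
    from sm.match_shift(1)[OF rx(4) this]
    show "int (snd (el s (x s + j))) < int (snd (el s' (x s' - r + j)))" by (simp add: sm.match_def)
  qed simp
  also have "\<dots> = (\<Sum>m\<in>{x s' - r..<x s'}. int (snd (el s' m)))"
    using sum.shift_bounds_nat_ivl[of "\<lambda>m. int (snd (el s' m))" 0 "x s' - r" r] rx(2) by (simp add: add.commute)
  finally show ?thesis unfolding split[of x] split[of ?x] rest 1 2 by simp
qed

lemma finite_states: "finite {x. state x}"
proof (rule finite_subset)
  show "{x. state x} \<subseteq> (\<Pi>\<^sub>E C\<in>comps. {..len C})"
    by (auto simp: state_def bounded_state_def PiE_iff extensional_def)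
  show "finite (\<Pi>\<^sub>E C\<in>comps. {..len C})" by (rule finite_PiE[OF finite_comps]) simp
qed

end

section \<open>The moment graph as a graph of states\<close>

locale straight_GKM = straight_Gr Q M b e for Q :: "('v, 'a) pre_digraph" and M :: "('v, 'a, 'n::finite) rep"
    and b :: "'v \<Rightarrow> nat \<Rightarrow> complex ^ 'n" and e :: "'v \<Rightarrow> int" +
  fixes chi :: "('v, 'a) tindex \<Rightarrow> int" and \<alpha> :: "('v \<Rightarrow> (complex ^ 'n) set) set \<Rightarrow> ('v, 'a) tindex \<Rightarrow> int"
  assumes attr: "attractive_compatible Q M chi b" and labelling: "edge_labelling I act X \<alpha>"
begin

abbreviation "\<G> \<equiv> TM_moment_graph Q M b e chi"

lemma cochar_torus: "z \<noteq> 0 \<Longrightarrow> cochar_eval I chi z \<in> torus I"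
  by (auto simp: cochar_eval_def torus_def)

text \<open>Attractivity orders the weights over one vertex like the indices, so the cocharacter
  pairs positively with the label. This orients the edge from \<open>Phi x\<close> to
  \<open>Phi (move x s s' r)\<close>.\<close>

lemma ilab_cochar:
  assumes ed: "edge x s s' r"
  obtains d where "0 < d" "\<And>z. z \<noteq> 0 \<Longrightarrow> char_eval I (ilab x s s' r) (cochar_eval I chi z) = z ^ d"
proof -
  obtain wt where wt: "\<And>i k z. i \<in> verts Q \<Longrightarrow> k \<in> bix M i \<Longrightarrow> z \<noteq> 0 \<Longrightarrow>
      actv (cochar_eval I chi z) i (b i k) = (z powi wt (i, k)) *s b i k"
    and inc: "\<And>i k l. i \<in> verts Q \<Longrightarrow> k \<in> bix M i \<Longrightarrow> l \<in> bix M i \<Longrightarrow> k > l \<Longrightarrow> wt (i, k) > wt (i, l)"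
    using attr unfolding attractive_compatible_def attractive_grading_def by (elim conjE exE) blast
  have sc: "scal (cochar_eval I chi z) y = z powi wt y" if y: "y \<in> verts CQ" and z: "z \<noteq> 0" for y z
  proof -
    have ik: "fst y \<in> verts Q" "snd y \<in> bix M (fst y)" using y by (auto simp: verts_CQ)
    have "scal (cochar_eval I chi z) y *s bb y = actv (cochar_eval I chi z) (fst y) (bb y)"
      by (rule actv_bb[OF y, symmetric])
    also have "\<dots> = (z powi wt y) *s bb y" using wt[OF ik z] by (simp only: bb_def prod.collapse)
    finally show ?thesis using bb_nz[OF y] by simp
  qed
  let ?p = "el s (x s)" and ?q = "el s' (x s' - r)"
  have m: "sm.match s (x s) s' (x s' - r)" and r: "0 < r" using ed by (auto simp: sm.edge_def)
  then have pq: "?p \<in> verts CQ" "?q \<in> verts CQ" "fst ?p = fst ?q" "snd ?p < snd ?q"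
    by (auto simp: sm.match_def intro: el_in_verts)
  have "wt (fst ?q, snd ?p) < wt (fst ?q, snd ?q)"
    using pq by (intro inc) (auto simp: verts_CQ)
  then have w: "wt ?p < wt ?q" using pq(3) by (metis prod.collapse)
  have "char_eval I (ilab x s s' r) (cochar_eval I chi z) = z ^ nat (wt ?q - wt ?p)" if z: "z \<noteq> 0" for z
  proof -
    have "z powi wt ?q = char_eval I (ilab x s s' r) (cochar_eval I chi z) * z powi wt ?p"
      using scal_match[OF ed r cochar_torus[OF z]] sc[OF pq(1) z] sc[OF pq(2) z] by simp
    then have "char_eval I (ilab x s s' r) (cochar_eval I chi z) = z powi wt ?q / z powi wt ?p"
      using z by (simp add: field_simps)
    also have "\<dots> = z powi (wt ?q - wt ?p)" using z by (simp add: power_int_diff)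
    also have "\<dots> = z ^ nat (wt ?q - wt ?p)" using w by (simp add: power_int_def)
    finally show ?thesis .
  qed
  then show ?thesis using that[of "nat (wt ?q - wt ?p)"] w by simp
qed

lemma limitin_orb:
  assumes x: "state x" and ed: "edge x s s' r" and p: "p \<in> orb x s s' r"
  shows "limitin X (\<lambda>z. act (cochar_eval I chi z) p) (Phi x) (at 0)"
proof -
  obtain c where c: "c \<noteq> 0" "p = Psi x s s' r 1 c" using p by (auto simp: orb_def)
  obtain d where d: "0 < d" "\<And>z. z \<noteq> 0 \<Longrightarrow> char_eval I (ilab x s s' r) (cochar_eval I chi z) = z ^ d"
    using ilab_cochar[OF ed] by blast
  have "((\<lambda>z :: complex. c * z ^ d) \<longlongrightarrow> c * 0 ^ d) (at 0)" by (intro tendsto_intros)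
  then have "((\<lambda>z :: complex. c * z ^ d) \<longlongrightarrow> 0) (at 0)" using d(1) by (simp add: zero_power)
  from limitin_Psi_0[OF x ed this]
  show ?thesis
  proof (rule limitin_cong_eventually)
    have "Psi x s s' r 1 (c * z ^ d) = act (cochar_eval I chi z) p" if "z \<noteq> 0" for z
      unfolding c(2) act_Psi[OF ed cochar_torus[OF that]] d(2)[OF that] ..
    then show "\<forall>\<^sub>F z in at 0. Psi x s s' r 1 (c * z ^ d) = act (cochar_eval I chi z) p"
      by (auto simp: eventually_at intro: exI[of _ 1])
  qed
qed

lemma arcs_iff:
  "(E, u, v) \<in> arcs \<G> \<longleftrightarrow>
    (\<exists>x s s' r. state x \<and> edge x s s' r \<and> E = orb x s s' r \<and> u = Phi x \<and> v = Phi (move x s s' r))"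
proof
  assume "(E, u, v) \<in> arcs \<G>"
  then have E: "E \<in> one_dim_orbits I act X" "u \<in> fixed_points I act X" "v \<in> fixed_points I act X"
    "X closure_of E = E \<union> {u, v}" "\<And>p. p \<in> E \<Longrightarrow> limitin X (\<lambda>z. act (cochar_eval I chi z) p) u (at 0)"
    by (auto simp: moment_graph_def)
  obtain x s s' r where x: "state x" "edge x s s' r" "E = orb x s s' r"
    using E(1) unfolding one_dim_orbits_iff by blast
  have nf: "p \<notin> fixed_points I act X" if "p \<in> E" for p
    using that Psi_not_fixed[OF x(2)] unfolding x(3) orb_def by auto
  have fp: "Phi x \<in> fixed_points I act X" "Phi (move x s s' r) \<in> fixed_points I act X"
    using Phi_fixed[OF x(1)] Phi_fixed[OF state_move[OF x(1,2)]] .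
  have cl: "E \<union> {u, v} = E \<union> {Phi x, Phi (move x s s' r)}"
    using E(4) closure_orb[OF x(1,2)] unfolding x(3) by simp
  have mem: "Psi x s s' r 1 1 \<in> E" by (simp add: x(3) orb_def)
  have u: "u = Phi x"
    using limitin_Hausdorff_unique[OF E(5)[OF mem] limitin_orb[OF x(1,2) mem[unfolded x(3)]] _ Hausdorff_X] by simp
  have ne: "Phi (move x s s' r) \<noteq> Phi x"
    using Phi_inj[OF state_move[OF x(1,2)] x(1)] potential_less[OF x(1,2)] by auto
  \<comment> \<open>This point lies in the closure but, being fixed, not in the orbit, and it
    differs from \<open>u\<close>; so it is the other end.\<close>
  have "Phi (move x s s' r) \<in> E \<union> {u, v}" unfolding cl by simp
  then have "v = Phi (move x s s' r)" using nf[of "Phi (move x s s' r)"] fp(2) u ne by auto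
  then show "\<exists>x s s' r. state x \<and> edge x s s' r \<and> E = orb x s s' r \<and> u = Phi x \<and> v = Phi (move x s s' r)"
    using x u by blast
next
  assume "\<exists>x s s' r. state x \<and> edge x s s' r \<and> E = orb x s s' r \<and> u = Phi x \<and> v = Phi (move x s s' r)"
  then obtain x s s' r where x: "state x" "edge x s s' r" "E = orb x s s' r" "u = Phi x" "v = Phi (move x s s' r)"
    by blast
  have "E \<in> one_dim_orbits I act X" unfolding one_dim_orbits_iff using x(1-3) by blast
  then show "(E, u, v) \<in> arcs \<G>"
    using Phi_fixed[OF x(1)] Phi_fixed[OF state_move[OF x(1,2)]] closure_orb[OF x(1,2)] limitin_orb[OF x(1,2)]
    unfolding moment_graph_def x(3-5) by simp
qed

lemma labelling_multiple:
  assumes x: "state x" and ed: "edge x s s' r"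
  obtains k :: int where "k \<noteq> 0" "\<And>j. j \<in> I \<Longrightarrow> \<alpha> (orb x s s' r) j = k * ilab x s s' r j"
proof -
  let ?E = "orb x s s' r" and ?l = "ilab x s s' r"
  have "describes_action I act ?E (\<alpha> ?E)"
    using labelling x ed one_dim_orbits_iff[of ?E] unfolding edge_labelling_def by blast
  then obtain \<phi> where \<phi>: "bij_betw \<phi> (- {0}) ?E"
    "\<And>t z. t \<in> torus I \<Longrightarrow> z \<noteq> 0 \<Longrightarrow> act t (\<phi> z) = \<phi> (char_eval I (\<alpha> ?E) t * z)"
    unfolding describes_action_def by blast
  have "\<phi> 1 \<in> ?E" using bij_betwE[OF \<phi>(1)] by simp
  then obtain c where c: "c \<noteq> 0" "\<phi> 1 = Psi x s s' r 1 c" by (auto simp: orb_def)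
  have ker: "char_eval I (\<alpha> ?E) t = 1 \<longleftrightarrow> char_eval I ?l t = 1" if t: "t \<in> torus I" for t
  proof -
    have nz: "char_eval I (\<alpha> ?E) t \<noteq> 0" by (rule char_eval_nz[OF finite_I torus_nz[OF t]])
    have "char_eval I ?l t = 1 \<longleftrightarrow> act t (\<phi> 1) = \<phi> 1" unfolding c(2) act_Psi_fixed[OF ed c(1) t] ..
    also have "\<dots> \<longleftrightarrow> \<phi> (char_eval I (\<alpha> ?E) t) = \<phi> 1" using \<phi>(2)[OF t, of 1] by simp
    also have "\<dots> \<longleftrightarrow> char_eval I (\<alpha> ?E) t = 1"
      using inj_on_eq_iff[OF bij_betw_imp_inj_on[OF \<phi>(1)], of "char_eval I (\<alpha> ?E) t" 1] nz by simp
    finally show ?thesis by simp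
  qed
  let ?k = "\<alpha> ?E (Inl s')"
  have mult: "\<alpha> ?E j = ?k * ?l j" if "j \<in> I" for j
    by (rule char_kernel_multiple[OF finite_I ilab_Inl(2)[OF ed], of ?l "\<alpha> ?E" j, OF ilab_Inl(1)[OF ed] _ that])
      (simp add: ker)
  \<comment> \<open>For \<open>?k = 0\<close> the given label would be trivial on the whole torus,
    whereas \<open>ilab\<close> takes every non-zero value.\<close>
  have "?k \<noteq> 0"
  proof
    assume k: "?k = 0"
    obtain t where t: "t \<in> torus I" "char_eval I ?l t = 2" using ilab_surj[OF ed, of 2] by auto
    have "char_eval I (\<alpha> ?E) t = 1" unfolding char_eval_def using mult k by (intro prod.neutral) simp
    then show False using ker[OF t(1)] t(2) by simp
  qed
  then show ?thesis using that[of ?k] mult by blast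
qed

lemma labelling_rat:
  assumes "state x" "edge x s s' r"
  obtains k :: rat where "k \<noteq> 0" "\<And>j. j \<in> I \<Longrightarrow> of_int (\<alpha> (orb x s s' r) j) = k * sm.labl x s s' r j"
proof -
  obtain k :: int where k: "k \<noteq> 0" "\<And>j. j \<in> I \<Longrightarrow> \<alpha> (orb x s s' r) j = k * ilab x s s' r j"
    using labelling_multiple[OF assms] by blast
  show ?thesis
    by (rule that[of "of_int k"]) (simp_all add: k labl_ilab)
qed

lemma label_dvd_iff:
  assumes "state x" "edge x s s' r"
  shows "char_poly I (\<alpha> (orb x s s' r)) dvd p \<longleftrightarrow> lin sm.Ix (sm.labl x s s' r) dvd p"
proof -
  obtain k :: rat where k: "k \<noteq> 0" "\<And>j. j \<in> I \<Longrightarrow> of_int (\<alpha> (orb x s s' r) j) = k * sm.labl x s s' r j"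
    using labelling_rat[OF assms] by blast
  have "char_poly I (\<alpha> (orb x s s' r)) = lin I (\<lambda>j. k * sm.labl x s s' r j)"
    unfolding char_poly_eq_lin using k(2) by (rule lin_cong)
  then show ?thesis using lin_multiple_dvd_iff[OF k(1)] by (simp only: I_eq)
qed

lemma verts_G: "verts \<G> = Phi ` {x. state x}"
  by (simp add: moment_graph_def fixed_points_eq)

text \<open>Inverting \<open>Phi\<close> carries the potential from states to fixed points. The
  extension property is \<open>string_extension\<close>, applied to the states whose fixed points
  lie in \<open>D\<close>; replacing labels by non-zero multiples does not affect
  divisibility.\<close>

lemma gkm_graph_moment_graph: "gkm_graph I \<G> \<alpha> (\<lambda>u. potential (the_inv_into {x. state x} Phi u))"
proof -
  have inj: "inj_on Phi {x. state x}" using Phi_inj by (auto simp: inj_on_def)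
  have pot: "potential (the_inv_into {x. state x} Phi (Phi x)) = potential x" if "state x" for x
    using the_inv_into_f_f[OF inj] that by simp
  have tl: "tail \<G> = (\<lambda>(E, x, y). x)" and hd: "head \<G> = (\<lambda>(E, x, y). y)" by (simp_all add: moment_graph_def)
  show ?thesis
  proof unfold_locales
    fix a assume "a \<in> arcs \<G>"
    then obtain E u v where a: "a = (E, u, v)" "(E, u, v) \<in> arcs \<G>" by (cases a) auto
    then show "tail \<G> a \<in> verts \<G>" "head \<G> a \<in> verts \<G>"
      unfolding tl hd by (simp_all add: moment_graph_def)
  next
    show "finite I" by (rule finite_I)
    show "finite (verts \<G>)" unfolding verts_G using finite_states by simp
    have "arcs \<G> \<subseteq> (\<lambda>(x, s, s', r). (orb x s s' r, Phi x, Phi (move x s s' r))) `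
        (SIGMA x : {x. state x}. comps \<times> comps \<times> {..\<Sum>C\<in>comps. len C})"
    proof
      fix a assume "a \<in> arcs \<G>"
      then obtain E u v where "a = (E, u, v)" "(E, u, v) \<in> arcs \<G>" by (cases a) auto
      then obtain x s s' r where x: "state x" "edge x s s' r" "a = (orb x s s' r, Phi x, Phi (move x s s' r))"
        unfolding arcs_iff by blast
      have "r \<le> len s'" using x(2) by (auto simp: sm.edge_def)
      also have "\<dots> \<le> (\<Sum>C\<in>comps. len C)"
        using member_le_sum[of s' comps len] sm.edge_size(5)[OF x(2)] finite_comps by simp
      finally show "a \<in> (\<lambda>(x, s, s', r). (orb x s s' r, Phi x, Phi (move x s s' r))) `
          (SIGMA x : {x. state x}. comps \<times> comps \<times> {..\<Sum>C\<in>comps. len C})"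
        using x sm.edge_size(4,5)[OF x(2)] by (intro image_eqI[of _ _ "(x, s, s', r)"]) simp_all
    qed
    then show "finite (arcs \<G>)"
      by (rule finite_subset) (intro finite_imageI finite_SigmaI finite_states finite_cartesian_product finite_comps finite_atMost)
    show "tail \<G> = (\<lambda>(E, x, y). x)" "head \<G> = (\<lambda>(E, x, y). y)" by (rule tl, rule hd)
  next
    fix E u v assume "(E, u, v) \<in> arcs \<G>"
    then obtain x s s' r where x: "state x" "edge x s s' r" "E = orb x s s' r" "u = Phi x" "v = Phi (move x s s' r)"
      unfolding arcs_iff by blast
    show "potential (the_inv_into {x. state x} Phi u) < potential (the_inv_into {x. state x} Phi v)"
      unfolding x(4,5) pot[OF x(1)] pot[OF state_move[OF x(1,2)]] by (rule potential_less[OF x(1,2)])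
    obtain k :: rat where k: "k \<noteq> 0" "\<And>j. j \<in> I \<Longrightarrow> of_int (\<alpha> (orb x s s' r) j) = k * sm.labl x s s' r j"
      using labelling_rat[OF x(1,2)] by blast
    obtain j where j: "j \<in> I" "sm.labl x s s' r j \<noteq> 0"
      using sm.labl_nz[OF x(2)] unfolding nz_on_def I_eq by blast
    show "nz_on I (\<lambda>j. of_int (\<alpha> E j))"
      unfolding nz_on_def x(3) using k(1) k(2)[OF j(1)] j by (intro bexI[of _ j]) simp_all
  next
    fix E u v E' v'
    assume a: "(E, u, v) \<in> arcs \<G>" "(E', u, v') \<in> arcs \<G>" "(E, v) \<noteq> (E', v')"
    obtain x s s' r where x: "state x" "edge x s s' r" "E = orb x s s' r" "u = Phi x" "v = Phi (move x s s' r)"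
      using a(1) unfolding arcs_iff by blast
    obtain y t t' r' where y: "state y" "edge y t t' r'" "E' = orb y t t' r'" "u = Phi y" "v' = Phi (move y t t' r')"
      using a(2) unfolding arcs_iff by blast
    have yx: "y = x" using Phi_inj[OF y(1) x(1)] x(4) y(4) by simp
    note y = y[unfolded yx]
    have ne: "(s, s', r) \<noteq> (t, t', r')" using a(3) x(3,5) y(3,5) by auto
    obtain k :: rat where k: "k \<noteq> 0" "\<And>j. j \<in> I \<Longrightarrow> of_int (\<alpha> (orb x s s' r) j) = k * sm.labl x s s' r j"
      using labelling_rat[OF x(1,2)] by blast
    obtain k' :: rat where k': "k' \<noteq> 0" "\<And>j. j \<in> I \<Longrightarrow> of_int (\<alpha> (orb x t t' r') j) = k' * sm.labl x t t' r' j"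
      using labelling_rat[OF y(1,2)] by blast
    show "\<not> lindep I (\<lambda>j. of_int (\<alpha> E j)) (\<lambda>j. of_int (\<alpha> E' j))"
    proof
      assume "lindep I (\<lambda>j. of_int (\<alpha> E j)) (\<lambda>j. of_int (\<alpha> E' j))"
      then obtain z where z: "\<And>j. j \<in> I \<Longrightarrow> of_int (\<alpha> E' j) = z * (of_int (\<alpha> E j) :: rat)"
        unfolding lindep_def by blast
      have "sm.labl x t t' r' j = (z * k / k') * sm.labl x s s' r j" if j: "j \<in> I" for j
      proof -
        have "k' * sm.labl x t t' r' j = z * (k * sm.labl x s s' r j)"
          using z[OF j] unfolding x(3) y(3) k(2)[OF j] k'(2)[OF j] .
        then show ?thesis using k'(1) by (simp add: field_simps)
      qed
      then have "lindep sm.Ix (sm.labl x s s' r) (sm.labl x t t' r')" unfolding lindep_def I_eq by blast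
      then show False using sm.labl_indep[OF x(2) y(2)] ne by blast
    qed
  next
    fix u D f
    assume u: "u \<in> verts \<G>" and D: "D \<subseteq> verts \<G>"
      and closed: "\<And>E u v. (E, u, v) \<in> arcs \<G> \<Longrightarrow> u \<in> D \<Longrightarrow> v \<in> D"
      and heads: "\<And>E v. (E, u, v) \<in> arcs \<G> \<Longrightarrow> v \<in> D"
      and f: "\<And>E u v. (E, u, v) \<in> arcs \<G> \<Longrightarrow> u \<in> D \<Longrightarrow> char_poly I (\<alpha> E) dvd f u - f v"
    obtain x where x: "state x" "u = Phi x" using u unfolding verts_G by blast
    have arcI: "(orb y s s' r, Phi y, Phi (move y s s' r)) \<in> arcs \<G>" if "state y" "edge y s s' r" for y s s' r
      unfolding arcs_iff using that by blast
    interpret cl: string_model_class comps "supp_arcs Q M" len "\<lambda>C m. fst (el C m)" "\<lambda>C m. int (snd (el C m))" ep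
      x "{y. state y \<and> Phi y \<in> D}" "\<lambda>y. f (Phi y)"
    proof
      fix y s s' r assume y: "y \<in> {y. state y \<and> Phi y \<in> D}" and ed: "edge y s s' r"
      show "move y s s' r \<in> {y. state y \<and> Phi y \<in> D}"
        using y state_move[OF _ ed] closed[OF arcI[OF _ ed]] by simp
      show "lin sm.Ix (sm.labl y s s' r) dvd f (Phi y) - f (Phi (move y s s' r))"
        using y f[OF arcI[OF _ ed]] label_dvd_iff[OF _ ed] by simp
    next
      show "x C \<le> len C" if "C \<in> comps" for C using x(1) that by (simp add: state_def bounded_state_def)
      show "move x s s' r \<in> {y. state y \<and> Phi y \<in> D}" if "edge x s s' r" for s s' r
        using state_move[OF x(1) that] heads arcI[OF x(1) that] x(2) by auto
    qed
    obtain g where g: "\<And>s s' r. edge x s s' r \<Longrightarrow> lin sm.Ix (sm.labl x s s' r) dvd g - f (Phi (move x s s' r))"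
      using cl.string_extension by blast
    have "char_poly I (\<alpha> E) dvd g - f v" if a: "(E, u, v) \<in> arcs \<G>" for E v
    proof -
      obtain y s s' r where y: "state y" "edge y s s' r" "E = orb y s s' r" "u = Phi y" "v = Phi (move y s s' r)"
        using a unfolding arcs_iff by blast
      have "y = x" using Phi_inj[OF y(1) x(1)] x(2) y(4) by simp
      then show ?thesis using g y label_dvd_iff[OF y(1,2)] by simp
    qed
    then show "\<exists>g. \<forall>E v. (E, u, v) \<in> arcs \<G> \<longrightarrow> char_poly I (\<alpha> E) dvd g - f v" by blast
  qed
qed

end

theorem lemma5p5:
  fixes Q :: "('v, 'a) pre_digraph"
    and M :: "('v, 'a, 'n::finite) rep"
    and e :: "'v \<Rightarrow> int"
    and b :: "'v \<Rightarrow> nat \<Rightarrow> complex ^ 'n"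
    and chi :: "('v, 'a) tindex \<Rightarrow> int"
    and \<alpha> :: "('v \<Rightarrow> (complex ^ 'n) set) set \<Rightarrow> ('v, 'a) tindex \<Rightarrow> int"
  assumes "fin_digraph Q"
    and "quiver_rep Q M"
    and "straight Q M"
    and "chi \<in> cocharacters (TM_index Q M b)"
    and "generic_cochar (TM_index Q M b) (TM_act Q M b) (quiver_Gr_top Q M e) chi"
    and "attractive_compatible Q M chi b"
    and "edge_labelling (TM_index Q M b) (TM_act Q M b) (quiver_Gr_top Q M e) \<alpha>"
  shows "\<exists>P. KT_basis (TM_index Q M b) (TM_moment_graph Q M b e chi) \<alpha> P"
proof -
  have "straightening_basis Q M b" "normalized Q M b" "aligned Q M b"
    using assms(6) by (simp_all add: attractive_compatible_def)
  then have "straight_GKM Q M b e chi \<alpha>"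
    using assms(1,2,6,7)
    by (intro straight_GKM.intro straight_Gr.intro straight_rep.intro straight_GKM_axioms.intro)
  then interpret straight_GKM Q M b e chi \<alpha> .
  show ?thesis using gkm_graph_moment_graph by (rule gkm_graph.KT_basis_exists)
qed

end
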